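(* Let $B=A^{\mathrm{co}H}\subseteq A$ be a quantum principal bundle, let $\Omega^\bullet(H)$ be the maximal prolongation of a bicovariant first order differential calculus on $H$, and let $\Omega^\bullet(A)$ be a complete differential calculus on $A$ (with respect to $\Omega^\bullet(H)$). Then the Atiyah sequence $$0\to\mathrm{hor}^1\hookrightarrow\Omega^1(A)\xrightarrow{\ \pi_v\ }\mathrm{ver}^1\to 0$$ is exact in the category ${}_A\mathcal{M}_A^H$ of right $H$-covariant $A$-bimodules.
   Context: Conventions: $\Bbbk$ is a field; everything is $\Bbbk$-linear; algebras are associative and unital. $H$ is a Hopf algebra with invertible antipode $S$, $\Delta(h)=h_1\otimes h_2$; right coactions are written $m\mapsto m_0\otimes m_1$, left coactions $m\mapsto m_{-1}\otimes m_0$, iterated as usual. Differential calculi: A first order differential calculus (FODC) on an algebra $A$ is an $A$-bimodule $\Gamma$ with a linear map $\mathrm{d}\colon A\to\Gamma$ satisfying the Leibniz rule and $\Gamma=\mathrm{span}\{a\,\mathrm{d}a'\}$. A differential calculus (DC) on $A$ is an $\mathbb{N}_0$-graded differential graded algebra (DGA) $(\Omega^\bullet,\wedge,\mathrm{d})$ ($\mathrm{d}$ of degree $1$, $\mathrm{d}^2=0$, graded Leibniz rule) with $\Omega^0=A$ and $\Omega^k=\mathrm{span}\{a^0\mathrm{d}a^1\wedge\ldots\wedge\mathrm{d}a^k\}$. The maximal prolongation of a FODC $(\Gamma,\mathrm{d})$ is the quotient of the tensor algebra $\bigoplus_k\Gamma^{\otimes_A k}$ by the ideal generated by all $\sum_i\mathrm{d}a^i\otimes_A\mathrm{d}b^i$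 with $\sum_i a^i\mathrm{d}b^i=0$, with $\mathrm{d}(a\,\mathrm{d}b)=\mathrm{d}a\wedge\mathrm{d}b$. A FODC on $H$ is bicovariant if $h\,\mathrm{d}g\mapsto h_1\mathrm{d}g_1\otimes h_2g_2$ and $h\,\mathrm{d}g\mapsto h_1g_1\otimes h_2\mathrm{d}g_2$ are well defined (right and left $H$-coactions). Tensor products of DGAs carry the Koszul-sign product $(\omega\otimes\omega')\wedge(\eta\otimes\eta')=(-1)^{|\omega'||\eta|}\omega\wedge\eta\otimes\omega'\wedge\eta'$ and differential $\mathrm{d}_\otimes(\omega\otimes\omega')=\mathrm{d}\omega\otimes\omega'+(-1)^{|\omega|}\omega\otimes\mathrm{d}\omega'$. Quantum principal bundle: a right $H$-comodule algebra $A$ (coaction $\Delta_A$ an algebra map) with $B=A^{\mathrm{co}H}=\{a:\Delta_A(a)=a\otimes1\}$ such that $\chi\colon A\otimes_BA\to A\otimes H$, $a\otimes_Ba'\mapsto aa'_0\otimes a'_1$, is bijective and $A$ is faithfully flat as a right $B$-module. Complete calculus: a DC $\Omega^\bullet(A)$ on $A$ is complete if $\Delta_A\colon A\to A\otimes H$ extends to a (necessarily unique) morphism of DGAs $\Delta_A^\bullet\colon\Omega^\bullet(A)\to\Omega^\bullet(A)\otimes\Omega^\bullet(H)$. In particular $\Omega^1(A)$ is a right $H$-covariant $A$-bimodule, with coaction $a\,\mathrm{d}a'\mapsto a_0\mathrm{d}a'_0\otimes a_1a'_1$. Horizontal $1$-forms: $\mathrm{hor}^1=\{\omega\in\Omega^1(A):\Delta_A^\bullet(\omega)\in\Omega^1(A)\otimes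 H\}$. Vertical $1$-forms: let $\Lambda^1$ be the space of left coinvariant elements of $\Omega^1(H)$, with right $H$-action $\vartheta\leftharpoonup h=S(h_1)\vartheta h_2$ and right $H$-coaction the restriction of the right coaction of $\Omega^1(H)$. Then $\mathrm{ver}^1=A\otimes\Lambda^1$ with actions $a(a'\otimes\vartheta)a''=aa'a''_0\otimes(\vartheta\leftharpoonup a''_1)$ and right $H$-coaction $a\otimes\vartheta\mapsto a_0\otimes\vartheta_0\otimes a_1\vartheta_1$. The map $\pi_v$ is $\pi_v(a\,\mathrm{d}a')=a_0a'_0\otimes S(a_1a'_1)a_2\mathrm{d}a'_2=aa'_0\otimes S(a'_1)\mathrm{d}a'_2$, which is well defined for complete calculi. An $A$-bimodule $M$ is right $H$-covariant if it has a right $H$-coaction with $\Delta_M(ama')=\Delta_A(a)\Delta_M(m)\Delta_A(a')$; morphisms in ${}_A\mathcal{M}_A^H$ are $A$-bilinear right $H$-colinear maps. *)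

theory Defs
  imports "HOL-Algebra.Module" "HOL-Algebra.QuotRing"
begin

section \<open>Linear algebra over a field\<close>

text \<open>
  Vector spaces over a field \<open>K\<close> are \<open>module\<close> records of HOL-Algebra. For a mere vector space the
  fields \<open>mult\<close> and \<open>one\<close> are irrelevant; for an algebra they carry the product.
\<close>

definition lin_maps ::
  "'k ring \<Rightarrow> ('k, 'v, 'e) module_scheme \<Rightarrow> ('k, 'w, 'f) module_scheme \<Rightarrow> ('v \<Rightarrow> 'w) set"
  where "lin_maps K V W = {f \<in> carrier V \<rightarrow> carrier W.
    (\<forall>x \<in> carrier V. \<forall>y \<in> carrier V. f (x \<oplus>\<^bsub>V\<^esub> y) = f x \<oplus>\<^bsub>W\<^esub> f y) \<and>
    (\<forall>c \<in> carrier K. \<forall>x \<in> carrier V. f (c \<odot>\<^bsub>V\<^esub> x) = c \<odot>\<^bsub>W\<^esub> f x)}"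

definition lin_span :: "'k ring \<Rightarrow> ('k, 'v, 'e) module_scheme \<Rightarrow> 'v set \<Rightarrow> 'v set"
  where "lin_span K V S = \<Inter>{N. submodule N K V \<and> S \<subseteq> N}"

text \<open>Associative unital algebras. The locale \<open>algebra\<close> of HOL-Algebra is restricted to commutative
  ones.\<close>

definition assoc_algebra :: "'k ring \<Rightarrow> ('k, 'a, 'e) module_scheme \<Rightarrow> bool"
  where "assoc_algebra K A \<longleftrightarrow> module K A \<and> ring A \<and>
    (\<forall>c \<in> carrier K. \<forall>x \<in> carrier A. \<forall>y \<in> carrier A.
      (c \<odot>\<^bsub>A\<^esub> x) \<otimes>\<^bsub>A\<^esub> y = c \<odot>\<^bsub>A\<^esub> (x \<otimes>\<^bsub>A\<^esub> y) \<and> x \<otimes>\<^bsub>A\<^esub> (c \<odot>\<^bsub>A\<^esub> y) = c \<odot>\<^bsub>A\<^esub> (x \<otimes>\<^bsub>A\<^esub> y))"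

definition algebra_homs ::
  "'k ring \<Rightarrow> ('k, 'a, 'e) module_scheme \<Rightarrow> ('k, 'b, 'f) module_scheme \<Rightarrow> ('a \<Rightarrow> 'b) set"
  where "algebra_homs K A B = lin_maps K A B \<inter> ring_hom A B"


subsection \<open>Vector spaces given by generators and relations\<close>

definition free_space :: "'k ring \<Rightarrow> 'x set \<Rightarrow> ('k, 'x \<Rightarrow> 'k) module"
  where "free_space K X =
    \<lparr>carrier = {f. range f \<subseteq> carrier K \<and> finite {x. f x \<noteq> \<zero>\<^bsub>K\<^esub>} \<and> {x. f x \<noteq> \<zero>\<^bsub>K\<^esub>} \<subseteq> X},
     mult = undefined, one = undefined, zero = (\<lambda>_. \<zero>\<^bsub>K\<^esub>), add = (\<lambda>f g x. f x \<oplus>\<^bsub>K\<^esub> g x),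
     smult = (\<lambda>c f x. c \<otimes>\<^bsub>K\<^esub> f x)\<rparr>"

definition free_gen :: "'k ring \<Rightarrow> 'x \<Rightarrow> 'x \<Rightarrow> 'k"
  where "free_gen K x = (\<lambda>y. if y = x then \<one>\<^bsub>K\<^esub> else \<zero>\<^bsub>K\<^esub>)"

text \<open>The quotient of the free space on \<open>X\<close> by the span of \<open>R\<close>; its elements are cosets.\<close>

definition presented :: "'k ring \<Rightarrow> 'x set \<Rightarrow> ('x \<Rightarrow> 'k) set \<Rightarrow> ('k, ('x \<Rightarrow> 'k) set) module"
  where "presented K X R = (let F = free_space K X; N = lin_span K F R in
    \<lparr>carrier = a_rcosets\<^bsub>F\<^esub> N, mult = undefined, one = undefined, zero = N, add = set_add F,
     smult = (\<lambda>c P. \<Union>f \<in> P. N +>\<^bsub>F\<^esub> (c \<odot>\<^bsub>F\<^esub> f))\<rparr>)"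

definition pres_gen :: "'k ring \<Rightarrow> 'x set \<Rightarrow> ('x \<Rightarrow> 'k) set \<Rightarrow> 'x \<Rightarrow> ('x \<Rightarrow> 'k) set"
  where "pres_gen K X R x = (let F = free_space K X in lin_span K F R +>\<^bsub>F\<^esub> free_gen K x)"

text \<open>
  The linear map on a presented space which sends the generator \<open>x\<close> to \<open>\<beta> x\<close>: the coset of
  \<open>\<Sum>\<^sub>i c\<^sub>i x\<^sub>i\<close> goes to \<open>\<Sum>\<^sub>i c\<^sub>i \<beta>(x\<^sub>i)\<close>. It is only meaningful (independent of the chosen
  representative) if the linear extension of \<open>\<beta>\<close> kills the relations.
\<close>

definition pres_lift ::
  "'k ring \<Rightarrow> ('k, 'u, 'e) module_scheme \<Rightarrow> ('x \<Rightarrow> 'u) \<Rightarrow> ('x \<Rightarrow> 'k) set \<Rightarrow> 'u"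
  where "pres_lift K U \<beta> P = (let f = (SOME f. f \<in> P) in
    finsum U (\<lambda>x. f x \<odot>\<^bsub>U\<^esub> \<beta> x) {x. f x \<noteq> \<zero>\<^bsub>K\<^esub>})"


subsection \<open>Tensor products\<close>

definition bilin_rels ::
  "'k ring \<Rightarrow> ('k, 'v, 'e) module_scheme \<Rightarrow> ('k, 'w, 'f) module_scheme \<Rightarrow> ('v \<times> 'w \<Rightarrow> 'k) set"
  where "bilin_rels K V W = (let F = free_space K (carrier V \<times> carrier W); g = free_gen K in
    {g (v \<oplus>\<^bsub>V\<^esub> v', w) \<ominus>\<^bsub>F\<^esub> (g (v, w) \<oplus>\<^bsub>F\<^esub> g (v', w)) | v v' w.
      v \<in> carrier V \<and> v' \<in> carrier V \<and> w \<in> carrier W} \<union>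
    {g (v, w \<oplus>\<^bsub>W\<^esub> w') \<ominus>\<^bsub>F\<^esub> (g (v, w) \<oplus>\<^bsub>F\<^esub> g (v, w')) | v w w'.
      v \<in> carrier V \<and> w \<in> carrier W \<and> w' \<in> carrier W} \<union>
    {g (c \<odot>\<^bsub>V\<^esub> v, w) \<ominus>\<^bsub>F\<^esub> (c \<odot>\<^bsub>F\<^esub> g (v, w)) | c v w.
      c \<in> carrier K \<and> v \<in> carrier V \<and> w \<in> carrier W} \<union>
    {g (v, c \<odot>\<^bsub>W\<^esub> w) \<ominus>\<^bsub>F\<^esub> (c \<odot>\<^bsub>F\<^esub> g (v, w)) | c v w.
      c \<in> carrier K \<and> v \<in> carrier V \<and> w \<in> carrier W})"

definition tensor_space ::
  "'k ring \<Rightarrow> ('k, 'v, 'e) module_scheme \<Rightarrow> ('k, 'w, 'f) module_scheme \<Rightarrow>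
    ('k, ('v \<times> 'w \<Rightarrow> 'k) set) module"
  where "tensor_space K V W = presented K (carrier V \<times> carrier W) (bilin_rels K V W)"

definition tens ::
  "'k ring \<Rightarrow> ('k, 'v, 'e) module_scheme \<Rightarrow> ('k, 'w, 'f) module_scheme \<Rightarrow> 'v \<Rightarrow> 'w \<Rightarrow>
    ('v \<times> 'w \<Rightarrow> 'k) set"
  where "tens K V W v w = pres_gen K (carrier V \<times> carrier W) (bilin_rels K V W) (v, w)"

text \<open>The map \<open>f \<otimes> g\<close>; only its target \<open>V \<otimes> W\<close> enters the definition.\<close>

definition tensor_map ::
  "'k ring \<Rightarrow> ('k, 'v, 'e) module_scheme \<Rightarrow> ('k, 'w, 'f) module_scheme \<Rightarrow> ('x \<Rightarrow> 'v) \<Rightarrow> ('y \<Rightarrow> 'w) \<Rightarrow>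
    ('x \<times> 'y \<Rightarrow> 'k) set \<Rightarrow> ('v \<times> 'w \<Rightarrow> 'k) set"
  where "tensor_map K V W f g = pres_lift K (tensor_space K V W) (\<lambda>(x, y). tens K V W (f x) (g y))"

text \<open>The associator \<open>(U \<otimes> V) \<otimes> W \<rightarrow> U \<otimes> (V \<otimes> W)\<close>.\<close>

definition tensor_assoc ::
  "'k ring \<Rightarrow> ('k, 'u, 'e) module_scheme \<Rightarrow> ('k, 'v, 'f) module_scheme \<Rightarrow> ('k, 'w, 'g) module_scheme \<Rightarrow>
    (('u \<times> 'v \<Rightarrow> 'k) set \<times> 'w \<Rightarrow> 'k) set \<Rightarrow> ('u \<times> ('v \<times> 'w \<Rightarrow> 'k) set \<Rightarrow> 'k) set"
  where "tensor_assoc K U V W = (let VW = tensor_space K V W; T = tensor_space K U VW in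
    pres_lift K T (\<lambda>(x, w). pres_lift K T (\<lambda>(u, v). tens K U VW u (tens K V W v w)) x))"

definition tensor_algebra_prod ::
  "'k ring \<Rightarrow> ('k, 'a, 'e) module_scheme \<Rightarrow> ('k, 'b, 'f) module_scheme \<Rightarrow>
    ('k, ('a \<times> 'b \<Rightarrow> 'k) set) module"
  where "tensor_algebra_prod K A B = (let T = tensor_space K A B in T
    \<lparr>mult := (\<lambda>P Q. pres_lift K T (\<lambda>(a, b). pres_lift K T (\<lambda>(a', b').
        tens K A B (a \<otimes>\<^bsub>A\<^esub> a') (b \<otimes>\<^bsub>B\<^esub> b')) Q) P),
     one := tens K A B \<one>\<^bsub>A\<^esub> \<one>\<^bsub>B\<^esub>\<rparr>)"

text \<open>The tensor product \<open>V \<otimes>\<^sub>B W\<close> of a right module \<open>V\<close> (action \<open>ra\<close>) and a left module \<open>W\<close>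
  (action \<open>la\<close>) over an algebra \<open>B\<close>.\<close>

definition balanced_rels ::
  "'k ring \<Rightarrow> ('k, 'b, 'd) module_scheme \<Rightarrow> ('k, 'v, 'e) module_scheme \<Rightarrow> ('v \<Rightarrow> 'b \<Rightarrow> 'v) \<Rightarrow>
    ('k, 'w, 'f) module_scheme \<Rightarrow> ('b \<Rightarrow> 'w \<Rightarrow> 'w) \<Rightarrow> ('v \<times> 'w \<Rightarrow> 'k) set"
  where "balanced_rels K B V ra W la =
    bilin_rels K V W \<union>
    {free_gen K (ra v b, w) \<ominus>\<^bsub>free_space K (carrier V \<times> carrier W)\<^esub> free_gen K (v, la b w) | v b w.
      v \<in> carrier V \<and> b \<in> carrier B \<and> w \<in> carrier W}"

definition tensor_over ::
  "'k ring \<Rightarrow> ('k, 'b, 'd) module_scheme \<Rightarrow> ('k, 'v, 'e) module_scheme \<Rightarrow> ('v \<Rightarrow> 'b \<Rightarrow> 'v) \<Rightarrow>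
    ('k, 'w, 'f) module_scheme \<Rightarrow> ('b \<Rightarrow> 'w \<Rightarrow> 'w) \<Rightarrow> ('k, ('v \<times> 'w \<Rightarrow> 'k) set) module"
  where "tensor_over K B V ra W la =
    presented K (carrier V \<times> carrier W) (balanced_rels K B V ra W la)"

definition tens_over ::
  "'k ring \<Rightarrow> ('k, 'b, 'd) module_scheme \<Rightarrow> ('k, 'v, 'e) module_scheme \<Rightarrow> ('v \<Rightarrow> 'b \<Rightarrow> 'v) \<Rightarrow>
    ('k, 'w, 'f) module_scheme \<Rightarrow> ('b \<Rightarrow> 'w \<Rightarrow> 'w) \<Rightarrow> 'v \<Rightarrow> 'w \<Rightarrow> ('v \<times> 'w \<Rightarrow> 'k) set"
  where "tens_over K B V ra W la v w =
    pres_gen K (carrier V \<times> carrier W) (balanced_rels K B V ra W la) (v, w)"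


subsection \<open>Modules and bimodules over an algebra\<close>

record ('k, 'm, 'a) left_mod = "('k, 'm) module" +
  lact :: "'a \<Rightarrow> 'm \<Rightarrow> 'm"

record ('k, 'm, 'a) bimod = "('k, 'm, 'a) left_mod" +
  ract :: "'m \<Rightarrow> 'a \<Rightarrow> 'm"

definition left_module ::
  "'k ring \<Rightarrow> ('k, 'a, 'd) module_scheme \<Rightarrow> ('k, 'm, 'a, 'e) left_mod_scheme \<Rightarrow> bool"
  where "left_module K A M \<longleftrightarrow> module K M \<and>
    (\<forall>a \<in> carrier A. lact M a \<in> lin_maps K M M) \<and>
    (\<forall>m \<in> carrier M. (\<lambda>a. lact M a m) \<in> lin_maps K A M) \<and>
    (\<forall>m \<in> carrier M. lact M \<one>\<^bsub>A\<^esub> m = m) \<and>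
    (\<forall>a \<in> carrier A. \<forall>b \<in> carrier A. \<forall>m \<in> carrier M.
      lact M (a \<otimes>\<^bsub>A\<^esub> b) m = lact M a (lact M b m))"

definition bimodule ::
  "'k ring \<Rightarrow> ('k, 'a, 'd) module_scheme \<Rightarrow> ('k, 'm, 'a, 'e) bimod_scheme \<Rightarrow> bool"
  where "bimodule K A M \<longleftrightarrow> left_module K A M \<and>
    (\<forall>a \<in> carrier A. (\<lambda>m. ract M m a) \<in> lin_maps K M M) \<and>
    (\<forall>m \<in> carrier M. ract M m \<in> lin_maps K A M) \<and>
    (\<forall>m \<in> carrier M. ract M m \<one>\<^bsub>A\<^esub> = m) \<and>
    (\<forall>a \<in> carrier A. \<forall>b \<in> carrier A. \<forall>m \<in> carrier M.
      ract M m (a \<otimes>\<^bsub>A\<^esub> b) = ract M (ract M m a) b) \<and>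
    (\<forall>a \<in> carrier A. \<forall>b \<in> carrier A. \<forall>m \<in> carrier M.
      ract M (lact M a m) b = lact M a (ract M m b))"

definition exact_at ::
  "('k, 'l, 'd) module_scheme \<Rightarrow> ('l \<Rightarrow> 'm) \<Rightarrow> ('k, 'm, 'e) module_scheme \<Rightarrow> ('m \<Rightarrow> 'n) \<Rightarrow>
    ('k, 'n, 'f) module_scheme \<Rightarrow> bool"
  where "exact_at L f M g N \<longleftrightarrow> f ` carrier L = {m \<in> carrier M. g m = \<zero>\<^bsub>N\<^esub>}"

definition left_module_homs ::
  "'k ring \<Rightarrow> ('k, 'b, 'd) module_scheme \<Rightarrow> ('k, 'm, 'b, 'e) left_mod_scheme \<Rightarrow>
    ('k, 'n, 'b, 'f) left_mod_scheme \<Rightarrow> ('m \<Rightarrow> 'n) set"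
  where "left_module_homs K B M N = {f \<in> lin_maps K M N.
    \<forall>b \<in> carrier B. \<forall>m \<in> carrier M. f (lact M b m) = lact N b (f m)}"

text \<open>
  \<open>V\<close> (with right \<open>B\<close>-action \<open>ra\<close>) is faithfully flat: a sequence of left \<open>B\<close>-modules is exact iff
  it is exact after applying \<open>V \<otimes>\<^sub>B -\<close>. A formula cannot quantify over types, so the element type
  \<open>'m\<close> of the test modules is a parameter. If \<open>B\<close> has element type \<open>'b\<close>, then \<open>'m = 'b set\<close>
  is enough for full faithful flatness: it accommodates all left ideals and all cyclic modules (whose
  elements are cosets), and these detect both flatness (injectivity of \<open>V \<otimes>\<^sub>B I \<rightarrow> V\<close>) and
  faithfulness (\<open>V \<otimes>\<^sub>B B/I \<noteq> 0\<close> for \<open>I \<noteq> B\<close>).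
\<close>

definition faithfully_flat_right ::
  "'m itself \<Rightarrow> 'k ring \<Rightarrow> ('k, 'b, 'd) module_scheme \<Rightarrow> ('k, 'v, 'e) module_scheme \<Rightarrow>
    ('v \<Rightarrow> 'b \<Rightarrow> 'v) \<Rightarrow> bool"
  where "faithfully_flat_right _ K B V ra \<longleftrightarrow>
    (\<forall>(L :: ('k, 'm, 'b) left_mod) (M :: ('k, 'm, 'b) left_mod) (N :: ('k, 'm, 'b) left_mod) f g.
      left_module K B L \<and> left_module K B M \<and> left_module K B N \<and>
      f \<in> left_module_homs K B L M \<and> g \<in> left_module_homs K B M N \<longrightarrow>
      (let VL = tensor_over K B V ra L (lact L);
           VM = tensor_over K B V ra M (lact M);
           VN = tensor_over K B V ra N (lact N);
           id_f = pres_lift K VM (\<lambda>(v, l). tens_over K B V ra M (lact M) v (f l));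
           id_g = pres_lift K VN (\<lambda>(v, m). tens_over K B V ra N (lact N) v (g m))
       in exact_at L f M g N \<longleftrightarrow> exact_at VL id_f VM id_g VN))"


section \<open>Hopf algebras and comodules\<close>

record ('k, 'h) hopf = "('k, 'h) module" +
  comult :: "'h \<Rightarrow> ('h \<times> 'h \<Rightarrow> 'k) set"
  counit :: "'h \<Rightarrow> 'k"
  antipode :: "'h \<Rightarrow> 'h"

definition right_comodule ::
  "'k ring \<Rightarrow> ('k, 'h) hopf \<Rightarrow> ('k, 'v, 'e) module_scheme \<Rightarrow> ('v \<Rightarrow> ('v \<times> 'h \<Rightarrow> 'k) set) \<Rightarrow> bool"
  where "right_comodule K H V \<delta> \<longleftrightarrow> module K V \<and> \<delta> \<in> lin_maps K V (tensor_space K V H) \<and>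
    (\<forall>v \<in> carrier V.
      tensor_assoc K V H H (tensor_map K (tensor_space K V H) H \<delta> id (\<delta> v)) =
        tensor_map K V (tensor_space K H H) id (comult H) (\<delta> v) \<and>
      pres_lift K V (\<lambda>(v\<^sub>0, v\<^sub>1). counit H v\<^sub>1 \<odot>\<^bsub>V\<^esub> v\<^sub>0) (\<delta> v) = v)"

definition hopf_algebra :: "'k ring \<Rightarrow> ('k, 'h) hopf \<Rightarrow> bool"
  where "hopf_algebra K H \<longleftrightarrow> assoc_algebra K H \<and>
    right_comodule K H H (comult H) \<and>
    (\<forall>h \<in> carrier H. pres_lift K H (\<lambda>(h\<^sub>1, h\<^sub>2). counit H h\<^sub>1 \<odot>\<^bsub>H\<^esub> h\<^sub>2) (comult H h) = h) \<and>
    comult H \<in> algebra_homs K H (tensor_algebra_prod K H H) \<and>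
    counit H \<in> ring_hom H K \<and>
    (\<forall>c \<in> carrier K. \<forall>h \<in> carrier H. counit H (c \<odot>\<^bsub>H\<^esub> h) = c \<otimes>\<^bsub>K\<^esub> counit H h) \<and>
    antipode H \<in> lin_maps K H H \<and>
    (\<forall>h \<in> carrier H.
      pres_lift K H (\<lambda>(h\<^sub>1, h\<^sub>2). antipode H h\<^sub>1 \<otimes>\<^bsub>H\<^esub> h\<^sub>2) (comult H h) = counit H h \<odot>\<^bsub>H\<^esub> \<one>\<^bsub>H\<^esub> \<and>
      pres_lift K H (\<lambda>(h\<^sub>1, h\<^sub>2). h\<^sub>1 \<otimes>\<^bsub>H\<^esub> antipode H h\<^sub>2) (comult H h) = counit H h \<odot>\<^bsub>H\<^esub> \<one>\<^bsub>H\<^esub>)"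

record ('k, 'a, 'h) comodule_alg = "('k, 'a) module" +
  coact :: "'a \<Rightarrow> ('a \<times> 'h \<Rightarrow> 'k) set"

definition comodule_algebra :: "'k ring \<Rightarrow> ('k, 'h) hopf \<Rightarrow> ('k, 'a, 'h) comodule_alg \<Rightarrow> bool"
  where "comodule_algebra K H A \<longleftrightarrow> assoc_algebra K A \<and> right_comodule K H A (coact A) \<and>
    coact A \<in> algebra_homs K A (tensor_algebra_prod K A H)"

definition coinvariants ::
  "'k ring \<Rightarrow> ('k, 'h) hopf \<Rightarrow> ('k, 'a, 'h) comodule_alg \<Rightarrow> ('k, 'a, 'h) comodule_alg"
  where "coinvariants K H A = A\<lparr>carrier := {a \<in> carrier A. coact A a = tens K A H a \<one>\<^bsub>H\<^esub>}\<rparr>"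

definition galois_map ::
  "'k ring \<Rightarrow> ('k, 'h) hopf \<Rightarrow> ('k, 'a, 'h) comodule_alg \<Rightarrow> ('a \<times> 'a \<Rightarrow> 'k) set \<Rightarrow> ('a \<times> 'h \<Rightarrow> 'k) set"
  where "galois_map K H A = (let AH = tensor_space K A H in
    pres_lift K AH (\<lambda>(a, a'). pres_lift K AH (\<lambda>(a'\<^sub>0, a'\<^sub>1). tens K A H (a \<otimes>\<^bsub>A\<^esub> a'\<^sub>0) a'\<^sub>1) (coact A a')))"

definition quantum_principal_bundle :: "'k ring \<Rightarrow> ('k, 'h) hopf \<Rightarrow> ('k, 'a, 'h) comodule_alg \<Rightarrow> bool"
  where "quantum_principal_bundle K H A \<longleftrightarrow> comodule_algebra K H A \<and>
    (let B = coinvariants K H A in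
      bij_betw (galois_map K H A)
        (carrier (tensor_over K B A (mult A) A (mult A))) (carrier (tensor_space K A H)) \<and>
      faithfully_flat_right TYPE('a set) K B A (mult A))"


section \<open>Covariant bimodules\<close>

record ('k, 'm, 'a, 'h) cov_bimod = "('k, 'm, 'a) bimod" +
  bcoact :: "'m \<Rightarrow> ('m \<times> 'h \<Rightarrow> 'k) set"

definition covariant_bimodule ::
  "'k ring \<Rightarrow> ('k, 'h) hopf \<Rightarrow> ('k, 'a, 'h) comodule_alg \<Rightarrow> ('k, 'm, 'a, 'h) cov_bimod \<Rightarrow> bool"
  where "covariant_bimodule K H A M \<longleftrightarrow> bimodule K A M \<and> right_comodule K H M (bcoact M) \<and>
    (let MH = tensor_space K M H in
      \<forall>a \<in> carrier A. \<forall>a' \<in> carrier A. \<forall>m \<in> carrier M.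
        bcoact M (lact M a (ract M m a')) =
          pres_lift K MH (\<lambda>(a\<^sub>0, a\<^sub>1). pres_lift K MH (\<lambda>(m\<^sub>0, m\<^sub>1). pres_lift K MH (\<lambda>(a'\<^sub>0, a'\<^sub>1).
            tens K M H (lact M a\<^sub>0 (ract M m\<^sub>0 a'\<^sub>0)) (a\<^sub>1 \<otimes>\<^bsub>H\<^esub> (m\<^sub>1 \<otimes>\<^bsub>H\<^esub> a'\<^sub>1)))
            (coact A a')) (bcoact M m)) (coact A a))"

definition covariant_homs ::
  "'k ring \<Rightarrow> ('k, 'h) hopf \<Rightarrow> ('k, 'a, 'h) comodule_alg \<Rightarrow> ('k, 'm, 'a, 'h) cov_bimod \<Rightarrow>
    ('k, 'n, 'a, 'h) cov_bimod \<Rightarrow> ('m \<Rightarrow> 'n) set"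
  where "covariant_homs K H A M N = {f \<in> lin_maps K M N.
    (\<forall>a \<in> carrier A. \<forall>m \<in> carrier M.
      f (lact M a m) = lact N a (f m) \<and> f (ract M m a) = ract N (f m) a) \<and>
    (\<forall>m \<in> carrier M. bcoact N (f m) = tensor_map K N H f id (bcoact M m))}"

text \<open>Over a field, kernels and cokernels of covariant bimodule maps are those of the underlying
  vector spaces, so exactness of a sequence of morphisms is checked there.\<close>

definition short_exact_covariant ::
  "'k ring \<Rightarrow> ('k, 'h) hopf \<Rightarrow> ('k, 'a, 'h) comodule_alg \<Rightarrow> ('k, 'l, 'a, 'h) cov_bimod \<Rightarrow> ('l \<Rightarrow> 'm) \<Rightarrow>
    ('k, 'm, 'a, 'h) cov_bimod \<Rightarrow> ('m \<Rightarrow> 'n) \<Rightarrow> ('k, 'n, 'a, 'h) cov_bimod \<Rightarrow> bool"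
  where "short_exact_covariant K H A L f M g N \<longleftrightarrow>
    covariant_bimodule K H A L \<and> covariant_bimodule K H A M \<and> covariant_bimodule K H A N \<and>
    f \<in> covariant_homs K H A L M \<and> g \<in> covariant_homs K H A M N \<and>
    inj_on f (carrier L) \<and> exact_at L f M g N \<and> g ` carrier M = carrier N"

definition with_coaction ::
  "('k, 'm, 'a, 'e) bimod_scheme \<Rightarrow> ('m \<Rightarrow> ('m \<times> 'h \<Rightarrow> 'k) set) \<Rightarrow> ('k, 'm, 'a, 'h) cov_bimod"
  where "with_coaction M \<delta> = \<lparr>carrier = carrier M, mult = mult M, one = one M, zero = zero M,
    add = add M, smult = smult M, lact = lact M, ract = ract M, bcoact = \<delta>\<rparr>"

text \<open>The restriction of a coaction \<open>\<delta> : V \<rightarrow> V \<otimes> H\<close> to a subspace \<open>N\<close> with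
  \<open>\<delta>(N) \<subseteq> N \<otimes> H\<close>. The elements of \<open>N \<otimes> H\<close> and \<open>V \<otimes> H\<close> are different
  cosets, so one has to go back along the injection \<open>N \<otimes> H \<rightarrow> V \<otimes> H\<close>.\<close>

definition restrict_coaction ::
  "'k ring \<Rightarrow> ('k, 'h) hopf \<Rightarrow> ('k, 'v, 'd) module_scheme \<Rightarrow> ('k, 'v, 'e) module_scheme \<Rightarrow>
    ('v \<Rightarrow> ('v \<times> 'h \<Rightarrow> 'k) set) \<Rightarrow> 'v \<Rightarrow> ('v \<times> 'h \<Rightarrow> 'k) set"
  where "restrict_coaction K H N V \<delta> v =
    inv_into (carrier (tensor_space K N H)) (tensor_map K V H id id) (\<delta> v)"


section \<open>First order differential calculi\<close>

record ('k, 'm, 'a) fodc = "('k, 'm, 'a) bimod" +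
  fdiff :: "'a \<Rightarrow> 'm"

definition first_order_calculus ::
  "'k ring \<Rightarrow> ('k, 'a, 'd) module_scheme \<Rightarrow> ('k, 'm, 'a) fodc \<Rightarrow> bool"
  where "first_order_calculus K A \<Gamma> \<longleftrightarrow> bimodule K A \<Gamma> \<and> fdiff \<Gamma> \<in> lin_maps K A \<Gamma> \<and>
    (\<forall>a \<in> carrier A. \<forall>b \<in> carrier A.
      fdiff \<Gamma> (a \<otimes>\<^bsub>A\<^esub> b) = ract \<Gamma> (fdiff \<Gamma> a) b \<oplus>\<^bsub>\<Gamma>\<^esub> lact \<Gamma> a (fdiff \<Gamma> b)) \<and>
    carrier \<Gamma> = lin_span K \<Gamma> {lact \<Gamma> a (fdiff \<Gamma> b) | a b. a \<in> carrier A \<and> b \<in> carrier A}"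

text \<open>The linear maps \<open>f\<close> on \<open>\<Gamma>\<close> with \<open>f(a db) = \<beta>(a, b)\<close>; there is at most one up to values
  outside of the carrier, and there is one iff \<open>a db \<mapsto> \<beta>(a, b)\<close> is well defined.\<close>

definition fodc_maps ::
  "'k ring \<Rightarrow> ('k, 'a, 'd) module_scheme \<Rightarrow> ('k, 'm, 'a) fodc \<Rightarrow> ('k, 'u, 'e) module_scheme \<Rightarrow>
    ('a \<Rightarrow> 'a \<Rightarrow> 'u) \<Rightarrow> ('m \<Rightarrow> 'u) set"
  where "fodc_maps K A \<Gamma> U \<beta> = {f \<in> lin_maps K \<Gamma> U.
    \<forall>a \<in> carrier A. \<forall>b \<in> carrier A. f (lact \<Gamma> a (fdiff \<Gamma> b)) = \<beta> a b}"

definition fodc_lift ::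
  "'k ring \<Rightarrow> ('k, 'a, 'd) module_scheme \<Rightarrow> ('k, 'm, 'a) fodc \<Rightarrow> ('k, 'u, 'e) module_scheme \<Rightarrow>
    ('a \<Rightarrow> 'a \<Rightarrow> 'u) \<Rightarrow> 'm \<Rightarrow> 'u"
  where "fodc_lift K A \<Gamma> U \<beta> = (SOME f. f \<in> fodc_maps K A \<Gamma> U \<beta>)"

text \<open>\<open>a\<^sub>0 db\<^sub>0 \<otimes> a\<^sub>1 b\<^sub>1\<close>, for a right coaction \<open>\<delta>\<close> of \<open>H\<close> on \<open>A\<close>.\<close>

definition right_coact_formula ::
  "'k ring \<Rightarrow> ('k, 'h) hopf \<Rightarrow> ('a \<Rightarrow> ('a \<times> 'h \<Rightarrow> 'k) set) \<Rightarrow> ('k, 'm, 'a) fodc \<Rightarrow>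
    'a \<Rightarrow> 'a \<Rightarrow> ('m \<times> 'h \<Rightarrow> 'k) set"
  where "right_coact_formula K H \<delta> \<Gamma> a b = (let T = tensor_space K \<Gamma> H in
    pres_lift K T (\<lambda>(a\<^sub>0, a\<^sub>1). pres_lift K T (\<lambda>(b\<^sub>0, b\<^sub>1).
      tens K \<Gamma> H (lact \<Gamma> a\<^sub>0 (fdiff \<Gamma> b\<^sub>0)) (a\<^sub>1 \<otimes>\<^bsub>H\<^esub> b\<^sub>1)) (\<delta> b)) (\<delta> a))"

text \<open>\<open>h\<^sub>1 g\<^sub>1 \<otimes> h\<^sub>2 dg\<^sub>2\<close>.\<close>

definition left_coact_formula ::
  "'k ring \<Rightarrow> ('k, 'h) hopf \<Rightarrow> ('k, 'm, 'h) fodc \<Rightarrow> 'h \<Rightarrow> 'h \<Rightarrow> ('h \<times> 'm \<Rightarrow> 'k) set"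
  where "left_coact_formula K H \<Gamma> h g = (let T = tensor_space K H \<Gamma> in
    pres_lift K T (\<lambda>(h\<^sub>1, h\<^sub>2). pres_lift K T (\<lambda>(g\<^sub>1, g\<^sub>2).
      tens K H \<Gamma> (h\<^sub>1 \<otimes>\<^bsub>H\<^esub> g\<^sub>1) (lact \<Gamma> h\<^sub>2 (fdiff \<Gamma> g\<^sub>2))) (comult H g)) (comult H h))"

definition bicovariant_calculus :: "'k ring \<Rightarrow> ('k, 'h) hopf \<Rightarrow> ('k, 'm, 'h) fodc \<Rightarrow> bool"
  where "bicovariant_calculus K H \<Gamma> \<longleftrightarrow> first_order_calculus K H \<Gamma> \<and>
    fodc_maps K H \<Gamma> (tensor_space K \<Gamma> H) (right_coact_formula K H (comult H) \<Gamma>) \<noteq> {} \<and>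
    fodc_maps K H \<Gamma> (tensor_space K H \<Gamma>) (left_coact_formula K H \<Gamma>) \<noteq> {}"

definition right_coaction ::
  "'k ring \<Rightarrow> ('k, 'h) hopf \<Rightarrow> ('k, 'a, 'd) module_scheme \<Rightarrow> ('a \<Rightarrow> ('a \<times> 'h \<Rightarrow> 'k) set) \<Rightarrow>
    ('k, 'm, 'a) fodc \<Rightarrow> 'm \<Rightarrow> ('m \<times> 'h \<Rightarrow> 'k) set"
  where "right_coaction K H A \<delta> \<Gamma> =
    fodc_lift K A \<Gamma> (tensor_space K \<Gamma> H) (right_coact_formula K H \<delta> \<Gamma>)"

definition left_coaction ::
  "'k ring \<Rightarrow> ('k, 'h) hopf \<Rightarrow> ('k, 'm, 'h) fodc \<Rightarrow> 'm \<Rightarrow> ('h \<times> 'm \<Rightarrow> 'k) set"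
  where "left_coaction K H \<Gamma> = fodc_lift K H \<Gamma> (tensor_space K H \<Gamma>) (left_coact_formula K H \<Gamma>)"


section \<open>Differential graded algebras and differential calculi\<close>

record ('k, 'w) dga = "('k, 'w) module" +
  deg :: "nat \<Rightarrow> 'w set"
  diff :: "'w \<Rightarrow> 'w"

definition is_decomposition :: "('k, 'w) dga \<Rightarrow> 'w \<Rightarrow> (nat \<Rightarrow> 'w) \<Rightarrow> bool"
  where "is_decomposition \<Omega> x f \<longleftrightarrow> (\<forall>n. f n \<in> deg \<Omega> n) \<and> finite {n. f n \<noteq> \<zero>\<^bsub>\<Omega>\<^esub>} \<and>
    x = finsum \<Omega> f {n. f n \<noteq> \<zero>\<^bsub>\<Omega>\<^esub>}"

definition component :: "('k, 'w) dga \<Rightarrow> 'w \<Rightarrow> nat \<Rightarrow> 'w"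
  where "component \<Omega> x = (THE f. is_decomposition \<Omega> x f)"

definition signed :: "('k, 'v, 'e) module_scheme \<Rightarrow> nat \<Rightarrow> 'v \<Rightarrow> 'v"
  where "signed V n x = (if even n then x else \<ominus>\<^bsub>V\<^esub> x)"

definition diff_graded_algebra :: "'k ring \<Rightarrow> ('k, 'w) dga \<Rightarrow> bool"
  where "diff_graded_algebra K \<Omega> \<longleftrightarrow> assoc_algebra K \<Omega> \<and>
    (\<forall>n. submodule (deg \<Omega> n) K \<Omega>) \<and>
    (\<forall>x \<in> carrier \<Omega>. \<exists>!f. is_decomposition \<Omega> x f) \<and>
    \<one>\<^bsub>\<Omega>\<^esub> \<in> deg \<Omega> 0 \<and>
    (\<forall>i j. \<forall>x \<in> deg \<Omega> i. \<forall>y \<in> deg \<Omega> j. x \<otimes>\<^bsub>\<Omega>\<^esub> y \<in> deg \<Omega> (i + j)) \<and>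
    diff \<Omega> \<in> lin_maps K \<Omega> \<Omega> \<and>
    (\<forall>i. \<forall>x \<in> deg \<Omega> i. diff \<Omega> x \<in> deg \<Omega> (Suc i)) \<and>
    (\<forall>x \<in> carrier \<Omega>. diff \<Omega> (diff \<Omega> x) = \<zero>\<^bsub>\<Omega>\<^esub>) \<and>
    (\<forall>i. \<forall>x \<in> deg \<Omega> i. \<forall>y \<in> carrier \<Omega>.
      diff \<Omega> (x \<otimes>\<^bsub>\<Omega>\<^esub> y) = diff \<Omega> x \<otimes>\<^bsub>\<Omega>\<^esub> y \<oplus>\<^bsub>\<Omega>\<^esub> signed \<Omega> i (x \<otimes>\<^bsub>\<Omega>\<^esub> diff \<Omega> y))"

definition dga_homs :: "'k ring \<Rightarrow> ('k, 'v) dga \<Rightarrow> ('k, 'w) dga \<Rightarrow> ('v \<Rightarrow> 'w) set"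
  where "dga_homs K \<Omega> \<Omega>' = {f \<in> algebra_homs K \<Omega> \<Omega>'.
    (\<forall>n. f ` deg \<Omega> n \<subseteq> deg \<Omega>' n) \<and> (\<forall>x \<in> carrier \<Omega>. f (diff \<Omega> x) = diff \<Omega>' (f x))}"

text \<open>
  The tensor product of DGAs. On homogeneous elements the product is
  \<open>(\<omega> \<otimes> \<omega>') (\<eta> \<otimes> \<eta>') = (-1)\<^bsup>|\<omega>'| |\<eta>|\<^esup> \<omega>\<eta> \<otimes> \<omega>'\<eta>'\<close> and the differential is
  \<open>d(\<omega> \<otimes> \<omega>') = d\<omega> \<otimes> \<omega>' + (-1)\<^bsup>|\<omega>|\<^esup> \<omega> \<otimes> d\<omega>'\<close>; below, \<open>\<omega>\<close>, \<open>\<omega>'\<close>, \<open>\<eta>\<close>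
  are decomposed into homogeneous components.
\<close>

definition dga_tensor ::
  "'k ring \<Rightarrow> ('k, 'v) dga \<Rightarrow> ('k, 'w) dga \<Rightarrow> ('k, ('v \<times> 'w \<Rightarrow> 'k) set) dga"
  where "dga_tensor K \<Omega> \<Omega>' = (let T = tensor_space K \<Omega> \<Omega>' in
    \<lparr>carrier = carrier T,
     mult = (\<lambda>P Q. pres_lift K T (\<lambda>(\<omega>, \<omega>'). pres_lift K T (\<lambda>(\<eta>, \<eta>').
       finsum T (\<lambda>(i, j). signed T (i * j)
           (tens K \<Omega> \<Omega>' (\<omega> \<otimes>\<^bsub>\<Omega>\<^esub> component \<Omega> \<eta> j) (component \<Omega>' \<omega>' i \<otimes>\<^bsub>\<Omega>'\<^esub> \<eta>')))
         ({i. component \<Omega>' \<omega>' i \<noteq> \<zero>\<^bsub>\<Omega>'\<^esub>} \<times> {j. component \<Omega> \<eta> j \<noteq> \<zero>\<^bsub>\<Omega>\<^esub>})) Q) P),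
     one = tens K \<Omega> \<Omega>' \<one>\<^bsub>\<Omega>\<^esub> \<one>\<^bsub>\<Omega>'\<^esub>, zero = zero T, add = add T, smult = smult T,
     deg = (\<lambda>n. lin_span K T {tens K \<Omega> \<Omega>' \<omega> \<omega>' | \<omega> \<omega>' i j.
       i + j = n \<and> \<omega> \<in> deg \<Omega> i \<and> \<omega>' \<in> deg \<Omega>' j}),
     diff = pres_lift K T (\<lambda>(\<omega>, \<omega>'). tens K \<Omega> \<Omega>' (diff \<Omega> \<omega>) \<omega>' \<oplus>\<^bsub>T\<^esub>
       finsum T (\<lambda>i. signed T i (tens K \<Omega> \<Omega>' (component \<Omega> \<omega> i) (diff \<Omega>' \<omega>')))
         {i. component \<Omega> \<omega> i \<noteq> \<zero>\<^bsub>\<Omega>\<^esub>})\<rparr>)"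

definition differential_calculus ::
  "'k ring \<Rightarrow> ('k, 'a, 'd) module_scheme \<Rightarrow> ('k, 'a) dga \<Rightarrow> bool"
  where "differential_calculus K A \<Omega> \<longleftrightarrow> diff_graded_algebra K \<Omega> \<and>
    carrier A = deg \<Omega> 0 \<and> \<one>\<^bsub>A\<^esub> = \<one>\<^bsub>\<Omega>\<^esub> \<and> \<zero>\<^bsub>A\<^esub> = \<zero>\<^bsub>\<Omega>\<^esub> \<and>
    (\<forall>a \<in> carrier A. \<forall>b \<in> carrier A. a \<otimes>\<^bsub>A\<^esub> b = a \<otimes>\<^bsub>\<Omega>\<^esub> b \<and> a \<oplus>\<^bsub>A\<^esub> b = a \<oplus>\<^bsub>\<Omega>\<^esub> b) \<and>
    (\<forall>c \<in> carrier K. \<forall>a \<in> carrier A. c \<odot>\<^bsub>A\<^esub> a = c \<odot>\<^bsub>\<Omega>\<^esub> a) \<and>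
    (\<forall>k. deg \<Omega> k = lin_span K \<Omega> {a \<otimes>\<^bsub>\<Omega>\<^esub> foldr (\<lambda>b w. diff \<Omega> b \<otimes>\<^bsub>\<Omega>\<^esub> w) bs \<one>\<^bsub>\<Omega>\<^esub> | a bs.
      a \<in> carrier A \<and> set bs \<subseteq> carrier A \<and> length bs = k})"

definition first_order :: "('k, 'a) dga \<Rightarrow> ('k, 'a, 'a) fodc"
  where "first_order \<Omega> = \<lparr>carrier = deg \<Omega> 1, mult = mult \<Omega>, one = one \<Omega>, zero = zero \<Omega>,
    add = add \<Omega>, smult = smult \<Omega>, lact = mult \<Omega>, ract = mult \<Omega>, fdiff = diff \<Omega>\<rparr>"


subsection \<open>Maximal prolongation\<close>

text \<open>
  The tensor algebra \<open>A \<oplus> \<Gamma> \<oplus> \<Gamma> \<otimes>\<^sub>A \<Gamma> \<oplus> \<dots>\<close>. It is spanned by the generators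
  \<open>Inl a\<close> (\<open>a\<close> in degree 0) and \<open>Inr [\<gamma>\<^sub>1, \<dots>, \<gamma>\<^sub>k]\<close> with \<open>k \<ge> 1\<close>
  (\<open>\<gamma>\<^sub>1 \<otimes>\<^sub>A \<dots> \<otimes>\<^sub>A \<gamma>\<^sub>k\<close>); the relations are linearity in \<open>a\<close>, multilinearity in the \<open>\<gamma>\<^sub>i\<close> and
  \<open>A\<close>-balancedness.
\<close>

definition tensor_words ::
  "('k, 'a, 'd) module_scheme \<Rightarrow> ('k, 'm, 'a, 'e) bimod_scheme \<Rightarrow> ('a + 'm list) set"
  where "tensor_words A \<Gamma> =
    Inl ` carrier A \<union> Inr ` {\<gamma>s. \<gamma>s \<noteq> [] \<and> set \<gamma>s \<subseteq> carrier \<Gamma>}"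

definition tensor_word_rels ::
  "'k ring \<Rightarrow> ('k, 'a, 'd) module_scheme \<Rightarrow> ('k, 'm, 'a, 'e) bimod_scheme \<Rightarrow> ('a + 'm list \<Rightarrow> 'k) set"
  where "tensor_word_rels K A \<Gamma> =
    (let F = free_space K (tensor_words A \<Gamma>); g = free_gen K; C = carrier \<Gamma> in
    {g (Inl (a \<oplus>\<^bsub>A\<^esub> b)) \<ominus>\<^bsub>F\<^esub> (g (Inl a) \<oplus>\<^bsub>F\<^esub> g (Inl b)) | a b. a \<in> carrier A \<and> b \<in> carrier A} \<union>
    {g (Inl (c \<odot>\<^bsub>A\<^esub> a)) \<ominus>\<^bsub>F\<^esub> (c \<odot>\<^bsub>F\<^esub> g (Inl a)) | c a. c \<in> carrier K \<and> a \<in> carrier A} \<union>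
    {g (Inr (xs @ (\<gamma> \<oplus>\<^bsub>\<Gamma>\<^esub> \<gamma>') # ys)) \<ominus>\<^bsub>F\<^esub> (g (Inr (xs @ \<gamma> # ys)) \<oplus>\<^bsub>F\<^esub> g (Inr (xs @ \<gamma>' # ys))) |
      xs \<gamma> \<gamma>' ys. set xs \<subseteq> C \<and> set ys \<subseteq> C \<and> \<gamma> \<in> C \<and> \<gamma>' \<in> C} \<union>
    {g (Inr (xs @ (c \<odot>\<^bsub>\<Gamma>\<^esub> \<gamma>) # ys)) \<ominus>\<^bsub>F\<^esub> (c \<odot>\<^bsub>F\<^esub> g (Inr (xs @ \<gamma> # ys))) |
      xs \<gamma> ys c. set xs \<subseteq> C \<and> set ys \<subseteq> C \<and> \<gamma> \<in> C \<and> c \<in> carrier K} \<union>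
    {g (Inr (xs @ ract \<Gamma> \<gamma> a # \<gamma>' # ys)) \<ominus>\<^bsub>F\<^esub> g (Inr (xs @ \<gamma> # lact \<Gamma> a \<gamma>' # ys)) |
      xs \<gamma> a \<gamma>' ys. set xs \<subseteq> C \<and> set ys \<subseteq> C \<and> \<gamma> \<in> C \<and> \<gamma>' \<in> C \<and> a \<in> carrier A})"

fun tensor_word_mult ::
  "('k, 'a, 'd) module_scheme \<Rightarrow> ('k, 'm, 'a, 'e) bimod_scheme \<Rightarrow>
    'a + 'm list \<Rightarrow> 'a + 'm list \<Rightarrow> 'a + 'm list"
  where
    "tensor_word_mult A \<Gamma> (Inl a) (Inl b) = Inl (a \<otimes>\<^bsub>A\<^esub> b)"
  | "tensor_word_mult A \<Gamma> (Inl a) (Inr ys) = Inr (lact \<Gamma> a (hd ys) # tl ys)"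
  | "tensor_word_mult A \<Gamma> (Inr xs) (Inl b) = Inr (butlast xs @ [ract \<Gamma> (last xs) b])"
  | "tensor_word_mult A \<Gamma> (Inr xs) (Inr ys) = Inr (xs @ ys)"

definition tensor_word ::
  "'k ring \<Rightarrow> ('k, 'a, 'd) module_scheme \<Rightarrow> ('k, 'm, 'a, 'e) bimod_scheme \<Rightarrow> 'a + 'm list \<Rightarrow>
    ('a + 'm list \<Rightarrow> 'k) set"
  where "tensor_word K A \<Gamma> = pres_gen K (tensor_words A \<Gamma>) (tensor_word_rels K A \<Gamma>)"

definition tensor_algebra ::
  "'k ring \<Rightarrow> ('k, 'a, 'd) module_scheme \<Rightarrow> ('k, 'm, 'a, 'e) bimod_scheme \<Rightarrow>
    ('k, ('a + 'm list \<Rightarrow> 'k) set) module"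
  where "tensor_algebra K A \<Gamma> = (let T = presented K (tensor_words A \<Gamma>) (tensor_word_rels K A \<Gamma>) in T
    \<lparr>mult := (\<lambda>P Q. pres_lift K T (\<lambda>x. pres_lift K T (\<lambda>y.
        tensor_word K A \<Gamma> (tensor_word_mult A \<Gamma> x y)) Q) P),
     one := tensor_word K A \<Gamma> (Inl \<one>\<^bsub>A\<^esub>)\<rparr>)"

definition prolongation_ideal ::
  "'k ring \<Rightarrow> ('k, 'a, 'd) module_scheme \<Rightarrow> ('k, 'm, 'a) fodc \<Rightarrow> ('a + 'm list \<Rightarrow> 'k) set set"
  where "prolongation_ideal K A \<Gamma> = (let T = tensor_algebra K A \<Gamma> in
    Idl\<^bsub>T\<^esub> {finsum T (\<lambda>i. tensor_word K A \<Gamma> (Inr [fdiff \<Gamma> (a i), fdiff \<Gamma> (b i)])) {..<n} | a b n.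
      a \<in> {..<n} \<rightarrow> carrier A \<and> b \<in> {..<n} \<rightarrow> carrier A \<and>
      finsum \<Gamma> (\<lambda>i. lact \<Gamma> (a i) (fdiff \<Gamma> (b i))) {..<n :: nat} = \<zero>\<^bsub>\<Gamma>\<^esub>})"

text \<open>
  \<open>\<Omega>\<close> is the maximal prolongation of its first order part \<open>\<Gamma>\<close>: the identities of \<open>A\<close> and \<open>\<Gamma>\<close>
  extend to an isomorphism from the quotient of the tensor algebra onto \<open>\<Omega>\<close>. The rule
  \<open>d(a db) = da db\<close> is part of \<open>\<Omega>\<close> being a differential calculus.
\<close>

definition maximal_prolongation ::
  "'k ring \<Rightarrow> ('k, 'a, 'd) module_scheme \<Rightarrow> ('k, 'a) dga \<Rightarrow> bool"
  where "maximal_prolongation K A \<Omega> \<longleftrightarrow> differential_calculus K A \<Omega> \<and>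
    (let \<Gamma> = first_order \<Omega>; T = tensor_algebra K A \<Gamma>; J = prolongation_ideal K A \<Gamma> in
      \<exists>\<phi> \<in> ring_iso (T Quot J) \<Omega>.
        (\<forall>a \<in> carrier A. \<phi> (J +>\<^bsub>T\<^esub> tensor_word K A \<Gamma> (Inl a)) = a) \<and>
        (\<forall>\<gamma> \<in> carrier \<Gamma>. \<phi> (J +>\<^bsub>T\<^esub> tensor_word K A \<Gamma> (Inr [\<gamma>])) = \<gamma>))"


section \<open>Complete calculi, horizontal and vertical forms\<close>

text \<open>The calculus \<open>\<Omega>\<^sub>A\<close> is complete with respect to \<open>\<Omega>\<^sub>H\<close>, \<open>D\<close> being the extension of
  \<open>\<Delta>\<^sub>A\<close>. The map \<open>id \<otimes> id\<close> is the inclusion of \<open>A \<otimes> H\<close> into the tensor product of the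
  calculi.\<close>

definition complete_calculus ::
  "'k ring \<Rightarrow> ('k, 'h) hopf \<Rightarrow> ('k, 'h) dga \<Rightarrow> ('k, 'a, 'h) comodule_alg \<Rightarrow> ('k, 'a) dga \<Rightarrow>
    ('a \<Rightarrow> ('a \<times> 'h \<Rightarrow> 'k) set) \<Rightarrow> bool"
  where "complete_calculus K H \<Omega>\<^sub>H A \<Omega>\<^sub>A D \<longleftrightarrow> differential_calculus K A \<Omega>\<^sub>A \<and>
    D \<in> dga_homs K \<Omega>\<^sub>A (dga_tensor K \<Omega>\<^sub>A \<Omega>\<^sub>H) \<and>
    (\<forall>a \<in> carrier A. D a = tensor_map K \<Omega>\<^sub>A \<Omega>\<^sub>H id id (coact A a))"

definition Omega1 ::
  "'k ring \<Rightarrow> ('k, 'h) hopf \<Rightarrow> ('k, 'a, 'h) comodule_alg \<Rightarrow> ('k, 'a) dga \<Rightarrow> ('k, 'a, 'a, 'h) cov_bimod"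
  where "Omega1 K H A \<Omega>\<^sub>A =
    with_coaction (first_order \<Omega>\<^sub>A) (right_coaction K H A (coact A) (first_order \<Omega>\<^sub>A))"

definition hor1_forms ::
  "'k ring \<Rightarrow> ('k, 'h) hopf \<Rightarrow> ('k, 'h) dga \<Rightarrow> ('k, 'a) dga \<Rightarrow> ('a \<Rightarrow> ('a \<times> 'h \<Rightarrow> 'k) set) \<Rightarrow> 'a set"
  where "hor1_forms K H \<Omega>\<^sub>H \<Omega>\<^sub>A D = {\<omega> \<in> deg \<Omega>\<^sub>A 1.
    D \<omega> \<in> tensor_map K \<Omega>\<^sub>A \<Omega>\<^sub>H id id ` carrier (tensor_space K (first_order \<Omega>\<^sub>A) H)}"

definition hor1 ::
  "'k ring \<Rightarrow> ('k, 'h) hopf \<Rightarrow> ('k, 'h) dga \<Rightarrow> ('k, 'a, 'h) comodule_alg \<Rightarrow> ('k, 'a) dga \<Rightarrow>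
    ('a \<Rightarrow> ('a \<times> 'h \<Rightarrow> 'k) set) \<Rightarrow> ('k, 'a, 'a, 'h) cov_bimod"
  where "hor1 K H \<Omega>\<^sub>H A \<Omega>\<^sub>A D =
    (let M = Omega1 K H A \<Omega>\<^sub>A; N = M\<lparr>carrier := hor1_forms K H \<Omega>\<^sub>H \<Omega>\<^sub>A D\<rparr> in
      N\<lparr>bcoact := restrict_coaction K H N M (bcoact M)\<rparr>)"

text \<open>The left coinvariant \<open>1\<close>-forms \<open>\<Lambda>\<^sup>1\<close>, as a subspace of \<open>\<Gamma> = \<Omega>\<^sup>1(H)\<close>, with their right
  action \<open>\<theta> \<leftharpoonup> h = S(h\<^sub>1) \<theta> h\<^sub>2\<close> and right coaction.\<close>

definition Lambda1 :: "'k ring \<Rightarrow> ('k, 'h) hopf \<Rightarrow> ('k, 'm, 'h) fodc \<Rightarrow> ('k, 'm, 'h) fodc"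
  where "Lambda1 K H \<Gamma> =
    \<Gamma>\<lparr>carrier := {\<theta> \<in> carrier \<Gamma>. left_coaction K H \<Gamma> \<theta> = tens K H \<Gamma> \<one>\<^bsub>H\<^esub> \<theta>}\<rparr>"

definition Lambda1_act :: "'k ring \<Rightarrow> ('k, 'h) hopf \<Rightarrow> ('k, 'm, 'h) fodc \<Rightarrow> 'm \<Rightarrow> 'h \<Rightarrow> 'm"
  where "Lambda1_act K H \<Gamma> \<theta> h =
    pres_lift K \<Gamma> (\<lambda>(h\<^sub>1, h\<^sub>2). ract \<Gamma> (lact \<Gamma> (antipode H h\<^sub>1) \<theta>) h\<^sub>2) (comult H h)"

definition Lambda1_coact ::
  "'k ring \<Rightarrow> ('k, 'h) hopf \<Rightarrow> ('k, 'm, 'h) fodc \<Rightarrow> 'm \<Rightarrow> ('m \<times> 'h \<Rightarrow> 'k) set"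
  where "Lambda1_coact K H \<Gamma> =
    restrict_coaction K H (Lambda1 K H \<Gamma>) \<Gamma> (right_coaction K H H (comult H) \<Gamma>)"

definition ver1 ::
  "'k ring \<Rightarrow> ('k, 'h) hopf \<Rightarrow> ('k, 'h) dga \<Rightarrow> ('k, 'a, 'h) comodule_alg \<Rightarrow>
    ('k, ('a \<times> 'h \<Rightarrow> 'k) set, 'a, 'h) cov_bimod"
  where "ver1 K H \<Omega>\<^sub>H A =
    (let \<Gamma> = first_order \<Omega>\<^sub>H; L = Lambda1 K H \<Gamma>; V = tensor_space K A L; VH = tensor_space K V H in
    \<lparr>carrier = carrier V, mult = mult V, one = one V, zero = zero V, add = add V, smult = smult V,
     lact = (\<lambda>a. pres_lift K V (\<lambda>(a', \<theta>). tens K A L (a \<otimes>\<^bsub>A\<^esub> a') \<theta>)),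
     ract = (\<lambda>v a. pres_lift K V (\<lambda>(a', \<theta>). pres_lift K V (\<lambda>(a\<^sub>0, a\<^sub>1).
       tens K A L (a' \<otimes>\<^bsub>A\<^esub> a\<^sub>0) (Lambda1_act K H \<Gamma> \<theta> a\<^sub>1)) (coact A a)) v),
     bcoact = pres_lift K VH (\<lambda>(a, \<theta>). pres_lift K VH (\<lambda>(a\<^sub>0, a\<^sub>1). pres_lift K VH (\<lambda>(\<theta>\<^sub>0, \<theta>\<^sub>1).
       tens K V H (tens K A L a\<^sub>0 \<theta>\<^sub>0) (a\<^sub>1 \<otimes>\<^bsub>H\<^esub> \<theta>\<^sub>1)) (Lambda1_coact K H \<Gamma> \<theta>)) (coact A a))\<rparr>)"

text \<open>\<open>\<pi>\<^sub>v(a db) = a b\<^sub>0 \<otimes> S(b\<^sub>1) db\<^sub>2\<close>. The sum over the second coproduct is formed inside the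
  right tensor factor, since only \<open>S(h\<^sub>1) dh\<^sub>2\<close> as a whole lies in \<open>\<Lambda>\<^sup>1\<close>.\<close>

definition pi_v ::
  "'k ring \<Rightarrow> ('k, 'h) hopf \<Rightarrow> ('k, 'h) dga \<Rightarrow> ('k, 'a, 'h) comodule_alg \<Rightarrow> ('k, 'a) dga \<Rightarrow>
    'a \<Rightarrow> ('a \<times> 'h \<Rightarrow> 'k) set"
  where "pi_v K H \<Omega>\<^sub>H A \<Omega>\<^sub>A =
    (let \<Gamma> = first_order \<Omega>\<^sub>H; L = Lambda1 K H \<Gamma>; V = tensor_space K A L in
     fodc_lift K A (first_order \<Omega>\<^sub>A) V (\<lambda>a b.
       pres_lift K V (\<lambda>(b\<^sub>0, h). tens K A L (a \<otimes>\<^bsub>A\<^esub> b\<^sub>0)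
         (pres_lift K \<Gamma> (\<lambda>(h\<^sub>1, h\<^sub>2). lact \<Gamma> (antipode H h\<^sub>1) (fdiff \<Gamma> h\<^sub>2)) (comult H h))) (coact A b)))"

end

theory Submission
  imports Defs
begin

text \<open>On \<open>\<Omega>\<^sup>1(A)\<close> the map \<open>\<Delta>\<^sub>A\<^sup>\<bullet>\<close> splits as \<open>D\<^sup>1\<^sup>0 + D\<^sup>0\<^sup>1\<close> with values in \<open>\<Omega>\<^sup>1(A) \<otimes> H\<close> and
  \<open>A \<otimes> \<Omega>\<^sup>1(H)\<close>, so that \<open>hor\<^sup>1\<close> is the kernel of \<open>D\<^sup>0\<^sup>1\<close>. Over a field the functor \<open>- \<otimes> H\<close> is
  exact, hence \<open>hor\<^sup>1\<close> inherits the coaction of \<open>\<Omega>\<^sup>1(A)\<close> as soon as \<open>D\<^sup>0\<^sup>1\<close> is colinear. The map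
  \<open>a \<otimes> \<theta> \<mapsto> a\<^sub>0 \<otimes> a\<^sub>1 \<theta>\<close> embeds \<open>ver\<^sup>1\<close> into \<open>A \<otimes> \<Omega>\<^sup>1(H)\<close>, with retraction
  \<open>a \<otimes> \<gamma> \<mapsto> a\<^sub>0 \<otimes> P(S(a\<^sub>1) \<gamma>)\<close> for the projection \<open>P(\<gamma>) = S(\<gamma>\<^sub>-\<^sub>1) \<gamma>\<^sub>0\<close> to \<open>\<Lambda>\<^sup>1\<close>, and it sends \<open>\<pi>\<^sub>v(\<omega>)\<close> to \<open>D\<^sup>0\<^sup>1(\<omega>)\<close>. Therefore
  \<open>\<pi>\<^sub>v\<close> has kernel \<open>hor\<^sup>1\<close>, and its linearity and colinearity, as well as the axioms of a covariant
  bimodule for \<open>ver\<^sup>1\<close>, follow from those of \<open>D\<^sup>0\<^sup>1\<close>. Every left coinvariant form is \<open>S(h\<^sub>1) dh\<^sub>2\<close> for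
  some \<open>h\<close>, and \<open>\<pi>\<^sub>v\<close> maps \<open>\<Sum> a da'\<close> to \<open>a \<otimes> S(h\<^sub>1) dh\<^sub>2\<close> whenever the Galois map sends
  \<open>\<Sum> a \<otimes> a'\<close> to \<open>a \<otimes> h\<close>, so \<open>\<pi>\<^sub>v\<close> is onto.\<close>

section \<open>Linear algebra over a field\<close>

text \<open>In the definitions, a map out of a tensor product is evaluated at a chosen
  representative, and the coaction of \<Omega>^1(A) and \<open>pi_v\<close> are chosen among the
  linear maps with prescribed values on a db. Existence is therefore earned each time by exhibiting
  one: the component \<open>D10\<close> of D for the coaction, and the retraction applied to
  \<open>D01\<close> for \<open>pi_v\<close>. Sweedler sums become nested applications of
  \<open>lift\<close>. The cancellation behind the embedding of the vertical forms is that a b_0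
  \<otimes> S(b_1) db_2 goes to a_0 b_0 \<otimes> a_1 b_1 S(b_2) db_3 = a_0 b_0 \<otimes> a_1 db_1.
  The bimodule and comodule axioms of ver^1 are not computed from its formulas: once
  \<open>pi_v\<close> is known to be onto and compatible with all operations, they descend from
  \<Omega>^1(A). The coaction axioms of hor^1 are read off inside \<Omega>^1(A) \<otimes> H, into
  which hor^1 \<otimes> H injects because a subspace has a linear retraction; the same splitting,
  from Zorn's lemma, gives the exactness of - \<otimes> H.\<close>

locale base_field =
  fixes K :: "'k ring"
  assumes field_K: "field K"
begin

abbreviation VS :: "('k, 'v, 'e) module_scheme \<Rightarrow> bool"
  where "VS V \<equiv> module K V"

abbreviation Lin :: "('k, 'v, 'e) module_scheme \<Rightarrow> ('k, 'w, 'f) module_scheme \<Rightarrow> ('v \<Rightarrow> 'w) set"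
  where "Lin V W \<equiv> lin_maps K V W"

lemma cring_K: "cring K"
  using field_K by (simp add: field_def domain_def)

lemma ring_K: "ring K"
  using cring_K by (rule cring.axioms(1))

lemma K_closed [simp]: "\<zero>\<^bsub>K\<^esub> \<in> carrier K" "\<one>\<^bsub>K\<^esub> \<in> carrier K"
  using ring_K by (simp_all add: ring.ring_simprules)

lemma one_neq_zero_K [simp]: "\<one>\<^bsub>K\<^esub> \<noteq> \<zero>\<^bsub>K\<^esub>"
  using field_K by (simp add: field_def domain.one_not_zero)

lemma abelian_group_VS: "VS V \<Longrightarrow> abelian_group V"
  by (rule module.axioms(2))

lemma abelian_monoid_VS: "VS V \<Longrightarrow> abelian_monoid V"
  by (simp add: abelian_group.axioms(1) abelian_group_VS)

lemma VS_closed [simp]: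
  assumes "VS V"
  shows "\<zero>\<^bsub>V\<^esub> \<in> carrier V"
    and "x \<in> carrier V \<Longrightarrow> y \<in> carrier V \<Longrightarrow> x \<oplus>\<^bsub>V\<^esub> y \<in> carrier V"
    and "x \<in> carrier V \<Longrightarrow> \<ominus>\<^bsub>V\<^esub> x \<in> carrier V"
    and "x \<in> carrier V \<Longrightarrow> y \<in> carrier V \<Longrightarrow> x \<ominus>\<^bsub>V\<^esub> y \<in> carrier V"
    and "c \<in> carrier K \<Longrightarrow> x \<in> carrier V \<Longrightarrow> c \<odot>\<^bsub>V\<^esub> x \<in> carrier V"
  using abelian_group_VS[OF assms] module.smult_closed[OF assms]
  by (auto simp: abelian_group.minus_closed abelian_group.a_inv_closed
      abelian_monoid.a_closed abelian_group.axioms(1) abelian_monoid.zero_closed)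

lemma VS_zero_smult [simp]: "VS V \<Longrightarrow> x \<in> carrier V \<Longrightarrow> \<zero>\<^bsub>K\<^esub> \<odot>\<^bsub>V\<^esub> x = \<zero>\<^bsub>V\<^esub>"
  by (rule module.smult_l_null)

lemma VS_smult_zero [simp]: "VS V \<Longrightarrow> c \<in> carrier K \<Longrightarrow> c \<odot>\<^bsub>V\<^esub> \<zero>\<^bsub>V\<^esub> = \<zero>\<^bsub>V\<^esub>"
  by (rule module.smult_r_null)

lemma VS_one_smult [simp]: "VS V \<Longrightarrow> x \<in> carrier V \<Longrightarrow> \<one>\<^bsub>K\<^esub> \<odot>\<^bsub>V\<^esub> x = x"
  by (rule module.smult_one)

lemma VS_neg: "VS V \<Longrightarrow> x \<in> carrier V \<Longrightarrow> \<ominus>\<^bsub>V\<^esub> x = (\<ominus>\<^bsub>K\<^esub> \<one>\<^bsub>K\<^esub>) \<odot>\<^bsub>V\<^esub> x"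
  using module.smult_l_minus[of K V "\<one>\<^bsub>K\<^esub>" x] by simp

lemma neg_one_K [simp]: "\<ominus>\<^bsub>K\<^esub> \<one>\<^bsub>K\<^esub> \<in> carrier K"
  using ring_K by (simp add: ring.ring_simprules)

lemma VS_zero_add [simp]:
  "VS V \<Longrightarrow> x \<in> carrier V \<Longrightarrow> \<zero>\<^bsub>V\<^esub> \<oplus>\<^bsub>V\<^esub> x = x"
  "VS V \<Longrightarrow> x \<in> carrier V \<Longrightarrow> x \<oplus>\<^bsub>V\<^esub> \<zero>\<^bsub>V\<^esub> = x"
  by (simp_all add: abelian_monoid.l_zero abelian_monoid.r_zero abelian_monoid_VS)

lemma VS_minus_eq_zero:
  "VS V \<Longrightarrow> x \<in> carrier V \<Longrightarrow> y \<in> carrier V \<Longrightarrow> x \<ominus>\<^bsub>V\<^esub> y = \<zero>\<^bsub>V\<^esub> \<longleftrightarrow> x = y"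
proof
  assume V: "VS V" "x \<in> carrier V" "y \<in> carrier V" and eq: "x \<ominus>\<^bsub>V\<^esub> y = \<zero>\<^bsub>V\<^esub>"
  interpret V: abelian_group V using V(1) by (rule abelian_group_VS)
  from V eq have "\<ominus>\<^bsub>V\<^esub> (\<ominus>\<^bsub>V\<^esub> y) = x"
    by (intro V.minus_equality) (simp_all add: a_minus_def V.r_neg)
  then show "x = y" using V by simp
qed (simp add: a_minus_def abelian_group.r_neg abelian_group_VS)

lemma finsum_closed_VS [simp]:
  "VS V \<Longrightarrow> (\<And>i. i \<in> I \<Longrightarrow> g i \<in> carrier V) \<Longrightarrow> finsum V g I \<in> carrier V"
  by (simp add: abelian_monoid.finsum_closed abelian_monoid_VS Pi_def)

lemma finsum_cong_VS:
  assumes "VS V" "I = J" "\<And>i. i \<in> J \<Longrightarrow> f i = g i" "\<And>i. i \<in> J \<Longrightarrow> g i \<in> carrier V"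
  shows "finsum V f I = finsum V g J"
  using abelian_monoid.finsum_cong'[OF abelian_monoid_VS[OF assms(1)], of I J g f] assms(2-4)
  by auto

lemma finsum_superset:
  assumes "VS V" "finite J" "I \<subseteq> J" "\<And>i. i \<in> J - I \<Longrightarrow> g i = \<zero>\<^bsub>V\<^esub>"
    "\<And>i. i \<in> I \<Longrightarrow> g i \<in> carrier V"
  shows "finsum V g I = finsum V g J"
proof -
  interpret V: abelian_monoid V using assms(1) by (rule abelian_monoid_VS)
  have "g i \<in> carrier V" if "i \<in> J" for i
    using assms(4,5)[of i] that by (cases "i \<in> I") auto
  then show ?thesis
    by (intro V.add.finprod_mono_neutral_cong_left[OF assms(2,3)]) (use assms(4,5) in auto)
qed

lemma Lin_I:
  assumes "\<And>x. x \<in> carrier V \<Longrightarrow> f x \<in> carrier W"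
    and "\<And>x y. x \<in> carrier V \<Longrightarrow> y \<in> carrier V \<Longrightarrow> f (x \<oplus>\<^bsub>V\<^esub> y) = f x \<oplus>\<^bsub>W\<^esub> f y"
    and "\<And>c x. c \<in> carrier K \<Longrightarrow> x \<in> carrier V \<Longrightarrow> f (c \<odot>\<^bsub>V\<^esub> x) = c \<odot>\<^bsub>W\<^esub> f x"
  shows "f \<in> Lin V W"
  using assms by (auto simp: lin_maps_def)

lemma Lin_closed: "f \<in> Lin V W \<Longrightarrow> x \<in> carrier V \<Longrightarrow> f x \<in> carrier W"
  by (auto simp: lin_maps_def)

lemma Lin_add:
  "f \<in> Lin V W \<Longrightarrow> x \<in> carrier V \<Longrightarrow> y \<in> carrier V \<Longrightarrow> f (x \<oplus>\<^bsub>V\<^esub> y) = f x \<oplus>\<^bsub>W\<^esub> f y"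
  by (auto simp: lin_maps_def)

lemma Lin_smult:
  "f \<in> Lin V W \<Longrightarrow> c \<in> carrier K \<Longrightarrow> x \<in> carrier V \<Longrightarrow> f (c \<odot>\<^bsub>V\<^esub> x) = c \<odot>\<^bsub>W\<^esub> f x"
  by (auto simp: lin_maps_def)

lemma Lin_zero:
  assumes "f \<in> Lin V W" "VS V" "VS W"
  shows "f \<zero>\<^bsub>V\<^esub> = \<zero>\<^bsub>W\<^esub>"
  using Lin_smult[OF assms(1), of "\<zero>\<^bsub>K\<^esub>" "\<zero>\<^bsub>V\<^esub>"] Lin_closed[OF assms(1)] assms(2,3) by simp

lemma Lin_neg:
  assumes "f \<in> Lin V W" "VS V" "VS W" "x \<in> carrier V"
  shows "f (\<ominus>\<^bsub>V\<^esub> x) = \<ominus>\<^bsub>W\<^esub> f x"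
  using assms by (simp add: VS_neg Lin_smult Lin_closed[OF assms(1)])

lemma Lin_minus:
  assumes "f \<in> Lin V W" "VS V" "VS W" "x \<in> carrier V" "y \<in> carrier V"
  shows "f (x \<ominus>\<^bsub>V\<^esub> y) = f x \<ominus>\<^bsub>W\<^esub> f y"
  using assms by (simp add: a_minus_def Lin_add Lin_neg)

lemma Lin_finsum:
  assumes "f \<in> Lin V W" "VS V" "VS W" "\<And>i. i \<in> I \<Longrightarrow> g i \<in> carrier V"
  shows "f (finsum V g I) = finsum W (\<lambda>i. f (g i)) I"
proof (cases "finite I")
  case True
  interpret V: abelian_monoid V using assms(2) by (rule abelian_monoid_VS)
  interpret W: abelian_monoid W using assms(3) by (rule abelian_monoid_VS)
  from True assms(4) show ?thesis
  proof (induction I)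
    case (insert i I)
    then show ?case
      using Lin_closed[OF assms(1)] assms(2) by (simp add: Pi_def Lin_add[OF assms(1)])
  qed (simp add: Lin_zero[OF assms(1-3)])
next
  \<comment> \<open>Over an infinite index set \<open>finsum\<close> has the default value zero,
    which a linear map preserves.\<close>
  case False
  then show ?thesis
    by (simp add: finsum_def finprod_def Lin_zero[OF assms(1-3)])
qed

lemma Lin_cong:
  assumes "f \<in> Lin V W" "VS V" "\<And>x. x \<in> carrier V \<Longrightarrow> g x = f x"
  shows "g \<in> Lin V W"
  using assms by (auto simp: lin_maps_def)

lemma Lin_id: "(\<lambda>x. x) \<in> Lin V V"
  by (auto simp: lin_maps_def)

lemma Lin_comp: "f \<in> Lin V W \<Longrightarrow> g \<in> Lin X V \<Longrightarrow> (\<lambda>x. f (g x)) \<in> Lin X W"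
  by (rule Lin_I) (auto simp: Lin_add Lin_smult Lin_closed)

lemma Lin_zero_map: "VS W \<Longrightarrow> (\<lambda>x. \<zero>\<^bsub>W\<^esub>) \<in> Lin V W"
  by (auto simp: lin_maps_def)

lemma VS_add_4:
  assumes "VS V" "a \<in> carrier V" "b \<in> carrier V" "c \<in> carrier V" "d \<in> carrier V"
  shows "(a \<oplus>\<^bsub>V\<^esub> b) \<oplus>\<^bsub>V\<^esub> (c \<oplus>\<^bsub>V\<^esub> d) = (a \<oplus>\<^bsub>V\<^esub> c) \<oplus>\<^bsub>V\<^esub> (b \<oplus>\<^bsub>V\<^esub> d)"
proof -
  interpret V: abelian_monoid V using assms(1) by (rule abelian_monoid_VS)
  show ?thesis using assms(2-) by (simp add: V.a_ac)
qed

lemma Lin_add_map: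
  assumes "f \<in> Lin V W" "g \<in> Lin V W" "VS W"
  shows "(\<lambda>x. f x \<oplus>\<^bsub>W\<^esub> g x) \<in> Lin V W"
  by (rule Lin_I) (use assms in \<open>auto simp: Lin_closed[OF assms(1)] Lin_closed[OF assms(2)]
    Lin_add[OF assms(1)] Lin_add[OF assms(2)] Lin_smult[OF assms(1)] Lin_smult[OF assms(2)]
    VS_add_4 module.smult_r_distr\<close>)

lemma Lin_smult_map:
  assumes "f \<in> Lin V W" "c \<in> carrier K" "VS W"
  shows "(\<lambda>x. c \<odot>\<^bsub>W\<^esub> f x) \<in> Lin V W"
proof (rule Lin_I)
  fix d x assume "d \<in> carrier K" "x \<in> carrier V"
  then show "c \<odot>\<^bsub>W\<^esub> f (d \<odot>\<^bsub>V\<^esub> x) = d \<odot>\<^bsub>W\<^esub> (c \<odot>\<^bsub>W\<^esub> f x)"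
    using assms by (simp add: Lin_smult[OF assms(1)] Lin_closed[OF assms(1)] cring.cring_simprules(14)[OF cring_K]
        flip: module.smult_assoc1)
qed (use assms in \<open>auto simp: Lin_closed[OF assms(1)] Lin_add[OF assms(1)] module.smult_r_distr\<close>)

lemma Lin_minus_map:
  assumes "f \<in> Lin V W" "g \<in> Lin V W" "VS W" "VS V"
  shows "(\<lambda>x. f x \<ominus>\<^bsub>W\<^esub> g x) \<in> Lin V W"
proof -
  have "(\<lambda>x. \<ominus>\<^bsub>W\<^esub> g x) \<in> Lin V W"
    by (rule Lin_cong[OF Lin_smult_map[OF assms(2) neg_one_K assms(3)] assms(4)])
      (simp add: VS_neg assms(3) Lin_closed[OF assms(2)])
  from Lin_add_map[OF assms(1) this assms(3)] show ?thesis by (simp add: a_minus_def)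
qed

lemma Lin_finsum_map:
  assumes "finite I" "\<And>i. i \<in> I \<Longrightarrow> f i \<in> Lin V W" "VS W"
  shows "(\<lambda>x. finsum W (\<lambda>i. f i x) I) \<in> Lin V W"
proof -
  interpret W: abelian_monoid W using assms(3) by (rule abelian_monoid_VS)
  interpret WM: module K W by fact
  have cl: "f i x \<in> carrier W" if "i \<in> I" "x \<in> carrier V" for i x
    using Lin_closed[OF assms(2)] that by blast
  show ?thesis
  proof (rule Lin_I)
    fix x y assume "x \<in> carrier V" "y \<in> carrier V"
    then have "finsum W (\<lambda>i. f i (x \<oplus>\<^bsub>V\<^esub> y)) I = finsum W (\<lambda>i. f i x \<oplus>\<^bsub>W\<^esub> f i y) I"
      by (intro finsum_cong_VS[OF assms(3)]) (auto simp: Lin_add[OF assms(2)] assms(3) cl)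
    then show "finsum W (\<lambda>i. f i (x \<oplus>\<^bsub>V\<^esub> y)) I =
      finsum W (\<lambda>i. f i x) I \<oplus>\<^bsub>W\<^esub> finsum W (\<lambda>i. f i y) I"
      using \<open>x \<in> carrier V\<close> \<open>y \<in> carrier V\<close> by (simp add: cl)
  next
    fix c x assume "c \<in> carrier K" "x \<in> carrier V"
    then show "finsum W (\<lambda>i. f i (c \<odot>\<^bsub>V\<^esub> x)) I = c \<odot>\<^bsub>W\<^esub> finsum W (\<lambda>i. f i x) I"
      by (subst WM.finsum_smult_ldistr[OF assms(1)])
        (auto intro!: finsum_cong_VS[OF assms(3)] simp: Lin_smult[OF assms(2)] assms(3) cl)
  qed (use assms(3) cl in auto)
qed

lemma submoduleI':
  assumes "VS V" "N \<subseteq> carrier V" "\<zero>\<^bsub>V\<^esub> \<in> N"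
    and "\<And>x y. x \<in> N \<Longrightarrow> y \<in> N \<Longrightarrow> x \<oplus>\<^bsub>V\<^esub> y \<in> N"
    and "\<And>c x. c \<in> carrier K \<Longrightarrow> x \<in> N \<Longrightarrow> c \<odot>\<^bsub>V\<^esub> x \<in> N"
  shows "submodule N K V"
proof (rule module.submoduleI[OF assms(1)])
  fix x assume "x \<in> N"
  then show "\<ominus>\<^bsub>V\<^esub> x \<in> N" using assms by (subst VS_neg) auto
qed (use assms in auto)

lemma submoduleD:
  assumes "VS V" "submodule N K V"
  shows "N \<subseteq> carrier V" "\<zero>\<^bsub>V\<^esub> \<in> N"
    and "x \<in> N \<Longrightarrow> y \<in> N \<Longrightarrow> x \<oplus>\<^bsub>V\<^esub> y \<in> N"
    and "x \<in> N \<Longrightarrow> y \<in> N \<Longrightarrow> x \<ominus>\<^bsub>V\<^esub> y \<in> N"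
    and "c \<in> carrier K \<Longrightarrow> x \<in> N \<Longrightarrow> c \<odot>\<^bsub>V\<^esub> x \<in> N"
  using module.submoduleE[OF assms] subgroup.one_closed[OF submodule.axioms(1)[OF assms(2)]]
  by (auto simp: a_minus_def)

lemma submodule_finsum:
  assumes "VS V" "submodule N K V" "\<And>i. i \<in> I \<Longrightarrow> g i \<in> N"
  shows "finsum V g I \<in> N"
proof (cases "finite I")
  case True
  interpret V: abelian_monoid V using assms(1) by (rule abelian_monoid_VS)
  from True assms(3) show ?thesis
    by (induction I) (use submoduleD[OF assms(1,2)] in \<open>auto simp: Pi_def subset_eq\<close>)
qed (use submoduleD[OF assms(1,2)] in \<open>simp add: finsum_def finprod_def\<close>)

lemma lin_span_superset: "S \<subseteq> lin_span K V S"
  by (auto simp: lin_span_def)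

lemma lin_span_least: "submodule N K V \<Longrightarrow> S \<subseteq> N \<Longrightarrow> lin_span K V S \<subseteq> N"
  by (auto simp: lin_span_def)

lemma lin_span_submodule:
  assumes "VS V" "S \<subseteq> carrier V"
  shows "submodule (lin_span K V S) K V"
  by (rule submoduleI'[OF assms(1)])
    (use assms module.carrier_is_submodule[OF assms(1)] submoduleD[OF assms(1)]
      in \<open>auto simp: lin_span_def\<close>)

lemma Lin_equalizer_submodule:
  assumes "f \<in> Lin V W" "g \<in> Lin V W" "VS V" "VS W"
  shows "submodule {x \<in> carrier V. f x = g x} K V"
  by (rule submoduleI') (use assms in \<open>auto simp: Lin_zero Lin_add Lin_smult\<close>)

lemma Lin_eq_on_span:
  assumes "f \<in> Lin V W" "g \<in> Lin V W" "VS V" "VS W" "S \<subseteq> carrier V"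
    "\<And>x. x \<in> S \<Longrightarrow> f x = g x" "x \<in> lin_span K V S"
  shows "f x = g x"
  using lin_span_least[OF Lin_equalizer_submodule[OF assms(1-4)], of S] assms(5-7) by auto

lemma Lin_preimage_submodule:
  assumes "f \<in> Lin V W" "VS V" "VS W" "submodule N K W"
  shows "submodule {x \<in> carrier V. f x \<in> N} K V"
  by (rule submoduleI') (use assms submoduleD[OF assms(3,4)] in
      \<open>auto simp: Lin_zero Lin_add Lin_smult\<close>)

lemma Lin_image_submodule:
  assumes "f \<in> Lin V W" "VS V" "VS W"
  shows "submodule (f ` carrier V) K W"
proof (rule submoduleI')
  show "\<zero>\<^bsub>W\<^esub> \<in> f ` carrier V" using Lin_zero[OF assms] assms(2) by (metis VS_closed(1) imageI)
next
  fix x y assume "x \<in> f ` carrier V" "y \<in> f ` carrier V"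
  then show "x \<oplus>\<^bsub>W\<^esub> y \<in> f ` carrier V"
    using assms(2) by (auto simp: Lin_add[OF assms(1), symmetric])
next
  fix c x assume "c \<in> carrier K" "x \<in> f ` carrier V"
  then show "c \<odot>\<^bsub>W\<^esub> x \<in> f ` carrier V"
    using assms(2) by (auto simp: Lin_smult[OF assms(1), symmetric])
qed (use assms Lin_closed in auto)

lemma Lin_image_span:
  assumes "f \<in> Lin V W" "VS V" "VS W" "S \<subseteq> carrier V" "x \<in> lin_span K V S"
    "submodule N K W" "\<And>s. s \<in> S \<Longrightarrow> f s \<in> N"
  shows "f x \<in> N"
  using lin_span_least[OF Lin_preimage_submodule[OF assms(1-3,6)], of S] assms by auto

end

section \<open>Free and presented spaces\<close>

context base_field
begin

lemma finsum_swap: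
  assumes "VS U" "finite I" "finite J" "\<And>i j. i \<in> I \<Longrightarrow> j \<in> J \<Longrightarrow> h i j \<in> carrier U"
  shows "finsum U (\<lambda>i. finsum U (h i) J) I = finsum U (\<lambda>j. finsum U (\<lambda>i. h i j) I) J"
proof -
  interpret U: abelian_monoid U using assms(1) by (rule abelian_monoid_VS)
  from assms(2,4) show ?thesis
  proof (induction I)
    case empty
    then show ?case by simp
  next
    case (insert i I)
    have "finsum U (\<lambda>j. finsum U (\<lambda>i. h i j) (insert i I)) J
      = finsum U (\<lambda>j. h i j \<oplus>\<^bsub>U\<^esub> finsum U (\<lambda>i. h i j) I) J"
      by (rule finsum_cong_VS) (use insert assms(1) in auto)
    then show ?case using insert assms(1) by (simp add: Pi_def)
  qed
qed

lemma free_space_iff: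
  "f \<in> carrier (free_space K X) \<longleftrightarrow> (\<forall>x. f x \<in> carrier K) \<and> finite {x. f x \<noteq> \<zero>\<^bsub>K\<^esub>} \<and>
    (\<forall>x. f x \<noteq> \<zero>\<^bsub>K\<^esub> \<longrightarrow> x \<in> X)"
  by (auto simp: free_space_def)

lemma free_space_ops:
  "\<zero>\<^bsub>free_space K X\<^esub> = (\<lambda>_. \<zero>\<^bsub>K\<^esub>)"
  "f \<oplus>\<^bsub>free_space K X\<^esub> g = (\<lambda>x. f x \<oplus>\<^bsub>K\<^esub> g x)"
  "c \<odot>\<^bsub>free_space K X\<^esub> f = (\<lambda>x. c \<otimes>\<^bsub>K\<^esub> f x)"
  by (auto simp: free_space_def)

lemma VS_free_space [simp]: "VS (free_space K X)"
proof -
  interpret K: cring K by (rule cring_K)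
  have fin: "finite {x. f x \<oplus>\<^bsub>K\<^esub> g x \<noteq> \<zero>\<^bsub>K\<^esub>}"
    if "finite {x. f x \<noteq> \<zero>\<^bsub>K\<^esub>}" "finite {x. g x \<noteq> \<zero>\<^bsub>K\<^esub>}" for f g :: "'a \<Rightarrow> 'k"
    by (rule finite_subset[OF _ finite_UnI[OF that]]) auto
  have fin2: "finite {x. c \<otimes>\<^bsub>K\<^esub> f x \<noteq> \<zero>\<^bsub>K\<^esub>}"
    if "finite {x. f x \<noteq> \<zero>\<^bsub>K\<^esub>}" "c \<in> carrier K" for f :: "'a \<Rightarrow> 'k" and c
    by (rule finite_subset[OF _ that(1)]) (use that(2) in auto)
  show ?thesis
  proof (rule moduleI[OF cring_K])
    show "abelian_group (free_space K X)"
    proof (rule abelian_groupI)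
      fix f assume f: "f \<in> carrier (free_space K X)"
      have "(\<lambda>x. \<ominus>\<^bsub>K\<^esub> f x) \<in> carrier (free_space K X)"
        using f finite_subset[of "{x. \<ominus>\<^bsub>K\<^esub> f x \<noteq> \<zero>\<^bsub>K\<^esub>}" "{x. f x \<noteq> \<zero>\<^bsub>K\<^esub>}"]
        by (fastforce simp: free_space_iff)
      then show "\<exists>g\<in>carrier (free_space K X). g \<oplus>\<^bsub>free_space K X\<^esub> f = \<zero>\<^bsub>free_space K X\<^esub>"
        using f by (intro bexI[of _ "\<lambda>x. \<ominus>\<^bsub>K\<^esub> f x"])
          (auto simp: free_space_ops free_space_iff K.l_neg)
    qed (force simp: free_space_ops free_space_iff K.a_ac intro: fin)+
  qed (force simp: free_space_ops free_space_iff K.l_distr K.r_distr K.m_assoc intro: fin2)+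
qed

lemma free_gen_closed [simp]: "x \<in> X \<Longrightarrow> free_gen K x \<in> carrier (free_space K X)"
  by (auto simp: free_space_iff free_gen_def)

text \<open>Induction on the support: clearing the value at one point y leaves a function with
  smaller support, and what was removed is a multiple of the generator at y.\<close>

lemma free_space_submodule:
  assumes "submodule N K (free_space K X)" "\<And>x. x \<in> X \<Longrightarrow> free_gen K x \<in> N"
    "f \<in> carrier (free_space K X)"
  shows "f \<in> N"
proof -
  interpret K: cring K by (rule cring_K)
  note N = submoduleD[OF VS_free_space assms(1)]
  have "finite {x. f x \<noteq> \<zero>\<^bsub>K\<^esub>}" using assms(3) by (simp add: free_space_iff)
  then show ?thesis using assms(3)
  proof (induction "{x. f x \<noteq> \<zero>\<^bsub>K\<^esub>}" arbitrary: f rule: finite_induct)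
    case empty
    then have "f = \<zero>\<^bsub>free_space K X\<^esub>" by (auto simp: free_space_ops)
    then show ?case using N by simp
  next
    case (insert y S)
    have "S = {x. (f(y := \<zero>\<^bsub>K\<^esub>)) x \<noteq> \<zero>\<^bsub>K\<^esub>}" using insert(2,4) by auto
    moreover from this have "f(y := \<zero>\<^bsub>K\<^esub>) \<in> carrier (free_space K X)"
      using insert.prems insert.hyps by (auto simp: free_space_iff)
    ultimately have "f(y := \<zero>\<^bsub>K\<^esub>) \<in> N" by (rule insert.hyps(3))
    moreover have "f y \<odot>\<^bsub>free_space K X\<^esub> free_gen K y \<in> N"
      using insert.prems insert.hyps assms(2) by (intro N(5)) (auto simp: free_space_iff)
    moreover have "f = f(y := \<zero>\<^bsub>K\<^esub>) \<oplus>\<^bsub>free_space K X\<^esub> (f y \<odot>\<^bsub>free_space K X\<^esub> free_gen K y)"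
      using insert.prems by (auto simp: free_space_ops free_gen_def free_space_iff)
    ultimately show ?case using N(3) by metis
  qed
qed

text \<open>The sum inside \<open>pres_lift\<close> as a function of the representative. It is
  linear for every \<beta> with values in U; relations matter only when passing to cosets.\<close>

definition lin_ext :: "('k, 'u, 'e) module_scheme \<Rightarrow> ('x \<Rightarrow> 'u) \<Rightarrow> ('x \<Rightarrow> 'k) \<Rightarrow> 'u"
  where "lin_ext U \<beta> f = finsum U (\<lambda>x. f x \<odot>\<^bsub>U\<^esub> \<beta> x) {x. f x \<noteq> \<zero>\<^bsub>K\<^esub>}"

lemma lin_ext_superset:
  assumes "VS U" "f \<in> carrier (free_space K X)" "\<And>x. x \<in> X \<Longrightarrow> \<beta> x \<in> carrier U"
    "finite B" "{x. f x \<noteq> \<zero>\<^bsub>K\<^esub>} \<subseteq> B" "B \<subseteq> X"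
  shows "lin_ext U \<beta> f = finsum U (\<lambda>x. f x \<odot>\<^bsub>U\<^esub> \<beta> x) B"
  unfolding lin_ext_def
  by (rule finsum_superset) (use assms in \<open>auto simp: free_space_iff subset_eq\<close>)

lemma lin_ext_Lin:
  assumes "VS U" "\<And>x. x \<in> X \<Longrightarrow> \<beta> x \<in> carrier U"
  shows "lin_ext U \<beta> \<in> Lin (free_space K X) U"
proof (rule Lin_I)
  interpret U: abelian_monoid U using assms(1) by (rule abelian_monoid_VS)
  interpret UM: module K U by (rule assms(1))
  fix f assume f: "f \<in> carrier (free_space K X)"
  then show "lin_ext U \<beta> f \<in> carrier U"
    unfolding lin_ext_def by (intro finsum_closed_VS) (auto simp: free_space_iff assms)
  {
    fix g assume g: "g \<in> carrier (free_space K X)"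
    let ?B = "{x. f x \<noteq> \<zero>\<^bsub>K\<^esub>} \<union> {x. g x \<noteq> \<zero>\<^bsub>K\<^esub>}"
    have B: "finite ?B" "?B \<subseteq> X" using f g by (auto simp: free_space_iff)
    have fg: "f \<oplus>\<^bsub>free_space K X\<^esub> g \<in> carrier (free_space K X)" using f g by simp
    have "lin_ext U \<beta> (f \<oplus>\<^bsub>free_space K X\<^esub> g) =
      finsum U (\<lambda>x. (f \<oplus>\<^bsub>free_space K X\<^esub> g) x \<odot>\<^bsub>U\<^esub> \<beta> x) ?B"
      by (rule lin_ext_superset[OF assms(1) fg assms(2)]) (use B in \<open>auto simp: free_space_ops\<close>)
    also have "\<dots> = finsum U (\<lambda>x. (f x \<odot>\<^bsub>U\<^esub> \<beta> x) \<oplus>\<^bsub>U\<^esub> (g x \<odot>\<^bsub>U\<^esub> \<beta> x)) ?B"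
      by (rule finsum_cong_VS) (use f g B assms in
          \<open>auto simp: free_space_ops free_space_iff UM.smult_l_distr\<close>)
    also have "\<dots> = finsum U (\<lambda>x. f x \<odot>\<^bsub>U\<^esub> \<beta> x) ?B \<oplus>\<^bsub>U\<^esub> finsum U (\<lambda>x. g x \<odot>\<^bsub>U\<^esub> \<beta> x) ?B"
      by (rule U.finsum_addf) (use f g B assms in \<open>auto simp: free_space_iff\<close>)
    also have "\<dots> = lin_ext U \<beta> f \<oplus>\<^bsub>U\<^esub> lin_ext U \<beta> g"
      by (subst (1 2) lin_ext_superset[OF assms(1) _ assms(2)]) (use f g B in auto)
    finally show "lin_ext U \<beta> (f \<oplus>\<^bsub>free_space K X\<^esub> g) = lin_ext U \<beta> f \<oplus>\<^bsub>U\<^esub> lin_ext U \<beta> g" .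
  }
  {
    fix c assume c: "c \<in> carrier K"
    let ?B = "{x. f x \<noteq> \<zero>\<^bsub>K\<^esub>}"
    interpret K: cring K by (rule cring_K)
    have B: "finite ?B" "?B \<subseteq> X" using f by (auto simp: free_space_iff)
    have cf: "c \<odot>\<^bsub>free_space K X\<^esub> f \<in> carrier (free_space K X)" using c f by simp
    have "lin_ext U \<beta> (c \<odot>\<^bsub>free_space K X\<^esub> f) =
      finsum U (\<lambda>x. (c \<odot>\<^bsub>free_space K X\<^esub> f) x \<odot>\<^bsub>U\<^esub> \<beta> x) ?B"
      by (rule lin_ext_superset[OF assms(1) cf assms(2)]) (use B c in \<open>auto simp: free_space_ops\<close>)
    also have "\<dots> = finsum U (\<lambda>x. c \<odot>\<^bsub>U\<^esub> (f x \<odot>\<^bsub>U\<^esub> \<beta> x)) ?B"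
      by (rule finsum_cong_VS) (use f c B assms in
          \<open>auto simp: free_space_ops free_space_iff UM.smult_assoc1\<close>)
    also have "\<dots> = c \<odot>\<^bsub>U\<^esub> lin_ext U \<beta> f"
      unfolding lin_ext_def by (rule UM.finsum_smult_ldistr[symmetric])
        (use f c B assms in \<open>auto simp: free_space_iff\<close>)
    finally show "lin_ext U \<beta> (c \<odot>\<^bsub>free_space K X\<^esub> f) = c \<odot>\<^bsub>U\<^esub> lin_ext U \<beta> f" .
  }
qed

lemma lin_ext_gen:
  assumes "VS U" "\<beta> x \<in> carrier U"
  shows "lin_ext U \<beta> (free_gen K x) = \<beta> x"
proof -
  interpret U: abelian_monoid U using assms(1) by (rule abelian_monoid_VS)
  have "{y. free_gen K x y \<noteq> \<zero>\<^bsub>K\<^esub>} = {x}" by (auto simp: free_gen_def)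
  then show ?thesis using assms by (simp add: lin_ext_def) (simp add: free_gen_def)
qed

lemma lin_ext_cong:
  assumes "VS U" "f \<in> carrier (free_space K X)" "\<And>x. x \<in> X \<Longrightarrow> \<beta> x = \<gamma> x"
    "\<And>x. x \<in> X \<Longrightarrow> \<gamma> x \<in> carrier U"
  shows "lin_ext U \<beta> f = lin_ext U \<gamma> f"
  unfolding lin_ext_def
  by (rule finsum_cong_VS) (use assms in \<open>auto simp: free_space_iff\<close>)

lemma Lin_lin_ext:
  assumes "VS U" "VS W" "f \<in> carrier (free_space K X)" "\<And>x. x \<in> X \<Longrightarrow> \<beta> x \<in> carrier U"
    "h \<in> Lin U W"
  shows "h (lin_ext U \<beta> f) = lin_ext W (\<lambda>x. h (\<beta> x)) f"
  unfolding lin_ext_def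
proof (subst Lin_finsum[OF assms(5,1,2)])
  show "finsum W (\<lambda>x. h (f x \<odot>\<^bsub>U\<^esub> \<beta> x)) {x. f x \<noteq> \<zero>\<^bsub>K\<^esub>} =
    finsum W (\<lambda>x. f x \<odot>\<^bsub>W\<^esub> h (\<beta> x)) {x. f x \<noteq> \<zero>\<^bsub>K\<^esub>}"
    by (rule finsum_cong_VS)
      (use assms in \<open>auto simp: free_space_iff Lin_smult Lin_closed[OF assms(5)]\<close>)
qed (use assms in \<open>auto simp: free_space_iff\<close>)

lemma lin_ext_Lin_param:
  assumes "VS U" "f \<in> carrier (free_space K X)" "\<And>x. x \<in> X \<Longrightarrow> (\<lambda>v. \<beta> v x) \<in> Lin V U"
  shows "(\<lambda>v. lin_ext U (\<beta> v) f) \<in> Lin V U"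
  unfolding lin_ext_def
  by (rule Lin_finsum_map) (use assms in \<open>auto simp: free_space_iff intro!: Lin_smult_map\<close>)

lemma lin_ext_swap:
  assumes "VS U" "f \<in> carrier (free_space K X)" "g \<in> carrier (free_space K Y)"
    "\<And>x y. x \<in> X \<Longrightarrow> y \<in> Y \<Longrightarrow> \<beta> x y \<in> carrier U"
  shows "lin_ext U (\<lambda>x. lin_ext U (\<beta> x) g) f = lin_ext U (\<lambda>y. lin_ext U (\<lambda>x. \<beta> x y) f) g"
proof -
  interpret K: cring K by (rule cring_K)
  interpret UM: module K U by (rule assms(1))
  let ?S = "{x. f x \<noteq> \<zero>\<^bsub>K\<^esub>}" and ?T = "{y. g y \<noteq> \<zero>\<^bsub>K\<^esub>}"
  note fg = assms(2,3)[unfolded free_space_iff]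
  have "lin_ext U (\<lambda>x. lin_ext U (\<beta> x) g) f =
    finsum U (\<lambda>x. finsum U (\<lambda>y. f x \<odot>\<^bsub>U\<^esub> (g y \<odot>\<^bsub>U\<^esub> \<beta> x y)) ?T) ?S"
    unfolding lin_ext_def by (rule finsum_cong_VS)
      (use fg assms in \<open>auto intro!: UM.finsum_smult_ldistr\<close>)
  also have "\<dots> = finsum U (\<lambda>y. finsum U (\<lambda>x. f x \<odot>\<^bsub>U\<^esub> (g y \<odot>\<^bsub>U\<^esub> \<beta> x y)) ?S) ?T"
    by (rule finsum_swap) (use fg assms in auto)
  also have "\<dots> = finsum U (\<lambda>y. finsum U (\<lambda>x. g y \<odot>\<^bsub>U\<^esub> (f x \<odot>\<^bsub>U\<^esub> \<beta> x y)) ?S) ?T"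
    using fg assms by (intro finsum_cong_VS)
      (auto simp: K.m_comm simp flip: UM.smult_assoc1)
  also have "\<dots> = lin_ext U (\<lambda>y. lin_ext U (\<lambda>x. \<beta> x y) f) g"
    unfolding lin_ext_def by (rule finsum_cong_VS)
      (use fg assms in \<open>auto intro!: UM.finsum_smult_ldistr[symmetric]\<close>)
  finally show ?thesis .
qed

end

section \<open>Cosets modulo relations and the linear maps they carry\<close>

locale presentation = base_field K for K :: "'k ring" +
  fixes X :: "'x set" and R :: "('x \<Rightarrow> 'k) set"
  assumes R_sub: "R \<subseteq> carrier (free_space K X)"
begin

definition rel :: "('x \<Rightarrow> 'k) set"
  where "rel = lin_span K (free_space K X) R"

definition cls :: "('x \<Rightarrow> 'k) \<Rightarrow> ('x \<Rightarrow> 'k) set"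
  where "cls f = rel +>\<^bsub>free_space K X\<^esub> f"

lemma rel_submodule: "submodule rel K (free_space K X)"
  unfolding rel_def by (rule lin_span_submodule[OF VS_free_space R_sub])

lemma rel_subgroup: "abelian_subgroup rel (free_space K X)"
  using submodule.axioms(1)[OF rel_submodule]
  by (intro abelian_subgroupI3 additive_subgroup.intro abelian_group_VS[OF VS_free_space])

lemma cls_eq_iff:
  assumes "f \<in> carrier (free_space K X)" "g \<in> carrier (free_space K X)"
  shows "cls f = cls g \<longleftrightarrow> f \<ominus>\<^bsub>free_space K X\<^esub> g \<in> rel"
proof -
  interpret S: abelian_subgroup rel "free_space K X" by (rule rel_subgroup)
  have "f \<ominus>\<^bsub>free_space K X\<^esub> g \<in> rel \<longleftrightarrow> f \<in> cls g"
    unfolding cls_def using S.a_rcos_module[OF assms(2,1)] by (simp add: a_minus_def)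
  also have "\<dots> \<longleftrightarrow> cls f = cls g"
    unfolding cls_def
    using S.a_repr_independence'[OF _ assms(2), of f] S.a_rcos_self[OF assms(1)] by auto
  finally show ?thesis by simp
qed

abbreviation Q :: "('k, ('x \<Rightarrow> 'k) set) module"
  where "Q \<equiv> presented K X R"

lemma carrier_Q: "carrier Q = cls ` carrier (free_space K X)"
  by (auto simp: presented_def Let_def A_RCOSETS_def' cls_def rel_def)

lemma cls_closed [simp]: "f \<in> carrier (free_space K X) \<Longrightarrow> cls f \<in> carrier Q"
  by (simp add: carrier_Q)

lemma cls_zero: "cls \<zero>\<^bsub>free_space K X\<^esub> = \<zero>\<^bsub>Q\<^esub>"
proof -
  interpret S: abelian_subgroup rel "free_space K X" by (rule rel_subgroup)
  show ?thesis
    using S.a_rcos_const[OF submoduleD(2)[OF VS_free_space rel_submodule]] by (simp add: cls_def presented_def Let_def flip: rel_def)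
qed

lemma cls_add:
  assumes "f \<in> carrier (free_space K X)" "g \<in> carrier (free_space K X)"
  shows "cls f \<oplus>\<^bsub>Q\<^esub> cls g = cls (f \<oplus>\<^bsub>free_space K X\<^esub> g)"
  using abelian_subgroup.a_rcos_sum[OF rel_subgroup assms]
  by (simp add: cls_def presented_def Let_def rel_def)

lemma cls_rep:
  assumes "P \<in> carrier Q" "f \<in> P"
  shows "f \<in> carrier (free_space K X)" "cls f = P"
proof -
  interpret S: abelian_subgroup rel "free_space K X" by (rule rel_subgroup)
  obtain g where g: "g \<in> carrier (free_space K X)" "P = cls g" using assms(1) by (auto simp: carrier_Q)
  show f: "f \<in> carrier (free_space K X)"
    using S.a_r_coset_subset_G[OF S.a_subset g(1)] assms(2) g(2) by (auto simp: cls_def)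
  show "cls f = P"
    using S.a_repr_independence'[of f g] g assms(2) by (simp add: cls_def)
qed

lemma cls_mem: "f \<in> carrier (free_space K X) \<Longrightarrow> f \<in> cls f"
  unfolding cls_def by (rule abelian_subgroup.a_rcos_self[OF rel_subgroup])

text \<open>Scalar multiplication in \<open>presented\<close> is a union over all representatives of
  a coset. The union is a single coset because two representatives differ by an element of the
  subspace of relations, which is stable under scalars.\<close>

lemma cls_smult:
  assumes c: "c \<in> carrier K" and f: "f \<in> carrier (free_space K X)"
  shows "c \<odot>\<^bsub>Q\<^esub> cls f = cls (c \<odot>\<^bsub>free_space K X\<^esub> f)"
proof -
  let ?F = "free_space K X"
  interpret F: module K ?F by (rule VS_free_space)
  have eq: "cls (c \<odot>\<^bsub>?F\<^esub> g) = cls (c \<odot>\<^bsub>?F\<^esub> f)" if "g \<in> cls f" for g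
  proof -
    have g: "g \<in> carrier ?F" "cls g = cls f" by (rule cls_rep[OF cls_closed[OF f] that])+
    have "c \<odot>\<^bsub>?F\<^esub> (g \<ominus>\<^bsub>?F\<^esub> f) \<in> rel"
      using submoduleD(5)[OF VS_free_space rel_submodule c] cls_eq_iff[OF g(1) f] g(2) by blast
    moreover have "c \<odot>\<^bsub>?F\<^esub> (g \<ominus>\<^bsub>?F\<^esub> f) = c \<odot>\<^bsub>?F\<^esub> g \<ominus>\<^bsub>?F\<^esub> c \<odot>\<^bsub>?F\<^esub> f"
      using g(1) f c by (simp add: a_minus_def F.smult_r_distr F.smult_r_minus)
    ultimately show ?thesis
      using cls_eq_iff[of "c \<odot>\<^bsub>?F\<^esub> g" "c \<odot>\<^bsub>?F\<^esub> f"] g(1) f c by simp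
  qed
  have "c \<odot>\<^bsub>Q\<^esub> cls f = (\<Union>g \<in> cls f. cls (c \<odot>\<^bsub>?F\<^esub> g))"
    by (simp add: presented_def Let_def cls_def rel_def)
  also have "\<dots> = (\<Union>g \<in> cls f. cls (c \<odot>\<^bsub>?F\<^esub> f))"
    by (intro SUP_cong refl eq)
  also have "\<dots> = cls (c \<odot>\<^bsub>?F\<^esub> f)" using cls_mem[OF f] by auto
  finally show ?thesis .
qed

lemma VS_presented: "VS Q"
proof -
  interpret K: cring K by (rule cring_K)
  interpret F: module K "free_space K X" by (rule VS_free_space)
  show ?thesis
  proof (rule moduleI[OF cring_K])
    show "abelian_group Q"
    proof (rule abelian_groupI)
      show "\<zero>\<^bsub>Q\<^esub> \<in> carrier Q" by (simp flip: cls_zero)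
      show "\<zero>\<^bsub>Q\<^esub> \<oplus>\<^bsub>Q\<^esub> P = P" if "P \<in> carrier Q" for P
        using that by (auto simp: carrier_Q cls_add simp flip: cls_zero)
      fix P assume "P \<in> carrier Q"
      then obtain f where "f \<in> carrier (free_space K X)" "P = cls f" by (auto simp: carrier_Q)
      then show "\<exists>P' \<in> carrier Q. P' \<oplus>\<^bsub>Q\<^esub> P = \<zero>\<^bsub>Q\<^esub>"
        by (intro bexI[of _ "cls (\<ominus>\<^bsub>free_space K X\<^esub> f)"]) (auto simp: cls_add F.l_neg cls_zero)
      show "P \<oplus>\<^bsub>Q\<^esub> P' = P' \<oplus>\<^bsub>Q\<^esub> P" if PP: "P \<in> carrier Q" "P' \<in> carrier Q" for P P'
      proof -
        obtain f g where "f \<in> carrier (free_space K X)" "P = cls f"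
          "g \<in> carrier (free_space K X)" "P' = cls g" using PP by (auto simp: carrier_Q)
        then show ?thesis by (simp add: cls_add F.a_comm[of f g])
      qed
    qed (auto simp: carrier_Q cls_add F.a_assoc)
  qed (auto simp: carrier_Q cls_add cls_smult F.smult_l_distr F.smult_r_distr F.smult_assoc1)
qed

lemma cls_Lin: "cls \<in> Lin (free_space K X) Q"
  by (rule Lin_I) (simp_all add: cls_add cls_smult)

lemma pres_gen_cls: "pres_gen K X R x = cls (free_gen K x)"
  by (simp add: pres_gen_def Let_def cls_def rel_def)

lemma pres_gen_closed: "x \<in> X \<Longrightarrow> pres_gen K X R x \<in> carrier Q"
  by (simp add: pres_gen_cls)

lemma pres_eqI:
  assumes "f \<in> Lin Q U" "g \<in> Lin Q U" "VS U" "P \<in> carrier Q"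
    "\<And>x. x \<in> X \<Longrightarrow> f (pres_gen K X R x) = g (pres_gen K X R x)"
  shows "f P = g P"
proof -
  obtain p where p: "p \<in> carrier (free_space K X)" "P = cls p" using assms(4) by (auto simp: carrier_Q)
  have "p \<in> {p \<in> carrier (free_space K X). f (cls p) = g (cls p)}"
    by (rule free_space_submodule[OF Lin_equalizer_submodule[OF Lin_comp[OF assms(1) cls_Lin]
      Lin_comp[OF assms(2) cls_Lin] VS_free_space assms(3)] _ p(1)])
      (use assms(5) in \<open>simp add: pres_gen_cls\<close>)
  then show ?thesis using p by simp
qed

definition rep :: "('x \<Rightarrow> 'k) set \<Rightarrow> ('x \<Rightarrow> 'k)"
  where "rep P = (SOME f. f \<in> P)"

lemma rep:
  assumes "P \<in> carrier Q"
  shows "rep P \<in> P" "rep P \<in> carrier (free_space K X)" "cls (rep P) = P"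
proof -
  obtain f where "f \<in> carrier (free_space K X)" "P = cls f" using assms by (auto simp: carrier_Q)
  then have "f \<in> P" by (simp add: cls_mem)
  then show *: "rep P \<in> P" unfolding rep_def by (rule someI[of "\<lambda>f. f \<in> P"])
  show "rep P \<in> carrier (free_space K X)" "cls (rep P) = P" using cls_rep[OF assms *] by auto
qed

lemma pres_lift_rep: "pres_lift K U \<beta> P = lin_ext U \<beta> (rep P)"
  by (simp add: pres_lift_def lin_ext_def rep_def Let_def)

lemma pres_lift_closed:
  assumes "VS U" "P \<in> carrier Q" "\<And>x. x \<in> X \<Longrightarrow> \<beta> x \<in> carrier U"
  shows "pres_lift K U \<beta> P \<in> carrier U"
  unfolding pres_lift_rep by (rule Lin_closed[OF lin_ext_Lin[OF assms(1,3)] rep(2)[OF assms(2)]])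

lemma lin_ext_rel:
  assumes "VS U" "\<And>x. x \<in> X \<Longrightarrow> \<beta> x \<in> carrier U" "\<And>r. r \<in> R \<Longrightarrow> lin_ext U \<beta> r = \<zero>\<^bsub>U\<^esub>" "f \<in> rel"
  shows "lin_ext U \<beta> f = \<zero>\<^bsub>U\<^esub>"
  by (rule Lin_eq_on_span[OF lin_ext_Lin[OF assms(1,2)] Lin_zero_map[OF assms(1)]
      VS_free_space assms(1) R_sub assms(3) assms(4)[unfolded rel_def]])

lemma pres_lift_cls:
  assumes "VS U" "\<And>x. x \<in> X \<Longrightarrow> \<beta> x \<in> carrier U" "\<And>r. r \<in> R \<Longrightarrow> lin_ext U \<beta> r = \<zero>\<^bsub>U\<^esub>"
    "f \<in> carrier (free_space K X)"
  shows "pres_lift K U \<beta> (cls f) = lin_ext U \<beta> f"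
proof -
  note L = lin_ext_Lin[OF assms(1,2)]
  have r: "rep (cls f) \<in> carrier (free_space K X)" "cls (rep (cls f)) = cls f"
    using rep[OF cls_closed[OF assms(4)]] by auto
  then have "lin_ext U \<beta> (rep (cls f) \<ominus>\<^bsub>free_space K X\<^esub> f) = \<zero>\<^bsub>U\<^esub>"
    using assms(4) by (intro lin_ext_rel[OF assms(1-3)]) (auto simp: cls_eq_iff)
  then show ?thesis
    using r assms(1,4) Lin_closed[OF L r(1)] Lin_closed[OF L assms(4)]
    by (simp add: pres_lift_rep Lin_minus[OF L] VS_minus_eq_zero)
qed

lemma pres_lift_Lin:
  assumes "VS U" "\<And>x. x \<in> X \<Longrightarrow> \<beta> x \<in> carrier U" "\<And>r. r \<in> R \<Longrightarrow> lin_ext U \<beta> r = \<zero>\<^bsub>U\<^esub>"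
  shows "pres_lift K U \<beta> \<in> Lin Q U"
proof (rule Lin_I)
  note L = lin_ext_Lin[OF assms(1,2)] and C = pres_lift_cls[OF assms]
  show "pres_lift K U \<beta> P \<in> carrier U" if "P \<in> carrier Q" for P
    by (rule pres_lift_closed[OF assms(1) that assms(2)])
  show "pres_lift K U \<beta> (P \<oplus>\<^bsub>Q\<^esub> P') = pres_lift K U \<beta> P \<oplus>\<^bsub>U\<^esub> pres_lift K U \<beta> P'"
    if "P \<in> carrier Q" "P' \<in> carrier Q" for P P'
    using that by (auto simp: carrier_Q cls_add C Lin_add[OF L])
  show "pres_lift K U \<beta> (c \<odot>\<^bsub>Q\<^esub> P) = c \<odot>\<^bsub>U\<^esub> pres_lift K U \<beta> P"
    if "c \<in> carrier K" "P \<in> carrier Q" for c P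
    using that by (auto simp: carrier_Q cls_smult C Lin_smult[OF L])
qed

lemma pres_lift_gen:
  assumes "VS U" "\<And>x. x \<in> X \<Longrightarrow> \<beta> x \<in> carrier U" "\<And>r. r \<in> R \<Longrightarrow> lin_ext U \<beta> r = \<zero>\<^bsub>U\<^esub>" "x \<in> X"
  shows "pres_lift K U \<beta> (pres_gen K X R x) = \<beta> x"
  using assms by (simp add: pres_gen_cls pres_lift_cls[OF assms(1-3)] lin_ext_gen)

lemma pres_lift_cong:
  assumes "VS U" "P \<in> carrier Q" "\<And>x. x \<in> X \<Longrightarrow> \<beta> x = \<gamma> x" "\<And>x. x \<in> X \<Longrightarrow> \<gamma> x \<in> carrier U"
  shows "pres_lift K U \<beta> P = pres_lift K U \<gamma> P"
  unfolding pres_lift_rep by (rule lin_ext_cong[OF assms(1) rep(2)[OF assms(2)] assms(3,4)])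

end

section \<open>Tensor products\<close>

context base_field
begin

abbreviation tensor_VS ::
  "('k, 'v, 'e) module_scheme \<Rightarrow> ('k, 'w, 'f) module_scheme \<Rightarrow> ('k, ('v \<times> 'w \<Rightarrow> 'k) set) module"
  (infixr \<open>\<boxtimes>\<close> 72)
  where "V \<boxtimes> W \<equiv> tensor_space K V W"

definition bilin :: "('k, 'v, 'e) module_scheme \<Rightarrow> ('k, 'w, 'f) module_scheme \<Rightarrow>
    ('k, 'u, 'g) module_scheme \<Rightarrow> ('v \<Rightarrow> 'w \<Rightarrow> 'u) \<Rightarrow> bool"
  where "bilin V W U \<beta> \<longleftrightarrow> (\<forall>v \<in> carrier V. \<beta> v \<in> Lin W U) \<and> (\<forall>w \<in> carrier W. (\<lambda>v. \<beta> v w) \<in> Lin V U)"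

text \<open>The body is set to zero outside the carriers. Bodies that agree on the carriers then
  give literally the same value, so \<open>lift_cong\<close> holds for every P and lets the
  simplifier assume membership in the carriers inside a body. With P in front of the body, nested
  lifts read like Sweedler notation.\<close>

definition lift :: "('k, 'v, 'e) module_scheme \<Rightarrow> ('k, 'w, 'f) module_scheme \<Rightarrow>
    ('k, 'u, 'g) module_scheme \<Rightarrow> ('v \<times> 'w \<Rightarrow> 'k) set \<Rightarrow> ('v \<Rightarrow> 'w \<Rightarrow> 'u) \<Rightarrow> 'u"
  where "lift V W U P \<beta> =
    pres_lift K U (\<lambda>(v, w). if v \<in> carrier V \<and> w \<in> carrier W then \<beta> v w else \<zero>\<^bsub>U\<^esub>) P"

lemma bilinI:
  assumes "\<And>v. v \<in> carrier V \<Longrightarrow> (\<lambda>w. \<beta> v w) \<in> Lin W U"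
    and "\<And>w. w \<in> carrier W \<Longrightarrow> (\<lambda>v. \<beta> v w) \<in> Lin V U"
  shows "bilin V W U (\<lambda>v w. \<beta> v w)"
  using assms by (simp add: bilin_def)

lemma bilinD:
  assumes "bilin V W U \<beta>"
  shows "v \<in> carrier V \<Longrightarrow> \<beta> v \<in> Lin W U" "w \<in> carrier W \<Longrightarrow> (\<lambda>v. \<beta> v w) \<in> Lin V U"
    "v \<in> carrier V \<Longrightarrow> w \<in> carrier W \<Longrightarrow> \<beta> v w \<in> carrier U"
proof -
  show 1: "v \<in> carrier V \<Longrightarrow> \<beta> v \<in> Lin W U" and "w \<in> carrier W \<Longrightarrow> (\<lambda>v. \<beta> v w) \<in> Lin V U"
    using assms by (auto simp: bilin_def)
  show "v \<in> carrier V \<Longrightarrow> w \<in> carrier W \<Longrightarrow> \<beta> v w \<in> carrier U"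
    using Lin_closed[OF 1] by blast
qed

lemma lift_cong [cong]:
  assumes "P = Q" "\<And>v w. v \<in> carrier V \<Longrightarrow> w \<in> carrier W \<Longrightarrow> \<beta> v w = \<gamma> v w"
  shows "lift V W U P \<beta> = lift V W U Q \<gamma>"
  unfolding lift_def assms(1) by (rule arg_cong2[where f = "pres_lift K U"]) (use assms(2) in auto)

lemma lin_ext_bilin_rels:
  assumes "bilin V W U \<beta>" "VS V" "VS W" "VS U" "r \<in> bilin_rels K V W"
  shows "lin_ext U (\<lambda>(v, w). if v \<in> carrier V \<and> w \<in> carrier W then \<beta> v w else \<zero>\<^bsub>U\<^esub>) r = \<zero>\<^bsub>U\<^esub>"
proof -
  let ?F = "free_space K (carrier V \<times> carrier W)"
  let ?\<beta> = "\<lambda>(v, w). if v \<in> carrier V \<and> w \<in> carrier W then \<beta> v w else \<zero>\<^bsub>U\<^esub>"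
  note b = bilinD[OF assms(1)]
  have L: "lin_ext U ?\<beta> \<in> Lin ?F U" using b(3) assms(4) by (intro lin_ext_Lin) auto
  have g: "lin_ext U ?\<beta> (free_gen K (v, w)) = \<beta> v w" if "v \<in> carrier V" "w \<in> carrier W" for v w
    using that assms(4) b(3) by (subst lin_ext_gen) auto
  have l: "\<beta> (v \<oplus>\<^bsub>V\<^esub> v') w = \<beta> v w \<oplus>\<^bsub>U\<^esub> \<beta> v' w" "\<beta> v (w \<oplus>\<^bsub>W\<^esub> w') = \<beta> v w \<oplus>\<^bsub>U\<^esub> \<beta> v w'"
    if "v \<in> carrier V" "w \<in> carrier W" "v' \<in> carrier V" "w' \<in> carrier W" for v w v' w'
    using that Lin_add[OF b(1)] Lin_add[OF b(2)] by auto
  have s: "\<beta> (c \<odot>\<^bsub>V\<^esub> v) w = c \<odot>\<^bsub>U\<^esub> \<beta> v w" "\<beta> v (c \<odot>\<^bsub>W\<^esub> w) = c \<odot>\<^bsub>U\<^esub> \<beta> v w"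
    if "v \<in> carrier V" "w \<in> carrier W" "c \<in> carrier K" for v w c
    using that Lin_smult[OF b(1)] Lin_smult[OF b(2)] by auto
  note eqs = Lin_minus[OF L VS_free_space assms(4)] Lin_add[OF L] Lin_smult[OF L] g l s VS_minus_eq_zero
  from assms(5) show ?thesis
    unfolding bilin_rels_def Let_def
    by (elim UnE; clarsimp simp: eqs assms(2-4) b(3))
qed

lemma bilin_rels_closed:
  assumes "VS V" "VS W"
  shows "bilin_rels K V W \<subseteq> carrier (free_space K (carrier V \<times> carrier W))"
  unfolding bilin_rels_def Let_def by (intro Un_least subsetI; clarsimp simp: assms)

lemma presentation_tensor:
  "VS V \<Longrightarrow> VS W \<Longrightarrow> presentation K (carrier V \<times> carrier W) (bilin_rels K V W)"
  by (intro presentation.intro presentation_axioms.intro base_field_axioms bilin_rels_closed)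

lemma VS_tensor [simp]: "VS V \<Longrightarrow> VS W \<Longrightarrow> VS (V \<boxtimes> W)"
  unfolding tensor_space_def by (rule presentation.VS_presented[OF presentation_tensor])

lemma tens_closed [simp]:
  "VS V \<Longrightarrow> VS W \<Longrightarrow> v \<in> carrier V \<Longrightarrow> w \<in> carrier W \<Longrightarrow> tens K V W v w \<in> carrier (V \<boxtimes> W)"
  unfolding tensor_space_def tens_def by (rule presentation.pres_gen_closed[OF presentation_tensor]) auto

lemma tens_bilin:
  assumes "VS V" "VS W"
  shows "bilin V W (V \<boxtimes> W) (tens K V W)"
proof -
  interpret T: presentation K "carrier V \<times> carrier W" "bilin_rels K V W"
    by (rule presentation_tensor[OF assms])
  let ?F = "free_space K (carrier V \<times> carrier W)"
  note C = T.cls_Lin[folded tensor_space_def]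
  have VQ: "VS (V \<boxtimes> W)" using assms by simp
  have eq: "T.cls f = T.cls g" if "f \<ominus>\<^bsub>?F\<^esub> g \<in> bilin_rels K V W" "f \<in> carrier ?F" "g \<in> carrier ?F" for f g
    using T.cls_eq_iff[OF that(2,3)] subsetD[OF lin_span_superset that(1)] by (simp add: T.rel_def)
  have t: "tens K V W v w = T.cls (free_gen K (v, w))" for v w
    by (simp add: tens_def T.pres_gen_cls)
  show ?thesis
  proof (intro bilin_def[THEN iffD2] conjI ballI Lin_I)
    fix v w w' assume v: "v \<in> carrier V" and w: "w \<in> carrier W" "w' \<in> carrier W"
    show "tens K V W v (w \<oplus>\<^bsub>W\<^esub> w') = tens K V W v w \<oplus>\<^bsub>V \<boxtimes> W\<^esub> tens K V W v w'"
      unfolding t using v w assms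
      by (subst Lin_add[OF C, symmetric], simp, simp, intro eq)
        (unfold bilin_rels_def Let_def, blast, simp_all)
  next
    fix v w c assume v: "v \<in> carrier V" and w: "w \<in> carrier W" "c \<in> carrier K"
    show "tens K V W v (c \<odot>\<^bsub>W\<^esub> w) = c \<odot>\<^bsub>V \<boxtimes> W\<^esub> tens K V W v w"
      unfolding t using v w assms
      by (subst Lin_smult[OF C, symmetric], simp, simp, intro eq)
        (unfold bilin_rels_def Let_def, blast, simp_all)
  next
    fix v v' w assume v: "v \<in> carrier V" "v' \<in> carrier V" and w: "w \<in> carrier W"
    show "tens K V W (v \<oplus>\<^bsub>V\<^esub> v') w = tens K V W v w \<oplus>\<^bsub>V \<boxtimes> W\<^esub> tens K V W v' w"
      unfolding t using v w assms
      by (subst Lin_add[OF C, symmetric], simp, simp, intro eq)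
        (unfold bilin_rels_def Let_def, blast, simp_all)
  next
    fix v w c assume v: "v \<in> carrier V" and w: "w \<in> carrier W" "c \<in> carrier K"
    show "tens K V W (c \<odot>\<^bsub>V\<^esub> v) w = c \<odot>\<^bsub>V \<boxtimes> W\<^esub> tens K V W v w"
      unfolding t using v w assms
      by (subst Lin_smult[OF C, symmetric], simp, simp, intro eq)
        (unfold bilin_rels_def Let_def, blast, simp_all)
  qed (use assms in auto)
qed

text \<open>The bridge from the formulas of the definitions to \<open>lift\<close>. Both sides are
  evaluated at the same representative of P, so it is enough that the bodies agree on pairs from the
  carriers.\<close>

lemma pres_lift_eq_lift:
  assumes "VS V" "VS W" "VS U" "P \<in> carrier (V \<boxtimes> W)"
    "\<And>v w. v \<in> carrier V \<Longrightarrow> w \<in> carrier W \<Longrightarrow> \<beta> v w \<in> carrier U"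
  shows "pres_lift K U (\<lambda>(v, w). \<beta> v w) P = lift V W U P \<beta>"
  unfolding lift_def using assms(4,5) unfolding tensor_space_def
  by (intro presentation.pres_lift_cong[OF presentation_tensor[OF assms(1,2)] assms(3)]) auto

lemma lift_closed:
  assumes "VS V" "VS W" "VS U" "P \<in> carrier (V \<boxtimes> W)"
    "\<And>v w. v \<in> carrier V \<Longrightarrow> w \<in> carrier W \<Longrightarrow> \<beta> v w \<in> carrier U"
  shows "lift V W U P \<beta> \<in> carrier U"
  unfolding lift_def using assms(3-5) unfolding tensor_space_def
  by (intro presentation.pres_lift_closed[OF presentation_tensor[OF assms(1,2)] assms(3)]) auto

lemma lift_Lin:
  assumes "VS V" "VS W" "VS U" "bilin V W U \<beta>"
  shows "(\<lambda>P. lift V W U P \<beta>) \<in> Lin (V \<boxtimes> W) U"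
  unfolding lift_def tensor_space_def
  by (rule presentation.pres_lift_Lin[OF presentation_tensor[OF assms(1,2)] assms(3)])
    (use bilinD(3)[OF assms(4)] assms(3) lin_ext_bilin_rels[OF assms(4,1-3)] in auto)

lemma lift_tens:
  assumes "VS V" "VS W" "VS U" "bilin V W U \<beta>" "v \<in> carrier V" "w \<in> carrier W"
  shows "lift V W U (tens K V W v w) \<beta> = \<beta> v w"
  unfolding lift_def tens_def
  by (subst presentation.pres_lift_gen[OF presentation_tensor[OF assms(1,2)] assms(3)])
    (use bilinD(3)[OF assms(4)] assms lin_ext_bilin_rels[OF assms(4,1-3)] in auto)

lemma tensor_eqI:
  assumes "f \<in> Lin (V \<boxtimes> W) U" "g \<in> Lin (V \<boxtimes> W) U" "VS V" "VS W" "VS U"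
    "\<And>v w. v \<in> carrier V \<Longrightarrow> w \<in> carrier W \<Longrightarrow> f (tens K V W v w) = g (tens K V W v w)"
    "P \<in> carrier (V \<boxtimes> W)"
  shows "f P = g P"
  by (rule presentation.pres_eqI[OF presentation_tensor[OF assms(3,4)]
      assms(1,2)[unfolded tensor_space_def] assms(5) assms(7)[unfolded tensor_space_def]])
    (use assms(6) in \<open>auto simp: tens_def\<close>)

lemma lift_id:
  assumes "VS V" "VS W" "P \<in> carrier (V \<boxtimes> W)"
  shows "lift V W (V \<boxtimes> W) P (tens K V W) = P"
  by (rule tensor_eqI[OF lift_Lin[OF assms(1,2) VS_tensor[OF assms(1,2)] tens_bilin[OF assms(1,2)]]
      Lin_id assms(1,2) VS_tensor[OF assms(1,2)] lift_tens[OF assms(1,2) VS_tensor[OF assms(1,2)]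
      tens_bilin[OF assms(1,2)]] assms(3)])

text \<open>At the chosen representative the lift is a finite linear combination of values of the
  body, and f passes through it term by term. The body may therefore be any function into U.\<close>

lemma Lin_lift:
  assumes "VS V" "VS W" "VS U" "VS U'" "P \<in> carrier (V \<boxtimes> W)"
    "\<And>v w. v \<in> carrier V \<Longrightarrow> w \<in> carrier W \<Longrightarrow> \<beta> v w \<in> carrier U" "f \<in> Lin U U'"
  shows "f (lift V W U P \<beta>) = lift V W U' P (\<lambda>v w. f (\<beta> v w))"
proof -
  interpret T: presentation K "carrier V \<times> carrier W" "bilin_rels K V W"
    by (rule presentation_tensor[OF assms(1,2)])
  show ?thesis
    unfolding lift_def T.pres_lift_rep
    using assms(3,6)
    by (subst Lin_lin_ext[OF assms(3,4) T.rep(2)[OF assms(5)[unfolded tensor_space_def]] _ assms(7)])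
      (auto intro!: lin_ext_cong[OF assms(4) T.rep(2)[OF assms(5)[unfolded tensor_space_def]]]
        simp: Lin_zero[OF assms(7,3,4)] Lin_closed[OF assms(7)])
qed

lemma Lin_lift_body:
  assumes "VS V" "VS W" "VS U" "P \<in> carrier (V \<boxtimes> W)"
    "\<And>v w. v \<in> carrier V \<Longrightarrow> w \<in> carrier W \<Longrightarrow> (\<lambda>x. \<beta> x v w) \<in> Lin X U"
  shows "(\<lambda>x. lift V W U P (\<beta> x)) \<in> Lin X U"
proof -
  interpret T: presentation K "carrier V \<times> carrier W" "bilin_rels K V W"
    by (rule presentation_tensor[OF assms(1,2)])
  show ?thesis
    unfolding lift_def T.pres_lift_rep
    by (rule lin_ext_Lin_param[OF assms(3) T.rep(2)[OF assms(4)[unfolded tensor_space_def]]])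
      (use assms(5) Lin_zero_map[OF assms(3)] in auto)
qed

text \<open>Both sides are the same finite double sum over the chosen representatives of P and P',
  taken in either order.\<close>

lemma lift_swap:
  assumes "VS V" "VS W" "VS V'" "VS W'" "VS U" "P \<in> carrier (V \<boxtimes> W)" "P' \<in> carrier (V' \<boxtimes> W')"
    "\<And>v w v' w'. v \<in> carrier V \<Longrightarrow> w \<in> carrier W \<Longrightarrow> v' \<in> carrier V' \<Longrightarrow> w' \<in> carrier W' \<Longrightarrow>
      \<beta> v w v' w' \<in> carrier U"
  shows "lift V W U P (\<lambda>v w. lift V' W' U P' (\<beta> v w)) =
    lift V' W' U P' (\<lambda>v' w'. lift V W U P (\<lambda>v w. \<beta> v w v' w'))"
proof -
  interpret T: presentation K "carrier V \<times> carrier W" "bilin_rels K V W"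
    by (rule presentation_tensor[OF assms(1,2)])
  interpret T': presentation K "carrier V' \<times> carrier W'" "bilin_rels K V' W'"
    by (rule presentation_tensor[OF assms(3,4)])
  define p where "p = T.rep P"
  define p' where "p' = T'.rep P'"
  have p: "p \<in> carrier (free_space K (carrier V \<times> carrier W))"
    "p' \<in> carrier (free_space K (carrier V' \<times> carrier W'))"
    unfolding p_def p'_def using assms(6,7) by (auto simp: tensor_space_def intro: T.rep T'.rep)
  let ?\<beta> = "\<lambda>x x'. if fst x \<in> carrier V \<and> snd x \<in> carrier W \<and> fst x' \<in> carrier V' \<and> snd x' \<in> carrier W'
    then \<beta> (fst x) (snd x) (fst x') (snd x') else \<zero>\<^bsub>U\<^esub>"
  have "lift V W U P (\<lambda>v w. lift V' W' U P' (\<beta> v w)) = lin_ext U (\<lambda>x. lin_ext U (?\<beta> x) p') p"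
    unfolding lift_def T.pres_lift_rep T'.pres_lift_rep p_def[symmetric] p'_def[symmetric]
    using assms(5,8) p
    by (intro lin_ext_cong[OF assms(5) p(1)])
      (auto intro!: lin_ext_cong[OF assms(5) p(2)] Lin_closed[OF lin_ext_Lin[OF assms(5)] p(2)])
  also have "\<dots> = lin_ext U (\<lambda>x'. lin_ext U (\<lambda>x. ?\<beta> x x') p) p'"
    using assms(5,8) by (intro lin_ext_swap[OF assms(5) p]) auto
  also have "\<dots> = lift V' W' U P' (\<lambda>v' w'. lift V W U P (\<lambda>v w. \<beta> v w v' w'))"
    unfolding lift_def T.pres_lift_rep T'.pres_lift_rep p_def[symmetric] p'_def[symmetric]
    using assms(5,8) p
    by (intro lin_ext_cong[OF assms(5) p(2)])
      (auto intro!: lin_ext_cong[OF assms(5) p(1)] Lin_closed[OF lin_ext_Lin[OF assms(5)] p(1)])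
  finally show ?thesis .
qed

text \<open>As a rewrite rule this flattens a Sweedler sum taken over an element that is itself
  given by a Sweedler sum. Bilinearity is asked of the outer body, since the outer lift must be
  linear in its argument.\<close>

lemma lift_lift:
  assumes "VS V" "VS W" "VS X" "VS Y" "VS U" "P \<in> carrier (X \<boxtimes> Y)" "bilin V W U \<beta>"
    "\<And>x y. x \<in> carrier X \<Longrightarrow> y \<in> carrier Y \<Longrightarrow> \<gamma> x y \<in> carrier (V \<boxtimes> W)"
  shows "lift V W U (lift X Y (V \<boxtimes> W) P \<gamma>) \<beta> = lift X Y U P (\<lambda>x y. lift V W U (\<gamma> x y) \<beta>)"
  by (rule Lin_lift[OF assms(3,4) _ assms(5,6,8) lift_Lin]) (use assms in auto)

lemma Lin_lift_arg:
  assumes "VS V" "VS W" "VS U" "bilin V W U \<beta>" "g \<in> Lin X (V \<boxtimes> W)"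
  shows "(\<lambda>x. lift V W U (g x) \<beta>) \<in> Lin X U"
  by (rule Lin_comp[OF lift_Lin[OF assms(1-4)] assms(5)])

lemma Lin_tens:
  assumes "VS V" "VS W"
  shows "f \<in> Lin X V \<Longrightarrow> w \<in> carrier W \<Longrightarrow> (\<lambda>x. tens K V W (f x) w) \<in> Lin X (V \<boxtimes> W)"
    and "v \<in> carrier V \<Longrightarrow> g \<in> Lin X W \<Longrightarrow> (\<lambda>x. tens K V W v (g x)) \<in> Lin X (V \<boxtimes> W)"
  by (rule Lin_comp[OF bilinD(2)[OF tens_bilin[OF assms]]]; assumption)
    (rule Lin_comp[OF bilinD(1)[OF tens_bilin[OF assms]]])

lemma tensor_map_lift:
  assumes "VS V" "VS W" "VS X" "VS Y" "P \<in> carrier (X \<boxtimes> Y)"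
    "\<And>x. x \<in> carrier X \<Longrightarrow> f x \<in> carrier V" "\<And>y. y \<in> carrier Y \<Longrightarrow> g y \<in> carrier W"
  shows "tensor_map K V W f g P = lift X Y (V \<boxtimes> W) P (\<lambda>x y. tens K V W (f x) (g y))"
  unfolding tensor_map_def by (rule pres_lift_eq_lift) (use assms in auto)

end

section \<open>Exactness of the tensor product over a field\<close>

context base_field
begin

lemma VS_regroup:
  assumes "VS V" "a \<in> carrier V" "b \<in> carrier V" "c \<in> carrier V" "d \<in> carrier V"
  shows "(a \<oplus>\<^bsub>V\<^esub> b) \<ominus>\<^bsub>V\<^esub> (c \<oplus>\<^bsub>V\<^esub> d) = (a \<ominus>\<^bsub>V\<^esub> c) \<oplus>\<^bsub>V\<^esub> (b \<ominus>\<^bsub>V\<^esub> d)"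
proof -
  interpret V: abelian_group V using assms(1) by (rule abelian_group_VS)
  show ?thesis using assms(2-) by (simp add: a_minus_def V.minus_add V.a_ac)
qed

lemma VS_smult_minus:
  assumes "VS V" "a \<in> carrier V" "b \<in> carrier V" "c \<in> carrier K"
  shows "c \<odot>\<^bsub>V\<^esub> (a \<ominus>\<^bsub>V\<^esub> b) = c \<odot>\<^bsub>V\<^esub> a \<ominus>\<^bsub>V\<^esub> c \<odot>\<^bsub>V\<^esub> b"
  using assms by (simp add: a_minus_def module.smult_r_distr module.smult_r_minus)

lemma VS_minus_zero:
  assumes "VS V" "x \<in> carrier V"
  shows "x \<ominus>\<^bsub>V\<^esub> \<zero>\<^bsub>V\<^esub> = x"
proof -
  interpret V: abelian_group V using assms(1) by (rule abelian_group_VS)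
  show ?thesis using assms(2) by (simp add: a_minus_def)
qed

text \<open>A subspace C that is maximal among those meeting N only in zero is a complement of N: if
  no v - n lay in C, then C + K v would be strictly larger and would still meet N only in
  zero.\<close>

lemma complement_exists:
  assumes V: "VS V" and N: "submodule N K V"
  obtains C where "submodule C K V" "C \<inter> N = {\<zero>\<^bsub>V\<^esub>}"
    "\<And>v. v \<in> carrier V \<Longrightarrow> \<exists>n \<in> N. v \<ominus>\<^bsub>V\<^esub> n \<in> C"
proof -
  interpret V: module K V by (rule V)
  interpret K: field K by (rule field_K)
  note ND = submoduleD[OF V N]
  let ?A = "{C. submodule C K V \<and> C \<inter> N = {\<zero>\<^bsub>V\<^esub>}}"
  have "{\<zero>\<^bsub>V\<^esub>} \<in> ?A" using ND(2) V by (auto intro!: submoduleI'[OF V])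
  moreover have "\<Union>\<C> \<in> ?A" if C: "\<C> \<noteq> {}" "subset.chain ?A \<C>" for \<C>
  proof -
    have m: "submodule C K V \<and> C \<inter> N = {\<zero>\<^bsub>V\<^esub>}" if "C \<in> \<C>" for C
      using C(2) that by (auto simp: subset.chain_def)
    have "submodule (\<Union>\<C>) K V"
    proof (rule submoduleI'[OF V])
      show "\<Union>\<C> \<subseteq> carrier V" "\<zero>\<^bsub>V\<^esub> \<in> \<Union>\<C>"
        using m C(1) submoduleD[OF V] by blast+
      show "c \<odot>\<^bsub>V\<^esub> x \<in> \<Union>\<C>" if "c \<in> carrier K" "x \<in> \<Union>\<C>" for c x
        using m that submoduleD(5)[OF V] by blast
      show "x \<oplus>\<^bsub>V\<^esub> y \<in> \<Union>\<C>" if xy: "x \<in> \<Union>\<C>" "y \<in> \<Union>\<C>" for x y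
      proof -
        obtain C D where CD: "x \<in> C" "C \<in> \<C>" "y \<in> D" "D \<in> \<C>" using xy by blast
        moreover from this have "C \<subseteq> D \<or> D \<subseteq> C" using C(2) by (simp add: subset_chain_def)
        ultimately obtain E where "E \<in> \<C>" "x \<in> E" "y \<in> E" by blast
        then show ?thesis using m submoduleD(3)[OF V] by blast
      qed
    qed
    moreover have "\<Union>\<C> \<inter> N = {\<zero>\<^bsub>V\<^esub>}" using m C(1) by blast
    ultimately show ?thesis by blast
  qed
  ultimately obtain C where C: "submodule C K V" "C \<inter> N = {\<zero>\<^bsub>V\<^esub>}"
    and max: "\<And>D. submodule D K V \<Longrightarrow> D \<inter> N = {\<zero>\<^bsub>V\<^esub>} \<Longrightarrow> C \<subseteq> D \<Longrightarrow> D = C"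
    using subset_Zorn_nonempty[of ?A] by (smt (verit, best) empty_iff mem_Collect_eq)
  note CD = submoduleD[OF V C(1)]
  have "\<exists>n \<in> N. v \<ominus>\<^bsub>V\<^esub> n \<in> C" if v: "v \<in> carrier V" for v
  proof (rule ccontr)
    assume nex: "\<not> (\<exists>n \<in> N. v \<ominus>\<^bsub>V\<^esub> n \<in> C)"
    let ?D = "{c \<oplus>\<^bsub>V\<^esub> k \<odot>\<^bsub>V\<^esub> v | c k. c \<in> C \<and> k \<in> carrier K}"
    have "submodule ?D K V"
    proof (rule submoduleI'[OF V])
      show "?D \<subseteq> carrier V" using CD v V by auto
      show "\<zero>\<^bsub>V\<^esub> \<in> ?D" using CD(2) v V by (intro CollectI exI[of _ "\<zero>\<^bsub>V\<^esub>"] exI[of _ "\<zero>\<^bsub>K\<^esub>"]) auto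
      fix x y assume "x \<in> ?D" "y \<in> ?D"
      then obtain c k d l where x: "x = c \<oplus>\<^bsub>V\<^esub> k \<odot>\<^bsub>V\<^esub> v" "c \<in> C" "k \<in> carrier K"
        and y: "y = d \<oplus>\<^bsub>V\<^esub> l \<odot>\<^bsub>V\<^esub> v" "d \<in> C" "l \<in> carrier K" by auto
      moreover have "c \<in> carrier V" "d \<in> carrier V" using x y CD(1) by auto
      ultimately have "x \<oplus>\<^bsub>V\<^esub> y = (c \<oplus>\<^bsub>V\<^esub> d) \<oplus>\<^bsub>V\<^esub> (k \<oplus>\<^bsub>K\<^esub> l) \<odot>\<^bsub>V\<^esub> v"
        using v by (simp add: VS_add_4[OF V] V.smult_l_distr)
      then show "x \<oplus>\<^bsub>V\<^esub> y \<in> ?D" using x y CD(3) by blast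
    next
      fix a x assume a: "a \<in> carrier K" and "x \<in> ?D"
      then obtain c k where x: "x = c \<oplus>\<^bsub>V\<^esub> k \<odot>\<^bsub>V\<^esub> v" "c \<in> C" "k \<in> carrier K" by auto
      moreover have "c \<in> carrier V" using x CD(1) by auto
      ultimately have "a \<odot>\<^bsub>V\<^esub> x = a \<odot>\<^bsub>V\<^esub> c \<oplus>\<^bsub>V\<^esub> (a \<otimes>\<^bsub>K\<^esub> k) \<odot>\<^bsub>V\<^esub> v"
        using v a by (simp add: V.smult_r_distr V.smult_assoc1)
      then show "a \<odot>\<^bsub>V\<^esub> x \<in> ?D" using a x CD(5) by blast
    qed
    moreover have "?D \<inter> N = {\<zero>\<^bsub>V\<^esub>}"
    proof -
      have "c \<oplus>\<^bsub>V\<^esub> k \<odot>\<^bsub>V\<^esub> v = \<zero>\<^bsub>V\<^esub>" if ck: "c \<in> C" "k \<in> carrier K" and n: "c \<oplus>\<^bsub>V\<^esub> k \<odot>\<^bsub>V\<^esub> v \<in> N" for c k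
      proof (cases "k = \<zero>\<^bsub>K\<^esub>")
        case True
        have cV: "c \<in> carrier V" using ck CD by auto
        then have eq: "c \<oplus>\<^bsub>V\<^esub> k \<odot>\<^bsub>V\<^esub> v = c" using True v V by simp
        then have "c \<in> C \<inter> N" using n ck by simp
        then show ?thesis using C(2) eq by simp
      next
        case False
        then have ki: "inv\<^bsub>K\<^esub> k \<in> carrier K" "inv\<^bsub>K\<^esub> k \<otimes>\<^bsub>K\<^esub> k = \<one>\<^bsub>K\<^esub>"
          using ck K.field_Units by auto
        have cV: "c \<in> carrier V" using ck CD by auto
        \<comment> \<open>Dividing the element c + k v of N by k gives n = c/k + v in N with v - n =
          -c/k in C, which contradicts the choice of v.\<close>
        have "inv\<^bsub>K\<^esub> k \<odot>\<^bsub>V\<^esub> (c \<oplus>\<^bsub>V\<^esub> k \<odot>\<^bsub>V\<^esub> v) = inv\<^bsub>K\<^esub> k \<odot>\<^bsub>V\<^esub> c \<oplus>\<^bsub>V\<^esub> v"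
          using ki ck cV v V by (simp add: V.smult_r_distr flip: V.smult_assoc1)
        moreover have "v \<ominus>\<^bsub>V\<^esub> (inv\<^bsub>K\<^esub> k \<odot>\<^bsub>V\<^esub> c \<oplus>\<^bsub>V\<^esub> v) = \<ominus>\<^bsub>V\<^esub> (inv\<^bsub>K\<^esub> k \<odot>\<^bsub>V\<^esub> c)"
          using ki cV v by (simp add: a_minus_def V.a_comm[of "inv\<^bsub>K\<^esub> k \<odot>\<^bsub>V\<^esub> c" v] V.minus_add V.r_neg2)
        moreover have "\<ominus>\<^bsub>V\<^esub> (inv\<^bsub>K\<^esub> k \<odot>\<^bsub>V\<^esub> c) \<in> C"
          using ki ck CD(5) V.submoduleE(3)[OF C(1)] by blast
        ultimately have "\<exists>n \<in> N. v \<ominus>\<^bsub>V\<^esub> n \<in> C"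
          using ND(5)[OF ki(1) n] by (intro bexI[of _ "inv\<^bsub>K\<^esub> k \<odot>\<^bsub>V\<^esub> (c \<oplus>\<^bsub>V\<^esub> k \<odot>\<^bsub>V\<^esub> v)"]) auto
        with nex show ?thesis by blast
      qed
      moreover have "\<zero>\<^bsub>V\<^esub> \<in> ?D" using submoduleD(2)[OF V \<open>submodule ?D K V\<close>] .
      ultimately show ?thesis using ND(2) by auto
    qed
    moreover have "C \<subseteq> ?D"
    proof
      fix c assume "c \<in> C"
      then show "c \<in> ?D" using CD(1) v V
        by (intro CollectI exI[of _ c] exI[of _ "\<zero>\<^bsub>K\<^esub>"]) auto
    qed
    ultimately have "?D = C" by (rule max)
    moreover have "v \<in> ?D" using CD(2) v V
      by (intro CollectI exI[of _ "\<zero>\<^bsub>V\<^esub>"] exI[of _ "\<one>\<^bsub>K\<^esub>"]) auto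
    ultimately have "v \<in> C" by simp
    then have "v \<ominus>\<^bsub>V\<^esub> \<zero>\<^bsub>V\<^esub> \<in> C" using CD(2,4) by blast
    with nex ND(2) show False by blast
  qed
  with C that show thesis by blast
qed

text \<open>The component in N along a complement C. It is unique because C and N meet only in zero,
  and the uniqueness makes the chosen component linear in v.\<close>

lemma retraction_exists:
  assumes V: "VS V" and N: "submodule N K V"
  obtains p where "p \<in> Lin V V" "\<And>v. v \<in> carrier V \<Longrightarrow> p v \<in> N" "\<And>v. v \<in> N \<Longrightarrow> p v = v"
proof -
  obtain C where C: "submodule C K V" "C \<inter> N = {\<zero>\<^bsub>V\<^esub>}"
    "\<And>v. v \<in> carrier V \<Longrightarrow> \<exists>n \<in> N. v \<ominus>\<^bsub>V\<^esub> n \<in> C"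
    using complement_exists[OF assms] by blast
  interpret V: module K V by (rule V)
  note ND = submoduleD[OF V N] and CD = submoduleD[OF V C(1)]
  define p where "p v = (SOME n. n \<in> N \<and> v \<ominus>\<^bsub>V\<^esub> n \<in> C)" for v
  have p: "p v \<in> N" "v \<ominus>\<^bsub>V\<^esub> p v \<in> C" if "v \<in> carrier V" for v
    using someI_ex[of "\<lambda>n. n \<in> N \<and> v \<ominus>\<^bsub>V\<^esub> n \<in> C"] C(3)[OF that] by (auto simp: p_def)
  have uniq: "p v = n" if v: "v \<in> carrier V" "n \<in> N" "v \<ominus>\<^bsub>V\<^esub> n \<in> C" for v n
  proof -
    have c: "p v \<in> carrier V" "n \<in> carrier V" using p(1) v ND(1) by auto
    have "(v \<ominus>\<^bsub>V\<^esub> n) \<ominus>\<^bsub>V\<^esub> (v \<ominus>\<^bsub>V\<^esub> p v) = (v \<ominus>\<^bsub>V\<^esub> v) \<oplus>\<^bsub>V\<^esub> (p v \<ominus>\<^bsub>V\<^esub> n)"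
      using v(1) c by (simp add: a_minus_def V.minus_add V.a_ac)
    also have "\<dots> = p v \<ominus>\<^bsub>V\<^esub> n" using v(1) c V by (simp add: a_minus_def V.r_neg)
    finally have "p v \<ominus>\<^bsub>V\<^esub> n \<in> C" using CD(4)[OF v(3) p(2)[OF v(1)]] by simp
    moreover have "p v \<ominus>\<^bsub>V\<^esub> n \<in> N" using ND(4) p(1) v by blast
    ultimately have "p v \<ominus>\<^bsub>V\<^esub> n = \<zero>\<^bsub>V\<^esub>" using C(2) by blast
    then show ?thesis using VS_minus_eq_zero[OF V c] by simp
  qed
  have pV: "p v \<in> carrier V" if "v \<in> carrier V" for v using p(1)[OF that] ND(1) by auto
  show thesis
  proof (rule that)
    show "p \<in> Lin V V"
    proof (rule Lin_I)
      show "p (x \<oplus>\<^bsub>V\<^esub> y) = p x \<oplus>\<^bsub>V\<^esub> p y" if "x \<in> carrier V" "y \<in> carrier V" for x y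
      proof (rule uniq)
        show "(x \<oplus>\<^bsub>V\<^esub> y) \<ominus>\<^bsub>V\<^esub> (p x \<oplus>\<^bsub>V\<^esub> p y) \<in> C"
          using that pV CD(3) p(2) by (simp add: VS_regroup[OF V])
      qed (use that ND(3) p(1) in auto)
      show "p (c \<odot>\<^bsub>V\<^esub> x) = c \<odot>\<^bsub>V\<^esub> p x" if "c \<in> carrier K" "x \<in> carrier V" for c x
      proof (rule uniq)
        show "(c \<odot>\<^bsub>V\<^esub> x) \<ominus>\<^bsub>V\<^esub> (c \<odot>\<^bsub>V\<^esub> p x) \<in> C"
          using that pV CD(5) p(2) by (simp flip: VS_smult_minus[OF V])
      qed (use that ND(5) p(1) in auto)
    qed (rule pV)
    show "p v = v" if "v \<in> N" for v
      using that ND(1) CD(2) by (intro uniq) (auto simp: a_minus_def V.r_neg subset_eq)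
  qed (rule p(1))
qed

lemma VS_carrier_update: "VS V \<Longrightarrow> submodule N K V \<Longrightarrow> VS (V\<lparr>carrier := N\<rparr>)"
  by (rule submodule.submodule_is_module)

lemma Lin_incl:
  assumes "VS V" "submodule N K V"
  shows "(\<lambda>x. x) \<in> Lin (V\<lparr>carrier := N\<rparr>) V"
  using submoduleD[OF assms] by (auto simp: lin_maps_def)

lemma Lin_corestrict:
  assumes "f \<in> Lin X V" "\<And>x. x \<in> carrier X \<Longrightarrow> f x \<in> N"
  shows "f \<in> Lin X (V\<lparr>carrier := N\<rparr>)"
  using assms by (auto simp: lin_maps_def)

text \<open>Linear maps over a field are von Neumann regular: project W onto the image of f, take a
  preimage, and make it canonical by removing its part in the kernel of f.\<close>

lemma quasi_inverse_exists:
  assumes V: "VS V" and W: "VS W" and f: "f \<in> Lin V W"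
  obtains g where "g \<in> Lin W V" "\<And>v. v \<in> carrier V \<Longrightarrow> f (g (f v)) = f v"
proof -
  define N where "N = {v \<in> carrier V. f v = \<zero>\<^bsub>W\<^esub>}"
  have N: "submodule N K V"
    unfolding N_def by (rule Lin_equalizer_submodule[OF f Lin_zero_map[OF W] V W])
  obtain p where p: "p \<in> Lin V V" "\<And>v. v \<in> carrier V \<Longrightarrow> p v \<in> N" "\<And>v. v \<in> N \<Longrightarrow> p v = v"
    using retraction_exists[OF V N] by blast
  obtain r where r: "r \<in> Lin W W" "\<And>w. w \<in> carrier W \<Longrightarrow> r w \<in> f ` carrier V"
    "\<And>w. w \<in> f ` carrier V \<Longrightarrow> r w = w"
    using retraction_exists[OF W Lin_image_submodule[OF f V W]] by blast
  \<comment> \<open>Since p is a projection onto the kernel of f, the value of q depends on f v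
    alone.\<close>
  define q where "q v = v \<ominus>\<^bsub>V\<^esub> p v" for v
  have q: "q \<in> Lin V V"
    unfolding q_def by (rule Lin_minus_map[OF Lin_id p(1) V V])
  have fq: "f (q v) = f v" if "v \<in> carrier V" for v
    using Lin_minus[OF f V W that Lin_closed[OF p(1) that]] p(2)[OF that] Lin_closed[OF f that]
    by (simp add: q_def N_def VS_minus_zero[OF W])
  have q0: "q v = q v'" if v: "v \<in> carrier V" "v' \<in> carrier V" "f v = f v'" for v v'
  proof -
    have vV: "v \<ominus>\<^bsub>V\<^esub> v' \<in> carrier V" using v(1,2) V by simp
    have "f (v \<ominus>\<^bsub>V\<^esub> v') = \<zero>\<^bsub>W\<^esub>"
      unfolding Lin_minus[OF f V W v(1,2)] v(3) VS_minus_eq_zero[OF W Lin_closed[OF f v(2)] Lin_closed[OF f v(2)]] ..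
    then have "p (v \<ominus>\<^bsub>V\<^esub> v') = v \<ominus>\<^bsub>V\<^esub> v'" using vV by (intro p(3)) (simp add: N_def)
    then have "q (v \<ominus>\<^bsub>V\<^esub> v') = \<zero>\<^bsub>V\<^esub>"
      unfolding q_def using VS_minus_eq_zero[OF V vV vV] by simp
    then show ?thesis
      unfolding Lin_minus[OF q V V v(1,2)]
        VS_minus_eq_zero[OF V Lin_closed[OF q v(1)] Lin_closed[OF q v(2)]] .
  qed
  \<comment> \<open>Any preimage of \<open>r w\<close> will do, because q takes the same value on
    all of them.\<close>
  define g where "g w = q (SOME v. v \<in> carrier V \<and> f v = r w)" for w
  have g: "g w = q v" if "v \<in> carrier V" "f v = r w" for w v
    unfolding g_def
  proof (rule someI2[of _ v])
    fix v' assume "v' \<in> carrier V \<and> f v' = r w"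
    then show "q v' = q v" by (intro q0) (simp_all add: that)
  qed (simp add: that)
  have ex: "\<exists>v \<in> carrier V. f v = r w" if "w \<in> carrier W" for w
    using r(2)[OF that] by (auto simp: image_iff)
  show thesis
  proof (rule that)
    show "g \<in> Lin W V"
    proof (rule Lin_I)
      show "g w \<in> carrier V" if "w \<in> carrier W" for w
        using ex[OF that] g Lin_closed[OF q] by metis
      show "g (w \<oplus>\<^bsub>W\<^esub> w') = g w \<oplus>\<^bsub>V\<^esub> g w'" if w: "w \<in> carrier W" "w' \<in> carrier W" for w w'
      proof -
        obtain v v' where "v \<in> carrier V" "f v = r w" "v' \<in> carrier V" "f v' = r w'"
          using ex w by blast
        then show ?thesis using w V g[of "v \<oplus>\<^bsub>V\<^esub> v'" "w \<oplus>\<^bsub>W\<^esub> w'"] g[of v w] g[of v' w']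
          by (simp add: Lin_add[OF f] Lin_add[OF r(1)] Lin_add[OF q])
      qed
      show "g (c \<odot>\<^bsub>W\<^esub> w) = c \<odot>\<^bsub>V\<^esub> g w" if w: "c \<in> carrier K" "w \<in> carrier W" for c w
      proof -
        obtain v where "v \<in> carrier V" "f v = r w" using ex w by blast
        then show ?thesis using w V g[of "c \<odot>\<^bsub>V\<^esub> v" "c \<odot>\<^bsub>W\<^esub> w"] g[of v w]
          by (simp add: Lin_smult[OF f] Lin_smult[OF r(1)] Lin_smult[OF q])
      qed
    qed
    show "f (g (f v)) = f v" if "v \<in> carrier V" for v
      using that g[of v "f v"] r(3)[of "f v"] fq by simp
  qed
qed

text \<open>With a quasi-inverse g of f, the map p = id - g f takes its values in the kernel of f,
  and p \<otimes> id changes t only by (g \<otimes> id)(f \<otimes> id) t = 0. So the image of t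
  under p \<otimes> id is the required preimage.\<close>

lemma kernel_tensor:
  assumes V: "VS V" and W: "VS W" and H: "VS H" and f: "f \<in> Lin V W"
    and t: "t \<in> carrier (V \<boxtimes> H)"
    and zero: "lift V H (W \<boxtimes> H) t (\<lambda>v h. tens K W H (f v) h) = \<zero>\<^bsub>W \<boxtimes> H\<^esub>"
  defines "N \<equiv> V\<lparr>carrier := {v \<in> carrier V. f v = \<zero>\<^bsub>W\<^esub>}\<rparr>"
  shows "\<exists>s \<in> carrier (N \<boxtimes> H). lift N H (V \<boxtimes> H) s (tens K V H) = t"
proof -
  have Nsub: "submodule {v \<in> carrier V. f v = \<zero>\<^bsub>W\<^esub>} K V"
    by (rule Lin_equalizer_submodule[OF f Lin_zero_map[OF W] V W])
  have N: "VS N" unfolding N_def by (rule VS_carrier_update[OF V Nsub])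
  have VH: "VS (V \<boxtimes> H)" and WH: "VS (W \<boxtimes> H)" and NH: "VS (N \<boxtimes> H)" using V W H N by auto
  obtain g where g: "g \<in> Lin W V" "\<And>v. v \<in> carrier V \<Longrightarrow> f (g (f v)) = f v"
    using quasi_inverse_exists[OF V W f] by blast
  define p where "p v = v \<ominus>\<^bsub>V\<^esub> g (f v)" for v
  have gf: "(\<lambda>v. g (f v)) \<in> Lin V V" by (rule Lin_comp[OF g(1) f])
  have pV: "p \<in> Lin V V" unfolding p_def by (rule Lin_minus_map[OF Lin_id gf V V])
  have pN: "p \<in> Lin V N"
    unfolding N_def using Lin_closed[OF pV] g(2) Lin_closed[OF f] Lin_closed[OF gf] W V
    by (intro Lin_corestrict[OF pV]) (auto simp: p_def Lin_minus[OF f V W] VS_minus_eq_zero)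
  have incl: "(\<lambda>x. x) \<in> Lin N V" unfolding N_def by (rule Lin_incl[OF V Nsub])
  let ?s = "lift V H (N \<boxtimes> H) t (\<lambda>v h. tens K N H (p v) h)"
  have b1: "bilin V H (V \<boxtimes> H) (\<lambda>v h. tens K V H (k v) h)" if "k \<in> Lin V V" for k
    using that V H by (intro bilinI Lin_tens Lin_id) (auto intro: Lin_closed)
  have b2: "bilin W H (V \<boxtimes> H) (\<lambda>v h. tens K V H (g v) h)"
    using g(1) V H by (intro bilinI Lin_tens Lin_id) (auto intro: Lin_closed)
  have b3: "bilin N H (V \<boxtimes> H) (tens K V H)"
    using incl V H by (intro bilinI Lin_tens Lin_id) (auto intro: Lin_closed)
  have "lift N H (V \<boxtimes> H) ?s (tens K V H) = lift V H (V \<boxtimes> H) t (\<lambda>v h. tens K V H (p v) h)"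
    using V H N b3 t Lin_closed[OF pN]
    by (subst lift_lift[OF N H V H VH t b3]) (auto simp: lift_tens)
  also have "\<dots> = lift V H (V \<boxtimes> H) t (\<lambda>v h. tens K V H v h \<ominus>\<^bsub>V \<boxtimes> H\<^esub> tens K V H (g (f v)) h)"
    unfolding p_def
    by (rule lift_cong[OF refl]) (use V H Lin_closed[OF gf] in
        \<open>simp add: Lin_minus[OF bilinD(2)[OF tens_bilin[OF V H]] V VH]\<close>)
  also have "\<dots> = lift V H (V \<boxtimes> H) t (tens K V H) \<ominus>\<^bsub>V \<boxtimes> H\<^esub>
      lift V H (V \<boxtimes> H) t (\<lambda>v h. tens K V H (g (f v)) h)"
  proof (rule tensor_eqI[OF _ _ V H VH _ t])
    have b: "bilin V H (V \<boxtimes> H) (\<lambda>v h. tens K V H v h \<ominus>\<^bsub>V \<boxtimes> H\<^esub> tens K V H (g (f v)) h)"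
      using b1[OF gf] b1[OF Lin_id] V H VH
      by (intro bilinI Lin_minus_map) (auto dest: bilinD(1,2))
    note b' = b1[OF gf] b1[OF Lin_id]
    show "(\<lambda>t. lift V H (V \<boxtimes> H) t (\<lambda>v h. tens K V H v h \<ominus>\<^bsub>V \<boxtimes> H\<^esub> tens K V H (g (f v)) h)) \<in> Lin (V \<boxtimes> H) (V \<boxtimes> H)"
      by (rule lift_Lin[OF V H VH b])
    show "(\<lambda>t. lift V H (V \<boxtimes> H) t (tens K V H) \<ominus>\<^bsub>V \<boxtimes> H\<^esub>
      lift V H (V \<boxtimes> H) t (\<lambda>v h. tens K V H (g (f v)) h)) \<in> Lin (V \<boxtimes> H) (V \<boxtimes> H)"
      by (rule Lin_minus_map[OF lift_Lin[OF V H VH b'(2)] lift_Lin[OF V H VH b'(1)] VH VH])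
    fix v h assume "v \<in> carrier V" "h \<in> carrier H"
    then show "lift V H (V \<boxtimes> H) (tens K V H v h) (\<lambda>v h. tens K V H v h \<ominus>\<^bsub>V \<boxtimes> H\<^esub> tens K V H (g (f v)) h) =
      lift V H (V \<boxtimes> H) (tens K V H v h) (tens K V H) \<ominus>\<^bsub>V \<boxtimes> H\<^esub>
      lift V H (V \<boxtimes> H) (tens K V H v h) (\<lambda>v h. tens K V H (g (f v)) h)"
      by (simp only: lift_tens[OF V H VH b] lift_tens[OF V H VH b'(1)] lift_tens[OF V H VH b'(2)])
  qed
  also have "lift V H (V \<boxtimes> H) t (tens K V H) = t" by (rule lift_id[OF V H t])
  also have "lift V H (V \<boxtimes> H) t (\<lambda>v h. tens K V H (g (f v)) h) =
      lift W H (V \<boxtimes> H) (lift V H (W \<boxtimes> H) t (\<lambda>v h. tens K W H (f v) h)) (\<lambda>w h. tens K V H (g w) h)"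
    using Lin_closed[OF f] V W H
    by (subst lift_lift[OF W H V H VH t b2]) (auto simp: lift_tens[OF W H VH b2])
  also have "\<dots> = \<zero>\<^bsub>V \<boxtimes> H\<^esub>"
    unfolding zero by (rule Lin_zero[OF lift_Lin[OF W H VH b2] WH VH])
  also have "t \<ominus>\<^bsub>V \<boxtimes> H\<^esub> \<zero>\<^bsub>V \<boxtimes> H\<^esub> = t"
    by (rule VS_minus_zero[OF VH t])
  finally have "lift N H (V \<boxtimes> H) ?s (tens K V H) = t" .
  moreover have "?s \<in> carrier (N \<boxtimes> H)"
    using Lin_closed[OF pN] N H V by (intro lift_closed[OF V H NH t]) auto
  ultimately show ?thesis by blast
qed

text \<open>A linear retraction of V onto N, tensored with H, is a left inverse.\<close>

lemma tensor_incl_inj: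
  assumes V: "VS V" and Nsub: "submodule N K V" and H: "VS H"
  shows "inj_on (\<lambda>s. lift (V\<lparr>carrier := N\<rparr>) H (V \<boxtimes> H) s (tens K V H)) (carrier (V\<lparr>carrier := N\<rparr> \<boxtimes> H))"
proof -
  let ?N = "V\<lparr>carrier := N\<rparr>"
  have N: "VS ?N" by (rule VS_carrier_update[OF V Nsub])
  have VH: "VS (V \<boxtimes> H)" and NH: "VS (?N \<boxtimes> H)" using V H N by auto
  obtain p where p: "p \<in> Lin V V" "\<And>v. v \<in> carrier V \<Longrightarrow> p v \<in> N" "\<And>v. v \<in> N \<Longrightarrow> p v = v"
    using retraction_exists[OF V Nsub] by blast
  have pN: "p \<in> Lin V ?N" by (rule Lin_corestrict[OF p(1,2)])
  have incl: "(\<lambda>x. x) \<in> Lin ?N V" by (rule Lin_incl[OF V Nsub])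
  have b: "bilin V H (?N \<boxtimes> H) (\<lambda>v h. tens K ?N H (p v) h)"
    using pN N H by (intro bilinI Lin_tens Lin_id) (auto dest: Lin_closed)
  have eq: "lift V H (?N \<boxtimes> H) (lift ?N H (V \<boxtimes> H) s (tens K V H)) (\<lambda>v h. tens K ?N H (p v) h) = s"
    if s: "s \<in> carrier (?N \<boxtimes> H)" for s
  proof -
    have "lift V H (?N \<boxtimes> H) (lift ?N H (V \<boxtimes> H) s (tens K V H)) (\<lambda>v h. tens K ?N H (p v) h) =
      lift ?N H (?N \<boxtimes> H) s (\<lambda>v h. lift V H (?N \<boxtimes> H) (tens K V H v h) (\<lambda>v h. tens K ?N H (p v) h))"
      using Lin_closed[OF incl] V H by (intro lift_lift[OF V H N H NH s b]) auto
    also have "\<dots> = lift ?N H (?N \<boxtimes> H) s (tens K ?N H)"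
      using Lin_closed[OF incl] p(3) by (intro lift_cong refl) (simp add: lift_tens[OF V H NH b])
    also have "\<dots> = s" by (rule lift_id[OF N H s])
    finally show ?thesis .
  qed
  show ?thesis by (rule inj_on_inverseI) (rule eq)
qed

end

section \<open>Hopf algebras and comodule algebras\<close>

text \<open>Closure rules for linearity of a nested Sweedler expression in one of its variables.
  With them \<open>intro lin_intro\<close> reduces bilinearity of a body to memberships in
  carriers.\<close>

named_theorems lin_intro

context base_field
begin

declare bilinI [lin_intro] Lin_id [lin_intro] Lin_lift_body [lin_intro] Lin_lift_arg [lin_intro]
  Lin_tens [lin_intro] Lin_add_map [lin_intro]
declare lift_closed [simp]

lemma Lin_bilin:
  assumes "bilin V W U \<beta>"
  shows "f \<in> Lin X V \<Longrightarrow> w \<in> carrier W \<Longrightarrow> (\<lambda>x. \<beta> (f x) w) \<in> Lin X U"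
    and "v \<in> carrier V \<Longrightarrow> g \<in> Lin X W \<Longrightarrow> (\<lambda>x. \<beta> v (g x)) \<in> Lin X U"
  by (rule Lin_comp[OF bilinD(2)[OF assms]]; assumption)
    (rule Lin_comp[OF bilinD(1)[OF assms]])

lemma assoc_algebraD:
  assumes "assoc_algebra K A"
  shows "VS A" "\<one>\<^bsub>A\<^esub> \<in> carrier A"
    and "a \<in> carrier A \<Longrightarrow> b \<in> carrier A \<Longrightarrow> a \<otimes>\<^bsub>A\<^esub> b \<in> carrier A"
    and "a \<in> carrier A \<Longrightarrow> \<one>\<^bsub>A\<^esub> \<otimes>\<^bsub>A\<^esub> a = a"
    and "a \<in> carrier A \<Longrightarrow> a \<otimes>\<^bsub>A\<^esub> \<one>\<^bsub>A\<^esub> = a"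
    and "a \<in> carrier A \<Longrightarrow> b \<in> carrier A \<Longrightarrow> c \<in> carrier A \<Longrightarrow>
      (a \<otimes>\<^bsub>A\<^esub> b) \<otimes>\<^bsub>A\<^esub> c = a \<otimes>\<^bsub>A\<^esub> (b \<otimes>\<^bsub>A\<^esub> c)"
    and "bilin A A A (mult A)"
proof -
  have "ring A" using assms by (simp add: assoc_algebra_def)
  then interpret A: ring A .
  show "VS A" using assms by (simp add: assoc_algebra_def)
  show "bilin A A A (mult A)"
    using assms by (intro bilinI Lin_I) (auto simp: assoc_algebra_def A.l_distr A.r_distr)
qed (use assms in \<open>auto simp: assoc_algebra_def ring.ring_simprules monoid.r_one ring.is_monoid\<close>)

lemma bimoduleD:
  assumes "bimodule K A M"
  shows "VS M"
    and "a \<in> carrier A \<Longrightarrow> m \<in> carrier M \<Longrightarrow> lact M a m \<in> carrier M"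
    and "a \<in> carrier A \<Longrightarrow> m \<in> carrier M \<Longrightarrow> ract M m a \<in> carrier M"
    and "m \<in> carrier M \<Longrightarrow> lact M \<one>\<^bsub>A\<^esub> m = m"
    and "m \<in> carrier M \<Longrightarrow> ract M m \<one>\<^bsub>A\<^esub> = m"
    and "a \<in> carrier A \<Longrightarrow> b \<in> carrier A \<Longrightarrow> m \<in> carrier M \<Longrightarrow>
      lact M (a \<otimes>\<^bsub>A\<^esub> b) m = lact M a (lact M b m)"
    and "a \<in> carrier A \<Longrightarrow> b \<in> carrier A \<Longrightarrow> m \<in> carrier M \<Longrightarrow>
      ract M m (a \<otimes>\<^bsub>A\<^esub> b) = ract M (ract M m a) b"
    and "a \<in> carrier A \<Longrightarrow> b \<in> carrier A \<Longrightarrow> m \<in> carrier M \<Longrightarrow>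
      ract M (lact M a m) b = lact M a (ract M m b)"
    and "bilin A M M (lact M)" "bilin M A M (ract M)"
  using assms by (auto simp: bimodule_def left_module_def bilin_def lin_maps_def)

definition trilin :: "('k, 'v, 'e) module_scheme \<Rightarrow> ('k, 'w, 'f) module_scheme \<Rightarrow>
    ('k, 'x, 'g) module_scheme \<Rightarrow> ('k, 'u, 'h) module_scheme \<Rightarrow> ('v \<Rightarrow> 'w \<Rightarrow> 'x \<Rightarrow> 'u) \<Rightarrow> bool"
  where "trilin V W X U \<beta> \<longleftrightarrow> (\<forall>v \<in> carrier V. bilin W X U (\<beta> v)) \<and>
    (\<forall>w \<in> carrier W. \<forall>x \<in> carrier X. (\<lambda>v. \<beta> v w x) \<in> Lin V U)"

lemma trilinI [lin_intro]:
  assumes "\<And>w x. w \<in> carrier W \<Longrightarrow> x \<in> carrier X \<Longrightarrow> (\<lambda>v. \<beta> v w x) \<in> Lin V U"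
    and "\<And>v x. v \<in> carrier V \<Longrightarrow> x \<in> carrier X \<Longrightarrow> (\<lambda>w. \<beta> v w x) \<in> Lin W U"
    and "\<And>v w. v \<in> carrier V \<Longrightarrow> w \<in> carrier W \<Longrightarrow> (\<lambda>x. \<beta> v w x) \<in> Lin X U"
  shows "trilin V W X U (\<lambda>v w x. \<beta> v w x)"
  using assms by (simp add: trilin_def bilin_def)

lemma trilinD:
  assumes "trilin V W X U \<beta>"
  shows "w \<in> carrier W \<Longrightarrow> x \<in> carrier X \<Longrightarrow> (\<lambda>v. \<beta> v w x) \<in> Lin V U"
    and "v \<in> carrier V \<Longrightarrow> x \<in> carrier X \<Longrightarrow> (\<lambda>w. \<beta> v w x) \<in> Lin W U"
    and "v \<in> carrier V \<Longrightarrow> w \<in> carrier W \<Longrightarrow> (\<lambda>x. \<beta> v w x) \<in> Lin X U"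
    and "v \<in> carrier V \<Longrightarrow> w \<in> carrier W \<Longrightarrow> x \<in> carrier X \<Longrightarrow> \<beta> v w x \<in> carrier U"
    and "v \<in> carrier V \<Longrightarrow> bilin W X U (\<beta> v)"
    and "x \<in> carrier X \<Longrightarrow> bilin V W U (\<lambda>v w. \<beta> v w x)"
  using assms Lin_closed[of "\<lambda>v. \<beta> v w x" V U v] by (auto simp: trilin_def bilin_def)

lemma tensor_assoc_lift:
  assumes [simp]: "VS U" "VS V" "VS W" and P: "P \<in> carrier ((U \<boxtimes> V) \<boxtimes> W)"
  shows "tensor_assoc K U V W P = lift (U \<boxtimes> V) W (U \<boxtimes> V \<boxtimes> W) P
    (\<lambda>x w. lift U V (U \<boxtimes> V \<boxtimes> W) x (\<lambda>u v. tens K U (V \<boxtimes> W) u (tens K V W v w)))"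
proof -
  have "tensor_assoc K U V W P = lift (U \<boxtimes> V) W (U \<boxtimes> V \<boxtimes> W) P
    (\<lambda>x w. pres_lift K (U \<boxtimes> V \<boxtimes> W) (\<lambda>(u, v). tens K U (V \<boxtimes> W) u (tens K V W v w)) x)"
    unfolding tensor_assoc_def Let_def
    by (rule pres_lift_eq_lift) (auto simp: P pres_lift_eq_lift[where V = U and W = V])
  also have "\<dots> = lift (U \<boxtimes> V) W (U \<boxtimes> V \<boxtimes> W) P
    (\<lambda>x w. lift U V (U \<boxtimes> V \<boxtimes> W) x (\<lambda>u v. tens K U (V \<boxtimes> W) u (tens K V W v w)))"
    by (rule lift_cong[OF refl]) (simp add: pres_lift_eq_lift[where V = U and W = V])
  finally show ?thesis .
qed

lemma right_comodule_assoc_lift: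
  fixes H :: "('k, 'h) hopf"
  assumes [simp]: "VS V" "VS H" and \<delta>: "\<delta> \<in> Lin V (V \<boxtimes> H)" and v: "v \<in> carrier V"
  shows "tensor_assoc K V H H (tensor_map K (V \<boxtimes> H) H \<delta> id (\<delta> v)) =
    lift V H (V \<boxtimes> H \<boxtimes> H) (\<delta> v) (\<lambda>v0 h. lift V H (V \<boxtimes> H \<boxtimes> H) (\<delta> v0)
      (\<lambda>a b. tens K V (H \<boxtimes> H) a (tens K H H b h)))"
proof -
  note [simp] = Lin_closed[OF \<delta>] and [lin_intro] = Lin_comp[OF \<delta>]
  have "tensor_map K (V \<boxtimes> H) H \<delta> id (\<delta> v) =
    lift V H ((V \<boxtimes> H) \<boxtimes> H) (\<delta> v) (\<lambda>x y. tens K (V \<boxtimes> H) H (\<delta> x) y)"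
    using v by (simp add: tensor_map_lift[where X = V and Y = H])
  moreover have "bilin (V \<boxtimes> H) H (V \<boxtimes> H \<boxtimes> H) (\<lambda>x w. lift V H (V \<boxtimes> H \<boxtimes> H) x
      (\<lambda>u v. tens K V (H \<boxtimes> H) u (tens K H H v w)))"
    by (intro lin_intro) simp_all
  ultimately show ?thesis
    using v by (simp add: tensor_assoc_lift lift_lift lift_tens)
qed

end

section \<open>Sweedler calculus for a Hopf algebra and its comodules\<close>

locale hopf_alg = base_field K for K :: "'k ring" +
  fixes H :: "('k, 'h) hopf"
  assumes hopf: "hopf_algebra K H"
begin

lemma algebra_H: "assoc_algebra K H"
  using hopf by (simp add: hopf_algebra_def)

lemmas H_simps [simp] = assoc_algebraD(1-5)[OF algebra_H]
lemmas [lin_intro] = Lin_bilin[OF assoc_algebraD(7)[OF algebra_H]]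

lemma comodule_H: "right_comodule K H H (comult H)"
  using hopf by (simp add: hopf_algebra_def)

lemma comult_hom: "comult H \<in> algebra_homs K H (tensor_algebra_prod K H H)"
  using hopf by (simp add: hopf_algebra_def)

lemma antipode_Lin: "antipode H \<in> Lin H H"
  using hopf by (simp add: hopf_algebra_def)

lemmas antipode_closed [simp] = Lin_closed[OF antipode_Lin]
lemmas [lin_intro] = Lin_comp[OF antipode_Lin]

lemma counit_closed [simp]: "h \<in> carrier H \<Longrightarrow> counit H h \<in> carrier K"
  using hopf by (auto simp: hopf_algebra_def ring_hom_def)

lemma counit_Lin [lin_intro]:
  assumes "f \<in> Lin X H" "u \<in> carrier U" "VS U"
  shows "(\<lambda>x. counit H (f x) \<odot>\<^bsub>U\<^esub> u) \<in> Lin X U"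
proof -
  interpret U: module K U by (rule assms(3))
  have "(\<lambda>h. counit H h \<odot>\<^bsub>U\<^esub> u) \<in> Lin H U"
    using hopf assms(2) by (intro Lin_I)
      (auto simp: hopf_algebra_def ring_hom_add U.smult_l_distr U.smult_assoc1)
  from Lin_comp[OF this assms(1)] show ?thesis .
qed

lemma counit_Lin' [lin_intro]:
  assumes "f \<in> Lin X U" "h \<in> carrier H" "VS U"
  shows "(\<lambda>x. counit H h \<odot>\<^bsub>U\<^esub> f x) \<in> Lin X U"
  using assms by (intro Lin_smult_map) auto

lemma counit_mult: "g \<in> carrier H \<Longrightarrow> h \<in> carrier H \<Longrightarrow> counit H (g \<otimes>\<^bsub>H\<^esub> h) = counit H g \<otimes>\<^bsub>K\<^esub> counit H h"
  using hopf by (auto simp: hopf_algebra_def ring_hom_def)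

lemma counit_one: "counit H \<one>\<^bsub>H\<^esub> = \<one>\<^bsub>K\<^esub>"
  using hopf by (auto simp: hopf_algebra_def ring_hom_def)

lemma right_comoduleD:
  assumes "right_comodule K H V \<delta>"
  shows "VS V" "\<delta> \<in> Lin V (V \<boxtimes> H)"
  using assms by (simp_all add: right_comodule_def)

text \<open>The comodule axiom is an equation in V \<otimes> (H \<otimes> H). A trilinear \<beta>
  factors through this space by the linear map \<open>G\<close>, and applying \<open>G\<close> to
  both sides gives the form in which the axiom is used in every later computation.\<close>

lemma coassoc:
  assumes com: "right_comodule K H V \<delta>" and U [simp]: "VS U" and v: "v \<in> carrier V"
    and b: "trilin V H H U \<beta>"
  shows "lift V H U (\<delta> v) (\<lambda>v0 h. lift V H U (\<delta> v0) (\<lambda>a b. \<beta> a b h)) =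
    lift V H U (\<delta> v) (\<lambda>v0 h. lift H H U (comult H h) (\<lambda>b c. \<beta> v0 b c))"
proof -
  note \<delta> = right_comoduleD(2)[OF com] and D = right_comoduleD(2)[OF comodule_H]
  note [simp] = right_comoduleD(1)[OF com] Lin_closed[OF \<delta>] Lin_closed[OF D] trilinD(4)[OF b]
  note [lin_intro] = Lin_comp[OF \<delta>] trilinD(1-3,5,6)[OF b]
  define G where "G z = lift V (H \<boxtimes> H) U z (\<lambda>v w. lift H H U w (\<beta> v))" for z
  have bG: "bilin V (H \<boxtimes> H) U (\<lambda>v w. lift H H U w (\<beta> v))"
    by (intro lin_intro) simp_all
  have G: "G \<in> Lin (V \<boxtimes> H \<boxtimes> H) U"
    unfolding G_def by (intro lift_Lin bG) simp_all
  have Gt: "G (tens K V (H \<boxtimes> H) x w) = lift H H U w (\<beta> x)" if "x \<in> carrier V" "w \<in> carrier (H \<boxtimes> H)" for x w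
    unfolding G_def using that by (simp add: lift_tens[OF _ _ _ bG])
  have push: "G (lift V H (V \<boxtimes> H \<boxtimes> H) P \<gamma>) = lift V H U P (\<lambda>x y. G (\<gamma> x y))"
    if "P \<in> carrier (V \<boxtimes> H)" "\<And>x y. x \<in> carrier V \<Longrightarrow> y \<in> carrier H \<Longrightarrow> \<gamma> x y \<in> carrier (V \<boxtimes> H \<boxtimes> H)" for P \<gamma>
    by (rule Lin_lift) (use that G in auto)
  have "G (tensor_assoc K V H H (tensor_map K (V \<boxtimes> H) H \<delta> id (\<delta> v))) =
    lift V H U (\<delta> v) (\<lambda>v0 h. lift V H U (\<delta> v0) (\<lambda>a b. \<beta> a b h))"
    using v by (simp add: right_comodule_assoc_lift[OF _ _ \<delta> v] push Gt lift_tens trilinD(5)[OF b])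
  moreover have "G (tensor_map K V (H \<boxtimes> H) id (comult H) (\<delta> v)) =
    lift V H U (\<delta> v) (\<lambda>v0 h. lift H H U (comult H h) (\<lambda>b c. \<beta> v0 b c))"
    using v by (simp add: tensor_map_lift[where X = V and Y = H] push Gt)
  ultimately show ?thesis using com v by (simp add: right_comodule_def)
qed

lemma counit_right:
  assumes com: "right_comodule K H V \<delta>" and v: "v \<in> carrier V"
  shows "lift V H V (\<delta> v) (\<lambda>v0 h. counit H h \<odot>\<^bsub>V\<^esub> v0) = v"
proof -
  note [simp] = right_comoduleD(1)[OF com] Lin_closed[OF right_comoduleD(2)[OF com]]
  show ?thesis using com v
    by (subst pres_lift_eq_lift[symmetric]) (auto simp: right_comodule_def)
qed

lemma counit_right_lift:
  assumes com: "right_comodule K H V \<delta>" and v: "v \<in> carrier V" and "VS U" and f: "f \<in> Lin V U"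
  shows "lift V H U (\<delta> v) (\<lambda>v0 h. counit H h \<odot>\<^bsub>U\<^esub> f v0) = f v"
proof -
  note [simp] = right_comoduleD(1)[OF com] Lin_closed[OF right_comoduleD(2)[OF com]]
    Lin_smult[OF f] assms(3)
  have "f (lift V H V (\<delta> v) (\<lambda>v0 h. counit H h \<odot>\<^bsub>V\<^esub> v0)) = lift V H U (\<delta> v) (\<lambda>v0 h. counit H h \<odot>\<^bsub>U\<^esub> f v0)"
    using v by (subst Lin_lift[where f = f and U = V and U' = U]) (auto simp: f)
  then show ?thesis by (simp add: counit_right[OF com v])
qed

lemma right_comoduleI:
  assumes V [simp]: "VS V" and \<delta>: "\<delta> \<in> Lin V (V \<boxtimes> H)"
    and "\<And>v. v \<in> carrier V \<Longrightarrow>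
      lift V H (V \<boxtimes> H \<boxtimes> H) (\<delta> v) (\<lambda>v0 h. lift V H (V \<boxtimes> H \<boxtimes> H) (\<delta> v0) (\<lambda>a b. tens K V (H \<boxtimes> H) a (tens K H H b h))) =
      lift V H (V \<boxtimes> H \<boxtimes> H) (\<delta> v) (\<lambda>v0 h. tens K V (H \<boxtimes> H) v0 (comult H h))"
    and "\<And>v. v \<in> carrier V \<Longrightarrow> lift V H V (\<delta> v) (\<lambda>v0 h. counit H h \<odot>\<^bsub>V\<^esub> v0) = v"
  shows "right_comodule K H V \<delta>"
proof -
  note [simp] = Lin_closed[OF \<delta>] Lin_closed[OF right_comoduleD(2)[OF comodule_H]]
  show ?thesis
    unfolding right_comodule_def
  proof (intro conjI ballI V \<delta>)
    fix v assume v: "v \<in> carrier V"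
    show "tensor_assoc K V H H (tensor_map K (V \<boxtimes> H) H \<delta> id (\<delta> v)) =
        tensor_map K V (H \<boxtimes> H) id (comult H) (\<delta> v)"
      unfolding right_comodule_assoc_lift[OF V H_simps(1) \<delta> v]
      using v by (simp add: tensor_map_lift[where X = V and Y = H] assms(3))
    show "pres_lift K V (\<lambda>(v\<^sub>0, v\<^sub>1). counit H v\<^sub>1 \<odot>\<^bsub>V\<^esub> v\<^sub>0) (\<delta> v) = v"
      using v by (simp add: pres_lift_eq_lift[where V = V and W = H] assms(4))
  qed
qed

end

context hopf_alg
begin

lemmas comult_Lin = right_comoduleD(2)[OF comodule_H]
lemmas comult_closed [simp] = Lin_closed[OF comult_Lin]
lemmas [lin_intro] = Lin_comp[OF comult_Lin]

lemma counit_left_lift: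
  assumes h: "h \<in> carrier H" and [simp]: "VS U" and f: "f \<in> Lin H U"
  shows "lift H H U (comult H h) (\<lambda>h1 h2. counit H h1 \<odot>\<^bsub>U\<^esub> f h2) = f h"
proof -
  note [simp] = Lin_smult[OF f]
  have "f (lift H H H (comult H h) (\<lambda>h1 h2. counit H h1 \<odot>\<^bsub>H\<^esub> h2)) =
    lift H H U (comult H h) (\<lambda>h1 h2. counit H h1 \<odot>\<^bsub>U\<^esub> f h2)"
    using h by (subst Lin_lift[where f = f and U = H and U' = U]) (auto simp: f)
  moreover have "lift H H H (comult H h) (\<lambda>h1 h2. counit H h1 \<odot>\<^bsub>H\<^esub> h2) = h"
    using hopf h by (subst pres_lift_eq_lift[symmetric]) (auto simp: hopf_algebra_def)
  ultimately show ?thesis by simp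
qed

lemma antipode_lift:
  assumes h: "h \<in> carrier H" and [simp]: "VS U" and f: "f \<in> Lin H U"
  shows "lift H H U (comult H h) (\<lambda>h1 h2. f (antipode H h1 \<otimes>\<^bsub>H\<^esub> h2)) = counit H h \<odot>\<^bsub>U\<^esub> f \<one>\<^bsub>H\<^esub>"
    and "lift H H U (comult H h) (\<lambda>h1 h2. f (h1 \<otimes>\<^bsub>H\<^esub> antipode H h2)) = counit H h \<odot>\<^bsub>U\<^esub> f \<one>\<^bsub>H\<^esub>"
proof -
  have "f (lift H H H (comult H h) (\<lambda>h1 h2. antipode H h1 \<otimes>\<^bsub>H\<^esub> h2)) =
    lift H H U (comult H h) (\<lambda>h1 h2. f (antipode H h1 \<otimes>\<^bsub>H\<^esub> h2))"
    using h by (subst Lin_lift[where f = f and U = H and U' = U]) (auto simp: f)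
  moreover have "lift H H H (comult H h) (\<lambda>h1 h2. antipode H h1 \<otimes>\<^bsub>H\<^esub> h2) = counit H h \<odot>\<^bsub>H\<^esub> \<one>\<^bsub>H\<^esub>"
    using hopf h by (subst pres_lift_eq_lift[symmetric]) (auto simp: hopf_algebra_def)
  ultimately show "lift H H U (comult H h) (\<lambda>h1 h2. f (antipode H h1 \<otimes>\<^bsub>H\<^esub> h2)) = counit H h \<odot>\<^bsub>U\<^esub> f \<one>\<^bsub>H\<^esub>"
    using h by (simp add: Lin_smult[OF f])
  have "f (lift H H H (comult H h) (\<lambda>h1 h2. h1 \<otimes>\<^bsub>H\<^esub> antipode H h2)) =
    lift H H U (comult H h) (\<lambda>h1 h2. f (h1 \<otimes>\<^bsub>H\<^esub> antipode H h2))"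
    using h by (subst Lin_lift[where f = f and U = H and U' = U]) (auto simp: f)
  moreover have "lift H H H (comult H h) (\<lambda>h1 h2. h1 \<otimes>\<^bsub>H\<^esub> antipode H h2) = counit H h \<odot>\<^bsub>H\<^esub> \<one>\<^bsub>H\<^esub>"
    using hopf h by (subst pres_lift_eq_lift[symmetric]) (auto simp: hopf_algebra_def)
  ultimately show "lift H H U (comult H h) (\<lambda>h1 h2. f (h1 \<otimes>\<^bsub>H\<^esub> antipode H h2)) = counit H h \<odot>\<^bsub>U\<^esub> f \<one>\<^bsub>H\<^esub>"
    using h by (simp add: Lin_smult[OF f])
qed

text \<open>On Hom(H, N), convolution with the identity of H and convolution with the antipode are
  mutually inverse: h_1 S(h_2) m(h_3) = m(h) = S(h_1) h_2 m(h_3).\<close>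

lemma convolution_cancel:
  assumes N [simp]: "VS N" and act: "bilin H N N act"
    and act_mult: "\<And>g h n. g \<in> carrier H \<Longrightarrow> h \<in> carrier H \<Longrightarrow> n \<in> carrier N \<Longrightarrow> act (g \<otimes>\<^bsub>H\<^esub> h) n = act g (act h n)"
    and act_one: "\<And>n. n \<in> carrier N \<Longrightarrow> act \<one>\<^bsub>H\<^esub> n = n"
    and m: "m \<in> Lin H N" and h: "h \<in> carrier H"
  shows "lift H H N (comult H h) (\<lambda>h1 h2. act h1 (lift H H N (comult H h2) (\<lambda>a b. act (antipode H a) (m b)))) = m h"
    and "lift H H N (comult H h) (\<lambda>h1 h2. act (antipode H h1) (lift H H N (comult H h2) (\<lambda>a b. act a (m b)))) = m h"
proof -
  note [simp] = bilinD(3)[OF act] Lin_closed[OF m] h act_one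
  note [lin_intro] = Lin_bilin[OF act] Lin_comp[OF m]
  have "lift H H N (comult H h) (\<lambda>h1 h2. act h1 (lift H H N (comult H h2) (\<lambda>a b. act (antipode H a) (m b)))) =
    lift H H N (comult H h) (\<lambda>h1 h2. lift H H N (comult H h2) (\<lambda>a b. act h1 (act (antipode H a) (m b))))"
    by (rule lift_cong[OF refl]) (simp add: Lin_lift[OF _ _ _ _ _ _ bilinD(1)[OF act]])
  also have "\<dots> = lift H H N (comult H h) (\<lambda>h0 c. lift H H N (comult H h0) (\<lambda>a b. act a (act (antipode H b) (m c))))"
    by (rule coassoc[OF comodule_H _ _, symmetric]; (intro lin_intro)?) simp_all
  also have "\<dots> = lift H H N (comult H h) (\<lambda>h0 c. lift H H N (comult H h0) (\<lambda>a b. act (a \<otimes>\<^bsub>H\<^esub> antipode H b) (m c)))"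
    by (simp add: act_mult)
  also have "\<dots> = m h"
    by (simp add: antipode_lift(2)[OF _ _ bilinD(2)[OF act]] counit_left_lift m)
  finally show "lift H H N (comult H h) (\<lambda>h1 h2. act h1 (lift H H N (comult H h2) (\<lambda>a b. act (antipode H a) (m b)))) = m h" .
  have "lift H H N (comult H h) (\<lambda>h1 h2. act (antipode H h1) (lift H H N (comult H h2) (\<lambda>a b. act a (m b)))) =
    lift H H N (comult H h) (\<lambda>h1 h2. lift H H N (comult H h2) (\<lambda>a b. act (antipode H h1) (act a (m b))))"
    by (rule lift_cong[OF refl]) (simp add: Lin_lift[OF _ _ _ _ _ _ bilinD(1)[OF act]])
  also have "\<dots> = lift H H N (comult H h) (\<lambda>h0 c. lift H H N (comult H h0) (\<lambda>a b. act (antipode H a) (act b (m c))))"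
    by (rule coassoc[OF comodule_H _ _, symmetric]; (intro lin_intro)?) simp_all
  also have "\<dots> = lift H H N (comult H h) (\<lambda>h0 c. lift H H N (comult H h0) (\<lambda>a b. act (antipode H a \<otimes>\<^bsub>H\<^esub> b) (m c)))"
    by (simp add: act_mult)
  also have "\<dots> = m h"
    by (simp add: antipode_lift(1)[OF _ _ bilinD(2)[OF act]] counit_left_lift m)
  finally show "lift H H N (comult H h) (\<lambda>h1 h2. act (antipode H h1) (lift H H N (comult H h2) (\<lambda>a b. act a (m b)))) = m h" .
qed

end

text \<open>The coaction is a parameter of its own rather than a field of A, so that H with its
  coproduct is an instance.\<close>

locale comod_alg = hopf_alg K H for K :: "'k ring" and H :: "('k, 'h) hopf" +
  fixes A :: "('k, 'a, 'e) module_scheme" and \<delta> :: "'a \<Rightarrow> ('a \<times> 'h \<Rightarrow> 'k) set"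
  assumes algebra_A: "assoc_algebra K A" and comodule_A: "right_comodule K H A \<delta>"
    and coaction_hom: "\<delta> \<in> algebra_homs K A (tensor_algebra_prod K A H)"
begin

lemmas A_simps [simp] = assoc_algebraD(1-5)[OF algebra_A]
lemmas [lin_intro] = Lin_bilin[OF assoc_algebraD(7)[OF algebra_A]]

lemmas coaction_Lin = right_comoduleD(2)[OF comodule_A]
lemmas coaction_closed [simp] = Lin_closed[OF coaction_Lin]
lemmas [lin_intro] = Lin_comp[OF coaction_Lin]

lemma coaction_one: "\<delta> \<one>\<^bsub>A\<^esub> = tens K A H \<one>\<^bsub>A\<^esub> \<one>\<^bsub>H\<^esub>"
  using coaction_hom by (simp add: algebra_homs_def ring_hom_def tensor_algebra_prod_def Let_def)

lemma coaction_mult: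
  assumes [simp]: "a \<in> carrier A" "b \<in> carrier A"
  shows "\<delta> (a \<otimes>\<^bsub>A\<^esub> b) = lift A H (A \<boxtimes> H) (\<delta> a) (\<lambda>a0 a1. lift A H (A \<boxtimes> H) (\<delta> b)
    (\<lambda>b0 b1. tens K A H (a0 \<otimes>\<^bsub>A\<^esub> b0) (a1 \<otimes>\<^bsub>H\<^esub> b1)))"
proof -
  have "\<delta> (a \<otimes>\<^bsub>A\<^esub> b) = pres_lift K (A \<boxtimes> H) (\<lambda>(a0, a1). pres_lift K (A \<boxtimes> H)
    (\<lambda>(b0, b1). tens K A H (a0 \<otimes>\<^bsub>A\<^esub> b0) (a1 \<otimes>\<^bsub>H\<^esub> b1)) (\<delta> b)) (\<delta> a)"
    using coaction_hom by (simp add: algebra_homs_def ring_hom_def tensor_algebra_prod_def Let_def)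
  also have "\<dots> = lift A H (A \<boxtimes> H) (\<delta> a) (\<lambda>a0 a1. pres_lift K (A \<boxtimes> H)
    (\<lambda>(b0, b1). tens K A H (a0 \<otimes>\<^bsub>A\<^esub> b0) (a1 \<otimes>\<^bsub>H\<^esub> b1)) (\<delta> b))"
    by (rule pres_lift_eq_lift) (auto simp: pres_lift_eq_lift[where V = A and W = H])
  finally show ?thesis by (simp add: pres_lift_eq_lift[where V = A and W = H])
qed

lemma coaction_mult_lift:
  assumes [simp]: "a \<in> carrier A" "b \<in> carrier A" "VS U" and \<beta>: "bilin A H U \<beta>"
  shows "lift A H U (\<delta> (a \<otimes>\<^bsub>A\<^esub> b)) \<beta> = lift A H U (\<delta> a) (\<lambda>a0 a1. lift A H U (\<delta> b)
    (\<lambda>b0 b1. \<beta> (a0 \<otimes>\<^bsub>A\<^esub> b0) (a1 \<otimes>\<^bsub>H\<^esub> b1)))"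
  by (simp add: coaction_mult lift_lift[OF _ _ _ _ _ _ \<beta>] lift_tens[OF _ _ _ \<beta>] bilinD(3)[OF \<beta>])

text \<open>Coassociativity for two elements at once. Since \<open>coassoc\<close> needs its two
  sums to be nested directly, the sums belonging to a and to b are exchanged before and after its
  two applications.\<close>

lemma double_coassoc:
  assumes [simp]: "VS U" "a \<in> carrier A" "b \<in> carrier A"
    and l: "\<And>h k b x y. h \<in> carrier H \<Longrightarrow> k \<in> carrier H \<Longrightarrow> b \<in> carrier A \<Longrightarrow> x \<in> carrier H \<Longrightarrow>
        y \<in> carrier H \<Longrightarrow> (\<lambda>a. \<beta> a h k b x y) \<in> Lin A U"
      "\<And>a k b x y. a \<in> carrier A \<Longrightarrow> k \<in> carrier H \<Longrightarrow> b \<in> carrier A \<Longrightarrow> x \<in> carrier H \<Longrightarrow>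
        y \<in> carrier H \<Longrightarrow> (\<lambda>h. \<beta> a h k b x y) \<in> Lin H U"
      "\<And>a h b x y. a \<in> carrier A \<Longrightarrow> h \<in> carrier H \<Longrightarrow> b \<in> carrier A \<Longrightarrow> x \<in> carrier H \<Longrightarrow>
        y \<in> carrier H \<Longrightarrow> (\<lambda>k. \<beta> a h k b x y) \<in> Lin H U"
      "\<And>a h k x y. a \<in> carrier A \<Longrightarrow> h \<in> carrier H \<Longrightarrow> k \<in> carrier H \<Longrightarrow> x \<in> carrier H \<Longrightarrow>
        y \<in> carrier H \<Longrightarrow> (\<lambda>b. \<beta> a h k b x y) \<in> Lin A U"
      "\<And>a h k b y. a \<in> carrier A \<Longrightarrow> h \<in> carrier H \<Longrightarrow> k \<in> carrier H \<Longrightarrow> b \<in> carrier A \<Longrightarrow>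
        y \<in> carrier H \<Longrightarrow> (\<lambda>x. \<beta> a h k b x y) \<in> Lin H U"
      "\<And>a h k b x. a \<in> carrier A \<Longrightarrow> h \<in> carrier H \<Longrightarrow> k \<in> carrier H \<Longrightarrow> b \<in> carrier A \<Longrightarrow>
        x \<in> carrier H \<Longrightarrow> (\<lambda>y. \<beta> a h k b x y) \<in> Lin H U"
  shows "lift A H U (\<delta> a) (\<lambda>a0 h. lift A H U (\<delta> b) (\<lambda>b0 k.
      lift A H U (\<delta> a0) (\<lambda>a00 h0. lift A H U (\<delta> b0) (\<lambda>b00 k0. \<beta> a00 h0 h b00 k0 k)))) =
    lift A H U (\<delta> a) (\<lambda>a0 h. lift A H U (\<delta> b) (\<lambda>b0 k.
      lift H H U (comult H h) (\<lambda>h1 h2. lift H H U (comult H k) (\<lambda>k1 k2. \<beta> a0 h1 h2 b0 k1 k2))))"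
    (is "?L = ?R")
proof -
  have cl [simp]: "\<beta> a h k b x y \<in> carrier U"
    if "a \<in> carrier A" "h \<in> carrier H" "k \<in> carrier H" "b \<in> carrier A" "x \<in> carrier H" "y \<in> carrier H"
    for a h k b x y
    using Lin_closed[OF l(1)] that by blast
  note [lin_intro] = l
  have "?L = lift A H U (\<delta> a) (\<lambda>a0 h. lift A H U (\<delta> a0) (\<lambda>a00 h0.
    lift A H U (\<delta> b) (\<lambda>b0 k. lift A H U (\<delta> b0) (\<lambda>b00 k0. \<beta> a00 h0 h b00 k0 k))))"
    by (intro lift_cong refl lift_swap) simp_all
  also have "\<dots> = lift A H U (\<delta> a) (\<lambda>a0 h. lift A H U (\<delta> a0) (\<lambda>a00 h0.
    lift A H U (\<delta> b) (\<lambda>b0 k. lift H H U (comult H k) (\<lambda>k1 k2. \<beta> a00 h0 h b0 k1 k2))))"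
    by (intro lift_cong refl coassoc[OF comodule_A] lin_intro) simp_all
  also have "\<dots> = lift A H U (\<delta> a) (\<lambda>a0 h. lift H H U (comult H h) (\<lambda>h1 h2.
    lift A H U (\<delta> b) (\<lambda>b0 k. lift H H U (comult H k) (\<lambda>k1 k2. \<beta> a0 h1 h2 b0 k1 k2))))"
    by (intro coassoc[OF comodule_A] lin_intro) simp_all
  also have "\<dots> = ?R"
    by (intro lift_cong refl lift_swap) simp_all
  finally show ?thesis .
qed

text \<open>The action of an element of A \<otimes> H on X \<otimes> Y through p and q on the
  factors; at \<open>\<delta> a\<close> this is the diagonal action of a. In p and q the acting
  element comes first, also when they are right actions.\<close>

definition tact :: "('k, 'x, 'f) module_scheme \<Rightarrow> ('k, 'y, 'g) module_scheme \<Rightarrow> ('a \<Rightarrow> 'x \<Rightarrow> 'x) \<Rightarrow>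
    ('h \<Rightarrow> 'y \<Rightarrow> 'y) \<Rightarrow> ('a \<times> 'h \<Rightarrow> 'k) set \<Rightarrow> ('x \<times> 'y \<Rightarrow> 'k) set \<Rightarrow> ('x \<times> 'y \<Rightarrow> 'k) set"
  where "tact X Y p q t n = lift A H (X \<boxtimes> Y) t (\<lambda>a h. lift X Y (X \<boxtimes> Y) n (\<lambda>x y. tens K X Y (p a x) (q h y)))"

context
  fixes X :: "('k, 'x, 'f) module_scheme" and Y :: "('k, 'y, 'g) module_scheme" and p q
  assumes VX [simp]: "VS X" and VY [simp]: "VS Y" and p: "bilin A X X p" and q: "bilin H Y Y q"
begin

lemma tact_bilin: "bilin (A \<boxtimes> H) (X \<boxtimes> Y) (X \<boxtimes> Y) (tact X Y p q)"
proof -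
  note [simp] = bilinD(3)[OF p] bilinD(3)[OF q]
  note [lin_intro] = Lin_bilin[OF p] Lin_bilin[OF q]
  show ?thesis unfolding tact_def by (intro lin_intro) simp_all
qed

lemma tact_lift_tens:
  assumes "t \<in> carrier (A \<boxtimes> H)" "x \<in> carrier X" "y \<in> carrier Y"
  shows "tact X Y p q t (tens K X Y x y) = lift A H (X \<boxtimes> Y) t (\<lambda>a h. tens K X Y (p a x) (q h y))"
proof -
  note [simp] = bilinD(3)[OF p] bilinD(3)[OF q]
  have "bilin X Y (X \<boxtimes> Y) (\<lambda>x y. tens K X Y (p a x) (q h y))"
    if "a \<in> carrier A" "h \<in> carrier H" for a h
    using that by (intro lin_intro Lin_bilin[OF p] Lin_bilin[OF q]) simp_all
  then show ?thesis using assms unfolding tact_def by (simp add: lift_tens)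
qed

lemma tact_tact:
  assumes p': "bilin A X X p'" and q': "bilin H Y Y q'"
    and [simp]: "s \<in> carrier (A \<boxtimes> H)" "t \<in> carrier (A \<boxtimes> H)" "n \<in> carrier (X \<boxtimes> Y)"
  shows "tact X Y p q s (tact X Y p' q' t n) = lift A H (X \<boxtimes> Y) s (\<lambda>a h. lift A H (X \<boxtimes> Y) t (\<lambda>b k.
    lift X Y (X \<boxtimes> Y) n (\<lambda>x y. tens K X Y (p a (p' b x)) (q h (q' k y)))))"
proof -
  note [simp] = bilinD(3)[OF p] bilinD(3)[OF q] bilinD(3)[OF p'] bilinD(3)[OF q']
  have b: "bilin X Y (X \<boxtimes> Y) (\<lambda>x y. tens K X Y (p a x) (q h y))"
    if "a \<in> carrier A" "h \<in> carrier H" for a h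
    using that by (intro lin_intro Lin_bilin[OF p] Lin_bilin[OF q]) simp_all
  then show ?thesis unfolding tact_def by (simp add: lift_lift lift_tens)
qed

lemma tact_mult:
  assumes "a \<in> carrier A" "b \<in> carrier A" "n \<in> carrier (X \<boxtimes> Y)"
    "\<And>a b x. a \<in> carrier A \<Longrightarrow> b \<in> carrier A \<Longrightarrow> x \<in> carrier X \<Longrightarrow> p (a \<otimes>\<^bsub>A\<^esub> b) x = p a (p b x)"
    "\<And>g h y. g \<in> carrier H \<Longrightarrow> h \<in> carrier H \<Longrightarrow> y \<in> carrier Y \<Longrightarrow> q (g \<otimes>\<^bsub>H\<^esub> h) y = q g (q h y)"
  shows "tact X Y p q (\<delta> (a \<otimes>\<^bsub>A\<^esub> b)) n = tact X Y p q (\<delta> a) (tact X Y p q (\<delta> b) n)"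
proof -
  note [simp] = bilinD(3)[OF p] bilinD(3)[OF q]
  have "bilin A H (X \<boxtimes> Y) (\<lambda>a h. lift X Y (X \<boxtimes> Y) n (\<lambda>x y. tens K X Y (p a x) (q h y)))"
    using assms(3) by (intro lin_intro Lin_bilin[OF p] Lin_bilin[OF q]) simp_all
  then show ?thesis
    using assms by (subst tact_tact[OF p q]) (simp_all add: tact_def coaction_mult_lift)
qed

lemma tact_commute:
  assumes p': "bilin A X X p'" and q': "bilin H Y Y q'"
    and n [simp]: "s \<in> carrier (A \<boxtimes> H)" "t \<in> carrier (A \<boxtimes> H)" "n \<in> carrier (X \<boxtimes> Y)"
    and "\<And>a b x. a \<in> carrier A \<Longrightarrow> b \<in> carrier A \<Longrightarrow> x \<in> carrier X \<Longrightarrow> p a (p' b x) = p' b (p a x)"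
    "\<And>g h y. g \<in> carrier H \<Longrightarrow> h \<in> carrier H \<Longrightarrow> y \<in> carrier Y \<Longrightarrow> q g (q' h y) = q' h (q g y)"
  shows "tact X Y p q s (tact X Y p' q' t n) = lift A H (X \<boxtimes> Y) t (\<lambda>b k. lift A H (X \<boxtimes> Y) s (\<lambda>a h.
    lift X Y (X \<boxtimes> Y) n (\<lambda>x y. tens K X Y (p' b (p a x)) (q' k (q h y)))))"
proof -
  note [simp] = bilinD(3)[OF p] bilinD(3)[OF q] bilinD(3)[OF p'] bilinD(3)[OF q']
  have "tact X Y p q s (tact X Y p' q' t n) = lift A H (X \<boxtimes> Y) s (\<lambda>a h. lift A H (X \<boxtimes> Y) t (\<lambda>b k.
    lift X Y (X \<boxtimes> Y) n (\<lambda>x y. tens K X Y (p' b (p a x)) (q' k (q h y)))))"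
    by (simp add: tact_tact[OF p' q'] assms(6,7))
  also have "\<dots> = lift A H (X \<boxtimes> Y) t (\<lambda>b k. lift A H (X \<boxtimes> Y) s (\<lambda>a h.
    lift X Y (X \<boxtimes> Y) n (\<lambda>x y. tens K X Y (p' b (p a x)) (q' k (q h y)))))"
    by (rule lift_swap) simp_all
  finally show ?thesis .
qed

end

end

section \<open>Covariant calculi\<close>

context base_field
begin

lemma lift_add:
  assumes "VS V" "VS W" "VS U" "P \<in> carrier (V \<boxtimes> W)"
    "\<And>v w. v \<in> carrier V \<Longrightarrow> w \<in> carrier W \<Longrightarrow> \<beta> v w \<in> carrier U"
    "\<And>v w. v \<in> carrier V \<Longrightarrow> w \<in> carrier W \<Longrightarrow> \<gamma> v w \<in> carrier U"
  shows "lift V W U P (\<lambda>v w. \<beta> v w \<oplus>\<^bsub>U\<^esub> \<gamma> v w) = lift V W U P \<beta> \<oplus>\<^bsub>U\<^esub> lift V W U P \<gamma>"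
proof -
  interpret T: presentation K "carrier V \<times> carrier W" "bilin_rels K V W"
    by (rule presentation_tensor[OF assms(1,2)])
  interpret U: module K U by (rule assms(3))
  have r: "T.rep P \<in> carrier (free_space K (carrier V \<times> carrier W))"
    using T.rep(2) assms(4) by (simp add: tensor_space_def)
  let ?r = "T.rep P" and ?E = "\<lambda>\<beta> (v, w). if v \<in> carrier V \<and> w \<in> carrier W then \<beta> v w else \<zero>\<^bsub>U\<^esub>"
  have "finsum U (\<lambda>x. ?r x \<odot>\<^bsub>U\<^esub> ?E (\<lambda>v w. \<beta> v w \<oplus>\<^bsub>U\<^esub> \<gamma> v w) x) {x. ?r x \<noteq> \<zero>\<^bsub>K\<^esub>} =
    finsum U (\<lambda>x. ?r x \<odot>\<^bsub>U\<^esub> ?E \<beta> x \<oplus>\<^bsub>U\<^esub> ?r x \<odot>\<^bsub>U\<^esub> ?E \<gamma> x) {x. ?r x \<noteq> \<zero>\<^bsub>K\<^esub>}"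
    using r assms(3,5,6) by (intro finsum_cong_VS) (auto simp: free_space_iff U.smult_r_distr)
  also have "\<dots> = finsum U (\<lambda>x. ?r x \<odot>\<^bsub>U\<^esub> ?E \<beta> x) {x. ?r x \<noteq> \<zero>\<^bsub>K\<^esub>} \<oplus>\<^bsub>U\<^esub>
      finsum U (\<lambda>x. ?r x \<odot>\<^bsub>U\<^esub> ?E \<gamma> x) {x. ?r x \<noteq> \<zero>\<^bsub>K\<^esub>}"
    using r assms(3,5,6) by (intro U.finsum_addf) (auto simp: free_space_iff)
  finally show ?thesis by (simp add: lift_def T.pres_lift_rep lin_ext_def)
qed

text \<open>Both actions take the algebra element as their first argument, so that left and right
  actions have the same type and \<open>tact\<close> can serve for either side.\<close>

definition biaction :: "('k, 'a, 'd) module_scheme \<Rightarrow> ('k, 'm, 'e) module_scheme \<Rightarrow>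
    ('a \<Rightarrow> 'm \<Rightarrow> 'm) \<Rightarrow> ('a \<Rightarrow> 'm \<Rightarrow> 'm) \<Rightarrow> bool"
  where "biaction A M l r \<longleftrightarrow> VS M \<and> bilin A M M l \<and> bilin A M M r \<and>
    (\<forall>a \<in> carrier A. \<forall>b \<in> carrier A. \<forall>m \<in> carrier M.
      l (a \<otimes>\<^bsub>A\<^esub> b) m = l a (l b m) \<and> r (a \<otimes>\<^bsub>A\<^esub> b) m = r b (r a m) \<and> l a (r b m) = r b (l a m))"

lemma biactionD:
  assumes "biaction A M l r"
  shows "VS M" "bilin A M M l" "bilin A M M r"
    and "a \<in> carrier A \<Longrightarrow> b \<in> carrier A \<Longrightarrow> m \<in> carrier M \<Longrightarrow> l (a \<otimes>\<^bsub>A\<^esub> b) m = l a (l b m)"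
    and "a \<in> carrier A \<Longrightarrow> b \<in> carrier A \<Longrightarrow> m \<in> carrier M \<Longrightarrow> r (a \<otimes>\<^bsub>A\<^esub> b) m = r b (r a m)"
    and "a \<in> carrier A \<Longrightarrow> b \<in> carrier A \<Longrightarrow> m \<in> carrier M \<Longrightarrow> l a (r b m) = r b (l a m)"
  using assms by (auto simp: biaction_def)

lemma biaction_bimodule:
  assumes "bimodule K A M"
  shows "biaction A M (lact M) (\<lambda>a m. ract M m a)"
  using bimoduleD[OF assms] by (simp add: biaction_def bilin_def)

lemma biaction_regular:
  assumes "assoc_algebra K A"
  shows "biaction A A (mult A) (\<lambda>a m. m \<otimes>\<^bsub>A\<^esub> a)"
  using assoc_algebraD[OF assms] by (simp add: biaction_def bilin_def)

lemma fodcD: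
  assumes "first_order_calculus K A \<Gamma>"
  shows "bimodule K A \<Gamma>" "fdiff \<Gamma> \<in> Lin A \<Gamma>"
    and "a \<in> carrier A \<Longrightarrow> b \<in> carrier A \<Longrightarrow>
      fdiff \<Gamma> (a \<otimes>\<^bsub>A\<^esub> b) = ract \<Gamma> (fdiff \<Gamma> a) b \<oplus>\<^bsub>\<Gamma>\<^esub> lact \<Gamma> a (fdiff \<Gamma> b)"
    and "carrier \<Gamma> = lin_span K \<Gamma> {lact \<Gamma> a (fdiff \<Gamma> b) | a b. a \<in> carrier A \<and> b \<in> carrier A}"
  using assms by (auto simp: first_order_calculus_def)

lemma fodc_submodule:
  assumes \<Gamma>: "first_order_calculus K A \<Gamma>" and N: "submodule N K \<Gamma>" "\<omega> \<in> carrier \<Gamma>"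
    and gen: "\<And>a b. a \<in> carrier A \<Longrightarrow> b \<in> carrier A \<Longrightarrow> lact \<Gamma> a (fdiff \<Gamma> b) \<in> N"
  shows "\<omega> \<in> N"
  using lin_span_least[OF N(1), of "{lact \<Gamma> a (fdiff \<Gamma> b) | a b. a \<in> carrier A \<and> b \<in> carrier A}"]
    fodcD(4)[OF \<Gamma>] N(2) gen by blast

lemma fodc_eqI:
  assumes \<Gamma>: "first_order_calculus K A \<Gamma>" and fg: "f \<in> Lin \<Gamma> U" "g \<in> Lin \<Gamma> U" "VS U" "\<omega> \<in> carrier \<Gamma>"
    and "\<And>a b. a \<in> carrier A \<Longrightarrow> b \<in> carrier A \<Longrightarrow> f (lact \<Gamma> a (fdiff \<Gamma> b)) = g (lact \<Gamma> a (fdiff \<Gamma> b))"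
  shows "f \<omega> = g \<omega>"
proof -
  note B = bimoduleD[OF fodcD(1)[OF \<Gamma>]]
  have "\<omega> \<in> {\<omega> \<in> carrier \<Gamma>. f \<omega> = g \<omega>}"
    by (rule fodc_submodule[OF \<Gamma> Lin_equalizer_submodule[OF fg(1,2) B(1) fg(3)] fg(4)])
      (use assms(6) B Lin_closed[OF fodcD(2)[OF \<Gamma>]] in auto)
  then show ?thesis by simp
qed

text \<open>The linear map \<open>a db \<mapsto> a D(b)\<close> induced by a derivation \<open>D\<close> is bilinear over the algebra:
  \<open>(b dc) a = b d(ca) - bc da\<close>.\<close>

lemma derivation_bilinear:
  assumes A: "assoc_algebra K A" and \<Gamma>: "first_order_calculus K A \<Gamma>" and N: "biaction A N l r"
    and F: "F \<in> Lin \<Gamma> N" and D: "\<And>a. a \<in> carrier A \<Longrightarrow> D a \<in> carrier N"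
    and Leibniz: "\<And>a b. a \<in> carrier A \<Longrightarrow> b \<in> carrier A \<Longrightarrow> D (a \<otimes>\<^bsub>A\<^esub> b) = r b (D a) \<oplus>\<^bsub>N\<^esub> l a (D b)"
    and gen: "\<And>a b. a \<in> carrier A \<Longrightarrow> b \<in> carrier A \<Longrightarrow> F (lact \<Gamma> a (fdiff \<Gamma> b)) = l a (D b)"
    and a: "a \<in> carrier A" and \<omega>: "\<omega> \<in> carrier \<Gamma>"
  shows "F (lact \<Gamma> a \<omega>) = l a (F \<omega>)" "F (ract \<Gamma> \<omega> a) = r a (F \<omega>)"
proof -
  note A' = assoc_algebraD[OF A] and B = bimoduleD[OF fodcD(1)[OF \<Gamma>]] and N' = biactionD[OF N]
  note d = Lin_closed[OF fodcD(2)[OF \<Gamma>]]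
  note [simp] = A'(1,3) B(1-3) N'(1) D d bilinD(3)[OF N'(2)] bilinD(3)[OF N'(3)]
  show "F (lact \<Gamma> a \<omega>) = l a (F \<omega>)"
    by (rule fodc_eqI[OF \<Gamma> Lin_comp[OF F bilinD(1)[OF B(9) a]] Lin_comp[OF bilinD(1)[OF N'(2) a] F] _ \<omega>])
      (use a in \<open>simp_all add: gen N'(4) flip: B(6)\<close>)
  show "F (ract \<Gamma> \<omega> a) = r a (F \<omega>)"
  proof (rule fodc_eqI[OF \<Gamma> Lin_comp[OF F bilinD(2)[OF B(10) a]] Lin_comp[OF bilinD(1)[OF N'(3) a] F] _ \<omega>])
    fix b c assume bc [simp]: "b \<in> carrier A" "c \<in> carrier A"
    interpret N: abelian_group N by (rule abelian_group_VS) simp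
    note [simp] = a Lin_closed[OF F]
    have "F (lact \<Gamma> b (ract \<Gamma> (fdiff \<Gamma> c) a)) \<oplus>\<^bsub>N\<^esub> l (b \<otimes>\<^bsub>A\<^esub> c) (D a) = F (lact \<Gamma> b (fdiff \<Gamma> (c \<otimes>\<^bsub>A\<^esub> a)))"
      by (simp add: fodcD(3)[OF \<Gamma>] Lin_add[OF bilinD(1)[OF B(9)]] Lin_add[OF F] flip: gen B(6))
    also have "\<dots> = l b (r a (D c)) \<oplus>\<^bsub>N\<^esub> l (b \<otimes>\<^bsub>A\<^esub> c) (D a)"
      by (simp add: gen Leibniz Lin_add[OF bilinD(1)[OF N'(2)]] N'(4))
    finally show "F (ract \<Gamma> (lact \<Gamma> b (fdiff \<Gamma> c)) a) = r a (F (lact \<Gamma> b (fdiff \<Gamma> c)))"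
      by (simp add: B(8) gen N'(6))
  qed simp
qed

end

context comod_alg
begin

text \<open>As \<delta> is multiplicative, the diagonal actions are again associative, and left and
  right ones commute because they do so on each factor. Right actions reverse the order of the two
  sums, hence the exchange in their case.\<close>

lemma biaction_tact:
  assumes X: "biaction A X p p'" and Y: "biaction H Y q q'"
  shows "biaction A (X \<boxtimes> Y) (\<lambda>a. tact X Y p q (\<delta> a)) (\<lambda>a. tact X Y p' q' (\<delta> a))"
proof -
  note X' = biactionD[OF X] and Y' = biactionD[OF Y]
  note [simp] = X'(1) Y'(1) bilinD(3)[OF X'(2)] bilinD(3)[OF X'(3)] bilinD(3)[OF Y'(2)] bilinD(3)[OF Y'(3)]
  note b = tact_bilin[OF X'(1) Y'(1) X'(2) Y'(2)] and b' = tact_bilin[OF X'(1) Y'(1) X'(3) Y'(3)]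
  note [simp] = bilinD(3)[OF b] bilinD(3)[OF b']
  show ?thesis
    unfolding biaction_def
  proof (intro conjI ballI)
    show "bilin A (X \<boxtimes> Y) (X \<boxtimes> Y) (\<lambda>a. tact X Y p q (\<delta> a))"
      "bilin A (X \<boxtimes> Y) (X \<boxtimes> Y) (\<lambda>a. tact X Y p' q' (\<delta> a))"
      by (intro lin_intro Lin_bilin[OF b] Lin_bilin[OF b']; simp)+
    fix a b n assume [simp]: "a \<in> carrier A" "b \<in> carrier A" "n \<in> carrier (X \<boxtimes> Y)"
    show "tact X Y p q (\<delta> (a \<otimes>\<^bsub>A\<^esub> b)) n = tact X Y p q (\<delta> a) (tact X Y p q (\<delta> b) n)"
      by (rule tact_mult[OF X'(1) Y'(1) X'(2) Y'(2)]) (simp_all add: X'(4) Y'(4))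
    have "bilin A H (X \<boxtimes> Y) (\<lambda>a h. lift X Y (X \<boxtimes> Y) n (\<lambda>x y. tens K X Y (p' a x) (q' h y)))"
      by (intro lin_intro Lin_bilin[OF X'(3)] Lin_bilin[OF Y'(3)]) simp_all
    moreover have "tact X Y p' q' (\<delta> b) (tact X Y p' q' (\<delta> a) n) =
      lift A H (X \<boxtimes> Y) (\<delta> a) (\<lambda>a h. lift A H (X \<boxtimes> Y) (\<delta> b) (\<lambda>b k.
        lift X Y (X \<boxtimes> Y) n (\<lambda>x y. tens K X Y (p' b (p' a x)) (q' k (q' h y)))))"
      unfolding tact_tact[OF X'(1) Y'(1) X'(3) Y'(3) X'(3) Y'(3) coaction_closed coaction_closed \<open>n \<in> _\<close>, OF \<open>b \<in> _\<close> \<open>a \<in> _\<close>]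
      by (rule lift_swap) simp_all
    ultimately show "tact X Y p' q' (\<delta> (a \<otimes>\<^bsub>A\<^esub> b)) n = tact X Y p' q' (\<delta> b) (tact X Y p' q' (\<delta> a) n)"
      by (simp add: tact_def[of X Y p' q' "\<delta> (a \<otimes>\<^bsub>A\<^esub> b)"] coaction_mult_lift X'(5) Y'(5))
    show "tact X Y p q (\<delta> a) (tact X Y p' q' (\<delta> b) n) = tact X Y p' q' (\<delta> b) (tact X Y p q (\<delta> a) n)"
      by (subst tact_commute[OF X'(1) Y'(1) X'(2) Y'(2) X'(3) Y'(3)])
        (simp_all add: tact_tact[OF X'(1) Y'(1) X'(3) Y'(3) X'(2) Y'(2)] X'(6) Y'(6))
  qed simp
qed

end

lemma (in comod_alg) right_coact_formula_lift:
  assumes \<Gamma>: "first_order_calculus K A \<Gamma>" and [simp]: "a \<in> carrier A" "b \<in> carrier A"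
  shows "right_coact_formula K H \<delta> \<Gamma> a b = lift A H (\<Gamma> \<boxtimes> H) (\<delta> a) (\<lambda>a0 a1.
    lift A H (\<Gamma> \<boxtimes> H) (\<delta> b) (\<lambda>b0 b1. tens K \<Gamma> H (lact \<Gamma> a0 (fdiff \<Gamma> b0)) (a1 \<otimes>\<^bsub>H\<^esub> b1)))"
proof -
  note [simp] = bimoduleD(1-3)[OF fodcD(1)[OF \<Gamma>]] Lin_closed[OF fodcD(2)[OF \<Gamma>]]
  have "right_coact_formula K H \<delta> \<Gamma> a b = lift A H (\<Gamma> \<boxtimes> H) (\<delta> a) (\<lambda>a0 a1. pres_lift K (\<Gamma> \<boxtimes> H)
    (\<lambda>(b0, b1). tens K \<Gamma> H (lact \<Gamma> a0 (fdiff \<Gamma> b0)) (a1 \<otimes>\<^bsub>H\<^esub> b1)) (\<delta> b))"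
    unfolding right_coact_formula_def Let_def
    by (rule pres_lift_eq_lift) (auto simp: pres_lift_eq_lift[where V = A and W = H])
  then show ?thesis by (simp add: pres_lift_eq_lift[where V = A and W = H])
qed

locale cov_fodc = comod_alg K H A \<delta> for K :: "'k ring" and H :: "('k, 'h) hopf"
    and A :: "('k, 'a, 'e) module_scheme" and \<delta> :: "'a \<Rightarrow> ('a \<times> 'h \<Rightarrow> 'k) set" +
  fixes \<Gamma> :: "('k, 'm, 'a) fodc" and \<rho> :: "'m \<Rightarrow> ('m \<times> 'h \<Rightarrow> 'k) set"
  assumes fodc: "first_order_calculus K A \<Gamma>"
    and coaction_map: "\<rho> \<in> fodc_maps K A \<Gamma> (tensor_space K \<Gamma> H) (right_coact_formula K H \<delta> \<Gamma>)"
begin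

abbreviation d :: "'a \<Rightarrow> 'm" where "d \<equiv> fdiff \<Gamma>"

lemmas bimodule_\<Gamma> = fodcD(1)[OF fodc]
lemmas \<Gamma>_simps [simp] = bimoduleD(1-5)[OF bimodule_\<Gamma>]
lemmas [lin_intro] = Lin_bilin[OF bimoduleD(9)[OF bimodule_\<Gamma>]] Lin_bilin[OF bimoduleD(10)[OF bimodule_\<Gamma>]]
lemmas d_Lin = fodcD(2)[OF fodc]
lemmas d_closed [simp] = Lin_closed[OF d_Lin]
lemmas [lin_intro] = Lin_comp[OF d_Lin]
lemmas Leibniz = fodcD(3)[OF fodc]

lemma \<rho>_Lin: "\<rho> \<in> Lin \<Gamma> (\<Gamma> \<boxtimes> H)"
  using coaction_map by (simp add: fodc_maps_def)

lemmas \<rho>_closed [simp] = Lin_closed[OF \<rho>_Lin]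
lemmas [lin_intro] = Lin_comp[OF \<rho>_Lin]

lemma \<rho>_gen:
  assumes "a \<in> carrier A" "b \<in> carrier A"
  shows "\<rho> (lact \<Gamma> a (d b)) = lift A H (\<Gamma> \<boxtimes> H) (\<delta> a) (\<lambda>a0 a1. lift A H (\<Gamma> \<boxtimes> H) (\<delta> b)
    (\<lambda>b0 b1. tens K \<Gamma> H (lact \<Gamma> a0 (d b0)) (a1 \<otimes>\<^bsub>H\<^esub> b1)))"
  using coaction_map assms by (simp add: fodc_maps_def right_coact_formula_lift[OF fodc])

text \<open>Both axioms are linear in the form and so may be checked on a db. There they follow from
  coassociativity and counitality of \<delta> at a and at b, because coproduct and counit of H are
  multiplicative on the second legs a_1 b_1.\<close>

lemma \<rho>_comodule: "right_comodule K H \<Gamma> \<rho>"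
proof (rule right_comoduleI)
  let ?U = "\<Gamma> \<boxtimes> H \<boxtimes> H"
  fix \<omega> assume \<omega>: "\<omega> \<in> carrier \<Gamma>"
  have B1: "bilin \<Gamma> H ?U (\<lambda>v0 h. lift \<Gamma> H ?U (\<rho> v0) (\<lambda>a b. tens K \<Gamma> (H \<boxtimes> H) a (tens K H H b h)))"
    by (intro lin_intro) simp_all
  have B2: "bilin \<Gamma> H ?U (\<lambda>a b. tens K \<Gamma> (H \<boxtimes> H) a (tens K H H b h))" if "h \<in> carrier H" for h
    using that by (intro lin_intro) simp_all
  have B3: "bilin \<Gamma> H ?U (\<lambda>v0 h. tens K \<Gamma> (H \<boxtimes> H) v0 (comult H h))"
    by (intro lin_intro) simp_all
  interpret HH: comod_alg K H H "comult H"
    by (intro comod_alg.intro comod_alg_axioms.intro hopf_alg_axioms algebra_H comodule_H comult_hom)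
  show "lift \<Gamma> H ?U (\<rho> \<omega>) (\<lambda>v0 h. lift \<Gamma> H ?U (\<rho> v0) (\<lambda>a b. tens K \<Gamma> (H \<boxtimes> H) a (tens K H H b h))) =
    lift \<Gamma> H ?U (\<rho> \<omega>) (\<lambda>v0 h. tens K \<Gamma> (H \<boxtimes> H) v0 (comult H h))"
  proof (rule fodc_eqI[where U = ?U, OF fodc _ _ _ \<omega>])
    fix a b assume [simp]: "a \<in> carrier A" "b \<in> carrier A"
    have "lift \<Gamma> H ?U (\<rho> (lact \<Gamma> a (d b))) (\<lambda>v0 h. lift \<Gamma> H ?U (\<rho> v0) (\<lambda>a b. tens K \<Gamma> (H \<boxtimes> H) a (tens K H H b h))) =
      lift A H ?U (\<delta> a) (\<lambda>a0 h. lift A H ?U (\<delta> b) (\<lambda>b0 k.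
      lift A H ?U (\<delta> a0) (\<lambda>a00 h0. lift A H ?U (\<delta> b0) (\<lambda>b00 k0.
        tens K \<Gamma> (H \<boxtimes> H) (lact \<Gamma> a00 (d b00)) (tens K H H (h0 \<otimes>\<^bsub>H\<^esub> k0) (h \<otimes>\<^bsub>H\<^esub> k))))))"
      by (simp add: \<rho>_gen lift_lift lift_tens B1 B2)
    also have "\<dots> = lift A H ?U (\<delta> a) (\<lambda>a0 h. lift A H ?U (\<delta> b) (\<lambda>b0 k.
      lift H H ?U (comult H h) (\<lambda>h1 h2. lift H H ?U (comult H k) (\<lambda>k1 k2.
        tens K \<Gamma> (H \<boxtimes> H) (lact \<Gamma> a0 (d b0)) (tens K H H (h1 \<otimes>\<^bsub>H\<^esub> k1) (h2 \<otimes>\<^bsub>H\<^esub> k2))))))"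
      by (rule double_coassoc; (intro lin_intro)?) simp_all
    also have "\<dots> = lift A H ?U (\<delta> a) (\<lambda>a0 h. lift A H ?U (\<delta> b) (\<lambda>b0 k.
        tens K \<Gamma> (H \<boxtimes> H) (lact \<Gamma> a0 (d b0)) (comult H (h \<otimes>\<^bsub>H\<^esub> k))))"
      by (intro lift_cong refl) (simp add: HH.coaction_mult
          Lin_lift[OF _ _ _ _ _ _ bilinD(1)[OF tens_bilin]])
    also have "\<dots> = lift \<Gamma> H ?U (\<rho> (lact \<Gamma> a (d b))) (\<lambda>v0 h. tens K \<Gamma> (H \<boxtimes> H) v0 (comult H h))"
      by (simp add: \<rho>_gen lift_lift lift_tens B3)
    finally show "lift \<Gamma> H ?U (\<rho> (lact \<Gamma> a (d b))) (\<lambda>v0 h. lift \<Gamma> H ?U (\<rho> v0) (\<lambda>a b. tens K \<Gamma> (H \<boxtimes> H) a (tens K H H b h))) =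
      lift \<Gamma> H ?U (\<rho> (lact \<Gamma> a (d b))) (\<lambda>v0 h. tens K \<Gamma> (H \<boxtimes> H) v0 (comult H h))" .
  qed ((rule Lin_lift_arg[OF _ _ _ B1 \<rho>_Lin] Lin_lift_arg[OF _ _ _ B3 \<rho>_Lin]; simp)+, simp)
  have B4: "bilin \<Gamma> H \<Gamma> (\<lambda>v0 h. counit H h \<odot>\<^bsub>\<Gamma>\<^esub> v0)"
    by (intro lin_intro) simp_all
  show "lift \<Gamma> H \<Gamma> (\<rho> \<omega>) (\<lambda>v0 h. counit H h \<odot>\<^bsub>\<Gamma>\<^esub> v0) = \<omega>"
  proof (rule fodc_eqI[OF fodc _ Lin_id _ \<omega>])
    interpret K: cring K by (rule cring_K)
    interpret G: module K \<Gamma> by simp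
    fix a b assume [simp]: "a \<in> carrier A" "b \<in> carrier A"
    have "lift \<Gamma> H \<Gamma> (\<rho> (lact \<Gamma> a (d b))) (\<lambda>v0 h. counit H h \<odot>\<^bsub>\<Gamma>\<^esub> v0) =
      lift A H \<Gamma> (\<delta> a) (\<lambda>a0 h. lift A H \<Gamma> (\<delta> b) (\<lambda>b0 k. counit H k \<odot>\<^bsub>\<Gamma>\<^esub> (counit H h \<odot>\<^bsub>\<Gamma>\<^esub> lact \<Gamma> a0 (d b0))))"
      by (simp add: \<rho>_gen lift_lift lift_tens B4 counit_mult K.m_comm flip: G.smult_assoc1)
    also have "\<dots> = lift A H \<Gamma> (\<delta> a) (\<lambda>a0 h. counit H h \<odot>\<^bsub>\<Gamma>\<^esub> lact \<Gamma> a0 (d b))"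
      by (intro lift_cong refl counit_right_lift[OF comodule_A, where f = "\<lambda>b. counit H _ \<odot>\<^bsub>\<Gamma>\<^esub> lact \<Gamma> _ (d b)"] lin_intro) simp_all
    also have "\<dots> = lact \<Gamma> a (d b)"
      by (intro counit_right_lift[OF comodule_A, where f = "\<lambda>a. lact \<Gamma> a (d b)"] lin_intro) simp_all
    finally show "lift \<Gamma> H \<Gamma> (\<rho> (lact \<Gamma> a (d b))) (\<lambda>v0 h. counit H h \<odot>\<^bsub>\<Gamma>\<^esub> v0) = lact \<Gamma> a (d b)" .
  qed (rule Lin_lift_arg[OF _ _ _ B4 \<rho>_Lin], simp_all)
qed (simp_all add: \<rho>_Lin)

text \<open>The value at a db is the diagonal action of a on db_0 \<otimes> b_1, and b \<mapsto>
  db_0 \<otimes> b_1 is a derivation for the diagonal bimodule structure. This is the situation of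
  \<open>derivation_bilinear\<close>.\<close>

lemma \<rho>_bilinear:
  assumes a [simp]: "a \<in> carrier A" and \<omega>: "\<omega> \<in> carrier \<Gamma>"
  shows "\<rho> (lact \<Gamma> a \<omega>) = tact \<Gamma> H (lact \<Gamma>) (mult H) (\<delta> a) (\<rho> \<omega>)"
    and "\<rho> (ract \<Gamma> \<omega> a) = tact \<Gamma> H (\<lambda>a m. ract \<Gamma> m a) (\<lambda>h m. m \<otimes>\<^bsub>H\<^esub> h) (\<delta> a) (\<rho> \<omega>)"
proof -
  note X = biaction_bimodule[OF bimodule_\<Gamma>] and Y = biaction_regular[OF algebra_H]
  note N = biaction_tact[OF X Y]
  let ?l = "tact \<Gamma> H (lact \<Gamma>) (mult H)" and ?r = "tact \<Gamma> H (\<lambda>a m. ract \<Gamma> m a) (\<lambda>h m. m \<otimes>\<^bsub>H\<^esub> h)"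
  define D where "D b = lift A H (\<Gamma> \<boxtimes> H) (\<delta> b) (\<lambda>b0 b1. tens K \<Gamma> H (d b0) b1)" for b
  have l: "?l (\<delta> a) (D b) = lift A H (\<Gamma> \<boxtimes> H) (\<delta> a) (\<lambda>a0 a1. lift A H (\<Gamma> \<boxtimes> H) (\<delta> b)
      (\<lambda>b0 b1. tens K \<Gamma> H (lact \<Gamma> a0 (d b0)) (a1 \<otimes>\<^bsub>H\<^esub> b1)))"
    if [simp]: "a \<in> carrier A" "b \<in> carrier A" for a b
  proof -
    have "bilin \<Gamma> H (\<Gamma> \<boxtimes> H) (\<lambda>x y. tens K \<Gamma> H (lact \<Gamma> a x) (h \<otimes>\<^bsub>H\<^esub> y))"
      if "a \<in> carrier A" "h \<in> carrier H" for a h using that by (intro lin_intro) simp_all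
    then show ?thesis by (simp add: tact_def D_def lift_lift lift_tens)
  qed
  have r: "?r (\<delta> b) (D a) = lift A H (\<Gamma> \<boxtimes> H) (\<delta> a) (\<lambda>a0 a1. lift A H (\<Gamma> \<boxtimes> H) (\<delta> b)
      (\<lambda>b0 b1. tens K \<Gamma> H (ract \<Gamma> (d a0) b0) (a1 \<otimes>\<^bsub>H\<^esub> b1)))"
    if [simp]: "a \<in> carrier A" "b \<in> carrier A" for a b
  proof -
    have "bilin \<Gamma> H (\<Gamma> \<boxtimes> H) (\<lambda>x y. tens K \<Gamma> H (ract \<Gamma> x a) (y \<otimes>\<^bsub>H\<^esub> h))"
      if "a \<in> carrier A" "h \<in> carrier H" for a h using that by (intro lin_intro) simp_all
    then have "?r (\<delta> b) (D a) = lift A H (\<Gamma> \<boxtimes> H) (\<delta> b) (\<lambda>b0 b1. lift A H (\<Gamma> \<boxtimes> H) (\<delta> a)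
      (\<lambda>a0 a1. tens K \<Gamma> H (ract \<Gamma> (d a0) b0) (a1 \<otimes>\<^bsub>H\<^esub> b1)))"
      by (simp add: tact_def D_def lift_lift lift_tens)
    also have "\<dots> = lift A H (\<Gamma> \<boxtimes> H) (\<delta> a) (\<lambda>a0 a1. lift A H (\<Gamma> \<boxtimes> H) (\<delta> b)
      (\<lambda>b0 b1. tens K \<Gamma> H (ract \<Gamma> (d a0) b0) (a1 \<otimes>\<^bsub>H\<^esub> b1)))"
      by (rule lift_swap) simp_all
    finally show ?thesis .
  qed
  have D: "D b \<in> carrier (\<Gamma> \<boxtimes> H)" if "b \<in> carrier A" for b using that by (simp add: D_def)
  have L: "D (a \<otimes>\<^bsub>A\<^esub> b) = ?r (\<delta> b) (D a) \<oplus>\<^bsub>\<Gamma> \<boxtimes> H\<^esub> ?l (\<delta> a) (D b)"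
    if [simp]: "a \<in> carrier A" "b \<in> carrier A" for a b
  proof -
    have "bilin A H (\<Gamma> \<boxtimes> H) (\<lambda>b0 b1. tens K \<Gamma> H (d b0) b1)" by (intro lin_intro) simp_all
    then have "D (a \<otimes>\<^bsub>A\<^esub> b) = lift A H (\<Gamma> \<boxtimes> H) (\<delta> a) (\<lambda>a0 a1. lift A H (\<Gamma> \<boxtimes> H) (\<delta> b)
      (\<lambda>b0 b1. tens K \<Gamma> H (ract \<Gamma> (d a0) b0) (a1 \<otimes>\<^bsub>H\<^esub> b1) \<oplus>\<^bsub>\<Gamma> \<boxtimes> H\<^esub> tens K \<Gamma> H (lact \<Gamma> a0 (d b0)) (a1 \<otimes>\<^bsub>H\<^esub> b1)))"
      by (simp add: D_def coaction_mult_lift Leibniz Lin_add[OF bilinD(2)[OF tens_bilin]])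
    then show ?thesis by (simp add: l r lift_add)
  qed
  have g: "\<rho> (lact \<Gamma> a (d b)) = ?l (\<delta> a) (D b)" if "a \<in> carrier A" "b \<in> carrier A" for a b
    using that by (simp add: \<rho>_gen l)
  show "\<rho> (lact \<Gamma> a \<omega>) = ?l (\<delta> a) (\<rho> \<omega>)" "\<rho> (ract \<Gamma> \<omega> a) = ?r (\<delta> a) (\<rho> \<omega>)"
    by (rule derivation_bilinear[OF algebra_A fodc N \<rho>_Lin D L g a \<omega>]; assumption)+
qed

end

context hopf_alg
begin

lemma comod_alg_H: "comod_alg K H H (comult H)"
  by (intro comod_alg.intro comod_alg_axioms.intro hopf_alg_axioms algebra_H comodule_H comult_hom)

lemma antipode_one: "antipode H \<one>\<^bsub>H\<^esub> = \<one>\<^bsub>H\<^esub>"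
proof -
  have "bilin H H H (\<lambda>h1 h2. antipode H h1 \<otimes>\<^bsub>H\<^esub> h2)" by (intro lin_intro) simp_all
  then show ?thesis
    using antipode_lift(1)[of "\<one>\<^bsub>H\<^esub>" H "\<lambda>h. h"]
    by (simp add: comod_alg.coaction_one[OF comod_alg_H] lift_tens counit_one Lin_id)
qed

end

text \<open>Both \<open>D\<^sup>0\<^sup>1\<close> and the left coaction of \<open>\<Omega>\<^sup>1(H)\<close> are instances of \<open>F\<close>.\<close>

locale two_fodc = cov_fodc K H A \<delta> \<Gamma> \<rho> + G: cov_fodc K H H "comult H" \<Gamma>' \<rho>'
  for K :: "'k ring" and H :: "('k, 'h) hopf" and A :: "('k, 'a, 'e) module_scheme" and \<delta>
    and \<Gamma> :: "('k, 'm, 'a) fodc" and \<rho> and \<Gamma>' :: "('k, 'n, 'h) fodc" and \<rho>' +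
  fixes F :: "'m \<Rightarrow> ('a \<times> 'n \<Rightarrow> 'k) set"
  assumes F_Lin: "F \<in> lin_maps K \<Gamma> (tensor_space K A \<Gamma>')"
    and F_gen: "\<And>a b. a \<in> carrier A \<Longrightarrow> b \<in> carrier A \<Longrightarrow> F (lact \<Gamma> a (fdiff \<Gamma> b)) =
      base_field.lift K A H (tensor_space K A \<Gamma>') (\<delta> a) (\<lambda>a0 a1.
      base_field.lift K A H (tensor_space K A \<Gamma>') (\<delta> b)
        (\<lambda>b0 b1. tens K A \<Gamma>' (a0 \<otimes>\<^bsub>A\<^esub> b0) (lact \<Gamma>' a1 (fdiff \<Gamma>' b1))))"
begin

abbreviation "lactW \<equiv> tact A \<Gamma>' (mult A) (lact \<Gamma>')"
abbreviation "ractW \<equiv> tact A \<Gamma>' (\<lambda>a m. m \<otimes>\<^bsub>A\<^esub> a) (\<lambda>h m. ract \<Gamma>' m h)"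

lemma biaction_W: "biaction A (A \<boxtimes> \<Gamma>') (\<lambda>a. lactW (\<delta> a)) (\<lambda>a. ractW (\<delta> a))"
  by (rule biaction_tact[OF biaction_regular[OF algebra_A] biaction_bimodule[OF G.bimodule_\<Gamma>]])

lemmas F_closed [simp] = Lin_closed[OF F_Lin]
lemmas [lin_intro] = Lin_comp[OF F_Lin]

text \<open>The same argument as for \<rho>, now with the derivation b \<mapsto> b_0 \<otimes> db_1
  into A \<otimes> \<Gamma>'.\<close>

lemma F_bilinear:
  assumes a [simp]: "a \<in> carrier A" and \<omega>: "\<omega> \<in> carrier \<Gamma>"
  shows "F (lact \<Gamma> a \<omega>) = lactW (\<delta> a) (F \<omega>)" and "F (ract \<Gamma> \<omega> a) = ractW (\<delta> a) (F \<omega>)"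
proof -
  let ?W = "A \<boxtimes> \<Gamma>'"
  define D where "D b = lift A H ?W (\<delta> b) (\<lambda>b0 b1. tens K A \<Gamma>' b0 (G.d b1))" for b
  have l: "lactW (\<delta> a) (D b) = lift A H ?W (\<delta> a) (\<lambda>a0 a1. lift A H ?W (\<delta> b)
      (\<lambda>b0 b1. tens K A \<Gamma>' (a0 \<otimes>\<^bsub>A\<^esub> b0) (lact \<Gamma>' a1 (G.d b1))))"
    if [simp]: "a \<in> carrier A" "b \<in> carrier A" for a b
  proof -
    have "bilin A \<Gamma>' ?W (\<lambda>x y. tens K A \<Gamma>' (a \<otimes>\<^bsub>A\<^esub> x) (lact \<Gamma>' h y))"
      if "a \<in> carrier A" "h \<in> carrier H" for a h using that by (intro lin_intro) simp_all
    then show ?thesis by (simp add: tact_def D_def lift_lift lift_tens)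
  qed
  have r: "ractW (\<delta> b) (D a) = lift A H ?W (\<delta> a) (\<lambda>a0 a1. lift A H ?W (\<delta> b)
      (\<lambda>b0 b1. tens K A \<Gamma>' (a0 \<otimes>\<^bsub>A\<^esub> b0) (ract \<Gamma>' (G.d a1) b1)))"
    if [simp]: "a \<in> carrier A" "b \<in> carrier A" for a b
  proof -
    have "bilin A \<Gamma>' ?W (\<lambda>x y. tens K A \<Gamma>' (x \<otimes>\<^bsub>A\<^esub> a) (ract \<Gamma>' y h))"
      if "a \<in> carrier A" "h \<in> carrier H" for a h using that by (intro lin_intro) simp_all
    then have "ractW (\<delta> b) (D a) = lift A H ?W (\<delta> b) (\<lambda>b0 b1. lift A H ?W (\<delta> a)
      (\<lambda>a0 a1. tens K A \<Gamma>' (a0 \<otimes>\<^bsub>A\<^esub> b0) (ract \<Gamma>' (G.d a1) b1)))"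
      by (simp add: tact_def D_def lift_lift lift_tens)
    also have "\<dots> = lift A H ?W (\<delta> a) (\<lambda>a0 a1. lift A H ?W (\<delta> b)
      (\<lambda>b0 b1. tens K A \<Gamma>' (a0 \<otimes>\<^bsub>A\<^esub> b0) (ract \<Gamma>' (G.d a1) b1)))"
      by (rule lift_swap) simp_all
    finally show ?thesis .
  qed
  have D: "D b \<in> carrier ?W" if "b \<in> carrier A" for b using that by (simp add: D_def)
  have L: "D (a \<otimes>\<^bsub>A\<^esub> b) = ractW (\<delta> b) (D a) \<oplus>\<^bsub>?W\<^esub> lactW (\<delta> a) (D b)"
    if [simp]: "a \<in> carrier A" "b \<in> carrier A" for a b
  proof -
    have "bilin A H ?W (\<lambda>b0 b1. tens K A \<Gamma>' b0 (G.d b1))" by (intro lin_intro) simp_all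
    then have "D (a \<otimes>\<^bsub>A\<^esub> b) = lift A H ?W (\<delta> a) (\<lambda>a0 a1. lift A H ?W (\<delta> b)
      (\<lambda>b0 b1. tens K A \<Gamma>' (a0 \<otimes>\<^bsub>A\<^esub> b0) (ract \<Gamma>' (G.d a1) b1) \<oplus>\<^bsub>?W\<^esub> tens K A \<Gamma>' (a0 \<otimes>\<^bsub>A\<^esub> b0) (lact \<Gamma>' a1 (G.d b1))))"
      by (simp add: D_def coaction_mult_lift G.Leibniz Lin_add[OF bilinD(1)[OF tens_bilin]])
    then show ?thesis by (simp add: l r lift_add)
  qed
  have g: "F (lact \<Gamma> a (d b)) = lactW (\<delta> a) (D b)" if "a \<in> carrier A" "b \<in> carrier A" for a b
    using that by (simp add: F_gen l)
  show "F (lact \<Gamma> a \<omega>) = lactW (\<delta> a) (F \<omega>)" "F (ract \<Gamma> \<omega> a) = ractW (\<delta> a) (F \<omega>)"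
    by (rule derivation_bilinear[OF algebra_A fodc biaction_W F_Lin D L g a \<omega>]; assumption)+
qed

text \<open>On a db both sides become a_0 b_0 \<otimes> a_1 db_1 \<otimes> a_2 b_2. When F is the
  left coaction of \<Omega>^1(H), this says that left and right coaction commute.\<close>

lemma F_colinear:
  assumes \<omega>: "\<omega> \<in> carrier \<Gamma>"
  defines "U \<equiv> (A \<boxtimes> \<Gamma>') \<boxtimes> H"
  shows "lift \<Gamma> H U (\<rho> \<omega>) (\<lambda>\<omega>0 h. tens K (A \<boxtimes> \<Gamma>') H (F \<omega>0) h) =
    lift A \<Gamma>' U (F \<omega>) (\<lambda>a \<gamma>. lift \<Gamma>' H U (\<rho>' \<gamma>) (\<lambda>\<gamma>0 g. tens K (A \<boxtimes> \<Gamma>') H (tens K A \<Gamma>' a \<gamma>0) g))"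
proof (rule fodc_eqI[where U = U, OF fodc _ _ _ \<omega>])
  have B1: "bilin \<Gamma> H U (\<lambda>\<omega>0 h. tens K (A \<boxtimes> \<Gamma>') H (F \<omega>0) h)"
    unfolding U_def by (intro lin_intro) simp_all
  have B2: "bilin A \<Gamma>' U (\<lambda>a \<gamma>. lift \<Gamma>' H U (\<rho>' \<gamma>) (\<lambda>\<gamma>0 g. tens K (A \<boxtimes> \<Gamma>') H (tens K A \<Gamma>' a \<gamma>0) g))"
    unfolding U_def by (intro lin_intro) simp_all
  have B3: "bilin \<Gamma>' H U (\<lambda>\<gamma>0 g. tens K (A \<boxtimes> \<Gamma>') H (tens K A \<Gamma>' a \<gamma>0) g)" if "a \<in> carrier A" for a
    using that unfolding U_def by (intro lin_intro) simp_all
  show "(\<lambda>\<omega>. lift \<Gamma> H U (\<rho> \<omega>) (\<lambda>\<omega>0 h. tens K (A \<boxtimes> \<Gamma>') H (F \<omega>0) h)) \<in> Lin \<Gamma> U"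
    "(\<lambda>\<omega>. lift A \<Gamma>' U (F \<omega>) (\<lambda>a \<gamma>. lift \<Gamma>' H U (\<rho>' \<gamma>) (\<lambda>\<gamma>0 g. tens K (A \<boxtimes> \<Gamma>') H (tens K A \<Gamma>' a \<gamma>0) g))) \<in> Lin \<Gamma> U"
    unfolding U_def by (intro lin_intro B1[unfolded U_def] B2[unfolded U_def]; simp)+
  fix a b assume [simp]: "a \<in> carrier A" "b \<in> carrier A"
  have U [simp]: "VS U" "\<And>n h. n \<in> carrier (A \<boxtimes> \<Gamma>') \<Longrightarrow> h \<in> carrier H \<Longrightarrow> tens K (A \<boxtimes> \<Gamma>') H n h \<in> carrier U"
    by (simp_all add: U_def)
  have push: "tens K (A \<boxtimes> \<Gamma>') H (lift A H (A \<boxtimes> \<Gamma>') P \<beta>) h = lift A H U P (\<lambda>x y. tens K (A \<boxtimes> \<Gamma>') H (\<beta> x y) h)"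
    if "P \<in> carrier (A \<boxtimes> H)" "h \<in> carrier H" "\<And>x y. x \<in> carrier A \<Longrightarrow> y \<in> carrier H \<Longrightarrow> \<beta> x y \<in> carrier (A \<boxtimes> \<Gamma>')" for P \<beta> h
    by (rule Lin_lift[where f = "\<lambda>n. tens K (A \<boxtimes> \<Gamma>') H n h" and U = "A \<boxtimes> \<Gamma>'"])
      (use that in \<open>simp_all add: U_def bilinD(2)[OF tens_bilin]\<close>)
  have "lift \<Gamma> H U (\<rho> (lact \<Gamma> a (d b))) (\<lambda>\<omega>0 h. tens K (A \<boxtimes> \<Gamma>') H (F \<omega>0) h) =
    lift A H U (\<delta> a) (\<lambda>a0 h. lift A H U (\<delta> b) (\<lambda>b0 k.
      lift A H U (\<delta> a0) (\<lambda>a00 h0. lift A H U (\<delta> b0) (\<lambda>b00 k0.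
        tens K (A \<boxtimes> \<Gamma>') H (tens K A \<Gamma>' (a00 \<otimes>\<^bsub>A\<^esub> b00) (lact \<Gamma>' h0 (G.d k0))) (h \<otimes>\<^bsub>H\<^esub> k)))))"
    by (simp add: \<rho>_gen lift_lift lift_tens B1 F_gen push)
  also have "\<dots> = lift A H U (\<delta> a) (\<lambda>a0 h. lift A H U (\<delta> b) (\<lambda>b0 k.
      lift H H U (comult H h) (\<lambda>h1 h2. lift H H U (comult H k) (\<lambda>k1 k2.
        tens K (A \<boxtimes> \<Gamma>') H (tens K A \<Gamma>' (a0 \<otimes>\<^bsub>A\<^esub> b0) (lact \<Gamma>' h1 (G.d k1))) (h2 \<otimes>\<^bsub>H\<^esub> k2)))))"
    by (rule double_coassoc; (unfold U_def)?; (intro lin_intro)?) simp_all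
  also have "\<dots> = lift A \<Gamma>' U (F (lact \<Gamma> a (d b))) (\<lambda>a \<gamma>. lift \<Gamma>' H U (\<rho>' \<gamma>) (\<lambda>\<gamma>0 g. tens K (A \<boxtimes> \<Gamma>') H (tens K A \<Gamma>' a \<gamma>0) g))"
    by (simp add: F_gen lift_lift lift_tens B2 B3 G.\<rho>_gen)
  finally show "lift \<Gamma> H U (\<rho> (lact \<Gamma> a (d b))) (\<lambda>\<omega>0 h. tens K (A \<boxtimes> \<Gamma>') H (F \<omega>0) h) =
    lift A \<Gamma>' U (F (lact \<Gamma> a (d b))) (\<lambda>a \<gamma>. lift \<Gamma>' H U (\<rho>' \<gamma>) (\<lambda>\<gamma>0 g. tens K (A \<boxtimes> \<Gamma>') H (tens K A \<Gamma>' a \<gamma>0) g))" .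
qed (simp add: U_def)

end

section \<open>Left coinvariant forms\<close>

locale bicov_fodc = cov_fodc K H H "comult H" \<Gamma> \<rho>
  for K :: "'k ring" and H :: "('k, 'h) hopf" and \<Gamma> :: "('k, 'm, 'h) fodc" and \<rho> +
  fixes lco :: "'m \<Rightarrow> ('h \<times> 'm \<Rightarrow> 'k) set"
  assumes left_map: "lco \<in> fodc_maps K H \<Gamma> (tensor_space K H \<Gamma>) (left_coact_formula K H \<Gamma>)"
begin

lemma left_Lin: "lco \<in> Lin \<Gamma> (H \<boxtimes> \<Gamma>)"
  using left_map by (simp add: fodc_maps_def)

lemmas left_closed [simp] = Lin_closed[OF left_Lin]
lemmas [lin_intro] = Lin_comp[OF left_Lin]

lemma left_gen:
  assumes [simp]: "g \<in> carrier H" "h \<in> carrier H"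
  shows "lco (lact \<Gamma> g (d h)) = lift H H (H \<boxtimes> \<Gamma>) (comult H g) (\<lambda>g1 g2. lift H H (H \<boxtimes> \<Gamma>) (comult H h)
    (\<lambda>h1 h2. tens K H \<Gamma> (g1 \<otimes>\<^bsub>H\<^esub> h1) (lact \<Gamma> g2 (d h2))))"
proof -
  have "lco (lact \<Gamma> g (d h)) = pres_lift K (H \<boxtimes> \<Gamma>) (\<lambda>(g1, g2). pres_lift K (H \<boxtimes> \<Gamma>)
    (\<lambda>(h1, h2). tens K H \<Gamma> (g1 \<otimes>\<^bsub>H\<^esub> h1) (lact \<Gamma> g2 (d h2))) (comult H h)) (comult H g)"
    using left_map by (simp add: fodc_maps_def left_coact_formula_def Let_def)
  also have "\<dots> = lift H H (H \<boxtimes> \<Gamma>) (comult H g) (\<lambda>g1 g2. pres_lift K (H \<boxtimes> \<Gamma>)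
    (\<lambda>(h1, h2). tens K H \<Gamma> (g1 \<otimes>\<^bsub>H\<^esub> h1) (lact \<Gamma> g2 (d h2))) (comult H h))"
    by (rule pres_lift_eq_lift) (auto simp: pres_lift_eq_lift[where V = H and W = H])
  finally show ?thesis by (simp add: pres_lift_eq_lift[where V = H and W = H])
qed

lemma two: "two_fodc K H H (comult H) \<Gamma> \<rho> \<Gamma> \<rho> lco"
  by (intro two_fodc.intro two_fodc_axioms.intro cov_fodc_axioms left_Lin left_gen)

lemmas left_bilinear = two_fodc.F_bilinear[OF two]
lemmas left_colinear = two_fodc.F_colinear[OF two]

text \<open>The convolution product of the antipode with m.\<close>

definition conv :: "('h \<Rightarrow> 'm) \<Rightarrow> 'h \<Rightarrow> 'm"
  where "conv m h = lift H H \<Gamma> (comult H h) (\<lambda>h1 h2. lact \<Gamma> (antipode H h1) (m h2))"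

lemma conv_Lin:
  assumes m: "m \<in> Lin H \<Gamma>"
  shows "conv m \<in> Lin H \<Gamma>"
  unfolding conv_def[abs_def] by (intro lin_intro Lin_comp[OF m]) (simp_all add: Lin_closed[OF m])

lemma conv_cancel:
  assumes "m \<in> Lin H \<Gamma>" "h \<in> carrier H"
  shows "lift H H \<Gamma> (comult H h) (\<lambda>h1 h2. lact \<Gamma> h1 (conv m h2)) = m h"
  unfolding conv_def
  by (rule convolution_cancel(1)[OF _ bimoduleD(9)[OF bimodule_\<Gamma>]])
    (simp_all add: assms bimoduleD(6)[OF bimodule_\<Gamma>])

text \<open>The Maurer--Cartan form \<open>S(h\<^sub>1) dh\<^sub>2\<close>.\<close>

definition mc :: "'h \<Rightarrow> 'm" where "mc = conv d"

lemmas mc_Lin = conv_Lin[OF d_Lin, folded mc_def]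
lemmas mc_closed [simp] = Lin_closed[OF mc_Lin]
lemmas [lin_intro] = Lin_comp[OF mc_Lin]
lemmas d_eq_mc = conv_cancel[OF d_Lin, folded mc_def]

abbreviation "lactW \<equiv> tact H \<Gamma> (mult H) (lact \<Gamma>)"
abbreviation "ractW \<equiv> tact H \<Gamma> (\<lambda>a m. m \<otimes>\<^bsub>H\<^esub> a) (\<lambda>h m. ract \<Gamma> m h)"

lemma lactW_tens:
  assumes [simp]: "h \<in> carrier H" "\<gamma> \<in> carrier \<Gamma>"
  shows "lactW (comult H h) (tens K H \<Gamma> \<one>\<^bsub>H\<^esub> \<gamma>) = lift H H (H \<boxtimes> \<Gamma>) (comult H h) (\<lambda>h1 h2. tens K H \<Gamma> h1 (lact \<Gamma> h2 \<gamma>))"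
  by (subst tact_lift_tens[OF _ _ assoc_algebraD(7)[OF algebra_H] bimoduleD(9)[OF bimodule_\<Gamma>]]) simp_all

lemma left_d:
  assumes [simp]: "h \<in> carrier H"
  shows "lco (d h) = lift H H (H \<boxtimes> \<Gamma>) (comult H h) (\<lambda>h1 h2. tens K H \<Gamma> h1 (d h2))"
proof -
  have "bilin H H (H \<boxtimes> \<Gamma>) (\<lambda>g1 g2. lift H H (H \<boxtimes> \<Gamma>) (comult H h)
    (\<lambda>h1 h2. tens K H \<Gamma> (g1 \<otimes>\<^bsub>H\<^esub> h1) (lact \<Gamma> g2 (d h2))))" by (intro lin_intro) simp_all
  then show ?thesis using left_gen[of "\<one>\<^bsub>H\<^esub>" h] by (simp add: coaction_one lift_tens)
qed

text \<open>Since dh = h_1 mc(h_2), the left coaction of dh is h_1 acting diagonally on 1 \<otimes>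
  mc(h_2). By bilinearity the left coaction of mc(h) is S(h_1) acting on h_2 acting on 1 \<otimes>
  mc(h_3), and \<open>convolution_cancel\<close> removes the antipode. The coproduct of S(h) never
  has to be computed.\<close>

lemma left_mc:
  assumes h [simp]: "h \<in> carrier H"
  shows "lco (mc h) = tens K H \<Gamma> \<one>\<^bsub>H\<^esub> (mc h)"
proof -
  let ?W = "H \<boxtimes> \<Gamma>"
  note N = biactionD[OF two_fodc.biaction_W[OF two]]
  \<comment> \<open>\<open>convolution_cancel\<close> asks for a unital action, and
    \<open>biaction\<close> contains no unit law.\<close>
  have one: "lactW (comult H \<one>\<^bsub>H\<^esub>) n = n" if n: "n \<in> carrier ?W" for n
  proof -
    have "bilin H H ?W (\<lambda>a h. lift H \<Gamma> ?W n (\<lambda>x y. tens K H \<Gamma> (a \<otimes>\<^bsub>H\<^esub> x) (lact \<Gamma> h y)))"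
      using n by (intro lin_intro) simp_all
    then show ?thesis using n by (simp add: tact_def coaction_one lift_tens lift_id)
  qed
  have dm: "lco (d h) = lift H H ?W (comult H h) (\<lambda>a b. lactW (comult H a) (tens K H \<Gamma> \<one>\<^bsub>H\<^esub> (mc b)))"
    if [simp]: "h \<in> carrier H" for h
  proof -
    have "lift H H ?W (comult H h) (\<lambda>a b. lactW (comult H a) (tens K H \<Gamma> \<one>\<^bsub>H\<^esub> (mc b))) =
      lift H H ?W (comult H h) (\<lambda>a b. lift H H ?W (comult H a) (\<lambda>h1 h2. tens K H \<Gamma> h1 (lact \<Gamma> h2 (mc b))))"
      by (simp add: lactW_tens)
    also have "\<dots> = lift H H ?W (comult H h) (\<lambda>h1 h2. lift H H ?W (comult H h2) (\<lambda>a b. tens K H \<Gamma> h1 (lact \<Gamma> a (mc b))))"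
      by (intro coassoc[OF comodule_H] lin_intro) simp_all
    also have "\<dots> = lift H H ?W (comult H h) (\<lambda>h1 h2. tens K H \<Gamma> h1 (lift H H \<Gamma> (comult H h2) (\<lambda>a b. lact \<Gamma> a (mc b))))"
      by (intro lift_cong refl) (simp add: Lin_lift[OF _ _ _ _ _ _ bilinD(1)[OF tens_bilin]])
    also have "\<dots> = lco (d h)" by (simp add: d_eq_mc left_d)
    finally show ?thesis by simp
  qed
  have "lco (mc h) = lift H H ?W (comult H h) (\<lambda>h1 h2. lco (lact \<Gamma> (antipode H h1) (d h2)))"
    unfolding mc_def conv_def by (rule Lin_lift[OF _ _ _ _ _ _ left_Lin]) simp_all
  also have "\<dots> = lift H H ?W (comult H h) (\<lambda>h1 h2. lactW (comult H (antipode H h1))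
      (lift H H ?W (comult H h2) (\<lambda>a b. lactW (comult H a) (tens K H \<Gamma> \<one>\<^bsub>H\<^esub> (mc b)))))"
    by (simp add: left_bilinear dm)
  also have "\<dots> = tens K H \<Gamma> \<one>\<^bsub>H\<^esub> (mc h)"
    by (rule convolution_cancel(2)[OF _ N(2) N(4) one, where m = "\<lambda>h. tens K H \<Gamma> \<one>\<^bsub>H\<^esub> (mc h)"];
      (intro lin_intro)?) simp_all
  finally show ?thesis .
qed

definition coinv :: "('k, 'm, 'h) fodc"
  where "coinv = \<Gamma>\<lparr>carrier := {\<theta> \<in> carrier \<Gamma>. lco \<theta> = tens K H \<Gamma> \<one>\<^bsub>H\<^esub> \<theta>}\<rparr>"

lemma coinv_iff: "\<theta> \<in> carrier coinv \<longleftrightarrow> \<theta> \<in> carrier \<Gamma> \<and> lco \<theta> = tens K H \<Gamma> \<one>\<^bsub>H\<^esub> \<theta>"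
  by (simp add: coinv_def)

lemma coinv_submodule: "submodule {\<theta> \<in> carrier \<Gamma>. lco \<theta> = tens K H \<Gamma> \<one>\<^bsub>H\<^esub> \<theta>} K \<Gamma>"
  by (rule Lin_equalizer_submodule[OF left_Lin]; (intro lin_intro)?) simp_all

lemma VS_coinv [simp]: "VS coinv"
  unfolding coinv_def by (rule VS_carrier_update[OF _ coinv_submodule]) simp

lemma coinv_closed [simp]: "\<theta> \<in> carrier coinv \<Longrightarrow> \<theta> \<in> carrier \<Gamma>"
  by (simp add: coinv_def)

lemma coinv_incl [lin_intro]: "(\<lambda>\<theta>. \<theta>) \<in> Lin coinv \<Gamma>"
  unfolding coinv_def by (rule Lin_incl[OF _ coinv_submodule]) simp

definition Pr :: "'m \<Rightarrow> 'm"
  where "Pr \<gamma> = lift H \<Gamma> \<Gamma> (lco \<gamma>) (\<lambda>h \<gamma>. lact \<Gamma> (antipode H h) \<gamma>)"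

lemma Pr_bilin: "bilin H \<Gamma> \<Gamma> (\<lambda>h \<gamma>. lact \<Gamma> (antipode H h) \<gamma>)"
  by (intro lin_intro) simp_all

lemma Pr_Lin_\<Gamma>: "Pr \<in> Lin \<Gamma> \<Gamma>"
  unfolding Pr_def[abs_def] by (intro lin_intro) simp_all

text \<open>For coinvariant \<theta> the left coaction of g \<theta> is g_1 \<otimes> g_2 \<theta>,
  so that the projection gives S(g_1) g_2 \<theta>.\<close>

lemma Pr_lact:
  assumes [simp]: "g \<in> carrier H" and "\<theta> \<in> carrier coinv"
  shows "Pr (lact \<Gamma> g \<theta>) = counit H g \<odot>\<^bsub>\<Gamma>\<^esub> \<theta>"
proof -
  have \<theta> [simp]: "\<theta> \<in> carrier \<Gamma>" "lco \<theta> = tens K H \<Gamma> \<one>\<^bsub>H\<^esub> \<theta>" using assms(2) by (simp_all add: coinv_iff)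
  have "Pr (lact \<Gamma> g \<theta>) = lift H H \<Gamma> (comult H g) (\<lambda>g1 g2. lact \<Gamma> (antipode H g1 \<otimes>\<^bsub>H\<^esub> g2) \<theta>)"
    by (simp add: Pr_def left_bilinear lactW_tens lift_lift lift_tens Pr_bilin bimoduleD(6)[OF bimodule_\<Gamma>])
  also have "\<dots> = counit H g \<odot>\<^bsub>\<Gamma>\<^esub> lact \<Gamma> \<one>\<^bsub>H\<^esub> \<theta>"
    by (intro antipode_lift(1)[where f = "\<lambda>h. lact \<Gamma> h \<theta>"] lin_intro) simp_all
  finally show ?thesis by simp
qed

lemma Pr_id: "\<theta> \<in> carrier coinv \<Longrightarrow> Pr \<theta> = \<theta>"
  using Pr_lact[of "\<one>\<^bsub>H\<^esub>" \<theta>] by (simp add: counit_one)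

lemma mc_coinv [simp]: "h \<in> carrier H \<Longrightarrow> mc h \<in> carrier coinv"
  by (simp add: coinv_iff left_mc)

text \<open>Write g dh = g h_1 mc(h_2) and apply \<open>Pr_lact\<close>. The scalar \<epsilon>(g) is
  put inside \<open>mc\<close>, so that the value is visibly in the image of
  \<open>mc\<close>.\<close>

lemma Pr_gen:
  assumes [simp]: "g \<in> carrier H" "h \<in> carrier H"
  shows "Pr (lact \<Gamma> g (d h)) = mc (counit H g \<odot>\<^bsub>H\<^esub> h)"
proof -
  interpret K: cring K by (rule cring_K)
  interpret \<Gamma>: module K \<Gamma> by simp
  have "lact \<Gamma> g (d h) = lift H H \<Gamma> (comult H h) (\<lambda>h1 h2. lact \<Gamma> (g \<otimes>\<^bsub>H\<^esub> h1) (mc h2))"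
    by (subst d_eq_mc[symmetric])
      (simp_all add: Lin_lift[OF _ _ _ _ _ _ bilinD(1)[OF bimoduleD(9)[OF bimodule_\<Gamma>]]] bimoduleD(6)[OF bimodule_\<Gamma>])
  then have "Pr (lact \<Gamma> g (d h)) = lift H H \<Gamma> (comult H h) (\<lambda>h1 h2. Pr (lact \<Gamma> (g \<otimes>\<^bsub>H\<^esub> h1) (mc h2)))"
    by (simp add: Lin_lift[OF _ _ _ _ _ _ Pr_Lin_\<Gamma>])
  also have "\<dots> = lift H H \<Gamma> (comult H h) (\<lambda>h1 h2. counit H h1 \<odot>\<^bsub>\<Gamma>\<^esub> (counit H g \<odot>\<^bsub>\<Gamma>\<^esub> mc h2))"
    by (simp add: Pr_lact counit_mult K.m_comm flip: \<Gamma>.smult_assoc1)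
  also have "\<dots> = counit H g \<odot>\<^bsub>\<Gamma>\<^esub> mc h"
    by (intro counit_left_lift[where f = "\<lambda>h. counit H g \<odot>\<^bsub>\<Gamma>\<^esub> mc h"] lin_intro) simp_all
  finally show ?thesis by (simp add: Lin_smult[OF mc_Lin])
qed

lemma Pr_image: "\<gamma> \<in> carrier \<Gamma> \<Longrightarrow> Pr \<gamma> \<in> mc ` carrier H"
  using fodc_submodule[OF fodc Lin_preimage_submodule[OF Pr_Lin_\<Gamma> _ _ Lin_image_submodule[OF mc_Lin]], of \<gamma>]
  by (simp add: Pr_gen)

text \<open>\<open>Pr\<close> fixes every coinvariant form and takes all its values in the image of
  \<open>mc\<close>; the other inclusion is \<open>left_mc\<close>. This is where all left
  coinvariant forms are seen to be Maurer-Cartan forms.\<close>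

lemma coinv_eq: "carrier coinv = mc ` carrier H"
proof (intro equalityI subsetI)
  fix \<theta> assume "\<theta> \<in> carrier coinv"
  then show "\<theta> \<in> mc ` carrier H" using Pr_image[of \<theta>] by (simp add: Pr_id)
qed auto

lemma Pr_Lin: "Pr \<in> Lin \<Gamma> coinv"
proof -
  have "Pr \<in> Lin \<Gamma> (\<Gamma>\<lparr>carrier := carrier coinv\<rparr>)"
    by (rule Lin_corestrict[OF Pr_Lin_\<Gamma>]) (unfold coinv_eq, rule Pr_image)
  moreover have "\<Gamma>\<lparr>carrier := carrier coinv\<rparr> = coinv" unfolding coinv_def by simp
  ultimately show ?thesis by simp
qed

lemmas Pr_closed [simp] = Lin_closed[OF Pr_Lin]
lemmas [lin_intro] = Lin_comp[OF Pr_Lin]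

lemma mc_Lin_coinv [lin_intro]: "f \<in> Lin X H \<Longrightarrow> (\<lambda>x. mc (f x)) \<in> Lin X coinv"
  unfolding coinv_def
  by (rule Lin_corestrict[OF Lin_comp[OF mc_Lin]]) (auto simp: left_mc Lin_closed[of f X H])

text \<open>Phrased as a convolution with the antipode, so that \<open>Psi_conv\<close> covers this
  action together with \<open>mc\<close>.\<close>

definition cact :: "'m \<Rightarrow> 'h \<Rightarrow> 'm"
  where "cact \<theta> h = conv (\<lambda>h. ract \<Gamma> \<theta> h) h"

text \<open>The left coaction of \<theta> h is h_1 \<otimes> \<theta> h_2, and applying the
  projection gives S(h_1) \<theta> h_2. In this form it is clear that the action preserves
  coinvariant forms and is bilinear.\<close>

lemma cact_Pr:
  assumes "\<theta> \<in> carrier coinv" and [simp]: "h \<in> carrier H"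
  shows "cact \<theta> h = Pr (ract \<Gamma> \<theta> h)"
proof -
  have \<theta> [simp]: "\<theta> \<in> carrier \<Gamma>" "lco \<theta> = tens K H \<Gamma> \<one>\<^bsub>H\<^esub> \<theta>" using assms(1) by (simp_all add: coinv_iff)
  have "bilin H H H (\<lambda>a m. m \<otimes>\<^bsub>H\<^esub> a)" "bilin H \<Gamma> \<Gamma> (\<lambda>h m. ract \<Gamma> m h)" by (intro lin_intro; simp)+
  then have "ractW (comult H h) (tens K H \<Gamma> \<one>\<^bsub>H\<^esub> \<theta>) = lift H H (H \<boxtimes> \<Gamma>) (comult H h) (\<lambda>h1 h2. tens K H \<Gamma> h1 (ract \<Gamma> \<theta> h2))"
    by (subst tact_lift_tens) simp_all
  then show ?thesis
    by (simp add: Pr_def left_bilinear lift_lift lift_tens Pr_bilin cact_def conv_def)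
qed

lemma cact_closed [simp]: "\<theta> \<in> carrier coinv \<Longrightarrow> h \<in> carrier H \<Longrightarrow> cact \<theta> h \<in> carrier coinv"
  by (simp add: cact_Pr)

lemma cact_bilin: "bilin coinv H coinv cact"
proof -
  have "bilin coinv H coinv (\<lambda>\<theta> h. Pr (ract \<Gamma> \<theta> h))" by (intro lin_intro) simp_all
  then show ?thesis
    by (simp add: bilin_def lin_maps_def cact_Pr)
qed

text \<open>A closed formula with values in \<open>coinv\<close> \<otimes> H, in place of an inverse
  image under the inclusion into \<Gamma> \<otimes> H; \<open>ccoact_incl\<close> shows that it is
  the restriction of \<rho>.\<close>

definition ccoact :: "'m \<Rightarrow> ('m \<times> 'h \<Rightarrow> 'k) set"
  where "ccoact \<theta> = lift \<Gamma> H (coinv \<boxtimes> H) (\<rho> \<theta>) (\<lambda>\<theta>0 \<theta>1. tens K coinv H (Pr \<theta>0) \<theta>1)"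

lemma ccoact_Lin: "ccoact \<in> Lin coinv (coinv \<boxtimes> H)"
  unfolding ccoact_def[abs_def] by (intro lin_intro) simp_all

text \<open>Because left and right coaction commute, the left coaction applied to the first leg of
  \<rho>(\<theta>) gives 1 \<otimes> \<theta>_0 \<otimes> \<theta>_1. The projection in the first
  leg therefore multiplies by S(1) = 1 and changes nothing.\<close>

lemma ccoact_incl:
  assumes "\<theta> \<in> carrier coinv"
  shows "lift coinv H (\<Gamma> \<boxtimes> H) (ccoact \<theta>) (tens K \<Gamma> H) = \<rho> \<theta>"
proof -
  have \<theta> [simp]: "\<theta> \<in> carrier \<Gamma>" "lco \<theta> = tens K H \<Gamma> \<one>\<^bsub>H\<^esub> \<theta>" using assms(1) by (simp_all add: coinv_iff)
  let ?U = "(H \<boxtimes> \<Gamma>) \<boxtimes> H"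
  let ?g = "\<lambda>n h. tens K \<Gamma> H (lift H \<Gamma> \<Gamma> n (\<lambda>h \<gamma>. lact \<Gamma> (antipode H h) \<gamma>)) h"
  have B1: "bilin coinv H (\<Gamma> \<boxtimes> H) (\<lambda>\<theta> h. tens K \<Gamma> H \<theta> h)" by (intro lin_intro) simp_all
  have B2: "bilin (H \<boxtimes> \<Gamma>) H (\<Gamma> \<boxtimes> H) ?g" by (intro lin_intro) simp_all
  have B3: "bilin H \<Gamma> ?U (\<lambda>a \<gamma>. lift \<Gamma> H ?U (\<rho> \<gamma>) (\<lambda>\<gamma>0 g. tens K (H \<boxtimes> \<Gamma>) H (tens K H \<Gamma> a \<gamma>0) g))"
    by (intro lin_intro) simp_all
  have "lift coinv H (\<Gamma> \<boxtimes> H) (ccoact \<theta>) (tens K \<Gamma> H) = lift \<Gamma> H (\<Gamma> \<boxtimes> H) (\<rho> \<theta>) (\<lambda>\<theta>0 \<theta>1. tens K \<Gamma> H (Pr \<theta>0) \<theta>1)"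
    by (simp add: ccoact_def lift_lift lift_tens B1)
  also have "\<dots> = lift (H \<boxtimes> \<Gamma>) H (\<Gamma> \<boxtimes> H) (lift \<Gamma> H ?U (\<rho> \<theta>) (\<lambda>\<omega>0 h. tens K (H \<boxtimes> \<Gamma>) H (lco \<omega>0) h)) ?g"
    by (simp add: Pr_def lift_lift lift_tens B2)
  also have "\<dots> = lift (H \<boxtimes> \<Gamma>) H (\<Gamma> \<boxtimes> H) (lift \<Gamma> H ?U (\<rho> \<theta>) (\<lambda>\<gamma>0 g. tens K (H \<boxtimes> \<Gamma>) H (tens K H \<Gamma> \<one>\<^bsub>H\<^esub> \<gamma>0) g)) ?g"
    by (simp add: left_colinear lift_tens B3)
  also have "\<dots> = \<rho> \<theta>"
    by (simp add: lift_lift lift_tens B2 Pr_bilin antipode_one lift_id)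
  finally show ?thesis .
qed

end

section \<open>Vertical forms\<close>

context base_field
begin

lemma lift_submodule:
  assumes "VS V" "VS W" "VS U" "P \<in> carrier (V \<boxtimes> W)" "submodule N K U"
    "\<And>v w. v \<in> carrier V \<Longrightarrow> w \<in> carrier W \<Longrightarrow> \<beta> v w \<in> N"
  shows "lift V W U P \<beta> \<in> N"
proof -
  interpret T: presentation K "carrier V \<times> carrier W" "bilin_rels K V W"
    by (rule presentation_tensor[OF assms(1,2)])
  have r: "T.rep P \<in> carrier (free_space K (carrier V \<times> carrier W))"
    using T.rep(2) assms(4) by (simp add: tensor_space_def)
  note S = submoduleD[OF assms(3,5)]
  show ?thesis
    unfolding lift_def T.pres_lift_rep lin_ext_def
    by (rule submodule_finsum[OF assms(3,5)], rule S(5)) (use r S(2) assms(6) in \<open>auto simp: free_space_iff\<close>)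
qed

end

locale vert = two_fodc K H A \<delta> \<Gamma> \<rho> \<Gamma>' \<rho>' F + G: bicov_fodc K H \<Gamma>' \<rho>' lco
  for K :: "'k ring" and H :: "('k, 'h) hopf" and A :: "('k, 'a, 'e) module_scheme" and \<delta>
    and \<Gamma> :: "('k, 'm, 'a) fodc" and \<rho> and \<Gamma>' :: "('k, 'n, 'h) fodc" and \<rho>' and F and lco
begin

abbreviation "L \<equiv> G.coinv"
abbreviation "V \<equiv> A \<boxtimes> G.coinv"
abbreviation "W \<equiv> A \<boxtimes> \<Gamma>'"

definition Psi :: "('a \<times> 'n \<Rightarrow> 'k) set \<Rightarrow> ('a \<times> 'n \<Rightarrow> 'k) set"
  where "Psi v = lift A L W v (\<lambda>a \<theta>. lift A H W (\<delta> a) (\<lambda>a0 a1. tens K A \<Gamma>' a0 (lact \<Gamma>' a1 \<theta>)))"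

definition Ret :: "('a \<times> 'n \<Rightarrow> 'k) set \<Rightarrow> ('a \<times> 'n \<Rightarrow> 'k) set"
  where "Ret n = lift A \<Gamma>' V n (\<lambda>a \<gamma>. lift A H V (\<delta> a) (\<lambda>a0 a1. tens K A L a0 (G.Pr (lact \<Gamma>' (antipode H a1) \<gamma>))))"

text \<open>Composed from two linear maps, hence linear by construction; \<open>vpi_gen\<close>
  recovers the formula for the vertical projection, which is thereby seen to be well
  defined.\<close>

definition vpi :: "'m \<Rightarrow> ('a \<times> 'n \<Rightarrow> 'k) set"
  where "vpi \<omega> = Ret (F \<omega>)"

lemma Psi_bilin: "bilin A L W (\<lambda>a \<theta>. lift A H W (\<delta> a) (\<lambda>a0 a1. tens K A \<Gamma>' a0 (lact \<Gamma>' a1 \<theta>)))"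
  by (intro lin_intro) simp_all

lemma Psi_Lin: "Psi \<in> Lin V W"
  unfolding Psi_def[abs_def] by (intro lift_Lin Psi_bilin) simp_all

lemmas Psi_closed [simp] = Lin_closed[OF Psi_Lin]
lemmas [lin_intro] = Lin_comp[OF Psi_Lin]

lemma Psi_tens:
  "a \<in> carrier A \<Longrightarrow> \<theta> \<in> carrier L \<Longrightarrow>
    Psi (tens K A L a \<theta>) = lift A H W (\<delta> a) (\<lambda>a0 a1. tens K A \<Gamma>' a0 (lact \<Gamma>' a1 \<theta>))"
  by (simp add: Psi_def lift_tens Psi_bilin)

lemma Ret_bilin: "bilin A \<Gamma>' V (\<lambda>a \<gamma>. lift A H V (\<delta> a) (\<lambda>a0 a1. tens K A L a0 (G.Pr (lact \<Gamma>' (antipode H a1) \<gamma>))))"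
  by (intro lin_intro) simp_all

lemma Ret_Lin: "Ret \<in> Lin W V"
  unfolding Ret_def[abs_def] by (intro lift_Lin Ret_bilin) simp_all

lemmas Ret_closed [simp] = Lin_closed[OF Ret_Lin]
lemmas [lin_intro] = Lin_comp[OF Ret_Lin]

lemma vpi_Lin: "vpi \<in> Lin \<Gamma> V"
  unfolding vpi_def[abs_def] by (intro lin_intro)

lemmas vpi_closed [simp] = Lin_closed[OF vpi_Lin]
lemmas [lin_intro] = Lin_comp[OF vpi_Lin]

text \<open>The composite sends a \<otimes> \<theta> to a_0 \<otimes> P(S(a_1) a_2 \<theta>), which
  collapses to a \<otimes> P(\<theta>), and P fixes coinvariant forms.\<close>

lemma Ret_Psi:
  assumes v: "v \<in> carrier V"
  shows "Ret (Psi v) = v"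
proof (rule tensor_eqI[OF Lin_comp[OF Ret_Lin Psi_Lin] Lin_id _ _ _ _ v])
  fix a \<theta> assume [simp]: "a \<in> carrier A" "\<theta> \<in> carrier L"
  have "Ret (Psi (tens K A L a \<theta>)) = lift A H V (\<delta> a) (\<lambda>a0 a1. lift A H V (\<delta> a0)
    (\<lambda>p q. tens K A L p (G.Pr (lact \<Gamma>' (antipode H q) (lact \<Gamma>' a1 \<theta>)))))"
    by (simp add: Psi_tens Lin_lift[OF _ _ _ _ _ _ Ret_Lin]) (simp add: Ret_def lift_tens Ret_bilin)
  also have "\<dots> = lift A H V (\<delta> a) (\<lambda>a0 h. lift H H V (comult H h)
    (\<lambda>q r. tens K A L a0 (G.Pr (lact \<Gamma>' (antipode H q) (lact \<Gamma>' r \<theta>)))))"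
    by (intro coassoc[OF comodule_A] lin_intro) simp_all
  also have "\<dots> = lift A H V (\<delta> a) (\<lambda>a0 h. lift H H V (comult H h)
    (\<lambda>q r. tens K A L a0 (G.Pr (lact \<Gamma>' (antipode H q \<otimes>\<^bsub>H\<^esub> r) \<theta>))))"
    by (simp add: bimoduleD(6)[OF G.bimodule_\<Gamma>])
  also have "\<dots> = lift A H V (\<delta> a) (\<lambda>a0 h. counit H h \<odot>\<^bsub>V\<^esub> tens K A L a0 (G.Pr (lact \<Gamma>' \<one>\<^bsub>H\<^esub> \<theta>)))"
    by (intro lift_cong refl antipode_lift(1)[where f = "\<lambda>h. tens K A L _ (G.Pr (lact \<Gamma>' h \<theta>))"] lin_intro) simp_all
  also have "\<dots> = tens K A L a (G.Pr (lact \<Gamma>' \<one>\<^bsub>H\<^esub> \<theta>))"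
    by (intro counit_right_lift[OF comodule_A, where f = "\<lambda>a. tens K A L a (G.Pr (lact \<Gamma>' \<one>\<^bsub>H\<^esub> \<theta>))"] lin_intro) simp_all
  finally show "Ret (Psi (tens K A L a \<theta>)) = tens K A L a \<theta>" by (simp add: G.Pr_id)
qed simp_all

text \<open>The embedding produces a_0 c_0 \<otimes> a_1 c_1 S(c_2) m(c_3), where the antipode
  cancels. Used twice: with m = d for the vertical projection, and with m = (h \<mapsto> \<theta> h)
  for the right action on vertical forms.\<close>

lemma Psi_conv:
  assumes [simp]: "a \<in> carrier A" "c \<in> carrier A" and m: "m \<in> Lin H \<Gamma>'"
    and cm [simp]: "\<And>h. h \<in> carrier H \<Longrightarrow> G.conv m h \<in> carrier L"
  shows "Psi (lift A H V (\<delta> c) (\<lambda>c0 c1. tens K A L (a \<otimes>\<^bsub>A\<^esub> c0) (G.conv m c1))) =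
    lift A H W (\<delta> a) (\<lambda>a0 a1. lift A H W (\<delta> c) (\<lambda>c0 c1. tens K A \<Gamma>' (a0 \<otimes>\<^bsub>A\<^esub> c0) (lact \<Gamma>' a1 (m c1))))"
proof -
  note [simp] = Lin_closed[OF m]
  note cm_Lin = Lin_comp[OF G.conv_Lin[OF m]]
  have B: "bilin A H W (\<lambda>u v. tens K A \<Gamma>' u (lact \<Gamma>' v \<gamma>))" if "\<gamma> \<in> carrier \<Gamma>'" for \<gamma>
    using that by (intro lin_intro) simp_all
  have "Psi (lift A H V (\<delta> c) (\<lambda>c0 c1. tens K A L (a \<otimes>\<^bsub>A\<^esub> c0) (G.conv m c1))) =
    lift A H W (\<delta> c) (\<lambda>c0 c1. lift A H W (\<delta> a) (\<lambda>a0 a1. lift A H W (\<delta> c0)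
      (\<lambda>p q. tens K A \<Gamma>' (a0 \<otimes>\<^bsub>A\<^esub> p) (lact \<Gamma>' (a1 \<otimes>\<^bsub>H\<^esub> q) (G.conv m c1)))))"
    by (simp add: Lin_lift[OF _ _ _ _ _ _ Psi_Lin] Psi_tens coaction_mult_lift B)
  also have "\<dots> = lift A H W (\<delta> a) (\<lambda>a0 a1. lift A H W (\<delta> c) (\<lambda>c0 c1. lift A H W (\<delta> c0)
      (\<lambda>p q. tens K A \<Gamma>' (a0 \<otimes>\<^bsub>A\<^esub> p) (lact \<Gamma>' (a1 \<otimes>\<^bsub>H\<^esub> q) (G.conv m c1)))))"
    by (rule lift_swap) simp_all
  also have "\<dots> = lift A H W (\<delta> a) (\<lambda>a0 a1. lift A H W (\<delta> c) (\<lambda>c0 c1. lift H H W (comult H c1)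
      (\<lambda>q r. tens K A \<Gamma>' (a0 \<otimes>\<^bsub>A\<^esub> c0) (lact \<Gamma>' (a1 \<otimes>\<^bsub>H\<^esub> q) (G.conv m r)))))"
    by (intro lift_cong refl coassoc[OF comodule_A] lin_intro cm_Lin) simp_all
  also have "\<dots> = lift A H W (\<delta> a) (\<lambda>a0 a1. lift A H W (\<delta> c) (\<lambda>c0 c1.
      tens K A \<Gamma>' (a0 \<otimes>\<^bsub>A\<^esub> c0) (lact \<Gamma>' a1 (lift H H \<Gamma>' (comult H c1) (\<lambda>q r. lact \<Gamma>' q (G.conv m r))))))"
    by (intro lift_cong refl)
      (simp add: bimoduleD(6)[OF G.bimodule_\<Gamma>] Lin_lift[OF _ _ _ _ _ _ bilinD(1)[OF tens_bilin]]
        Lin_lift[OF _ _ _ _ _ _ bilinD(1)[OF bimoduleD(9)[OF G.bimodule_\<Gamma>]]])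
  finally show ?thesis by (simp add: G.conv_cancel[OF m])
qed

lemma Psi_gen:
  assumes "a \<in> carrier A" "b \<in> carrier A"
  shows "Psi (lift A H V (\<delta> b) (\<lambda>b0 h. tens K A L (a \<otimes>\<^bsub>A\<^esub> b0) (G.mc h))) = F (lact \<Gamma> a (d b))"
  using assms Psi_conv[OF assms G.d_Lin] by (simp add: G.mc_def[symmetric] F_gen)

lemma vpi_gen:
  assumes [simp]: "a \<in> carrier A" "b \<in> carrier A"
  shows "vpi (lact \<Gamma> a (d b)) = lift A H V (\<delta> b) (\<lambda>b0 h. tens K A L (a \<otimes>\<^bsub>A\<^esub> b0) (G.mc h))"
  by (simp add: vpi_def Ret_Psi flip: Psi_gen)

lemma Psi_vpi: "\<omega> \<in> carrier \<Gamma> \<Longrightarrow> Psi (vpi \<omega>) = F \<omega>"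
  by (rule fodc_eqI[OF fodc Lin_comp[OF Psi_Lin vpi_Lin] F_Lin]) (simp_all add: vpi_gen Psi_gen)

lemma Psi_inj: "v \<in> carrier V \<Longrightarrow> v' \<in> carrier V \<Longrightarrow> Psi v = Psi v' \<Longrightarrow> v = v'"
  by (metis Ret_Psi)

lemma vpi_zero_iff: "\<omega> \<in> carrier \<Gamma> \<Longrightarrow> vpi \<omega> = \<zero>\<^bsub>V\<^esub> \<longleftrightarrow> F \<omega> = \<zero>\<^bsub>W\<^esub>"
  using Psi_vpi[of \<omega>] Lin_zero[OF Psi_Lin] Lin_zero[OF Ret_Lin] by (auto simp: vpi_def)

definition vlact :: "'a \<Rightarrow> ('a \<times> 'n \<Rightarrow> 'k) set \<Rightarrow> ('a \<times> 'n \<Rightarrow> 'k) set"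
  where "vlact a v = lift A L V v (\<lambda>a' \<theta>. tens K A L (a \<otimes>\<^bsub>A\<^esub> a') \<theta>)"

definition vract :: "('a \<times> 'n \<Rightarrow> 'k) set \<Rightarrow> 'a \<Rightarrow> ('a \<times> 'n \<Rightarrow> 'k) set"
  where "vract v a = lift A L V v (\<lambda>a' \<theta>. lift A H V (\<delta> a)
    (\<lambda>a0 a1. tens K A L (a' \<otimes>\<^bsub>A\<^esub> a0) (G.cact \<theta> a1)))"

definition vcoact :: "('a \<times> 'n \<Rightarrow> 'k) set \<Rightarrow> (('a \<times> 'n \<Rightarrow> 'k) set \<times> 'h \<Rightarrow> 'k) set"
  where "vcoact v = lift A L (V \<boxtimes> H) v (\<lambda>a \<theta>. lift A H (V \<boxtimes> H) (\<delta> a) (\<lambda>a0 a1.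
    lift L H (V \<boxtimes> H) (G.ccoact \<theta>) (\<lambda>\<theta>0 \<theta>1. tens K V H (tens K A L a0 \<theta>0) (a1 \<otimes>\<^bsub>H\<^esub> \<theta>1))))"

lemma ccoact_closed [simp]: "\<theta> \<in> carrier L \<Longrightarrow> G.ccoact \<theta> \<in> carrier (L \<boxtimes> H)"
  by (rule Lin_closed[OF G.ccoact_Lin])

lemmas [lin_intro] = Lin_comp[OF G.ccoact_Lin] Lin_bilin[OF G.cact_bilin]

lemma vlact_bilin: "a \<in> carrier A \<Longrightarrow> bilin A L V (\<lambda>a' \<theta>. tens K A L (a \<otimes>\<^bsub>A\<^esub> a') \<theta>)"
  by (intro lin_intro) simp_all

lemma vract_bilin: "a \<in> carrier A \<Longrightarrow> bilin A L V (\<lambda>a' \<theta>. lift A H V (\<delta> a)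
    (\<lambda>a0 a1. tens K A L (a' \<otimes>\<^bsub>A\<^esub> a0) (G.cact \<theta> a1)))"
  by (intro lin_intro) simp_all

lemma vcoact_bilin: "bilin A L (V \<boxtimes> H) (\<lambda>a \<theta>. lift A H (V \<boxtimes> H) (\<delta> a) (\<lambda>a0 a1.
    lift L H (V \<boxtimes> H) (G.ccoact \<theta>) (\<lambda>\<theta>0 \<theta>1. tens K V H (tens K A L a0 \<theta>0) (a1 \<otimes>\<^bsub>H\<^esub> \<theta>1))))"
  by (intro lin_intro) simp_all

lemma vlact_Lin: "a \<in> carrier A \<Longrightarrow> vlact a \<in> Lin V V"
  unfolding vlact_def[abs_def] by (intro lift_Lin vlact_bilin) simp_all

lemma vract_Lin: "a \<in> carrier A \<Longrightarrow> (\<lambda>v. vract v a) \<in> Lin V V"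
  unfolding vract_def by (intro lift_Lin vract_bilin) simp_all

lemma vcoact_Lin: "vcoact \<in> Lin V (V \<boxtimes> H)"
  unfolding vcoact_def[abs_def] by (intro lift_Lin vcoact_bilin) simp_all

lemma Psi_vlact:
  assumes [simp]: "a \<in> carrier A" and v: "v \<in> carrier V"
  shows "Psi (vlact a v) = lactW (\<delta> a) (Psi v)"
proof (rule tensor_eqI[OF Lin_comp[OF Psi_Lin vlact_Lin] Lin_comp[OF bilinD(1)[OF biactionD(2)[OF biaction_W]] Psi_Lin] _ _ _ _ v])
  fix c \<theta> assume [simp]: "c \<in> carrier A" "\<theta> \<in> carrier L"
  have B: "bilin A \<Gamma>' W (\<lambda>x y. tens K A \<Gamma>' (a \<otimes>\<^bsub>A\<^esub> x) (lact \<Gamma>' h y))"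
    if "a \<in> carrier A" "h \<in> carrier H" for a h using that by (intro lin_intro) simp_all
  have B2: "bilin A H W (\<lambda>u v. tens K A \<Gamma>' u (lact \<Gamma>' v \<theta>))" by (intro lin_intro) simp_all
  show "Psi (vlact a (tens K A L c \<theta>)) = lactW (\<delta> a) (Psi (tens K A L c \<theta>))"
    by (simp add: vlact_def lift_tens vlact_bilin Psi_tens coaction_mult_lift B2 tact_def lift_lift B
        bimoduleD(6)[OF G.bimodule_\<Gamma>])
qed simp_all

text \<open>The twisted action on coinvariant forms is a convolution with the antipode, so
  \<open>Psi_conv\<close> turns the right action on vertical forms into the untwisted diagonal
  one.\<close>

lemma Psi_vract:
  assumes [simp]: "a \<in> carrier A" and v: "v \<in> carrier V"
  shows "Psi (vract v a) = ractW (\<delta> a) (Psi v)"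
proof (rule tensor_eqI[OF Lin_comp[OF Psi_Lin vract_Lin] Lin_comp[OF bilinD(1)[OF biactionD(3)[OF biaction_W]] Psi_Lin] _ _ _ _ v])
  fix c \<theta> assume [simp]: "c \<in> carrier A" "\<theta> \<in> carrier L"
  have B: "bilin A \<Gamma>' W (\<lambda>x y. tens K A \<Gamma>' (x \<otimes>\<^bsub>A\<^esub> a) (ract \<Gamma>' y h))"
    if "a \<in> carrier A" "h \<in> carrier H" for a h using that by (intro lin_intro) simp_all
  have m: "(\<lambda>h. ract \<Gamma>' \<theta> h) \<in> Lin H \<Gamma>'" by (intro lin_intro) simp_all
  have cv: "G.conv (ract \<Gamma>' \<theta>) h = G.cact \<theta> h" for h by (simp add: G.cact_def)
  have "Psi (vract (tens K A L c \<theta>) a) = lift A H W (\<delta> c) (\<lambda>c0 c1. lift A H W (\<delta> a)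
    (\<lambda>a0 a1. tens K A \<Gamma>' (c0 \<otimes>\<^bsub>A\<^esub> a0) (lact \<Gamma>' c1 (ract \<Gamma>' \<theta> a1))))"
    using Psi_conv[OF \<open>c \<in> carrier A\<close> assms(1) m] by (simp add: vract_def lift_tens vract_bilin cv)
  also have "\<dots> = lift A H W (\<delta> a) (\<lambda>a0 a1. lift A H W (\<delta> c)
    (\<lambda>c0 c1. tens K A \<Gamma>' (c0 \<otimes>\<^bsub>A\<^esub> a0) (lact \<Gamma>' c1 (ract \<Gamma>' \<theta> a1))))"
    by (rule lift_swap) simp_all
  also have "\<dots> = ractW (\<delta> a) (Psi (tens K A L c \<theta>))"
    by (simp add: Psi_tens tact_def lift_lift lift_tens B bimoduleD(8)[OF G.bimodule_\<Gamma>])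
  finally show "Psi (vract (tens K A L c \<theta>) a) = ractW (\<delta> a) (Psi (tens K A L c \<theta>))" .
qed simp_all

text \<open>Once \<open>ccoact_incl\<close> has replaced the coaction of coinvariant forms by
  \<open>\<rho>'\<close>, coassociativity splits the H-leg of a between the form and the last
  factor, and left linearity of \<open>\<rho>'\<close> recognises the result as the coaction of a_1
  \<theta>.\<close>

lemma Psi_vcoact:
  assumes v: "v \<in> carrier V"
  shows "lift V H (W \<boxtimes> H) (vcoact v) (\<lambda>v0 h. tens K W H (Psi v0) h) =
    lift A \<Gamma>' (W \<boxtimes> H) (Psi v) (\<lambda>a \<gamma>. lift \<Gamma>' H (W \<boxtimes> H) (\<rho>' \<gamma>) (\<lambda>\<gamma>0 g. tens K W H (tens K A \<Gamma>' a \<gamma>0) g))"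
proof -
  let ?U = "W \<boxtimes> H"
  have B1: "bilin V H ?U (\<lambda>v0 h. tens K W H (Psi v0) h)" by (intro lin_intro) simp_all
  have B2: "bilin A \<Gamma>' ?U (\<lambda>a \<gamma>. lift \<Gamma>' H ?U (\<rho>' \<gamma>) (\<lambda>\<gamma>0 g. tens K W H (tens K A \<Gamma>' a \<gamma>0) g))"
    by (intro lin_intro) simp_all
  show ?thesis
  proof (rule tensor_eqI[where U = ?U, OF Lin_comp[OF lift_Lin[OF _ _ _ B1] vcoact_Lin]
      Lin_comp[OF lift_Lin[OF _ _ _ B2] Psi_Lin] _ _ _ _ v])
    fix a \<theta> assume [simp]: "a \<in> carrier A" "\<theta> \<in> carrier L"
    have B3: "bilin \<Gamma>' H ?U (\<lambda>\<theta>0 \<theta>1. lift A H ?U (\<delta> a0) (\<lambda>p q. tens K W H (tens K A \<Gamma>' p (lact \<Gamma>' q \<theta>0)) (a1 \<otimes>\<^bsub>H\<^esub> \<theta>1)))"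
      if "a0 \<in> carrier A" "a1 \<in> carrier H" for a0 a1
      using that by (intro lin_intro) simp_all
    have B4: "bilin L H (\<Gamma>' \<boxtimes> H) (tens K \<Gamma>' H)" by (intro lin_intro) simp_all
    have B5: "bilin \<Gamma>' H ?U (\<lambda>\<gamma>0 g. tens K W H (tens K A \<Gamma>' a \<gamma>0) g)" if "a \<in> carrier A" for a
      using that by (intro lin_intro) simp_all
    have push: "tens K W H (lift A H W P \<beta>) h = lift A H ?U P (\<lambda>x y. tens K W H (\<beta> x y) h)"
      if "P \<in> carrier (A \<boxtimes> H)" "h \<in> carrier H" "\<And>x y. x \<in> carrier A \<Longrightarrow> y \<in> carrier H \<Longrightarrow> \<beta> x y \<in> carrier W" for P \<beta> h
      by (rule Lin_lift[where f = "\<lambda>n. tens K W H n h" and U = W])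
        (use that in \<open>simp_all add: bilinD(2)[OF tens_bilin]\<close>)
    have "lift V H ?U (vcoact (tens K A L a \<theta>)) (\<lambda>v0 h. tens K W H (Psi v0) h) =
      lift A H ?U (\<delta> a) (\<lambda>a0 a1. lift L H ?U (G.ccoact \<theta>) (\<lambda>\<theta>0 \<theta>1.
        lift A H ?U (\<delta> a0) (\<lambda>p q. tens K W H (tens K A \<Gamma>' p (lact \<Gamma>' q \<theta>0)) (a1 \<otimes>\<^bsub>H\<^esub> \<theta>1))))"
      by (simp add: vcoact_def vcoact_bilin lift_lift lift_tens B1 Psi_tens push)
    also have "\<dots> = lift A H ?U (\<delta> a) (\<lambda>a0 a1. lift \<Gamma>' H ?U (lift L H (\<Gamma>' \<boxtimes> H) (G.ccoact \<theta>) (tens K \<Gamma>' H)) (\<lambda>\<theta>0 \<theta>1.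
        lift A H ?U (\<delta> a0) (\<lambda>p q. tens K W H (tens K A \<Gamma>' p (lact \<Gamma>' q \<theta>0)) (a1 \<otimes>\<^bsub>H\<^esub> \<theta>1))))"
      by (simp add: lift_lift lift_tens B3)
    also have "\<dots> = lift A H ?U (\<delta> a) (\<lambda>a0 a1. lift A H ?U (\<delta> a0) (\<lambda>p q. lift \<Gamma>' H ?U (\<rho>' \<theta>) (\<lambda>\<theta>0 \<theta>1.
        tens K W H (tens K A \<Gamma>' p (lact \<Gamma>' q \<theta>0)) (a1 \<otimes>\<^bsub>H\<^esub> \<theta>1))))"
      unfolding G.ccoact_incl[OF \<open>\<theta> \<in> carrier L\<close>] by (intro lift_cong refl lift_swap) simp_all
    also have "\<dots> = lift A H ?U (\<delta> a) (\<lambda>a0 h. lift H H ?U (comult H h) (\<lambda>q r. lift \<Gamma>' H ?U (\<rho>' \<theta>) (\<lambda>\<theta>0 \<theta>1.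
        tens K W H (tens K A \<Gamma>' a0 (lact \<Gamma>' q \<theta>0)) (r \<otimes>\<^bsub>H\<^esub> \<theta>1))))"
      by (intro coassoc[OF comodule_A] lin_intro) simp_all
    also have "\<dots> = lift A \<Gamma>' ?U (Psi (tens K A L a \<theta>)) (\<lambda>a \<gamma>. lift \<Gamma>' H ?U (\<rho>' \<gamma>) (\<lambda>\<gamma>0 g. tens K W H (tens K A \<Gamma>' a \<gamma>0) g))"
      by (simp add: Psi_tens lift_lift lift_tens B2 G.\<rho>_bilinear G.tact_def B5)
    finally show "lift V H ?U (vcoact (tens K A L a \<theta>)) (\<lambda>v0 h. tens K W H (Psi v0) h) =
      lift A \<Gamma>' ?U (Psi (tens K A L a \<theta>)) (\<lambda>a \<gamma>. lift \<Gamma>' H ?U (\<rho>' \<gamma>) (\<lambda>\<gamma>0 g. tens K W H (tens K A \<Gamma>' a \<gamma>0) g))" .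
  qed simp_all
qed

text \<open>Compared after the injective map \<open>Psi\<close>, where the claim is
  \<open>F_bilinear\<close>.\<close>

lemma vpi_lact: "a \<in> carrier A \<Longrightarrow> \<omega> \<in> carrier \<Gamma> \<Longrightarrow> vpi (lact \<Gamma> a \<omega>) = vlact a (vpi \<omega>)"
  by (rule Psi_inj) (simp_all add: Psi_vpi Psi_vlact F_bilinear Lin_closed[OF vlact_Lin])

lemma vpi_ract: "a \<in> carrier A \<Longrightarrow> \<omega> \<in> carrier \<Gamma> \<Longrightarrow> vpi (ract \<Gamma> \<omega> a) = vract (vpi \<omega>) a"
  by (rule Psi_inj) (simp_all add: Psi_vpi Psi_vract F_bilinear Lin_closed[OF vract_Lin])

text \<open>Compared after \<open>Psi\<close> \<otimes> id, which is injective because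
  \<open>Ret\<close> \<otimes> id is a left inverse; there the claim is
  \<open>F_colinear\<close>.\<close>

lemma vpi_coact:
  assumes [simp]: "\<omega> \<in> carrier \<Gamma>"
  shows "vcoact (vpi \<omega>) = lift \<Gamma> H (V \<boxtimes> H) (\<rho> \<omega>) (\<lambda>\<omega>0 h. tens K V H (vpi \<omega>0) h)"
proof -
  have B1: "bilin V H (W \<boxtimes> H) (\<lambda>v0 h. tens K W H (Psi v0) h)" by (intro lin_intro) simp_all
  have B2: "bilin W H (V \<boxtimes> H) (\<lambda>v0 h. tens K V H (Ret v0) h)" by (intro lin_intro) simp_all
  have inv: "lift W H (V \<boxtimes> H) (lift V H (W \<boxtimes> H) t (\<lambda>v0 h. tens K W H (Psi v0) h)) (\<lambda>v0 h. tens K V H (Ret v0) h) = t"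
    if [simp]: "t \<in> carrier (V \<boxtimes> H)" for t
    by (simp add: lift_lift lift_tens B2 Ret_Psi lift_id)
  have "lift V H (W \<boxtimes> H) (lift \<Gamma> H (V \<boxtimes> H) (\<rho> \<omega>) (\<lambda>\<omega>0 h. tens K V H (vpi \<omega>0) h)) (\<lambda>v0 h. tens K W H (Psi v0) h) =
    lift \<Gamma> H (W \<boxtimes> H) (\<rho> \<omega>) (\<lambda>\<omega>0 h. tens K W H (F \<omega>0) h)"
    by (simp add: lift_lift lift_tens B1 Psi_vpi)
  also have "\<dots> = lift V H (W \<boxtimes> H) (vcoact (vpi \<omega>)) (\<lambda>v0 h. tens K W H (Psi v0) h)"
    by (simp add: F_colinear Psi_vcoact Psi_vpi)
  finally show ?thesis
    using inv[of "vcoact (vpi \<omega>)"] inv[of "lift \<Gamma> H (V \<boxtimes> H) (\<rho> \<omega>) (\<lambda>\<omega>0 h. tens K V H (vpi \<omega>0) h)"]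
    by (simp add: Lin_closed[OF vcoact_Lin])
qed

text \<open>Surjectivity of the Galois map enters as a statement about spans, so that no tensor
  product over the coinvariant subalgebra appears. The linear map a \<otimes> h \<mapsto> a
  \<otimes> mc(h) takes each spanning element to a value of \<open>vpi\<close>.\<close>

lemma vpi_surj:
  assumes gal: "carrier (A \<boxtimes> H) \<subseteq> lin_span K (A \<boxtimes> H)
    {lift A H (A \<boxtimes> H) (\<delta> b) (\<lambda>b0 b1. tens K A H (a \<otimes>\<^bsub>A\<^esub> b0) b1) | a b. a \<in> carrier A \<and> b \<in> carrier A}"
  shows "vpi ` carrier \<Gamma> = carrier V"
proof (intro equalityI subsetI)
  fix v assume v: "v \<in> carrier V"
  have I: "submodule (vpi ` carrier \<Gamma>) K V" by (rule Lin_image_submodule[OF vpi_Lin]) simp_all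
  have B: "bilin A H V (\<lambda>a h. tens K A L a (G.mc h))" by (intro lin_intro) simp_all
  have k: "lift A H V t (\<lambda>a h. tens K A L a (G.mc h)) \<in> vpi ` carrier \<Gamma>" if t: "t \<in> carrier (A \<boxtimes> H)" for t
  proof (rule Lin_image_span[OF lift_Lin[OF _ _ _ B] _ _ _ subsetD[OF gal t] I])
    fix s assume "s \<in> {lift A H (A \<boxtimes> H) (\<delta> b) (\<lambda>b0 b1. tens K A H (a \<otimes>\<^bsub>A\<^esub> b0) b1) | a b. a \<in> carrier A \<and> b \<in> carrier A}"
    then obtain a b where [simp]: "a \<in> carrier A" "b \<in> carrier A"
      and s: "s = lift A H (A \<boxtimes> H) (\<delta> b) (\<lambda>b0 b1. tens K A H (a \<otimes>\<^bsub>A\<^esub> b0) b1)" by blast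
    have "lift A H V s (\<lambda>a h. tens K A L a (G.mc h)) = vpi (lact \<Gamma> a (d b))"
      by (simp add: s lift_lift lift_tens B vpi_gen)
    then show "lift A H V s (\<lambda>a h. tens K A L a (G.mc h)) \<in> vpi ` carrier \<Gamma>" by simp
  qed auto
  have "lift A L V v (tens K A L) \<in> vpi ` carrier \<Gamma>"
  proof (rule lift_submodule[OF _ _ _ v I])
    fix a \<theta> assume a [simp]: "a \<in> carrier A" and "\<theta> \<in> carrier L"
    then obtain h where h [simp]: "h \<in> carrier H" "\<theta> = G.mc h" unfolding G.coinv_eq by blast
    show "tens K A L a \<theta> \<in> vpi ` carrier \<Gamma>"
      using k[of "tens K A H a h"] by (simp add: lift_tens B)
  qed simp_all
  then show "v \<in> vpi ` carrier \<Gamma>" using v by (simp add: lift_id)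
qed auto

end

section \<open>Covariant bimodules\<close>

context base_field
begin

lemma VS_transfer:
  assumes "VS V" "carrier W = carrier V" "add W = add V" "zero W = zero V" "smult W = smult V"
  shows "VS W"
proof -
  interpret V: module K V by (rule assms(1))
  note s = assms(2-5)
  show ?thesis
  proof (rule moduleI[OF cring_K])
    show "abelian_group W"
      by (rule abelian_groupI; unfold s) (auto simp: V.a_ac intro: V.l_neg)
  qed (unfold s, simp_all add: V.smult_l_distr V.smult_r_distr V.smult_assoc1)
qed

end

context hopf_alg
begin

lemma covariance_formula_lift:
  fixes A :: "('k, 'a, 'h) comodule_alg" and M :: "('k, 'm, 'a, 'h) cov_bimod"
  assumes A: "comod_alg K H A (coact A)" and M: "bimodule K A M"
    and \<delta>: "bcoact M \<in> Lin M (M \<boxtimes> H)"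
    and [simp]: "a \<in> carrier A" "b \<in> carrier A" "m \<in> carrier M"
  shows "pres_lift K (M \<boxtimes> H) (\<lambda>(a\<^sub>0, a\<^sub>1). pres_lift K (M \<boxtimes> H) (\<lambda>(m\<^sub>0, m\<^sub>1).
      pres_lift K (M \<boxtimes> H) (\<lambda>(b\<^sub>0, b\<^sub>1).
        tens K M H (lact M a\<^sub>0 (ract M m\<^sub>0 b\<^sub>0)) (a\<^sub>1 \<otimes>\<^bsub>H\<^esub> (m\<^sub>1 \<otimes>\<^bsub>H\<^esub> b\<^sub>1)))
        (coact A b)) (bcoact M m)) (coact A a) =
    lift A H (M \<boxtimes> H) (coact A a) (\<lambda>a0 a1. lift M H (M \<boxtimes> H) (bcoact M m) (\<lambda>m0 m1.
      lift A H (M \<boxtimes> H) (coact A b) (\<lambda>b0 b1.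
        tens K M H (lact M a0 (ract M m0 b0)) (a1 \<otimes>\<^bsub>H\<^esub> (m1 \<otimes>\<^bsub>H\<^esub> b1)))))" (is "?L = ?R")
proof -
  interpret A: comod_alg K H A "coact A" by (rule A)
  note [simp] = bimoduleD(1-3)[OF M] Lin_closed[OF \<delta>]
  note e = pres_lift_eq_lift[where V = A and W = H] pres_lift_eq_lift[where V = M and W = H]
  have "?L = lift A H (M \<boxtimes> H) (coact A a) (\<lambda>a0 a1. pres_lift K (M \<boxtimes> H) (\<lambda>(m\<^sub>0, m\<^sub>1).
      pres_lift K (M \<boxtimes> H) (\<lambda>(b\<^sub>0, b\<^sub>1).
        tens K M H (lact M a0 (ract M m\<^sub>0 b\<^sub>0)) (a1 \<otimes>\<^bsub>H\<^esub> (m\<^sub>1 \<otimes>\<^bsub>H\<^esub> b\<^sub>1)))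
        (coact A b)) (bcoact M m))"
    by (rule pres_lift_eq_lift) (auto simp: e)
  also have "\<dots> = lift A H (M \<boxtimes> H) (coact A a) (\<lambda>a0 a1. lift M H (M \<boxtimes> H) (bcoact M m) (\<lambda>m0 m1.
      pres_lift K (M \<boxtimes> H) (\<lambda>(b\<^sub>0, b\<^sub>1).
        tens K M H (lact M a0 (ract M m0 b\<^sub>0)) (a1 \<otimes>\<^bsub>H\<^esub> (m1 \<otimes>\<^bsub>H\<^esub> b\<^sub>1)))
        (coact A b)))"
    by (intro lift_cong refl pres_lift_eq_lift) (auto simp: e)
  also have "\<dots> = ?R"
    by (intro lift_cong refl pres_lift_eq_lift) auto
  finally show ?thesis .
qed

lemma covariant_bimodule_iff:
  fixes A :: "('k, 'a, 'h) comodule_alg" and M :: "('k, 'm, 'a, 'h) cov_bimod"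
  assumes A: "comod_alg K H A (coact A)"
  shows "covariant_bimodule K H A M \<longleftrightarrow> bimodule K A M \<and> right_comodule K H M (bcoact M) \<and>
    (\<forall>a \<in> carrier A. \<forall>b \<in> carrier A. \<forall>m \<in> carrier M. bcoact M (lact M a (ract M m b)) =
      lift A H (M \<boxtimes> H) (coact A a) (\<lambda>a0 a1. lift M H (M \<boxtimes> H) (bcoact M m) (\<lambda>m0 m1.
        lift A H (M \<boxtimes> H) (coact A b) (\<lambda>b0 b1.
          tens K M H (lact M a0 (ract M m0 b0)) (a1 \<otimes>\<^bsub>H\<^esub> (m1 \<otimes>\<^bsub>H\<^esub> b1))))))"
  unfolding covariant_bimodule_def Let_def
proof (intro conj_cong refl ball_cong)
  fix a b m assume "bimodule K A M" "right_comodule K H M (bcoact M)"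
    and "a \<in> carrier A" "b \<in> carrier A" "m \<in> carrier M"
  then show "(bcoact M (lact M a (ract M m b)) = pres_lift K (M \<boxtimes> H) (\<lambda>(a\<^sub>0, a\<^sub>1). pres_lift K (M \<boxtimes> H) (\<lambda>(m\<^sub>0, m\<^sub>1).
      pres_lift K (M \<boxtimes> H) (\<lambda>(b\<^sub>0, b\<^sub>1).
        tens K M H (lact M a\<^sub>0 (ract M m\<^sub>0 b\<^sub>0)) (a\<^sub>1 \<otimes>\<^bsub>H\<^esub> (m\<^sub>1 \<otimes>\<^bsub>H\<^esub> b\<^sub>1)))
        (coact A b)) (bcoact M m)) (coact A a)) = (bcoact M (lact M a (ract M m b)) =
    lift A H (M \<boxtimes> H) (coact A a) (\<lambda>a0 a1. lift M H (M \<boxtimes> H) (bcoact M m) (\<lambda>m0 m1.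
      lift A H (M \<boxtimes> H) (coact A b) (\<lambda>b0 b1.
        tens K M H (lact M a0 (ract M m0 b0)) (a1 \<otimes>\<^bsub>H\<^esub> (m1 \<otimes>\<^bsub>H\<^esub> b1))))))"
    by (simp only: covariance_formula_lift[OF A] right_comoduleD(2)[of M "bcoact M"])
qed

text \<open>The axioms are equations and every element of N is a value of p, so each axiom is the
  image under p or p \<otimes> id of the one for M. With \<open>pi_v\<close> as p, this replaces a
  verification from the formulas of \<open>ver1\<close>.\<close>

lemma covariant_bimodule_quotient:
  fixes A :: "('k, 'a, 'h) comodule_alg" and M :: "('k, 'm, 'a, 'h) cov_bimod"
    and N :: "('k, 'n, 'a, 'h) cov_bimod"
  assumes A: "comod_alg K H A (coact A)" and M: "covariant_bimodule K H A M"
    and N [simp]: "VS N" and p: "p \<in> Lin M N" and surj: "p ` carrier M = carrier N"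
    and l: "\<And>a m. a \<in> carrier A \<Longrightarrow> m \<in> carrier M \<Longrightarrow> p (lact M a m) = lact N a (p m)"
    and r: "\<And>a m. a \<in> carrier A \<Longrightarrow> m \<in> carrier M \<Longrightarrow> p (ract M m a) = ract N (p m) a"
    and c: "\<And>m. m \<in> carrier M \<Longrightarrow> bcoact N (p m) = lift M H (N \<boxtimes> H) (bcoact M m) (\<lambda>m0 h. tens K N H (p m0) h)"
  shows "covariant_bimodule K H A N"
proof -
  interpret A: comod_alg K H A "coact A" by (rule A)
  note M' = M[unfolded covariant_bimodule_iff[OF A]]
  have bM: "bimodule K A M" and cM: "right_comodule K H M (bcoact M)" using M' by auto
  note B = bimoduleD[OF bM] and \<delta> = right_comoduleD(2)[OF cM]
  note [simp] = B(1-5) Lin_closed[OF \<delta>] Lin_closed[OF p]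
  note [lin_intro] = Lin_comp[OF p] Lin_comp[OF \<delta>] Lin_bilin[OF B(9)] Lin_bilin[OF B(10)]
  have ex: "\<exists>m \<in> carrier M. n = p m" if "n \<in> carrier N" for n using surj that by auto
  have bN: "bimodule K A N"
    unfolding bimodule_def left_module_def
  proof (intro conjI ballI Lin_I N)
    fix a n n' assume [simp]: "a \<in> carrier A" and n: "n \<in> carrier N" "n' \<in> carrier N"
    obtain m m' where [simp]: "m \<in> carrier M" "m' \<in> carrier M" and m: "n = p m" "n' = p m'" using n ex by metis
    show "lact N a (n \<oplus>\<^bsub>N\<^esub> n') = lact N a n \<oplus>\<^bsub>N\<^esub> lact N a n'"
      by (simp add: m Lin_add[OF bilinD(1)[OF B(9)]] flip: l Lin_add[OF p])
    show "ract N (n \<oplus>\<^bsub>N\<^esub> n') a = ract N n a \<oplus>\<^bsub>N\<^esub> ract N n' a"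
      by (simp add: m Lin_add[OF bilinD(2)[OF B(10)]] flip: r Lin_add[OF p])
  next
    fix a k n assume [simp]: "a \<in> carrier A" "k \<in> carrier K" and n: "n \<in> carrier N"
    obtain m where [simp]: "m \<in> carrier M" and m: "n = p m" using n ex by metis
    show "lact N a (k \<odot>\<^bsub>N\<^esub> n) = k \<odot>\<^bsub>N\<^esub> lact N a n" "lact N (k \<odot>\<^bsub>A\<^esub> a) n = k \<odot>\<^bsub>N\<^esub> lact N a n"
      by (simp_all add: m Lin_smult[OF bilinD(1)[OF B(9)]] Lin_smult[OF bilinD(2)[OF B(9)]] flip: l Lin_smult[OF p])
    show "ract N (k \<odot>\<^bsub>N\<^esub> n) a = k \<odot>\<^bsub>N\<^esub> ract N n a" "ract N n (k \<odot>\<^bsub>A\<^esub> a) = k \<odot>\<^bsub>N\<^esub> ract N n a"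
      by (simp_all add: m Lin_smult[OF bilinD(1)[OF B(10)]] Lin_smult[OF bilinD(2)[OF B(10)]] flip: r Lin_smult[OF p])
  next
    fix a n assume [simp]: "a \<in> carrier A" and n: "n \<in> carrier N"
    obtain m where [simp]: "m \<in> carrier M" and m: "n = p m" using n ex by metis
    show "lact N a n \<in> carrier N" "lact N a n \<in> carrier N" "ract N n a \<in> carrier N" "ract N n a \<in> carrier N"
      by (simp_all add: m flip: l r)
  next
    fix n assume n: "n \<in> carrier N"
    obtain m where [simp]: "m \<in> carrier M" and m: "n = p m" using n ex by metis
    show "lact N \<one>\<^bsub>A\<^esub> n = n" "ract N n \<one>\<^bsub>A\<^esub> = n" by (simp_all add: m flip: l r)
  next
    fix a b n assume [simp]: "a \<in> carrier A" "b \<in> carrier A" and n: "n \<in> carrier N"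
    obtain m where [simp]: "m \<in> carrier M" and m: "n = p m" using n ex by metis
    show "lact N (a \<oplus>\<^bsub>A\<^esub> b) n = lact N a n \<oplus>\<^bsub>N\<^esub> lact N b n"
      by (simp add: m Lin_add[OF bilinD(2)[OF B(9)]] flip: l Lin_add[OF p])
    show "ract N n (a \<oplus>\<^bsub>A\<^esub> b) = ract N n a \<oplus>\<^bsub>N\<^esub> ract N n b"
      by (simp add: m Lin_add[OF bilinD(1)[OF B(10)]] flip: r Lin_add[OF p])
    show "lact N (a \<otimes>\<^bsub>A\<^esub> b) n = lact N a (lact N b n)" by (simp add: m B(6) flip: l)
    show "ract N n (a \<otimes>\<^bsub>A\<^esub> b) = ract N (ract N n a) b" by (simp add: m B(7) flip: r)
    show "ract N (lact N a n) b = lact N a (ract N n b)" by (simp add: m B(8) flip: l r)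
  qed
  have pp: "bilin M H (N \<boxtimes> H) (\<lambda>m0 h. tens K N H (p m0) h)" by (intro lin_intro) simp_all
  have \<delta>N: "bcoact N \<in> Lin N (N \<boxtimes> H)"
  proof (rule Lin_I)
    fix n n' assume n: "n \<in> carrier N" "n' \<in> carrier N"
    obtain m m' where [simp]: "m \<in> carrier M" "m' \<in> carrier M" and m: "n = p m" "n' = p m'" using n ex by metis
    show "bcoact N (n \<oplus>\<^bsub>N\<^esub> n') = bcoact N n \<oplus>\<^bsub>N \<boxtimes> H\<^esub> bcoact N n'"
      by (simp add: m c Lin_add[OF \<delta>] Lin_add[OF lift_Lin[OF _ _ _ pp]] flip: Lin_add[OF p])
  next
    fix k n assume [simp]: "k \<in> carrier K" and n: "n \<in> carrier N"
    obtain m where [simp]: "m \<in> carrier M" and m: "n = p m" using n ex by metis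
    show "bcoact N (k \<odot>\<^bsub>N\<^esub> n) = k \<odot>\<^bsub>N \<boxtimes> H\<^esub> bcoact N n"
      by (simp add: m c Lin_smult[OF \<delta>] Lin_smult[OF lift_Lin[OF _ _ _ pp]] flip: Lin_smult[OF p])
  next
    fix n assume n: "n \<in> carrier N"
    obtain m where [simp]: "m \<in> carrier M" and m: "n = p m" using n ex by metis
    show "bcoact N n \<in> carrier (N \<boxtimes> H)" by (simp add: m c)
  qed
  note [simp] = Lin_closed[OF \<delta>N] and [lin_intro] = Lin_comp[OF \<delta>N]
  have cN: "right_comodule K H N (bcoact N)"
  proof (rule right_comoduleI[OF N \<delta>N])
    let ?U = "N \<boxtimes> H \<boxtimes> H"
    fix n assume "n \<in> carrier N"
    then obtain m where [simp]: "m \<in> carrier M" and m: "n = p m" using ex by metis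
    have B1: "bilin N H ?U (\<lambda>v0 h. lift N H ?U (bcoact N v0) (\<lambda>a b. tens K N (H \<boxtimes> H) a (tens K H H b h)))"
      by (intro lin_intro) simp_all
    have B2: "bilin N H ?U (\<lambda>a b. tens K N (H \<boxtimes> H) a (tens K H H b h))" if "h \<in> carrier H" for h
      using that by (intro lin_intro) simp_all
    have B3: "bilin N H ?U (\<lambda>v0 h. tens K N (H \<boxtimes> H) v0 (comult H h))"
      by (intro lin_intro) simp_all
    have "lift N H ?U (bcoact N n) (\<lambda>v0 h. lift N H ?U (bcoact N v0) (\<lambda>a b. tens K N (H \<boxtimes> H) a (tens K H H b h))) =
      lift M H ?U (bcoact M m) (\<lambda>m0 h. lift M H ?U (bcoact M m0) (\<lambda>a b. tens K N (H \<boxtimes> H) (p a) (tens K H H b h)))"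
      by (simp add: m c lift_lift lift_tens B1 B2)
    also have "\<dots> = lift M H ?U (bcoact M m) (\<lambda>m0 h. lift H H ?U (comult H h) (\<lambda>b c. tens K N (H \<boxtimes> H) (p m0) (tens K H H b c)))"
      by (intro coassoc[OF cM] lin_intro) simp_all
    also have "\<dots> = lift M H ?U (bcoact M m) (\<lambda>m0 h. tens K N (H \<boxtimes> H) (p m0) (comult H h))"
      by (intro lift_cong refl)
        (simp add: lift_id flip: Lin_lift[OF _ _ _ _ _ _ bilinD(1)[OF tens_bilin]])
    also have "\<dots> = lift N H ?U (bcoact N n) (\<lambda>v0 h. tens K N (H \<boxtimes> H) v0 (comult H h))"
      by (simp add: m c lift_lift lift_tens B3)
    finally show "lift N H ?U (bcoact N n) (\<lambda>v0 h. lift N H ?U (bcoact N v0) (\<lambda>a b. tens K N (H \<boxtimes> H) a (tens K H H b h))) =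
      lift N H ?U (bcoact N n) (\<lambda>v0 h. tens K N (H \<boxtimes> H) v0 (comult H h))" .
    have B4: "bilin N H N (\<lambda>v0 h. counit H h \<odot>\<^bsub>N\<^esub> v0)" by (intro lin_intro) simp_all
    show "lift N H N (bcoact N n) (\<lambda>v0 h. counit H h \<odot>\<^bsub>N\<^esub> v0) = n"
      by (simp add: m c lift_lift lift_tens B4 counit_right_lift[OF cM _ _ p])
  qed
  show ?thesis
    unfolding covariant_bimodule_iff[OF A]
  proof (intro conjI ballI bN cN)
    fix a b n assume [simp]: "a \<in> carrier A" "b \<in> carrier A" and n: "n \<in> carrier N"
    obtain m where [simp]: "m \<in> carrier M" and m: "n = p m" using n ex by metis
    note BN = bimoduleD[OF bN]
    note [simp] = BN(2,3)
    have b': "bilin N H (N \<boxtimes> H) (\<lambda>m0 m1. lift A H (N \<boxtimes> H) (coact A b) (\<lambda>b0 b1.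
          tens K N H (lact N a0 (ract N m0 b0)) (a1 \<otimes>\<^bsub>H\<^esub> (m1 \<otimes>\<^bsub>H\<^esub> b1))))"
      if "a0 \<in> carrier A" "a1 \<in> carrier H" for a0 a1
      using that by (intro lin_intro Lin_bilin[OF BN(9)] Lin_bilin[OF BN(10)]) simp_all
    have "bcoact N (lact N a (ract N n b)) = lift M H (N \<boxtimes> H) (bcoact M (lact M a (ract M m b))) (\<lambda>m0 h. tens K N H (p m0) h)"
      by (simp add: m flip: l r c)
    also have "\<dots> = lift A H (N \<boxtimes> H) (coact A a) (\<lambda>a0 a1. lift M H (N \<boxtimes> H) (bcoact M m) (\<lambda>m0 m1.
        lift A H (N \<boxtimes> H) (coact A b) (\<lambda>b0 b1.
          tens K N H (lact N a0 (ract N (p m0) b0)) (a1 \<otimes>\<^bsub>H\<^esub> (m1 \<otimes>\<^bsub>H\<^esub> b1)))))"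
      using M' by (simp add: lift_lift lift_tens pp l r)
    also have "\<dots> = lift A H (N \<boxtimes> H) (coact A a) (\<lambda>a0 a1. lift N H (N \<boxtimes> H) (bcoact N n) (\<lambda>m0 m1.
        lift A H (N \<boxtimes> H) (coact A b) (\<lambda>b0 b1.
          tens K N H (lact N a0 (ract N m0 b0)) (a1 \<otimes>\<^bsub>H\<^esub> (m1 \<otimes>\<^bsub>H\<^esub> b1)))))"
      by (simp add: m c lift_lift lift_tens b')
    finally show "bcoact N (lact N a (ract N n b)) =
      lift A H (N \<boxtimes> H) (coact A a) (\<lambda>a0 a1. lift N H (N \<boxtimes> H) (bcoact N n) (\<lambda>m0 m1.
        lift A H (N \<boxtimes> H) (coact A b) (\<lambda>b0 b1.
          tens K N H (lact N a0 (ract N m0 b0)) (a1 \<otimes>\<^bsub>H\<^esub> (m1 \<otimes>\<^bsub>H\<^esub> b1)))))" .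
  qed
qed

text \<open>Equations in N \<otimes> H and in N \<otimes> H \<otimes> H are compared after inclusion
  into the corresponding tensor products with M, where they are the axioms of M.\<close>

lemma covariant_bimodule_sub:
  fixes A :: "('k, 'a, 'h) comodule_alg" and M N :: "('k, 'm, 'a, 'h) cov_bimod"
  assumes A: "comod_alg K H A (coact A)" and M: "covariant_bimodule K H A M"
    and sub: "submodule S K M"
    and l: "\<And>a m. a \<in> carrier A \<Longrightarrow> m \<in> S \<Longrightarrow> lact M a m \<in> S"
    and r: "\<And>a m. a \<in> carrier A \<Longrightarrow> m \<in> S \<Longrightarrow> ract M m a \<in> S"
    and N_def: "N = M\<lparr>carrier := S, bcoact := c\<rparr>"
    and c: "\<And>m. m \<in> S \<Longrightarrow> c m \<in> carrier (N \<boxtimes> H)"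
    and ci: "\<And>m. m \<in> S \<Longrightarrow> lift N H (M \<boxtimes> H) (c m) (tens K M H) = bcoact M m"
  shows "covariant_bimodule K H A N"
proof -
  interpret A: comod_alg K H A "coact A" by (rule A)
  note M' = M[unfolded covariant_bimodule_iff[OF A]]
  have bM: "bimodule K A M" and cM: "right_comodule K H M (bcoact M)" using M' by auto
  note B = bimoduleD[OF bM] and \<delta> = right_comoduleD(2)[OF cM]
  note [simp] = B(1-5) Lin_closed[OF \<delta>]
  note [lin_intro] = Lin_comp[OF \<delta>] Lin_bilin[OF B(9)] Lin_bilin[OF B(10)]
  have S: "S = carrier N" by (simp add: N_def)
  note sub = sub[unfolded S] and l = l[unfolded S] and r = r[unfolded S] and c = c[unfolded S] and ci = ci[unfolded S]
  have sel [simp]: "add N = add M" "smult N = smult M" "zero N = zero M"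
    "lact N = lact M" "ract N = ract M" "bcoact N = c" by (simp_all add: N_def)
  obtain p where p: "p \<in> Lin M M" "\<And>v. v \<in> carrier M \<Longrightarrow> p v \<in> carrier N" "\<And>v. v \<in> carrier N \<Longrightarrow> p v = v"
    using retraction_exists[OF B(1) sub] by blast
  have SM [simp]: "m \<in> carrier M" if "m \<in> carrier N" for m using submoduleD(1)[OF B(1) sub] that by blast
  have N [simp]: "VS N"
    by (rule VS_transfer[OF VS_carrier_update[OF B(1) sub]]) simp_all
  have incl [lin_intro]: "(\<lambda>x. x) \<in> Lin N M" by (simp add: lin_maps_def)
  have pN: "p \<in> Lin M N" using p by (auto simp: lin_maps_def)
  note [lin_intro] = Lin_comp[OF pN] and [simp] = p(2,3)
  have bN: "bimodule K A N"
    using bM l r submoduleD[OF B(1) sub]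
    by (simp add: bimodule_def left_module_def lin_maps_def)
  \<comment> \<open>The left inverse is the retraction p tensored with X. The factor X is left open
    because both H and H \<otimes> H are needed, the latter for coassociativity.\<close>
  have inj: "s = t" if [simp]: "s \<in> carrier (N \<boxtimes> X)" "t \<in> carrier (N \<boxtimes> X)" "VS X"
    and eq: "lift N X (M \<boxtimes> X) s (tens K M X) = lift N X (M \<boxtimes> X) t (tens K M X)" for s t X
  proof -
    have b: "bilin M X (N \<boxtimes> X) (\<lambda>v h. tens K N X (p v) h)" by (intro lin_intro) simp_all
    have *: "lift M X (N \<boxtimes> X) (lift N X (M \<boxtimes> X) s (tens K M X)) (\<lambda>v h. tens K N X (p v) h) = s"
      if [simp]: "s \<in> carrier (N \<boxtimes> X)" for s
      by (subst lift_lift[OF _ _ _ _ _ _ b]) (simp_all add: lift_tens[OF _ _ _ b] lift_id)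
    show ?thesis using *[OF that(1)] *[OF that(2)] unfolding eq by (rule trans[OF sym])
  qed
  have bi: "bilin N X (M \<boxtimes> X) (\<lambda>v h. tens K M X v h)" if [simp]: "VS X" for X
    by (intro lin_intro) simp_all
  note [simp] = c ci
  have cc: "lift N H U (c m) \<beta> = lift M H U (bcoact M m) \<beta>"
    if [simp]: "m \<in> carrier N" "VS U" and b: "bilin M H U \<beta>" for m U \<beta>
  proof -
    have "lift M H U (lift N H (M \<boxtimes> H) (c m) (tens K M H)) \<beta> = lift N H U (c m) \<beta>"
      by (subst lift_lift[OF _ _ _ _ _ _ b]) (simp_all add: lift_tens[OF _ _ _ b])
    then show ?thesis by simp
  qed
  note iL = lift_Lin[OF N _ _ bi]
  note D = submoduleD[OF B(1) sub]
  have cL: "c \<in> Lin N (N \<boxtimes> H)"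
  proof (rule Lin_I)
    fix m n assume "m \<in> carrier N" "n \<in> carrier N"
    then have [simp]: "m \<in> carrier N" "n \<in> carrier N" "m \<oplus>\<^bsub>M\<^esub> n \<in> carrier N" using D(3) by auto
    show "c m \<in> carrier (N \<boxtimes> H)" by simp
    show "c (m \<oplus>\<^bsub>N\<^esub> n) = c m \<oplus>\<^bsub>N \<boxtimes> H\<^esub> c n"
      by (rule inj[of _ H]) (simp_all add: Lin_add[OF iL] Lin_add[OF \<delta>])
  next
    fix k m assume [simp]: "k \<in> carrier K" and "m \<in> carrier N"
    then have [simp]: "m \<in> carrier N" "k \<odot>\<^bsub>M\<^esub> m \<in> carrier N" using D(5) by auto
    show "c (k \<odot>\<^bsub>N\<^esub> m) = k \<odot>\<^bsub>N \<boxtimes> H\<^esub> c m"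
      by (rule inj[of _ H]) (simp_all add: Lin_smult[OF iL] Lin_smult[OF \<delta>])
  qed
  note [lin_intro] = Lin_comp[OF cL]
  have cN: "right_comodule K H N c"
  proof (rule right_comoduleI[OF N cL])
    let ?U = "N \<boxtimes> H \<boxtimes> H" and ?M = "M \<boxtimes> H \<boxtimes> H"
    let ?I = "\<lambda>s. lift N (H \<boxtimes> H) ?M s (tens K M (H \<boxtimes> H))"
    fix m assume "m \<in> carrier N"
    then have [simp]: "m \<in> carrier N" by simp
    have push: "?I (lift N H ?U P \<beta>) = lift N H ?M P (\<lambda>v h. ?I (\<beta> v h))"
      if "P \<in> carrier (N \<boxtimes> H)" "\<And>v h. v \<in> carrier N \<Longrightarrow> h \<in> carrier H \<Longrightarrow> \<beta> v h \<in> carrier ?U" for P \<beta>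
      by (rule Lin_lift[where f = ?I and U = ?U]) (use that in \<open>simp_all add: iL\<close>)
    have It: "?I (tens K N (H \<boxtimes> H) v t) = tens K M (H \<boxtimes> H) v t" if "v \<in> carrier N" "t \<in> carrier (H \<boxtimes> H)" for v t
      by (rule lift_tens) (use that in \<open>simp_all add: bi\<close>)
    have B1: "bilin M H ?M (\<lambda>v0 h. lift M H ?M (bcoact M v0) (\<lambda>a b. tens K M (H \<boxtimes> H) a (tens K H H b h)))"
      by (intro lin_intro) simp_all
    have B2: "bilin M H ?M (\<lambda>a b. tens K M (H \<boxtimes> H) a (tens K H H b h))" if "h \<in> carrier H" for h
      using that by (intro lin_intro) simp_all
    have B3: "bilin M H ?M (\<lambda>v0 h. tens K M (H \<boxtimes> H) v0 (comult H h))"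
      by (intro lin_intro) simp_all
    show "lift N H ?U (c m) (\<lambda>v0 h. lift N H ?U (c v0) (\<lambda>a b. tens K N (H \<boxtimes> H) a (tens K H H b h))) =
      lift N H ?U (c m) (\<lambda>v0 h. tens K N (H \<boxtimes> H) v0 (comult H h))"
    proof (rule inj[of _ "H \<boxtimes> H"])
      have "?I (lift N H ?U (c m) (\<lambda>v0 h. lift N H ?U (c v0) (\<lambda>a b. tens K N (H \<boxtimes> H) a (tens K H H b h)))) =
        lift M H ?M (bcoact M m) (\<lambda>v0 h. lift M H ?M (bcoact M v0) (\<lambda>a b. tens K M (H \<boxtimes> H) a (tens K H H b h)))"
        by (simp add: push It cc B2 flip: cc[OF _ _ B1])
      also have "\<dots> = lift M H ?M (bcoact M m) (\<lambda>m0 h. lift H H ?M (comult H h) (\<lambda>b c. tens K M (H \<boxtimes> H) m0 (tens K H H b c)))"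
        by (intro coassoc[OF cM] lin_intro) simp_all
      also have "\<dots> = lift M H ?M (bcoact M m) (\<lambda>m0 h. tens K M (H \<boxtimes> H) m0 (comult H h))"
        by (intro lift_cong refl)
          (simp add: lift_id flip: Lin_lift[OF _ _ _ _ _ _ bilinD(1)[OF tens_bilin]])
      also have "\<dots> = ?I (lift N H ?U (c m) (\<lambda>v0 h. tens K N (H \<boxtimes> H) v0 (comult H h)))"
        by (simp add: push It cc B3)
      finally show "?I (lift N H ?U (c m) (\<lambda>v0 h. lift N H ?U (c v0) (\<lambda>a b. tens K N (H \<boxtimes> H) a (tens K H H b h)))) =
        ?I (lift N H ?U (c m) (\<lambda>v0 h. tens K N (H \<boxtimes> H) v0 (comult H h)))" .
    qed simp_all
    have B4: "bilin M H M (\<lambda>v0 h. counit H h \<odot>\<^bsub>M\<^esub> v0)" by (intro lin_intro) simp_all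
    have "lift N H N (c m) (\<lambda>v0 h. counit H h \<odot>\<^bsub>N\<^esub> v0) = lift N H M (c m) (\<lambda>v0 h. counit H h \<odot>\<^bsub>M\<^esub> v0)"
      using Lin_lift[OF N H_simps(1) N B(1) _ _ incl, of "c m" "\<lambda>v0 h. counit H h \<odot>\<^bsub>N\<^esub> v0"] D(5) by simp
    then show "lift N H N (c m) (\<lambda>v0 h. counit H h \<odot>\<^bsub>N\<^esub> v0) = m"
      by (simp add: cc B4 counit_right[OF cM])
  qed
  show ?thesis
    unfolding covariant_bimodule_iff[OF A]
  proof (intro conjI ballI)
    show "bimodule K A N" by (rule bN)
    show "right_comodule K H N (bcoact N)" using cN by simp
    fix a b m assume [simp]: "a \<in> carrier A" "b \<in> carrier A" and "m \<in> carrier N"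
    then have [simp]: "m \<in> carrier N" by simp
    note [simp] = l r
    let ?I = "\<lambda>s. lift N H (M \<boxtimes> H) s (tens K M H)"
    have push: "?I (lift X H (N \<boxtimes> H) P \<beta>) = lift X H (M \<boxtimes> H) P (\<lambda>v h. ?I (\<beta> v h))"
      if "VS X" "P \<in> carrier (X \<boxtimes> H)" "\<And>v h. v \<in> carrier X \<Longrightarrow> h \<in> carrier H \<Longrightarrow> \<beta> v h \<in> carrier (N \<boxtimes> H)"
      for P \<beta> and X :: "('k, 'x, 'z) module_scheme"
      by (rule Lin_lift[where f = ?I and U = "N \<boxtimes> H"]) (use that in \<open>simp_all add: iL\<close>)
    have push': "?I (lift N H (N \<boxtimes> H) P \<beta>) = lift N H (M \<boxtimes> H) P (\<lambda>v h. ?I (\<beta> v h))"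
      if "P \<in> carrier (N \<boxtimes> H)" "\<And>v h. v \<in> carrier N \<Longrightarrow> h \<in> carrier H \<Longrightarrow> \<beta> v h \<in> carrier (N \<boxtimes> H)" for P \<beta>
      by (rule push) (use that in simp_all)
    have It: "?I (tens K N H v t) = tens K M H v t" if "v \<in> carrier N" "t \<in> carrier H" for v t
      by (rule lift_tens) (use that in \<open>simp_all add: bi\<close>)
    have b': "bilin M H (M \<boxtimes> H) (\<lambda>m0 m1. lift A H (M \<boxtimes> H) (coact A b) (\<lambda>b0 b1.
          tens K M H (lact M a0 (ract M m0 b0)) (a1 \<otimes>\<^bsub>H\<^esub> (m1 \<otimes>\<^bsub>H\<^esub> b1))))"
      if "a0 \<in> carrier A" "a1 \<in> carrier H" for a0 a1
      using that by (intro lin_intro) simp_all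
    have "c (lact M a (ract M m b)) = lift A H (N \<boxtimes> H) (coact A a) (\<lambda>a0 a1. lift N H (N \<boxtimes> H) (c m) (\<lambda>m0 m1.
        lift A H (N \<boxtimes> H) (coact A b) (\<lambda>b0 b1.
          tens K N H (lact M a0 (ract M m0 b0)) (a1 \<otimes>\<^bsub>H\<^esub> (m1 \<otimes>\<^bsub>H\<^esub> b1)))))" (is "_ = ?R")
    proof (rule inj[of _ H])
      have "?I ?R = lift A H (M \<boxtimes> H) (coact A a) (\<lambda>a0 a1. lift M H (M \<boxtimes> H) (bcoact M m) (\<lambda>m0 m1.
        lift A H (M \<boxtimes> H) (coact A b) (\<lambda>b0 b1.
          tens K M H (lact M a0 (ract M m0 b0)) (a1 \<otimes>\<^bsub>H\<^esub> (m1 \<otimes>\<^bsub>H\<^esub> b1)))))"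
        by (simp add: push push' It cc b')
      then show "?I (c (lact M a (ract M m b))) = ?I ?R" using M' by simp
    qed simp_all
    then show "bcoact N (lact N a (ract N m b)) = lift A H (N \<boxtimes> H) (coact A a) (\<lambda>a0 a1. lift N H (N \<boxtimes> H) (bcoact N m) (\<lambda>m0 m1.
        lift A H (N \<boxtimes> H) (coact A b) (\<lambda>b0 b1.
          tens K N H (lact N a0 (ract N m0 b0)) (a1 \<otimes>\<^bsub>H\<^esub> (m1 \<otimes>\<^bsub>H\<^esub> b1)))))" by simp
  qed
qed

end

section \<open>Differential graded algebras\<close>

context base_field
begin

lemma lift_zero:
  assumes "VS V" "VS W" "VS U" "P \<in> carrier (V \<boxtimes> W)"
  shows "lift V W U P (\<lambda>v w. \<zero>\<^bsub>U\<^esub>) = \<zero>\<^bsub>U\<^esub>"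
  using Lin_lift[OF assms(1-3,3,4) _ Lin_zero_map[OF assms(3)], of "\<lambda>v w. \<zero>\<^bsub>U\<^esub>"] assms(3) by simp

lemma bilin_zero:
  assumes "bilin V W U \<beta>" "VS V" "VS W" "VS U"
  shows "w \<in> carrier W \<Longrightarrow> \<beta> \<zero>\<^bsub>V\<^esub> w = \<zero>\<^bsub>U\<^esub>" "v \<in> carrier V \<Longrightarrow> \<beta> v \<zero>\<^bsub>W\<^esub> = \<zero>\<^bsub>U\<^esub>"
  using Lin_zero[OF bilinD(2)[OF assms(1)] assms(2,4)] Lin_zero[OF bilinD(1)[OF assms(1)] assms(3,4)]
  by auto

lemma signed_Lin:
  assumes "f \<in> Lin V W" "VS V" "VS W"
  shows "(\<lambda>x. signed W n (f x)) \<in> Lin V W"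
proof (cases "even n")
  case False
  have "(\<lambda>x. \<ominus>\<^bsub>W\<^esub> f x) \<in> Lin V W"
    by (rule Lin_cong[OF Lin_smult_map[OF assms(1) neg_one_K assms(3)] assms(2)])
      (simp add: VS_neg assms(3) Lin_closed[OF assms(1)])
  then show ?thesis using False by (simp add: signed_def)
qed (use assms in \<open>simp add: signed_def\<close>)

lemma signed_closed: "VS V \<Longrightarrow> x \<in> carrier V \<Longrightarrow> signed V n x \<in> carrier V"
  by (simp add: signed_def)

end

locale dga = base_field K for K :: "'k ring" +
  fixes \<Omega> :: "('k, 'w) dga"
  assumes dga: "diff_graded_algebra K \<Omega>"
begin

lemma algebra_\<Omega>: "assoc_algebra K \<Omega>"
  using dga by (simp add: diff_graded_algebra_def)

lemmas \<Omega>_simps [simp] = assoc_algebraD(1-5)[OF algebra_\<Omega>]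
lemmas [lin_intro] = Lin_bilin[OF assoc_algebraD(7)[OF algebra_\<Omega>]]

lemma deg_submodule: "submodule (deg \<Omega> n) K \<Omega>"
  using dga by (simp add: diff_graded_algebra_def)

lemmas degD = submoduleD[OF \<Omega>_simps(1) deg_submodule]

lemma deg_closed [simp]: "x \<in> deg \<Omega> n \<Longrightarrow> x \<in> carrier \<Omega>"
  using degD(1) by blast

lemma deg_mult: "x \<in> deg \<Omega> i \<Longrightarrow> y \<in> deg \<Omega> j \<Longrightarrow> x \<otimes>\<^bsub>\<Omega>\<^esub> y \<in> deg \<Omega> (i + j)"
  using dga by (auto simp: diff_graded_algebra_def)

lemma diff_Lin: "diff \<Omega> \<in> Lin \<Omega> \<Omega>"
  using dga by (simp add: diff_graded_algebra_def)

lemmas diff_closed [simp] = Lin_closed[OF diff_Lin]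
lemmas [lin_intro] = Lin_comp[OF diff_Lin]

lemma diff_deg: "x \<in> deg \<Omega> i \<Longrightarrow> diff \<Omega> x \<in> deg \<Omega> (Suc i)"
  using dga by (auto simp: diff_graded_algebra_def)

lemma diff_Leibniz: "x \<in> deg \<Omega> 0 \<Longrightarrow> y \<in> carrier \<Omega> \<Longrightarrow>
    diff \<Omega> (x \<otimes>\<^bsub>\<Omega>\<^esub> y) = diff \<Omega> x \<otimes>\<^bsub>\<Omega>\<^esub> y \<oplus>\<^bsub>\<Omega>\<^esub> x \<otimes>\<^bsub>\<Omega>\<^esub> diff \<Omega> y"
  using dga by (force simp: diff_graded_algebra_def signed_def)

lemma decomposition_unique: "x \<in> carrier \<Omega> \<Longrightarrow> \<exists>!f. is_decomposition \<Omega> x f"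
  using dga unfolding diff_graded_algebra_def by blast

lemma component_eq:
  assumes "x \<in> carrier \<Omega>" "is_decomposition \<Omega> x f"
  shows "component \<Omega> x = f"
  unfolding component_def by (rule the1_equality, rule decomposition_unique, rule assms, rule assms)

lemma component_decomposition: "x \<in> carrier \<Omega> \<Longrightarrow> is_decomposition \<Omega> x (component \<Omega> x)"
  unfolding component_def by (rule theI'[OF decomposition_unique])

lemma component_deg: "x \<in> carrier \<Omega> \<Longrightarrow> component \<Omega> x n \<in> deg \<Omega> n"
  using component_decomposition by (simp add: is_decomposition_def)

lemma component_closed [simp]: "x \<in> carrier \<Omega> \<Longrightarrow> component \<Omega> x n \<in> carrier \<Omega>"
  by (rule deg_closed[OF component_deg])

lemma component_finite: "x \<in> carrier \<Omega> \<Longrightarrow> finite {n. component \<Omega> x n \<noteq> \<zero>\<^bsub>\<Omega>\<^esub>}"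
  using component_decomposition by (simp add: is_decomposition_def)

lemma component_sum:
  assumes "x \<in> carrier \<Omega>" "finite B" "{n. component \<Omega> x n \<noteq> \<zero>\<^bsub>\<Omega>\<^esub>} \<subseteq> B"
  shows "x = finsum \<Omega> (component \<Omega> x) B"
proof -
  have "x = finsum \<Omega> (component \<Omega> x) {n. component \<Omega> x n \<noteq> \<zero>\<^bsub>\<Omega>\<^esub>}"
    using component_decomposition[OF assms(1)] by (simp add: is_decomposition_def)
  also have "\<dots> = finsum \<Omega> (component \<Omega> x) B"
    by (rule finsum_superset) (use assms in auto)
  finally show ?thesis .
qed

lemma is_decompositionI:
  assumes "x \<in> carrier \<Omega>" "finite B" "\<And>n. f n \<in> deg \<Omega> n" "\<And>n. n \<notin> B \<Longrightarrow> f n = \<zero>\<^bsub>\<Omega>\<^esub>" "x = finsum \<Omega> f B"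
  shows "is_decomposition \<Omega> x f"
proof -
  have sub: "{n. f n \<noteq> \<zero>\<^bsub>\<Omega>\<^esub>} \<subseteq> B" using assms(4) by auto
  have "finsum \<Omega> f {n. f n \<noteq> \<zero>\<^bsub>\<Omega>\<^esub>} = finsum \<Omega> f B"
    by (rule finsum_superset[OF _ assms(2) sub]) (use deg_closed[OF assms(3)] assms(4) in auto)
  then show ?thesis
    using assms(3,5) finite_subset[OF sub assms(2)] by (simp add: is_decomposition_def)
qed

lemma component_hom: "x \<in> deg \<Omega> n \<Longrightarrow> component \<Omega> x i = (if i = n then x else \<zero>\<^bsub>\<Omega>\<^esub>)"
proof -
  assume x: "x \<in> deg \<Omega> n"
  interpret \<Omega>: abelian_monoid \<Omega> by (rule abelian_monoid_VS) simp
  have "is_decomposition \<Omega> x (\<lambda>i. if i = n then x else \<zero>\<^bsub>\<Omega>\<^esub>)"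
    by (rule is_decompositionI[of _ "{n}"]) (use x degD(2) in auto)
  then show ?thesis using component_eq[of x] x by simp
qed

text \<open>The sum of the decompositions of x and y is a decomposition of their sum, hence the
  decomposition by uniqueness; likewise for scalar multiples.\<close>

lemma component_Lin: "(\<lambda>x. component \<Omega> x i) \<in> Lin \<Omega> \<Omega>"
proof (rule Lin_I)
  interpret \<Omega>: module K \<Omega> by simp
  fix x y assume x [simp]: "x \<in> carrier \<Omega>" "y \<in> carrier \<Omega>"
  let ?B = "{n. component \<Omega> x n \<noteq> \<zero>\<^bsub>\<Omega>\<^esub>} \<union> {n. component \<Omega> y n \<noteq> \<zero>\<^bsub>\<Omega>\<^esub>}"
  have B: "finite ?B" using component_finite x by simp
  have "finsum \<Omega> (\<lambda>n. component \<Omega> x n \<oplus>\<^bsub>\<Omega>\<^esub> component \<Omega> y n) ?B =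
    finsum \<Omega> (component \<Omega> x) ?B \<oplus>\<^bsub>\<Omega>\<^esub> finsum \<Omega> (component \<Omega> y) ?B"
    by (rule \<Omega>.finsum_addf) auto
  also have "\<dots> = x \<oplus>\<^bsub>\<Omega>\<^esub> y"
    using component_sum[OF x(1) B] component_sum[OF x(2) B] by simp
  finally have "is_decomposition \<Omega> (x \<oplus>\<^bsub>\<Omega>\<^esub> y) (\<lambda>n. component \<Omega> x n \<oplus>\<^bsub>\<Omega>\<^esub> component \<Omega> y n)"
    using degD(3) component_deg by (intro is_decompositionI[OF _ B]) auto
  then show "component \<Omega> (x \<oplus>\<^bsub>\<Omega>\<^esub> y) i = component \<Omega> x i \<oplus>\<^bsub>\<Omega>\<^esub> component \<Omega> y i"
    by (subst component_eq) auto
next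
  interpret \<Omega>: module K \<Omega> by simp
  fix c x assume x [simp]: "c \<in> carrier K" "x \<in> carrier \<Omega>"
  let ?B = "{n. component \<Omega> x n \<noteq> \<zero>\<^bsub>\<Omega>\<^esub>}"
  have B: "finite ?B" using component_finite x by simp
  have "finsum \<Omega> (\<lambda>n. c \<odot>\<^bsub>\<Omega>\<^esub> component \<Omega> x n) ?B = c \<odot>\<^bsub>\<Omega>\<^esub> finsum \<Omega> (component \<Omega> x) ?B"
    by (rule \<Omega>.finsum_smult_ldistr[symmetric]) (use B in auto)
  also have "\<dots> = c \<odot>\<^bsub>\<Omega>\<^esub> x" using component_sum[OF x(2) B] by simp
  finally have "is_decomposition \<Omega> (c \<odot>\<^bsub>\<Omega>\<^esub> x) (\<lambda>n. c \<odot>\<^bsub>\<Omega>\<^esub> component \<Omega> x n)"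
    using degD(5) component_deg by (intro is_decompositionI[OF _ B]) auto
  then show "component \<Omega> (c \<odot>\<^bsub>\<Omega>\<^esub> x) i = c \<odot>\<^bsub>\<Omega>\<^esub> component \<Omega> x i"
    by (subst component_eq) auto
qed simp

text \<open>The sum runs over a support that depends on \<open>x\<close>; on finitely many elements at a time it can be
  replaced by a common finite index set, which makes it linear.\<close>

lemma graded_sum_Lin:
  assumes [simp]: "VS U" and fin: "\<And>B. finite B \<Longrightarrow> finite {k \<in> J. e k \<in> B}"
    and g: "\<And>k. k \<in> J \<Longrightarrow> g k \<in> Lin \<Omega> U"
  shows "(\<lambda>x. finsum U (\<lambda>k. g k (component \<Omega> x (e k))) {k \<in> J. component \<Omega> x (e k) \<noteq> \<zero>\<^bsub>\<Omega>\<^esub>}) \<in> Lin \<Omega> U"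
    (is "?f \<in> _")
proof -
  have cl: "g k (component \<Omega> x (e k)) \<in> carrier U" if "k \<in> J" "x \<in> carrier \<Omega>" for k x
    by (rule Lin_closed[OF g]) (use that in auto)
  have sup: "?f x = finsum U (\<lambda>k. g k (component \<Omega> x (e k))) {k \<in> J. e k \<in> B}"
    if x: "x \<in> carrier \<Omega>" and B: "finite B" "{n. component \<Omega> x n \<noteq> \<zero>\<^bsub>\<Omega>\<^esub>} \<subseteq> B" for x B
    by (rule finsum_superset) (use x B fin cl Lin_zero[OF g] in auto)
  have lin: "(\<lambda>x. finsum U (\<lambda>k. g k (component \<Omega> x (e k))) {k \<in> J. e k \<in> B}) \<in> Lin \<Omega> U"
    if "finite B" for B
    by (rule Lin_finsum_map) (use that fin in \<open>auto intro: Lin_comp[OF g component_Lin]\<close>)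
  let ?S = "\<lambda>x. {n. component \<Omega> x n \<noteq> \<zero>\<^bsub>\<Omega>\<^esub>}"
  show ?thesis
  proof (rule Lin_I)
    fix x y assume xy: "x \<in> carrier \<Omega>" "y \<in> carrier \<Omega>"
    then have xpy: "x \<oplus>\<^bsub>\<Omega>\<^esub> y \<in> carrier \<Omega>" by simp
    let ?B = "?S x \<union> ?S y \<union> ?S (x \<oplus>\<^bsub>\<Omega>\<^esub> y)"
    have B: "finite ?B" using component_finite xy xpy by blast
    have S: "?S x \<subseteq> ?B" "?S y \<subseteq> ?B" "?S (x \<oplus>\<^bsub>\<Omega>\<^esub> y) \<subseteq> ?B" by auto
    show "?f (x \<oplus>\<^bsub>\<Omega>\<^esub> y) = ?f x \<oplus>\<^bsub>U\<^esub> ?f y"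
      unfolding sup[OF xy(1) B S(1)] sup[OF xy(2) B S(2)] sup[OF xpy B S(3)]
      by (rule Lin_add[OF lin[OF B] xy])
  next
    fix c x assume x: "c \<in> carrier K" "x \<in> carrier \<Omega>"
    then have cx: "c \<odot>\<^bsub>\<Omega>\<^esub> x \<in> carrier \<Omega>" by simp
    let ?B = "?S x \<union> ?S (c \<odot>\<^bsub>\<Omega>\<^esub> x)"
    have B: "finite ?B" using component_finite x cx by blast
    have S: "?S x \<subseteq> ?B" "?S (c \<odot>\<^bsub>\<Omega>\<^esub> x) \<subseteq> ?B" by auto
    show "?f (c \<odot>\<^bsub>\<Omega>\<^esub> x) = c \<odot>\<^bsub>U\<^esub> ?f x"
      unfolding sup[OF x(2) B S(1)] sup[OF cx B S(2)]
      by (rule Lin_smult[OF lin[OF B] x])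
  qed (auto intro!: finsum_closed_VS cl)
qed

end

section \<open>Product and differential on the tensor product of two graded algebras\<close>

locale dga_pair = X: dga K \<Omega> + Y: dga K \<Omega>'
  for K :: "'k ring" and \<Omega> :: "('k, 'v) dga" and \<Omega>' :: "('k, 'w) dga"
begin

abbreviation "T \<equiv> tensor_space K \<Omega> \<Omega>'"

text \<open>The innermost value of the product in \<open>dga_tensor\<close>, isolated because its
  linearity has to be shown separately in each of the four arguments.\<close>

definition tterm :: "'v \<Rightarrow> 'w \<Rightarrow> 'v \<Rightarrow> 'w \<Rightarrow> ('v \<times> 'w \<Rightarrow> 'k) set"
  where "tterm \<omega> \<omega>' \<eta> \<eta>' = finsum T (\<lambda>(i, j). signed T (i * j)
      (tens K \<Omega> \<Omega>' (\<omega> \<otimes>\<^bsub>\<Omega>\<^esub> component \<Omega> \<eta> j) (component \<Omega>' \<omega>' i \<otimes>\<^bsub>\<Omega>'\<^esub> \<eta>')))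
    ({i. component \<Omega>' \<omega>' i \<noteq> \<zero>\<^bsub>\<Omega>'\<^esub>} \<times> {j. component \<Omega> \<eta> j \<noteq> \<zero>\<^bsub>\<Omega>\<^esub>})"

lemma tterm_closed [simp]:
  assumes "\<omega> \<in> carrier \<Omega>" "\<omega>' \<in> carrier \<Omega>'" "\<eta> \<in> carrier \<Omega>" "\<eta>' \<in> carrier \<Omega>'"
  shows "tterm \<omega> \<omega>' \<eta> \<eta>' \<in> carrier T"
  unfolding tterm_def by (rule X.finsum_closed_VS) (use assms in \<open>auto intro!: X.signed_closed\<close>)

lemma tterm_Lin1:
  assumes [simp]: "\<omega>' \<in> carrier \<Omega>'" "\<eta> \<in> carrier \<Omega>" "\<eta>' \<in> carrier \<Omega>'"
  shows "(\<lambda>\<omega>. tterm \<omega> \<omega>' \<eta> \<eta>') \<in> X.Lin \<Omega> T"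
proof -
  have "(\<lambda>\<omega>. case k of (i, j) \<Rightarrow> signed T (i * j) (tens K \<Omega> \<Omega>' (\<omega> \<otimes>\<^bsub>\<Omega>\<^esub> component \<Omega> \<eta> j)
    (component \<Omega>' \<omega>' i \<otimes>\<^bsub>\<Omega>'\<^esub> \<eta>'))) \<in> X.Lin \<Omega> T" for k
    by (cases k) (simp, intro lin_intro X.signed_Lin; simp)
  then show ?thesis unfolding tterm_def
    by (intro X.Lin_finsum_map) (simp_all add: X.component_finite Y.component_finite)
qed

lemma tterm_Lin4:
  assumes [simp]: "\<omega>' \<in> carrier \<Omega>'" "\<eta> \<in> carrier \<Omega>" "\<omega> \<in> carrier \<Omega>"
  shows "(\<lambda>\<eta>'. tterm \<omega> \<omega>' \<eta> \<eta>') \<in> X.Lin \<Omega>' T"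
proof -
  have "(\<lambda>\<eta>'. case k of (i, j) \<Rightarrow> signed T (i * j) (tens K \<Omega> \<Omega>' (\<omega> \<otimes>\<^bsub>\<Omega>\<^esub> component \<Omega> \<eta> j)
    (component \<Omega>' \<omega>' i \<otimes>\<^bsub>\<Omega>'\<^esub> \<eta>'))) \<in> X.Lin \<Omega>' T" for k
    by (cases k) (simp, intro lin_intro X.signed_Lin; simp)
  then show ?thesis unfolding tterm_def
    by (intro X.Lin_finsum_map) (simp_all add: X.component_finite Y.component_finite)
qed

text \<open>Here the argument \<eta> also determines the index set, through the degrees in which it
  has a component. The sum is regrouped over pairs whose second coordinate runs through all degrees,
  which is the shape of \<open>graded_sum_Lin\<close>.\<close>

lemma tterm_Lin3:
  assumes [simp]: "\<omega>' \<in> carrier \<Omega>'" "\<eta>' \<in> carrier \<Omega>'" "\<omega> \<in> carrier \<Omega>"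
  shows "(\<lambda>\<eta>. tterm \<omega> \<omega>' \<eta> \<eta>') \<in> X.Lin \<Omega> T"
proof -
  let ?I = "{i. component \<Omega>' \<omega>' i \<noteq> \<zero>\<^bsub>\<Omega>'\<^esub>}"
  let ?g = "\<lambda>k x. signed T (fst k * snd k) (tens K \<Omega> \<Omega>' (\<omega> \<otimes>\<^bsub>\<Omega>\<^esub> x) (component \<Omega>' \<omega>' (fst k) \<otimes>\<^bsub>\<Omega>'\<^esub> \<eta>'))"
  have "(\<lambda>x. finsum T (\<lambda>k. ?g k (component \<Omega> x (snd k))) {k \<in> ?I \<times> UNIV. component \<Omega> x (snd k) \<noteq> \<zero>\<^bsub>\<Omega>\<^esub>}) \<in> X.Lin \<Omega> T"
  proof (rule X.graded_sum_Lin)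
    fix B :: "nat set" assume "finite B"
    then have "finite (?I \<times> B)" by (simp add: Y.component_finite)
    then show "finite {k \<in> ?I \<times> UNIV. snd k \<in> B}" by (rule rev_finite_subset) auto
  next
    show "?g k \<in> X.Lin \<Omega> T" for k by (intro lin_intro X.signed_Lin; simp)
  qed simp
  moreover have "{k \<in> ?I \<times> UNIV. component \<Omega> x (snd k) \<noteq> \<zero>\<^bsub>\<Omega>\<^esub>} = ?I \<times> {j. component \<Omega> x j \<noteq> \<zero>\<^bsub>\<Omega>\<^esub>}" for x
    by auto
  ultimately show ?thesis unfolding tterm_def case_prod_unfold by (simp only:)
qed

lemma tterm_Lin2:
  assumes [simp]: "\<eta> \<in> carrier \<Omega>" "\<eta>' \<in> carrier \<Omega>'" "\<omega> \<in> carrier \<Omega>"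
  shows "(\<lambda>\<omega>'. tterm \<omega> \<omega>' \<eta> \<eta>') \<in> X.Lin \<Omega>' T"
proof -
  let ?J = "{j. component \<Omega> \<eta> j \<noteq> \<zero>\<^bsub>\<Omega>\<^esub>}"
  let ?g = "\<lambda>k x. signed T (fst k * snd k) (tens K \<Omega> \<Omega>' (\<omega> \<otimes>\<^bsub>\<Omega>\<^esub> component \<Omega> \<eta> (snd k)) (x \<otimes>\<^bsub>\<Omega>'\<^esub> \<eta>'))"
  have "(\<lambda>x. finsum T (\<lambda>k. ?g k (component \<Omega>' x (fst k))) {k \<in> UNIV \<times> ?J. component \<Omega>' x (fst k) \<noteq> \<zero>\<^bsub>\<Omega>'\<^esub>}) \<in> X.Lin \<Omega>' T"
  proof (rule Y.graded_sum_Lin)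
    fix B :: "nat set" assume "finite B"
    then have "finite (B \<times> ?J)" by (simp add: X.component_finite)
    then show "finite {k \<in> UNIV \<times> ?J. fst k \<in> B}" by (rule rev_finite_subset) auto
  next
    show "?g k \<in> X.Lin \<Omega>' T" for k by (intro lin_intro X.signed_Lin; simp)
  qed simp
  moreover have "{k \<in> UNIV \<times> ?J. component \<Omega>' x (fst k) \<noteq> \<zero>\<^bsub>\<Omega>'\<^esub>} = {i. component \<Omega>' x i \<noteq> \<zero>\<^bsub>\<Omega>'\<^esub>} \<times> ?J" for x
    by auto
  ultimately show ?thesis unfolding tterm_def case_prod_unfold by (simp only:)
qed

text \<open>For \<omega>' of degree zero the Koszul sign is +1. This covers every product in D(a
  db), where \<omega>' is a leg of the coaction of a.\<close>

lemma tterm_hom: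
  assumes [simp]: "\<omega> \<in> carrier \<Omega>" and \<omega>': "\<omega>' \<in> deg \<Omega>' 0" and \<eta>: "\<eta> \<in> deg \<Omega> j" and [simp]: "\<eta>' \<in> carrier \<Omega>'"
  shows "tterm \<omega> \<omega>' \<eta> \<eta>' = tens K \<Omega> \<Omega>' (\<omega> \<otimes>\<^bsub>\<Omega>\<^esub> \<eta>) (\<omega>' \<otimes>\<^bsub>\<Omega>'\<^esub> \<eta>')"
proof -
  note [simp] = Y.deg_closed[OF \<omega>'] X.deg_closed[OF \<eta>] Y.component_hom[OF \<omega>'] X.component_hom[OF \<eta>]
  interpret T: abelian_monoid T by (rule X.abelian_monoid_VS) simp
  note z = X.bilin_zero[OF X.tens_bilin] X.bilin_zero[OF X.assoc_algebraD(7)[OF X.algebra_\<Omega>]]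
    X.bilin_zero[OF X.assoc_algebraD(7)[OF Y.algebra_\<Omega>]]
  \<comment> \<open>The support may be empty, namely when \<omega>' or \<eta> is zero; enlarging the
    index set to the single pair (0, j) covers this case as well.\<close>
  have "tterm \<omega> \<omega>' \<eta> \<eta>' = finsum T (\<lambda>(i, l). signed T (i * l)
      (tens K \<Omega> \<Omega>' (\<omega> \<otimes>\<^bsub>\<Omega>\<^esub> component \<Omega> \<eta> l) (component \<Omega>' \<omega>' i \<otimes>\<^bsub>\<Omega>'\<^esub> \<eta>'))) {(0, j)}"
    unfolding tterm_def
    by (rule X.finsum_superset) (auto simp: signed_def z split: if_splits)
  also have "\<dots> = tens K \<Omega> \<Omega>' (\<omega> \<otimes>\<^bsub>\<Omega>\<^esub> \<eta>) (\<omega>' \<otimes>\<^bsub>\<Omega>'\<^esub> \<eta>')"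
    by (simp add: signed_def)
  finally show ?thesis .
qed

lemma mult_tensor:
  assumes [simp]: "P \<in> carrier T" "Q \<in> carrier T"
  shows "P \<otimes>\<^bsub>dga_tensor K \<Omega> \<Omega>'\<^esub> Q = X.lift \<Omega> \<Omega>' T P (\<lambda>\<omega> \<omega>'. X.lift \<Omega> \<Omega>' T Q (\<lambda>\<eta> \<eta>'. tterm \<omega> \<omega>' \<eta> \<eta>'))"
proof -
  have "P \<otimes>\<^bsub>dga_tensor K \<Omega> \<Omega>'\<^esub> Q = pres_lift K T (\<lambda>(\<omega>, \<omega>'). pres_lift K T (\<lambda>(\<eta>, \<eta>'). tterm \<omega> \<omega>' \<eta> \<eta>') Q) P"
    by (simp add: dga_tensor_def Let_def tterm_def)
  also have "\<dots> = X.lift \<Omega> \<Omega>' T P (\<lambda>\<omega> \<omega>'. pres_lift K T (\<lambda>(\<eta>, \<eta>'). tterm \<omega> \<omega>' \<eta> \<eta>') Q)"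
    by (rule X.pres_lift_eq_lift) (auto simp: X.pres_lift_eq_lift[where V = \<Omega> and W = \<Omega>'])
  finally show ?thesis by (simp add: X.pres_lift_eq_lift[where V = \<Omega> and W = \<Omega>'])
qed

lemma tterm_bilin: "\<omega> \<in> carrier \<Omega> \<Longrightarrow> \<omega>' \<in> carrier \<Omega>' \<Longrightarrow> X.bilin \<Omega> \<Omega>' T (\<lambda>\<eta> \<eta>'. tterm \<omega> \<omega>' \<eta> \<eta>')"
  by (intro X.bilinI tterm_Lin3 tterm_Lin4)

lemma mult_bilin: "X.bilin T T T (mult (dga_tensor K \<Omega> \<Omega>'))"
proof -
  note [lin_intro] = tterm_Lin1 tterm_Lin2 tterm_Lin3 tterm_Lin4
  have "X.bilin T T T (\<lambda>P Q. X.lift \<Omega> \<Omega>' T P (\<lambda>\<omega> \<omega>'. X.lift \<Omega> \<Omega>' T Q (\<lambda>\<eta> \<eta>'. tterm \<omega> \<omega>' \<eta> \<eta>')))"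
    by (intro lin_intro) simp_all
  then show ?thesis by (simp add: X.bilin_def lin_maps_def mult_tensor)
qed

lemma mult_tens:
  assumes [simp]: "\<omega> \<in> carrier \<Omega>" and \<omega>': "\<omega>' \<in> deg \<Omega>' 0" and \<eta>: "\<eta> \<in> deg \<Omega> j" and [simp]: "\<eta>' \<in> carrier \<Omega>'"
  shows "tens K \<Omega> \<Omega>' \<omega> \<omega>' \<otimes>\<^bsub>dga_tensor K \<Omega> \<Omega>'\<^esub> tens K \<Omega> \<Omega>' \<eta> \<eta>' =
    tens K \<Omega> \<Omega>' (\<omega> \<otimes>\<^bsub>\<Omega>\<^esub> \<eta>) (\<omega>' \<otimes>\<^bsub>\<Omega>'\<^esub> \<eta>')"
proof -
  note [simp] = Y.deg_closed[OF \<omega>'] X.deg_closed[OF \<eta>]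
  note [lin_intro] = tterm_Lin1 tterm_Lin2 tterm_Lin3 tterm_Lin4
  have "X.bilin \<Omega> \<Omega>' T (\<lambda>\<omega> \<omega>'. tterm \<omega> \<omega>' \<eta> \<eta>')"
    by (intro lin_intro) simp_all
  then show ?thesis by (simp add: mult_tensor X.lift_tens tterm_bilin tterm_hom[OF _ \<omega>' \<eta>])
qed

definition dterm :: "'v \<Rightarrow> 'w \<Rightarrow> ('v \<times> 'w \<Rightarrow> 'k) set"
  where "dterm \<omega> \<omega>' = tens K \<Omega> \<Omega>' (diff \<Omega> \<omega>) \<omega>' \<oplus>\<^bsub>T\<^esub>
       finsum T (\<lambda>i. signed T i (tens K \<Omega> \<Omega>' (component \<Omega> \<omega> i) (diff \<Omega>' \<omega>'))) {i. component \<Omega> \<omega> i \<noteq> \<zero>\<^bsub>\<Omega>\<^esub>}"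

lemma dterm_closed [simp]:
  "\<omega> \<in> carrier \<Omega> \<Longrightarrow> \<omega>' \<in> carrier \<Omega>' \<Longrightarrow> dterm \<omega> \<omega>' \<in> carrier T"
  unfolding dterm_def by (auto intro!: X.VS_closed X.finsum_closed_VS X.signed_closed)

lemma dterm_bilin: "X.bilin \<Omega> \<Omega>' T dterm"
proof -
  have "X.bilin \<Omega> \<Omega>' T (\<lambda>\<omega> \<omega>'. dterm \<omega> \<omega>')"
  proof (rule X.bilinI)
    fix \<omega> assume [simp]: "\<omega> \<in> carrier \<Omega>"
    show "(\<lambda>\<omega>'. dterm \<omega> \<omega>') \<in> X.Lin \<Omega>' T"
      unfolding dterm_def
      by (intro lin_intro X.Lin_finsum_map X.signed_Lin) (simp_all add: X.component_finite)
  next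
    fix \<omega>' assume [simp]: "\<omega>' \<in> carrier \<Omega>'"
    have "(\<lambda>x. finsum T (\<lambda>i. signed T i (tens K \<Omega> \<Omega>' (component \<Omega> x i) (diff \<Omega>' \<omega>')))
      {i \<in> UNIV. component \<Omega> x i \<noteq> \<zero>\<^bsub>\<Omega>\<^esub>}) \<in> X.Lin \<Omega> T"
      by (rule X.graded_sum_Lin[where e = "\<lambda>i. i" and g = "\<lambda>i x. signed T i (tens K \<Omega> \<Omega>' x (diff \<Omega>' \<omega>'))"])
        (auto intro!: lin_intro X.signed_Lin)
    then show "(\<lambda>\<omega>. dterm \<omega> \<omega>') \<in> X.Lin \<Omega> T"
      unfolding dterm_def by (intro lin_intro) simp_all
  qed
  then show ?thesis .
qed

lemma diff_tensor:
  "P \<in> carrier T \<Longrightarrow> diff (dga_tensor K \<Omega> \<Omega>') P = X.lift \<Omega> \<Omega>' T P dterm"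
  by (simp add: dga_tensor_def Let_def flip: dterm_def) (rule X.pres_lift_eq_lift; simp)

lemma diff_tensor_Lin: "diff (dga_tensor K \<Omega> \<Omega>') \<in> X.Lin T T"
  by (rule X.Lin_cong[OF X.lift_Lin[OF _ _ _ dterm_bilin]]) (simp_all add: diff_tensor)

text \<open>Degree zero of \<omega> makes the sign +1; it is applied to D(b), both legs of which
  have degree zero.\<close>

lemma diff_tens:
  assumes \<omega>: "\<omega> \<in> deg \<Omega> 0" and [simp]: "\<omega>' \<in> carrier \<Omega>'"
  shows "diff (dga_tensor K \<Omega> \<Omega>') (tens K \<Omega> \<Omega>' \<omega> \<omega>') =
    tens K \<Omega> \<Omega>' (diff \<Omega> \<omega>) \<omega>' \<oplus>\<^bsub>T\<^esub> tens K \<Omega> \<Omega>' \<omega> (diff \<Omega>' \<omega>')"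
proof -
  note [simp] = X.deg_closed[OF \<omega>] X.component_hom[OF \<omega>]
  interpret T: abelian_monoid T by (rule X.abelian_monoid_VS) simp
  have "finsum T (\<lambda>i. signed T i (tens K \<Omega> \<Omega>' (component \<Omega> \<omega> i) (diff \<Omega>' \<omega>'))) {i. component \<Omega> \<omega> i \<noteq> \<zero>\<^bsub>\<Omega>\<^esub>} =
    finsum T (\<lambda>i. signed T i (tens K \<Omega> \<Omega>' (component \<Omega> \<omega> i) (diff \<Omega>' \<omega>'))) {0}"
    by (rule X.finsum_superset) (auto simp: signed_def X.bilin_zero[OF X.tens_bilin] split: if_splits)
  then show ?thesis
    by (simp add: diff_tensor X.lift_tens dterm_bilin) (simp add: dterm_def signed_def)
qed

end

text \<open>Tensor products and the maps on them depend only on the underlying vector spaces, not on the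
  remaining fields of the records.\<close>

definition same_space :: "('k, 'v, 'e) module_scheme \<Rightarrow> ('k, 'v, 'f) module_scheme \<Rightarrow> bool"
  where "same_space V W \<longleftrightarrow> carrier V = carrier W \<and> add V = add W \<and> zero V = zero W \<and> smult V = smult W"

lemma lin_maps_same:
  assumes "same_space V V'" "same_space W W'"
  shows "lin_maps K V W = lin_maps K V' W'"
  using assms by (simp add: lin_maps_def same_space_def)

lemma bilin_rels_same:
  assumes "same_space V V'" "same_space W W'"
  shows "bilin_rels K V W = bilin_rels K V' W'"
  using assms by (simp add: bilin_rels_def same_space_def)

lemma tensor_space_same:
  assumes "same_space V V'" "same_space W W'"
  shows "tensor_space K V W = tensor_space K V' W'" "tens K V W = tens K V' W'"
  using assms bilin_rels_same[OF assms, of K]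
  by (auto simp: tensor_space_def tens_def same_space_def intro!: ext)

lemma finsum_same: "same_space V W \<Longrightarrow> finsum V g I = finsum W g I"
  by (simp add: finsum_def finprod_def same_space_def)

lemma pres_lift_same: "same_space V W \<Longrightarrow> pres_lift K V \<beta> P = pres_lift K W \<beta> P"
  by (simp add: pres_lift_def Let_def finsum_same) (simp add: same_space_def)

lemma same_space_refl: "same_space V V"
  by (simp add: same_space_def)

context base_field
begin

lemma lift_same:
  assumes "same_space V V'" "same_space W W'" "same_space U U'"
  shows "lift V W U P \<beta> = lift V' W' U' P \<beta>"
  unfolding lift_def pres_lift_same[OF assms(3)] using assms by (simp add: same_space_def cong: if_cong)

lemma VS_same: "same_space V W \<Longrightarrow> VS V \<Longrightarrow> VS W"
  by (rule VS_transfer[of V]) (simp_all add: same_space_def)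

end

lemma (in hopf_alg) right_comodule_same:
  assumes s: "same_space V W" and V: "right_comodule K H V \<delta>"
  shows "right_comodule K H W \<delta>"
proof -
  note r = same_space_refl
  note V' = right_comoduleD[OF V]
  note e = tensor_space_same[OF s r, symmetric] lift_same[OF s r r, symmetric]
  have sc: "carrier W = carrier V" "smult W = smult V" using s by (simp_all add: same_space_def)
  note [simp] = V'(1) Lin_closed[OF V'(2)]
  show ?thesis
  proof (rule right_comoduleI[OF VS_same[OF s V'(1)]])
    show "\<delta> \<in> Lin W (W \<boxtimes> H)" using V'(2) lin_maps_same[OF s r, of K "V \<boxtimes> H"] by (simp add: e)
    fix v assume "v \<in> carrier W"
    then have v [simp]: "v \<in> carrier V" by (simp add: sc)
    have "lift V H (V \<boxtimes> H \<boxtimes> H) (\<delta> v) (\<lambda>v0 h. lift V H (V \<boxtimes> H \<boxtimes> H) (\<delta> v0) (\<lambda>a b. tens K V (H \<boxtimes> H) a (tens K H H b h))) =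
      lift V H (V \<boxtimes> H \<boxtimes> H) (\<delta> v) (\<lambda>v0 h. lift H H (V \<boxtimes> H \<boxtimes> H) (comult H h) (\<lambda>b c. tens K V (H \<boxtimes> H) v0 (tens K H H b c)))"
      by (intro coassoc[OF V] lin_intro) simp_all
    also have "\<dots> = lift V H (V \<boxtimes> H \<boxtimes> H) (\<delta> v) (\<lambda>v0 h. tens K V (H \<boxtimes> H) v0 (comult H h))"
      by (intro lift_cong refl)
        (simp add: lift_id flip: Lin_lift[OF _ _ _ _ _ _ bilinD(1)[OF tens_bilin]])
    finally show "lift W H (W \<boxtimes> H \<boxtimes> H) (\<delta> v) (\<lambda>v0 h. lift W H (W \<boxtimes> H \<boxtimes> H) (\<delta> v0) (\<lambda>a b. tens K W (H \<boxtimes> H) a (tens K H H b h))) =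
      lift W H (W \<boxtimes> H \<boxtimes> H) (\<delta> v) (\<lambda>v0 h. tens K W (H \<boxtimes> H) v0 (comult H h))"
      unfolding e .
    show "lift W H W (\<delta> v) (\<lambda>v0 h. counit H h \<odot>\<^bsub>W\<^esub> v0) = v"
      using counit_right[OF V v] unfolding lift_same[OF s r s, symmetric] sc .
  qed
qed

section \<open>The first order part of a calculus, and the Galois map in terms of spans\<close>

context base_field
begin

lemma fodc_lift_mem:
  assumes "f \<in> fodc_maps K A \<Gamma> U \<beta>"
  shows "fodc_lift K A \<Gamma> U \<beta> \<in> fodc_maps K A \<Gamma> U \<beta>"
  unfolding fodc_lift_def by (rule someI[of "\<lambda>f. f \<in> fodc_maps K A \<Gamma> U \<beta>"]) (rule assms)

lemma first_order_sel [simp]: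
  "carrier (first_order \<Omega>) = deg \<Omega> 1" "add (first_order \<Omega>) = add \<Omega>" "zero (first_order \<Omega>) = zero \<Omega>"
  "smult (first_order \<Omega>) = smult \<Omega>" "lact (first_order \<Omega>) = mult \<Omega>" "ract (first_order \<Omega>) = mult \<Omega>"
  "fdiff (first_order \<Omega>) = diff \<Omega>"
  by (simp_all add: first_order_def)

lemma calculusD:
  assumes "differential_calculus K A \<Omega>"
  shows "dga K \<Omega>" "carrier A = deg \<Omega> 0" "\<one>\<^bsub>A\<^esub> = \<one>\<^bsub>\<Omega>\<^esub>"
    "a \<in> deg \<Omega> 0 \<Longrightarrow> b \<in> deg \<Omega> 0 \<Longrightarrow> a \<otimes>\<^bsub>A\<^esub> b = a \<otimes>\<^bsub>\<Omega>\<^esub> b"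
    "(\<lambda>a. a) \<in> Lin A \<Omega>"
    "deg \<Omega> 1 = lin_span K \<Omega> {a \<otimes>\<^bsub>\<Omega>\<^esub> diff \<Omega> b | a b. a \<in> deg \<Omega> 0 \<and> b \<in> deg \<Omega> 0}"
proof -
  note dc = assms[unfolded differential_calculus_def]
  have "diff_graded_algebra K \<Omega>" using dc by blast
  then show d: "dga K \<Omega>"
    by (intro dga.intro dga_axioms.intro base_field_axioms)
  then interpret dga K \<Omega> .
  show c: "carrier A = deg \<Omega> 0" "\<one>\<^bsub>A\<^esub> = \<one>\<^bsub>\<Omega>\<^esub>"
    "a \<in> deg \<Omega> 0 \<Longrightarrow> b \<in> deg \<Omega> 0 \<Longrightarrow> a \<otimes>\<^bsub>A\<^esub> b = a \<otimes>\<^bsub>\<Omega>\<^esub> b"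
    using dc by blast+
  show "(\<lambda>a. a) \<in> Lin A \<Omega>"
  proof (rule Lin_I)
    show "a \<in> carrier \<Omega>" if "a \<in> carrier A" for a using that by (simp add: c(1))
  qed (use dc in blast)+
  have "{a \<otimes>\<^bsub>\<Omega>\<^esub> foldr (\<lambda>b w. diff \<Omega> b \<otimes>\<^bsub>\<Omega>\<^esub> w) bs \<one>\<^bsub>\<Omega>\<^esub> | a bs.
      a \<in> deg \<Omega> 0 \<and> set bs \<subseteq> deg \<Omega> 0 \<and> length bs = 1} = {a \<otimes>\<^bsub>\<Omega>\<^esub> diff \<Omega> b | a b. a \<in> deg \<Omega> 0 \<and> b \<in> deg \<Omega> 0}"
    (is "?L = ?R")
  proof (intro equalityI subsetI)
    fix x assume "x \<in> ?L"
    then obtain a b where "a \<in> deg \<Omega> 0" "b \<in> deg \<Omega> 0" "x = a \<otimes>\<^bsub>\<Omega>\<^esub> (diff \<Omega> b \<otimes>\<^bsub>\<Omega>\<^esub> \<one>\<^bsub>\<Omega>\<^esub>)"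
      by (auto simp: length_Suc_conv)
    then show "x \<in> ?R" by auto
  next
    fix x assume "x \<in> ?R"
    then obtain a b where ab: "a \<in> deg \<Omega> 0" "b \<in> deg \<Omega> 0" "x = a \<otimes>\<^bsub>\<Omega>\<^esub> diff \<Omega> b" by auto
    then show "x \<in> ?L" by (intro CollectI exI[of _ a] exI[of _ "[b]"]) simp
  qed
  then have eq: "lin_span K \<Omega> ?L = lin_span K \<Omega> ?R" by (rule arg_cong)
  have "deg \<Omega> k = lin_span K \<Omega> {a \<otimes>\<^bsub>\<Omega>\<^esub> foldr (\<lambda>b w. diff \<Omega> b \<otimes>\<^bsub>\<Omega>\<^esub> w) bs \<one>\<^bsub>\<Omega>\<^esub> | a bs.
      a \<in> carrier A \<and> set bs \<subseteq> carrier A \<and> length bs = k}" for k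
    using dc by blast
  from trans[OF this[of 1, unfolded c(1)] eq] show "deg \<Omega> 1 = lin_span K \<Omega> ?R" .
qed

lemma first_order_VS: "dga K \<Omega> \<Longrightarrow> VS (first_order \<Omega>)"
  by (rule VS_transfer[OF VS_carrier_update[OF dga.\<Omega>_simps(1) dga.deg_submodule[of K \<Omega> 1]]]) simp_all

lemma first_order_fodc:
  assumes A: "assoc_algebra K A" and \<Omega>: "differential_calculus K A \<Omega>"
  shows "first_order_calculus K A (first_order \<Omega>)"
proof -
  note C = calculusD[OF \<Omega>]
  interpret dga K \<Omega> by (rule C(1))
  let ?\<Gamma> = "first_order \<Omega>"
  note V = first_order_VS[OF C(1)]
  note M = assoc_algebraD(7)[OF algebra_\<Omega>] and assoc = assoc_algebraD(6)[OF algebra_\<Omega>]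
  have add: "a \<oplus>\<^bsub>A\<^esub> b = a \<oplus>\<^bsub>\<Omega>\<^esub> b" "a \<otimes>\<^bsub>A\<^esub> b = a \<otimes>\<^bsub>\<Omega>\<^esub> b" if "a \<in> deg \<Omega> 0" "b \<in> deg \<Omega> 0" for a b
    using \<Omega>[unfolded differential_calculus_def] that C(2) by blast+
  have sm: "c \<odot>\<^bsub>A\<^esub> a = c \<odot>\<^bsub>\<Omega>\<^esub> a" if "c \<in> carrier K" "a \<in> deg \<Omega> 0" for c a
    using \<Omega>[unfolded differential_calculus_def] that C(2) by blast
  have m: "a \<otimes>\<^bsub>\<Omega>\<^esub> x \<in> deg \<Omega> (Suc 0)" "x \<otimes>\<^bsub>\<Omega>\<^esub> a \<in> deg \<Omega> (Suc 0)" if "a \<in> deg \<Omega> 0" "x \<in> deg \<Omega> (Suc 0)" for a x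
    using deg_mult[of a 0 x 1] deg_mult[of x 1 a 0] that by simp_all
  have bim: "bimodule K A ?\<Gamma>"
    unfolding bimodule_def left_module_def
    by (intro conjI ballI Lin_I V)
      (simp_all add: C(2,3) add sm m assoc Lin_add[OF bilinD(1)[OF M]] Lin_add[OF bilinD(2)[OF M]]
        Lin_smult[OF bilinD(1)[OF M]] Lin_smult[OF bilinD(2)[OF M]])
  have d: "diff \<Omega> \<in> Lin A ?\<Gamma>"
    using diff_deg[of _ 0] by (intro Lin_I) (simp_all add: C(2) add sm Lin_add[OF diff_Lin] Lin_smult[OF diff_Lin])
  let ?S = "{a \<otimes>\<^bsub>\<Omega>\<^esub> diff \<Omega> b | a b. a \<in> deg \<Omega> 0 \<and> b \<in> deg \<Omega> 0}"
  have S: "?S \<subseteq> deg \<Omega> 1" using m diff_deg[of _ 0] by auto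
  \<comment> \<open>Subspaces of the first order record are subspaces of the whole algebra, so that
    the span of the forms a db is the same in both.\<close>
  have sub: "submodule N K \<Omega>" if N: "submodule N K ?\<Gamma>" for N
    using submoduleD[OF V N] by (intro submoduleI') (auto dest: deg_closed)
  have "lin_span K ?\<Gamma> ?S = deg \<Omega> 1"
  proof
    show "lin_span K ?\<Gamma> ?S \<subseteq> deg \<Omega> 1"
      using lin_span_least[OF module.carrier_is_submodule[OF V], of ?S] S by simp
    have "deg \<Omega> 1 \<subseteq> N" if "submodule N K ?\<Gamma>" "?S \<subseteq> N" for N
      unfolding C(6) by (rule lin_span_least[OF sub[OF that(1)] that(2)])
    then show "deg \<Omega> 1 \<subseteq> lin_span K ?\<Gamma> ?S" by (auto simp: lin_span_def)
  qed
  then show ?thesis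
    unfolding first_order_calculus_def using bim d by (simp add: C(2) add diff_Leibniz)
qed

text \<open>Evaluated at a representative, each value of the Galois map is a linear combination of
  its values at pairs (a, b). Since it is onto, these span A \<otimes> H.\<close>

lemma galois_span:
  fixes H :: "('k, 'h) hopf" and A :: "('k, 'a, 'h) comodule_alg"
  assumes A: "comod_alg K H A (coact A)" and gal: "quantum_principal_bundle K H A"
  shows "carrier (A \<boxtimes> H) \<subseteq> lin_span K (A \<boxtimes> H)
    {lift A H (A \<boxtimes> H) (coact A b) (\<lambda>b0 b1. tens K A H (a \<otimes>\<^bsub>A\<^esub> b0) b1) | a b. a \<in> carrier A \<and> b \<in> carrier A}"
    (is "_ \<subseteq> lin_span K _ ?S")
proof
  interpret A: comod_alg K H A "coact A" by (rule A)
  fix t assume t: "t \<in> carrier (A \<boxtimes> H)"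
  let ?B = "coinvariants K H A"
  let ?R = "balanced_rels K ?B A (mult A) A (mult A)"
  have "?R \<subseteq> carrier (free_space K (carrier A \<times> carrier A))"
    unfolding balanced_rels_def
    by (intro Un_least subsetI) (use bilin_rels_closed[of A A] in \<open>auto simp: coinvariants_def\<close>)
  then interpret P: presentation K "carrier A \<times> carrier A" ?R
    by (intro presentation.intro presentation_axioms.intro base_field_axioms)
  have "t \<in> galois_map K H A ` carrier (presented K (carrier A \<times> carrier A) ?R)"
    using gal t by (auto simp: quantum_principal_bundle_def Let_def bij_betw_def tensor_over_def)
  then obtain P where P: "P \<in> carrier (presented K (carrier A \<times> carrier A) ?R)" "galois_map K H A P = t"
    by blast
  have V: "VS (A \<boxtimes> H)" by simp
  have S: "submodule (lin_span K (A \<boxtimes> H) ?S) K (A \<boxtimes> H)"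
    by (rule lin_span_submodule[OF V]) auto
  have "galois_map K H A P \<in> lin_span K (A \<boxtimes> H) ?S"
    unfolding galois_map_def Let_def P.pres_lift_rep lin_ext_def
  proof (rule submodule_finsum[OF V S], rule submoduleD(5)[OF V S])
    fix x assume x: "x \<in> {x. P.rep P x \<noteq> \<zero>\<^bsub>K\<^esub>}"
    then have "x \<in> carrier A \<times> carrier A"
      using P.rep(2)[OF P(1)] unfolding free_space_iff by blast
    then obtain a b where ab [simp]: "x = (a, b)" "a \<in> carrier A" "b \<in> carrier A" by blast
    have "lift A H (A \<boxtimes> H) (coact A b) (\<lambda>b0 b1. tens K A H (a \<otimes>\<^bsub>A\<^esub> b0) b1) \<in> ?S"
      by (intro CollectI exI[of _ a] exI[of _ b]) simp
    from subsetD[OF lin_span_superset this] show "(case x of (a, a') \<Rightarrow> pres_lift K (A \<boxtimes> H) (\<lambda>(a'\<^sub>0, a'\<^sub>1). tens K A H (a \<otimes>\<^bsub>A\<^esub> a'\<^sub>0) a'\<^sub>1) (coact A a'))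
      \<in> lin_span K (A \<boxtimes> H) ?S"
      by (simp add: pres_lift_eq_lift[where V = A and W = H])
    show "P.rep P x \<in> carrier K" using P.rep(2)[OF P(1)] by (simp add: free_space_iff)
  qed
  then show "t \<in> lin_span K (A \<boxtimes> H) ?S" using P(2) by simp
qed

end

lemma with_coaction_sel [simp]:
  "carrier (with_coaction \<Gamma> \<rho>) = carrier \<Gamma>" "add (with_coaction \<Gamma> \<rho>) = add \<Gamma>"
  "zero (with_coaction \<Gamma> \<rho>) = zero \<Gamma>" "smult (with_coaction \<Gamma> \<rho>) = smult \<Gamma>"
  "lact (with_coaction \<Gamma> \<rho>) = lact \<Gamma>" "ract (with_coaction \<Gamma> \<rho>) = ract \<Gamma>"
  "bcoact (with_coaction \<Gamma> \<rho>) = \<rho>"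
  by (simp_all add: with_coaction_def)

lemma same_with_coaction: "same_space \<Gamma> (with_coaction \<Gamma> \<rho>)"
  by (simp add: same_space_def)

lemma bimodule_same:
  assumes "same_space M N" "lact N = lact M" "ract N = ract M" "module K N"
  shows "bimodule K A M \<Longrightarrow> bimodule K A N"
  using assms by (simp add: bimodule_def left_module_def lin_maps_def same_space_def)

lemma (in hopf_alg) with_coaction_covariant:
  fixes A :: "('k, 'a, 'h) comodule_alg" and \<Gamma> :: "('k, 'm, 'a) fodc"
  assumes \<Gamma>: "cov_fodc K H A (coact A) \<Gamma> \<rho>"
  shows "covariant_bimodule K H A (with_coaction \<Gamma> \<rho>)"
proof -
  interpret cov_fodc K H A "coact A" \<Gamma> \<rho> by (rule \<Gamma>)
  let ?M = "with_coaction \<Gamma> \<rho>"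
  note s = same_with_coaction[of \<Gamma> \<rho>] and r = same_space_refl
  note e = tensor_space_same[OF s r, symmetric] lift_same[OF s r r, symmetric]
  have X: "bilin A \<Gamma> \<Gamma> (lact \<Gamma>)" "bilin A \<Gamma> \<Gamma> (\<lambda>a m. ract \<Gamma> m a)" "bilin H H H (mult H)" "bilin H H H (\<lambda>h m. m \<otimes>\<^bsub>H\<^esub> h)"
    by (intro lin_intro; simp)+
  show ?thesis
    unfolding covariant_bimodule_iff[OF comod_alg_axioms]
  proof (intro conjI ballI)
    show "bimodule K A ?M"
      by (rule bimodule_same[OF s _ _ VS_same[OF s] bimodule_\<Gamma>]) simp_all
    show "right_comodule K H ?M (bcoact ?M)"
      using right_comodule_same[OF s \<rho>_comodule] by simp
    fix a b m assume "a \<in> carrier A" "b \<in> carrier A" "m \<in> carrier ?M"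
    then have [simp]: "a \<in> carrier A" "b \<in> carrier A" "m \<in> carrier \<Gamma>" by simp_all
    have "\<rho> (lact \<Gamma> a (ract \<Gamma> m b)) = lift A H (\<Gamma> \<boxtimes> H) (coact A a) (\<lambda>a0 a1. lift A H (\<Gamma> \<boxtimes> H) (coact A b) (\<lambda>b0 b1.
      lift \<Gamma> H (\<Gamma> \<boxtimes> H) (\<rho> m) (\<lambda>x y. tens K \<Gamma> H (lact \<Gamma> a0 (ract \<Gamma> x b0)) (a1 \<otimes>\<^bsub>H\<^esub> (y \<otimes>\<^bsub>H\<^esub> b1)))))"
      by (simp add: \<rho>_bilinear tact_tact[OF _ _ X(1,3) X(2,4)])
    \<comment> \<open>In the covariance formula the sum over the form stands between those over a
      and b.\<close>
    also have "\<dots> = lift A H (\<Gamma> \<boxtimes> H) (coact A a) (\<lambda>a0 a1. lift \<Gamma> H (\<Gamma> \<boxtimes> H) (\<rho> m) (\<lambda>x y.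
      lift A H (\<Gamma> \<boxtimes> H) (coact A b) (\<lambda>b0 b1. tens K \<Gamma> H (lact \<Gamma> a0 (ract \<Gamma> x b0)) (a1 \<otimes>\<^bsub>H\<^esub> (y \<otimes>\<^bsub>H\<^esub> b1)))))"
      by (intro lift_cong refl lift_swap) simp_all
    finally show "bcoact ?M (lact ?M a (ract ?M m b)) = lift A H (?M \<boxtimes> H) (coact A a) (\<lambda>a0 a1. lift ?M H (?M \<boxtimes> H) (bcoact ?M m) (\<lambda>x y.
      lift A H (?M \<boxtimes> H) (coact A b) (\<lambda>b0 b1. tens K ?M H (lact ?M a0 (ract ?M x b0)) (a1 \<otimes>\<^bsub>H\<^esub> (y \<otimes>\<^bsub>H\<^esub> b1)))))"
      unfolding with_coaction_sel e .
  qed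
qed

section \<open>The Atiyah sequence\<close>

locale complete_bundle =
  fixes K :: "'k ring"
    and H :: "('k, 'h) hopf" and \<Omega>\<^sub>H :: "('k, 'h) dga"
    and A :: "('k, 'a, 'h) comodule_alg" and \<Omega>\<^sub>A :: "('k, 'a) dga"
    and D :: "'a \<Rightarrow> ('a \<times> 'h \<Rightarrow> 'k) set"
  assumes field: "field K" and hopf: "hopf_algebra K H"
    and qpb: "quantum_principal_bundle K H A"
    and bicov: "bicovariant_calculus K H (first_order \<Omega>\<^sub>H)"
    and calculus_H: "differential_calculus K H \<Omega>\<^sub>H"
    and complete: "complete_calculus K H \<Omega>\<^sub>H A \<Omega>\<^sub>A D"
begin

sublocale base_field K by (rule base_field.intro[OF field])
sublocale hopf_alg K H by (intro hopf_alg.intro hopf_alg_axioms.intro base_field_axioms hopf)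

lemma comod_alg_A: "comod_alg K H A (coact A)"
  using qpb by (intro comod_alg.intro comod_alg_axioms.intro hopf_alg_axioms)
    (simp_all add: quantum_principal_bundle_def comodule_algebra_def)

sublocale C: comod_alg K H A "coact A" by (rule comod_alg_A)

lemma calculus_A: "differential_calculus K A \<Omega>\<^sub>A"
  using complete by (simp add: complete_calculus_def)

lemmas calcA = calculusD[OF calculus_A] and calcH = calculusD[OF calculus_H]

sublocale dga_pair K \<Omega>\<^sub>A \<Omega>\<^sub>H by (intro dga_pair.intro calcA(1) calcH(1))

abbreviation "\<Gamma> \<equiv> first_order \<Omega>\<^sub>A"
abbreviation "\<Gamma>' \<equiv> first_order \<Omega>\<^sub>H"

lemma deg_0: "a \<in> carrier A \<Longrightarrow> a \<in> deg \<Omega>\<^sub>A 0" "h \<in> carrier H \<Longrightarrow> h \<in> deg \<Omega>\<^sub>H 0"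
  by (simp_all add: calcA(2) calcH(2))

lemmas fodc_A = first_order_fodc[OF C.algebra_A calculus_A]
lemmas fodc_H = first_order_fodc[OF algebra_H calculus_H]

lemmas VS_\<Gamma> [simp] = first_order_VS[OF calcA(1)] first_order_VS[OF calcH(1)]

lemma incl [simp]:
  "a \<in> carrier A \<Longrightarrow> a \<in> carrier \<Omega>\<^sub>A" "h \<in> carrier H \<Longrightarrow> h \<in> carrier \<Omega>\<^sub>H"
  using Lin_closed[OF calcA(5)] Lin_closed[OF calcH(5)] by blast+

lemma diff_1 [simp]:
  "a \<in> carrier A \<Longrightarrow> diff \<Omega>\<^sub>A a \<in> deg \<Omega>\<^sub>A (Suc 0)" "h \<in> carrier H \<Longrightarrow> diff \<Omega>\<^sub>H h \<in> deg \<Omega>\<^sub>H (Suc 0)"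
  using X.diff_deg[of a 0] Y.diff_deg[of h 0] by (simp_all add: deg_0)

lemma mult_eq:
  "a \<in> carrier A \<Longrightarrow> b \<in> carrier A \<Longrightarrow> a \<otimes>\<^bsub>\<Omega>\<^sub>A\<^esub> b = a \<otimes>\<^bsub>A\<^esub> b"
  "g \<in> carrier H \<Longrightarrow> h \<in> carrier H \<Longrightarrow> g \<otimes>\<^bsub>\<Omega>\<^sub>H\<^esub> h = g \<otimes>\<^bsub>H\<^esub> h"
  by (simp_all add: calcA(4) calcH(4) deg_0)

lemma mult_deg_1 [simp]:
  "a \<in> carrier A \<Longrightarrow> \<omega> \<in> deg \<Omega>\<^sub>A (Suc 0) \<Longrightarrow> a \<otimes>\<^bsub>\<Omega>\<^sub>A\<^esub> \<omega> \<in> deg \<Omega>\<^sub>A (Suc 0)"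
  "h \<in> carrier H \<Longrightarrow> \<theta> \<in> deg \<Omega>\<^sub>H (Suc 0) \<Longrightarrow> h \<otimes>\<^bsub>\<Omega>\<^sub>H\<^esub> \<theta> \<in> deg \<Omega>\<^sub>H (Suc 0)"
  using X.deg_mult[of a 0 \<omega> 1] Y.deg_mult[of h 0 \<theta> 1] by (simp_all add: deg_0)

lemma incl_Lin [lin_intro]:
  "(\<lambda>a. a) \<in> Lin A \<Omega>\<^sub>A" "(\<lambda>h. h) \<in> Lin H \<Omega>\<^sub>H" "(\<lambda>\<omega>. \<omega>) \<in> Lin \<Gamma> \<Omega>\<^sub>A" "(\<lambda>\<theta>. \<theta>) \<in> Lin \<Gamma>' \<Omega>\<^sub>H"
  using calcA(5) calcH(5) by (auto simp: lin_maps_def)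

lemma component_Lins:
  "(\<lambda>x. component \<Omega>\<^sub>A x 0) \<in> Lin \<Omega>\<^sub>A A" "(\<lambda>x. component \<Omega>\<^sub>A x (Suc 0)) \<in> Lin \<Omega>\<^sub>A \<Gamma>"
  "(\<lambda>x. component \<Omega>\<^sub>H x 0) \<in> Lin \<Omega>\<^sub>H H" "(\<lambda>x. component \<Omega>\<^sub>H x (Suc 0)) \<in> Lin \<Omega>\<^sub>H \<Gamma>'"
proof -
  note A = Lin_add[OF calcA(5), unfolded calcA(2)] Lin_smult[OF calcA(5), unfolded calcA(2)]
  note H = Lin_add[OF calcH(5), unfolded calcH(2)] Lin_smult[OF calcH(5), unfolded calcH(2)]
  note [simp] = X.component_deg Y.component_deg Lin_add[OF X.component_Lin] Lin_smult[OF X.component_Lin]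
    Lin_add[OF Y.component_Lin] Lin_smult[OF Y.component_Lin]
  show "(\<lambda>x. component \<Omega>\<^sub>A x 0) \<in> Lin \<Omega>\<^sub>A A" by (rule Lin_I) (simp_all add: calcA(2) A)
  show "(\<lambda>x. component \<Omega>\<^sub>H x 0) \<in> Lin \<Omega>\<^sub>H H" by (rule Lin_I) (simp_all add: calcH(2) H)
  show "(\<lambda>x. component \<Omega>\<^sub>A x (Suc 0)) \<in> Lin \<Omega>\<^sub>A \<Gamma>" "(\<lambda>x. component \<Omega>\<^sub>H x (Suc 0)) \<in> Lin \<Omega>\<^sub>H \<Gamma>'"
    by (rule Lin_I; simp)+
qed

lemmas component_mem [simp] = Lin_closed[OF component_Lins(1)] Lin_closed[OF component_Lins(2), simplified]
  Lin_closed[OF component_Lins(3)] Lin_closed[OF component_Lins(4), simplified]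

lemmas [lin_intro] = Lin_comp[OF component_Lins(1)] Lin_comp[OF component_Lins(2)]
  Lin_comp[OF component_Lins(3)] Lin_comp[OF component_Lins(4)]

lemma component_simps [simp]:
  "a \<in> carrier A \<Longrightarrow> component \<Omega>\<^sub>A a 0 = a" "a \<in> carrier A \<Longrightarrow> component \<Omega>\<^sub>A a (Suc 0) = \<zero>\<^bsub>\<Omega>\<^sub>A\<^esub>"
  "h \<in> carrier H \<Longrightarrow> component \<Omega>\<^sub>H h 0 = h" "h \<in> carrier H \<Longrightarrow> component \<Omega>\<^sub>H h (Suc 0) = \<zero>\<^bsub>\<Omega>\<^sub>H\<^esub>"
  "\<omega> \<in> deg \<Omega>\<^sub>A (Suc 0) \<Longrightarrow> component \<Omega>\<^sub>A \<omega> 0 = \<zero>\<^bsub>\<Omega>\<^sub>A\<^esub>" "\<omega> \<in> deg \<Omega>\<^sub>A (Suc 0) \<Longrightarrow> component \<Omega>\<^sub>A \<omega> (Suc 0) = \<omega>"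
  "\<theta> \<in> deg \<Omega>\<^sub>H (Suc 0) \<Longrightarrow> component \<Omega>\<^sub>H \<theta> 0 = \<zero>\<^bsub>\<Omega>\<^sub>H\<^esub>" "\<theta> \<in> deg \<Omega>\<^sub>H (Suc 0) \<Longrightarrow> component \<Omega>\<^sub>H \<theta> (Suc 0) = \<theta>"
  by (simp_all add: X.component_hom[OF deg_0(1)] Y.component_hom[OF deg_0(2)] X.component_hom Y.component_hom)

lemma zero_eq [simp]: "\<zero>\<^bsub>\<Omega>\<^sub>A\<^esub> = \<zero>\<^bsub>A\<^esub>" "\<zero>\<^bsub>\<Omega>\<^sub>H\<^esub> = \<zero>\<^bsub>H\<^esub>"
  using Lin_zero[OF calcA(5)] Lin_zero[OF calcH(5)] by simp_all

lemma D_Lin: "D \<in> Lin \<Omega>\<^sub>A T"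
  using complete by (simp add: complete_calculus_def dga_homs_def algebra_homs_def lin_maps_def dga_tensor_def Let_def)

lemmas [lin_intro] = Lin_comp[OF D_Lin]

lemma D_coact: "a \<in> carrier A \<Longrightarrow> D a = lift A H T (coact A a) (tens K \<Omega>\<^sub>A \<Omega>\<^sub>H)"
  using complete by (simp add: complete_calculus_def tensor_map_lift[where X = A and Y = H])

text \<open>As D is a morphism of DGAs, D(a db) is the product of D(a) with the differential of
  D(b), and D(a) and D(b) are the coactions. All Koszul signs are +1 because the legs a_1 and b_0
  have degree zero.\<close>

lemma D_gen:
  assumes [simp]: "a \<in> carrier A" "b \<in> carrier A"
  shows "D (a \<otimes>\<^bsub>\<Omega>\<^sub>A\<^esub> diff \<Omega>\<^sub>A b) = lift A H T (coact A a) (\<lambda>a0 a1. lift A H T (coact A b) (\<lambda>b0 b1.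
    tens K \<Omega>\<^sub>A \<Omega>\<^sub>H (a0 \<otimes>\<^bsub>\<Omega>\<^sub>A\<^esub> diff \<Omega>\<^sub>A b0) (a1 \<otimes>\<^bsub>H\<^esub> b1) \<oplus>\<^bsub>T\<^esub>
    tens K \<Omega>\<^sub>A \<Omega>\<^sub>H (a0 \<otimes>\<^bsub>A\<^esub> b0) (a1 \<otimes>\<^bsub>\<Omega>\<^sub>H\<^esub> diff \<Omega>\<^sub>H b1)))"
proof -
  let ?M = "mult (dga_tensor K \<Omega>\<^sub>A \<Omega>\<^sub>H)"
  note M = mult_bilin
  have hom: "D (x \<otimes>\<^bsub>\<Omega>\<^sub>A\<^esub> y) = ?M (D x) (D y)" "D (diff \<Omega>\<^sub>A x) = diff (dga_tensor K \<Omega>\<^sub>A \<Omega>\<^sub>H) (D x)"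
    if "x \<in> carrier \<Omega>\<^sub>A" "y \<in> carrier \<Omega>\<^sub>A" for x y
    using complete that by (auto simp: complete_calculus_def dga_homs_def algebra_homs_def ring_hom_def)
  let ?d = "\<lambda>b0 b1. tens K \<Omega>\<^sub>A \<Omega>\<^sub>H (diff \<Omega>\<^sub>A b0) b1 \<oplus>\<^bsub>T\<^esub> tens K \<Omega>\<^sub>A \<Omega>\<^sub>H b0 (diff \<Omega>\<^sub>H b1)"
  have Db: "D (diff \<Omega>\<^sub>A b) = lift A H T (coact A b) ?d"
    by (simp add: hom[of _ a] D_coact Lin_lift[OF _ _ _ _ _ _ diff_tensor_Lin] diff_tens deg_0)
  have "D (a \<otimes>\<^bsub>\<Omega>\<^sub>A\<^esub> diff \<Omega>\<^sub>A b) = ?M (lift A H T (coact A a) (tens K \<Omega>\<^sub>A \<Omega>\<^sub>H)) (lift A H T (coact A b) ?d)"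
    by (simp add: hom D_coact Db)
  also have "\<dots> = lift A H T (coact A a) (\<lambda>a0 a1. ?M (tens K \<Omega>\<^sub>A \<Omega>\<^sub>H a0 a1) (lift A H T (coact A b) ?d))"
    by (rule Lin_lift[where f = "\<lambda>P. ?M P (lift A H T (coact A b) ?d)" and U = T]) (simp_all add: bilinD(2)[OF M])
  also have "\<dots> = lift A H T (coact A a) (\<lambda>a0 a1. lift A H T (coact A b) (\<lambda>b0 b1. ?M (tens K \<Omega>\<^sub>A \<Omega>\<^sub>H a0 a1) (?d b0 b1)))"
    by (intro lift_cong refl) (simp add: Lin_lift[OF _ _ _ _ _ _ bilinD(1)[OF M]])
  also have "\<dots> = lift A H T (coact A a) (\<lambda>a0 a1. lift A H T (coact A b) (\<lambda>b0 b1.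
    tens K \<Omega>\<^sub>A \<Omega>\<^sub>H (a0 \<otimes>\<^bsub>\<Omega>\<^sub>A\<^esub> diff \<Omega>\<^sub>A b0) (a1 \<otimes>\<^bsub>H\<^esub> b1) \<oplus>\<^bsub>T\<^esub>
    tens K \<Omega>\<^sub>A \<Omega>\<^sub>H (a0 \<otimes>\<^bsub>A\<^esub> b0) (a1 \<otimes>\<^bsub>\<Omega>\<^sub>H\<^esub> diff \<Omega>\<^sub>H b1)))"
    by (intro lift_cong refl)
      (simp add: Lin_add[OF bilinD(1)[OF M]] mult_tens[OF _ deg_0(2) diff_1(1)] mult_tens[OF _ deg_0(2) deg_0(1)] mult_eq)
  finally show ?thesis .
qed

text \<open>The part of bidegree (1, 0). Taking components in each factor gives a value in \<Gamma>
  \<otimes> H itself rather than in its image inside the tensor product of the two calculi.\<close>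

definition D10 :: "'a \<Rightarrow> ('a \<times> 'h \<Rightarrow> 'k) set"
  where "D10 \<omega> = lift \<Omega>\<^sub>A \<Omega>\<^sub>H (\<Gamma> \<boxtimes> H) (D \<omega>) (\<lambda>x y. tens K \<Gamma> H (component \<Omega>\<^sub>A x 1) (component \<Omega>\<^sub>H y 0))"

definition D01 :: "'a \<Rightarrow> ('a \<times> 'h \<Rightarrow> 'k) set"
  where "D01 \<omega> = lift \<Omega>\<^sub>A \<Omega>\<^sub>H (A \<boxtimes> \<Gamma>') (D \<omega>) (\<lambda>x y. tens K A \<Gamma>' (component \<Omega>\<^sub>A x 0) (component \<Omega>\<^sub>H y 1))"

lemma D10_bilin: "bilin \<Omega>\<^sub>A \<Omega>\<^sub>H (\<Gamma> \<boxtimes> H) (\<lambda>x y. tens K \<Gamma> H (component \<Omega>\<^sub>A x (Suc 0)) (component \<Omega>\<^sub>H y 0))"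
  by (intro lin_intro) simp_all

lemma D01_bilin: "bilin \<Omega>\<^sub>A \<Omega>\<^sub>H (A \<boxtimes> \<Gamma>') (\<lambda>x y. tens K A \<Gamma>' (component \<Omega>\<^sub>A x 0) (component \<Omega>\<^sub>H y (Suc 0)))"
  by (intro lin_intro) simp_all

lemma D10_Lin: "D10 \<in> Lin \<Gamma> (\<Gamma> \<boxtimes> H)"
  unfolding D10_def[abs_def] One_nat_def by (intro lin_intro) simp_all

lemma D01_Lin: "D01 \<in> Lin \<Gamma> (A \<boxtimes> \<Gamma>')"
  unfolding D01_def[abs_def] One_nat_def by (intro lin_intro) simp_all

lemma zeros:
  "h \<in> carrier H \<Longrightarrow> tens K \<Gamma> H \<zero>\<^bsub>A\<^esub> h = \<zero>\<^bsub>\<Gamma> \<boxtimes> H\<^esub>" "\<theta> \<in> deg \<Omega>\<^sub>H (Suc 0) \<Longrightarrow> tens K A \<Gamma>' \<zero>\<^bsub>A\<^esub> \<theta> = \<zero>\<^bsub>A \<boxtimes> \<Gamma>'\<^esub>"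
  "\<omega> \<in> deg \<Omega>\<^sub>A (Suc 0) \<Longrightarrow> tens K \<Gamma> H \<omega> \<zero>\<^bsub>H\<^esub> = \<zero>\<^bsub>\<Gamma> \<boxtimes> H\<^esub>" "a \<in> carrier A \<Longrightarrow> tens K A \<Gamma>' a \<zero>\<^bsub>H\<^esub> = \<zero>\<^bsub>A \<boxtimes> \<Gamma>'\<^esub>"
  using bilin_zero[OF tens_bilin, of \<Gamma> H] bilin_zero[OF tens_bilin, of A \<Gamma>'] by simp_all

lemma D10_gen:
  assumes [simp]: "a \<in> carrier A" "b \<in> carrier A"
  shows "D10 (a \<otimes>\<^bsub>\<Omega>\<^sub>A\<^esub> diff \<Omega>\<^sub>A b) = lift A H (\<Gamma> \<boxtimes> H) (coact A a) (\<lambda>a0 a1. lift A H (\<Gamma> \<boxtimes> H) (coact A b) (\<lambda>b0 b1.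
    tens K \<Gamma> H (a0 \<otimes>\<^bsub>\<Omega>\<^sub>A\<^esub> diff \<Omega>\<^sub>A b0) (a1 \<otimes>\<^bsub>H\<^esub> b1)))"
  by (simp add: D10_def D_gen lift_lift D10_bilin Lin_add[OF lift_Lin[OF _ _ _ D10_bilin]] lift_tens zeros)

lemma D01_gen:
  assumes [simp]: "a \<in> carrier A" "b \<in> carrier A"
  shows "D01 (a \<otimes>\<^bsub>\<Omega>\<^sub>A\<^esub> diff \<Omega>\<^sub>A b) = lift A H (A \<boxtimes> \<Gamma>') (coact A a) (\<lambda>a0 a1. lift A H (A \<boxtimes> \<Gamma>') (coact A b) (\<lambda>b0 b1.
    tens K A \<Gamma>' (a0 \<otimes>\<^bsub>A\<^esub> b0) (a1 \<otimes>\<^bsub>\<Omega>\<^sub>H\<^esub> diff \<Omega>\<^sub>H b1)))"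
  by (simp add: D01_def D_gen lift_lift D01_bilin Lin_add[OF lift_Lin[OF _ _ _ D01_bilin]] lift_tens zeros)

lemma D_split:
  assumes \<omega>: "\<omega> \<in> carrier \<Gamma>"
  shows "D \<omega> = lift \<Gamma> H T (D10 \<omega>) (tens K \<Omega>\<^sub>A \<Omega>\<^sub>H) \<oplus>\<^bsub>T\<^esub> lift A \<Gamma>' T (D01 \<omega>) (tens K \<Omega>\<^sub>A \<Omega>\<^sub>H)"
proof (rule fodc_eqI[where U = T, OF fodc_A _ _ _ \<omega>])
  have B1: "bilin \<Gamma> H T (tens K \<Omega>\<^sub>A \<Omega>\<^sub>H)" and B2: "bilin A \<Gamma>' T (tens K \<Omega>\<^sub>A \<Omega>\<^sub>H)"
    by (intro lin_intro; simp)+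
  show "D \<in> Lin \<Gamma> T" using Lin_comp[OF D_Lin incl_Lin(3)] .
  show "(\<lambda>\<omega>. lift \<Gamma> H T (D10 \<omega>) (tens K \<Omega>\<^sub>A \<Omega>\<^sub>H) \<oplus>\<^bsub>T\<^esub> lift A \<Gamma>' T (D01 \<omega>) (tens K \<Omega>\<^sub>A \<Omega>\<^sub>H)) \<in> Lin \<Gamma> T"
    by (intro Lin_add_map Lin_lift_arg B1 B2 D10_Lin D01_Lin) simp_all
  fix a b assume [simp]: "a \<in> carrier A" "b \<in> carrier A"
  show "D (lact \<Gamma> a (fdiff \<Gamma> b)) = lift \<Gamma> H T (D10 (lact \<Gamma> a (fdiff \<Gamma> b))) (tens K \<Omega>\<^sub>A \<Omega>\<^sub>H) \<oplus>\<^bsub>T\<^esub>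
    lift A \<Gamma>' T (D01 (lact \<Gamma> a (fdiff \<Gamma> b))) (tens K \<Omega>\<^sub>A \<Omega>\<^sub>H)"
    by (simp add: D10_gen D01_gen D_gen lift_lift B1 B2 lift_tens lift_add)
qed simp

text \<open>If D(\<omega>) comes from \<Gamma> \<otimes> H, its first legs have no component of
  degree zero and \<open>D01\<close> vanishes. Conversely, \<open>D_split\<close> leaves only the
  part coming from \<Gamma> \<otimes> H.\<close>

lemma hor_iff:
  assumes \<omega>: "\<omega> \<in> deg \<Omega>\<^sub>A 1"
  shows "\<omega> \<in> hor1_forms K H \<Omega>\<^sub>H \<Omega>\<^sub>A D \<longleftrightarrow> D01 \<omega> = \<zero>\<^bsub>A \<boxtimes> \<Gamma>'\<^esub>"
proof -
  have [simp]: "\<omega> \<in> carrier \<Gamma>" "\<omega> \<in> deg \<Omega>\<^sub>A (Suc 0)" using \<omega> by simp_all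
  have B1: "bilin \<Gamma> H T (tens K \<Omega>\<^sub>A \<Omega>\<^sub>H)" and B2: "bilin A \<Gamma>' T (tens K \<Omega>\<^sub>A \<Omega>\<^sub>H)"
    by (intro lin_intro; simp)+
  have t: "tensor_map K \<Omega>\<^sub>A \<Omega>\<^sub>H id id s = lift \<Gamma> H T s (tens K \<Omega>\<^sub>A \<Omega>\<^sub>H)" if "s \<in> carrier (\<Gamma> \<boxtimes> H)" for s
    by (subst tensor_map_lift[where X = \<Gamma> and Y = H]) (use that in auto)
  show ?thesis
  proof
    assume "\<omega> \<in> hor1_forms K H \<Omega>\<^sub>H \<Omega>\<^sub>A D"
    then obtain s where s [simp]: "s \<in> carrier (\<Gamma> \<boxtimes> H)" and D\<omega>: "D \<omega> = lift \<Gamma> H T s (tens K \<Omega>\<^sub>A \<Omega>\<^sub>H)"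
      by (auto simp: hor1_forms_def t)
    have "D01 \<omega> = lift \<Gamma> H (A \<boxtimes> \<Gamma>') s (\<lambda>x y. lift \<Omega>\<^sub>A \<Omega>\<^sub>H (A \<boxtimes> \<Gamma>') (tens K \<Omega>\<^sub>A \<Omega>\<^sub>H x y)
      (\<lambda>x y. tens K A \<Gamma>' (component \<Omega>\<^sub>A x 0) (component \<Omega>\<^sub>H y 1)))"
      unfolding D01_def D\<omega> by (rule lift_lift) (simp_all add: D01_bilin)
    also have "\<dots> = lift \<Gamma> H (A \<boxtimes> \<Gamma>') s (\<lambda>x y. \<zero>\<^bsub>A \<boxtimes> \<Gamma>'\<^esub>)"
      by (intro lift_cong refl) (simp add: lift_tens D01_bilin zeros)
    finally show "D01 \<omega> = \<zero>\<^bsub>A \<boxtimes> \<Gamma>'\<^esub>" by (simp add: lift_zero)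
  next
    assume hor: "D01 \<omega> = \<zero>\<^bsub>A \<boxtimes> \<Gamma>'\<^esub>"
    have d: "D10 \<omega> \<in> carrier (\<Gamma> \<boxtimes> H)" by (rule Lin_closed[OF D10_Lin]) simp
    have c: "lift \<Gamma> H T (D10 \<omega>) (tens K \<Omega>\<^sub>A \<Omega>\<^sub>H) \<in> carrier T"
      by (rule Lin_closed[OF lift_Lin[OF _ _ _ B1] d]) simp_all
    have z: "lift A \<Gamma>' T \<zero>\<^bsub>A \<boxtimes> \<Gamma>'\<^esub> (tens K \<Omega>\<^sub>A \<Omega>\<^sub>H) = \<zero>\<^bsub>T\<^esub>"
      by (rule Lin_zero[OF lift_Lin[OF _ _ _ B2]]) simp_all
    have "D \<omega> = tensor_map K \<Omega>\<^sub>A \<Omega>\<^sub>H id id (D10 \<omega>)"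
      unfolding D_split[OF \<open>\<omega> \<in> carrier \<Gamma>\<close>] hor z t[OF d] by (rule VS_zero_add(2)[OF _ c]) simp
    then show "\<omega> \<in> hor1_forms K H \<Omega>\<^sub>H \<Omega>\<^sub>A D" unfolding hor1_forms_def using d \<omega> by blast
  qed
qed

section \<open>The coactions on one-forms\<close>

definition "rcoA \<equiv> right_coaction K H A (coact A) \<Gamma>"
definition "rcoH \<equiv> right_coaction K H H (comult H) \<Gamma>'"
definition "lcoH \<equiv> left_coaction K H \<Gamma>'"

text \<open>\<open>right_coaction\<close> is a choice among the linear maps with the prescribed
  values on a db, and \<open>D10\<close> shows that such a map exists.\<close>

lemma rcoA: "rcoA \<in> fodc_maps K A \<Gamma> (\<Gamma> \<boxtimes> H) (right_coact_formula K H (coact A) \<Gamma>)"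
  unfolding rcoA_def right_coaction_def
proof (rule fodc_lift_mem)
  show "D10 \<in> fodc_maps K A \<Gamma> (\<Gamma> \<boxtimes> H) (right_coact_formula K H (coact A) \<Gamma>)"
    by (simp add: fodc_maps_def D10_Lin C.right_coact_formula_lift[OF fodc_A] D10_gen)
qed

lemma rcoH: "rcoH \<in> fodc_maps K H \<Gamma>' (\<Gamma>' \<boxtimes> H) (right_coact_formula K H (comult H) \<Gamma>')"
  unfolding rcoH_def right_coaction_def
  using bicov by (auto simp: bicovariant_calculus_def intro: fodc_lift_mem)

lemma lcoH: "lcoH \<in> fodc_maps K H \<Gamma>' (H \<boxtimes> \<Gamma>') (left_coact_formula K H \<Gamma>')"
  unfolding lcoH_def left_coaction_def
  using bicov by (auto simp: bicovariant_calculus_def intro: fodc_lift_mem)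

lemma cov_A: "cov_fodc K H A (coact A) \<Gamma> rcoA"
  by (intro cov_fodc.intro cov_fodc_axioms.intro comod_alg_A fodc_A rcoA)

lemma cov_H: "cov_fodc K H H (comult H) \<Gamma>' rcoH"
  by (intro cov_fodc.intro cov_fodc_axioms.intro comod_alg_H fodc_H rcoH)

lemma vert: "vert K H A (coact A) \<Gamma> rcoA \<Gamma>' rcoH D01 lcoH"
  by (intro vert.intro two_fodc.intro two_fodc_axioms.intro bicov_fodc.intro bicov_fodc_axioms.intro
      cov_A cov_H lcoH D01_Lin) (simp add: D01_gen)

interpretation V: vert K H A "coact A" \<Gamma> rcoA \<Gamma>' rcoH D01 lcoH
  by (rule vert)

lemma Lambda1_eq: "Lambda1 K H \<Gamma>' = V.G.coinv"
  unfolding V.G.coinv_def Lambda1_def lcoH_def[symmetric] by simp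

lemma Lambda1_act_eq:
  assumes "\<theta> \<in> carrier V.G.coinv" "h \<in> carrier H"
  shows "Lambda1_act K H \<Gamma>' \<theta> h = V.G.cact \<theta> h"
proof -
  \<comment> \<open>These selector rules would rewrite carrier, actions and differential of the
    first order records into those of the graded algebra, and the facts of the interpretation
    \<open>V\<close> would no longer match.\<close>
  note [simp del] = first_order_sel
  note [simp] = assms bimoduleD(8)[OF V.G.bimodule_\<Gamma>]
  show ?thesis
    unfolding Lambda1_act_def by (subst pres_lift_eq_lift[where V = H and W = H])
      (simp_all add: V.G.cact_def V.G.conv_def)
qed

text \<open>\<open>restrict_coaction\<close> goes back along the inclusion of \<Lambda>^1 \<otimes>
  H into \<Gamma>' \<otimes> H. The inclusion is injective by \<open>tensor_incl_inj\<close>, and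
  \<open>ccoact_incl\<close> names the preimage.\<close>

lemma Lambda1_coact_eq:
  assumes \<theta>: "\<theta> \<in> carrier V.G.coinv"
  shows "Lambda1_coact K H \<Gamma>' \<theta> = V.G.ccoact \<theta>"
proof -
  note [simp del] = first_order_sel
  have t: "tensor_map K \<Gamma>' H id id s = lift V.G.coinv H (\<Gamma>' \<boxtimes> H) s (tens K \<Gamma>' H)"
    if "s \<in> carrier (V.G.coinv \<boxtimes> H)" for s
    using that by (simp add: tensor_map_lift[where X = V.G.coinv and Y = H])
  have "inj_on (\<lambda>s. lift V.G.coinv H (\<Gamma>' \<boxtimes> H) s (tens K \<Gamma>' H)) (carrier (V.G.coinv \<boxtimes> H))"
    unfolding V.G.coinv_def by (rule tensor_incl_inj[OF _ V.G.coinv_submodule]) simp_all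
  then have "inj_on (tensor_map K \<Gamma>' H id id) (carrier (V.G.coinv \<boxtimes> H))"
    unfolding inj_on_def by (metis (no_types, lifting) t)
  then show ?thesis
    unfolding Lambda1_coact_def restrict_coaction_def Lambda1_eq rcoH_def[symmetric]
    by (rule inv_into_f_eq) (use \<theta> V.G.ccoact_incl[OF \<theta>] t[of "V.G.ccoact \<theta>"] in simp_all)
qed

section \<open>Identification of the defined bimodules and of the vertical projection with their
  working forms\<close>

abbreviation "M \<equiv> Omega1 K H A \<Omega>\<^sub>A"
abbreviation "N \<equiv> ver1 K H \<Omega>\<^sub>H A"

lemma M_eq: "M = with_coaction \<Gamma> rcoA"
  by (simp add: Omega1_def rcoA_def)

lemma same_M: "same_space \<Gamma> M"
  unfolding M_eq by (rule same_with_coaction)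

lemma same_N: "same_space V.V N"
  by (simp add: same_space_def ver1_def Let_def Lambda1_eq)

lemma M_sel [simp]: "carrier M = carrier \<Gamma>" "zero M = zero \<Gamma>" "lact M = lact \<Gamma>" "ract M = ract \<Gamma>" "bcoact M = rcoA"
  unfolding M_eq by (simp_all only: with_coaction_sel)

lemma N_carrier [simp]: "carrier N = carrier V.V"
  using same_N by (simp add: same_space_def)

lemma N_lact:
  assumes "a \<in> carrier A" "v \<in> carrier V.V"
  shows "lact N a v = V.vlact a v"
proof -
  note [simp del] = first_order_sel
  have "lact N a v = pres_lift K V.V (\<lambda>(a', \<theta>). tens K A V.G.coinv (a \<otimes>\<^bsub>A\<^esub> a') \<theta>) v"
    by (simp add: ver1_def Let_def Lambda1_eq)
  then show ?thesis using assms by (simp add: V.vlact_def pres_lift_eq_lift[where V = A and W = V.G.coinv])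
qed

lemma N_ract:
  assumes [simp]: "a \<in> carrier A" "v \<in> carrier V.V"
  shows "ract N v a = V.vract v a"
proof -
  note [simp del] = first_order_sel
  have "ract N v a = pres_lift K V.V (\<lambda>(a', \<theta>). pres_lift K V.V (\<lambda>(a0, a1).
    tens K A V.G.coinv (a' \<otimes>\<^bsub>A\<^esub> a0) (Lambda1_act K H \<Gamma>' \<theta> a1)) (coact A a)) v"
    by (simp add: ver1_def Let_def Lambda1_eq)
  also have "\<dots> = lift A V.G.coinv V.V v (\<lambda>a' \<theta>. pres_lift K V.V (\<lambda>(a0, a1).
    tens K A V.G.coinv (a' \<otimes>\<^bsub>A\<^esub> a0) (Lambda1_act K H \<Gamma>' \<theta> a1)) (coact A a))"
    by (rule pres_lift_eq_lift) (auto simp: pres_lift_eq_lift[where V = A and W = H] Lambda1_act_eq)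
  finally show ?thesis
    by (simp add: V.vract_def pres_lift_eq_lift[where V = A and W = H] Lambda1_act_eq)
qed

lemma N_coact:
  assumes [simp]: "v \<in> carrier V.V"
  shows "bcoact N v = V.vcoact v"
proof -
  note [simp del] = first_order_sel
  let ?L = V.G.coinv and ?U = "V.V \<boxtimes> H"
  have "bcoact N v = pres_lift K ?U (\<lambda>(a, \<theta>). pres_lift K ?U (\<lambda>(a0, a1). pres_lift K ?U (\<lambda>(\<theta>0, \<theta>1).
    tens K V.V H (tens K A ?L a0 \<theta>0) (a1 \<otimes>\<^bsub>H\<^esub> \<theta>1)) (Lambda1_coact K H \<Gamma>' \<theta>)) (coact A a)) v"
    by (simp add: ver1_def Let_def Lambda1_eq)
  also have "\<dots> = lift A ?L ?U v (\<lambda>a \<theta>. pres_lift K ?U (\<lambda>(a0, a1). pres_lift K ?U (\<lambda>(\<theta>0, \<theta>1).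
    tens K V.V H (tens K A ?L a0 \<theta>0) (a1 \<otimes>\<^bsub>H\<^esub> \<theta>1)) (Lambda1_coact K H \<Gamma>' \<theta>)) (coact A a))"
    by (rule pres_lift_eq_lift)
      (auto simp: pres_lift_eq_lift[where V = A and W = H] pres_lift_eq_lift[where V = ?L and W = H] Lambda1_coact_eq)
  also have "\<dots> = lift A ?L ?U v (\<lambda>a \<theta>. lift A H ?U (coact A a) (\<lambda>a0 a1. pres_lift K ?U (\<lambda>(\<theta>0, \<theta>1).
    tens K V.V H (tens K A ?L a0 \<theta>0) (a1 \<otimes>\<^bsub>H\<^esub> \<theta>1)) (Lambda1_coact K H \<Gamma>' \<theta>)))"
    by (intro lift_cong refl pres_lift_eq_lift)
      (auto simp: pres_lift_eq_lift[where V = ?L and W = H] Lambda1_coact_eq)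
  finally show ?thesis
    by (simp add: V.vcoact_def pres_lift_eq_lift[where V = ?L and W = H] Lambda1_coact_eq)
qed

text \<open>\<open>vpi\<close> has the prescribed values on a db by \<open>vpi_gen\<close>, so the
  choice in \<open>pi_v\<close> is not void; linear maps that agree on all a db agree on every
  form.\<close>

lemma pi_v_eq:
  assumes \<omega>: "\<omega> \<in> carrier \<Gamma>"
  shows "pi_v K H \<Omega>\<^sub>H A \<Omega>\<^sub>A \<omega> = V.vpi \<omega>"
proof -
  note [simp del] = first_order_sel
  let ?L = V.G.coinv
  define \<beta> where "\<beta> a b = pres_lift K V.V (\<lambda>(b\<^sub>0, h). tens K A ?L (a \<otimes>\<^bsub>A\<^esub> b\<^sub>0)
         (pres_lift K \<Gamma>' (\<lambda>(h\<^sub>1, h\<^sub>2). lact \<Gamma>' (antipode H h\<^sub>1) (fdiff \<Gamma>' h\<^sub>2)) (comult H h))) (coact A b)" for a b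
  have mc: "pres_lift K \<Gamma>' (\<lambda>(h\<^sub>1, h\<^sub>2). lact \<Gamma>' (antipode H h\<^sub>1) (fdiff \<Gamma>' h\<^sub>2)) (comult H h) = V.G.mc h"
    if [simp]: "h \<in> carrier H" for h
    by (subst pres_lift_eq_lift[where V = H and W = H]) (simp_all add: V.G.mc_def V.G.conv_def)
  have \<beta>: "\<beta> a b = V.vpi (lact \<Gamma> a (fdiff \<Gamma> b))" if [simp]: "a \<in> carrier A" "b \<in> carrier A" for a b
    unfolding \<beta>_def by (subst pres_lift_eq_lift[where V = A and W = H]) (simp_all add: mc V.vpi_gen)
  have p: "pi_v K H \<Omega>\<^sub>H A \<Omega>\<^sub>A = fodc_lift K A \<Gamma> V.V \<beta>"
    unfolding pi_v_def Let_def Lambda1_eq \<beta>_def ..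
  have "V.vpi \<in> fodc_maps K A \<Gamma> V.V \<beta>" by (simp add: fodc_maps_def V.vpi_Lin \<beta>)
  from fodc_lift_mem[OF this] have "fodc_lift K A \<Gamma> V.V \<beta> \<in> fodc_maps K A \<Gamma> V.V \<beta>" .
  then show ?thesis
    unfolding p by (intro fodc_eqI[OF fodc_A _ V.vpi_Lin _ \<omega>]) (simp_all add: fodc_maps_def \<beta>)
qed

lemma M_covariant: "covariant_bimodule K H A M"
  unfolding M_eq by (rule with_coaction_covariant[OF cov_A])

lemma pi_v_Lin: "pi_v K H \<Omega>\<^sub>H A \<Omega>\<^sub>A \<in> Lin M N"
  unfolding lin_maps_same[OF same_M same_N, symmetric]
  by (rule Lin_cong[OF V.vpi_Lin _ pi_v_eq]) simp_all

lemma pi_v_surj: "pi_v K H \<Omega>\<^sub>H A \<Omega>\<^sub>A ` carrier M = carrier N"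
proof -
  have "pi_v K H \<Omega>\<^sub>H A \<Omega>\<^sub>A ` carrier \<Gamma> = V.vpi ` carrier \<Gamma>"
    by (rule image_cong[OF refl pi_v_eq])
  then show ?thesis using V.vpi_surj[OF galois_span[OF comod_alg_A qpb]] by (simp del: first_order_sel)
qed

lemma pi_v_lact:
  assumes "a \<in> carrier A" "\<omega> \<in> carrier M"
  shows "pi_v K H \<Omega>\<^sub>H A \<Omega>\<^sub>A (lact M a \<omega>) = lact N a (pi_v K H \<Omega>\<^sub>H A \<Omega>\<^sub>A \<omega>)"
  using assms by (simp add: pi_v_eq V.vpi_lact N_lact del: first_order_sel)

lemma pi_v_ract:
  assumes "a \<in> carrier A" "\<omega> \<in> carrier M"
  shows "pi_v K H \<Omega>\<^sub>H A \<Omega>\<^sub>A (ract M \<omega> a) = ract N (pi_v K H \<Omega>\<^sub>H A \<Omega>\<^sub>A \<omega>) a"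
  using assms by (simp add: pi_v_eq V.vpi_ract N_ract del: first_order_sel)

lemma pi_v_coact:
  assumes "\<omega> \<in> carrier M"
  shows "bcoact N (pi_v K H \<Omega>\<^sub>H A \<Omega>\<^sub>A \<omega>) =
    lift M H (N \<boxtimes> H) (bcoact M \<omega>) (\<lambda>\<omega>0 h. tens K N H (pi_v K H \<Omega>\<^sub>H A \<Omega>\<^sub>A \<omega>0) h)"
proof -
  note [simp del] = first_order_sel
  note r = same_space_refl
  have "bcoact N (pi_v K H \<Omega>\<^sub>H A \<Omega>\<^sub>A \<omega>) = lift \<Gamma> H (V.V \<boxtimes> H) (rcoA \<omega>) (\<lambda>\<omega>0 h. tens K V.V H (V.vpi \<omega>0) h)"
    using assms by (simp add: pi_v_eq N_coact V.vpi_coact)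
  also have "\<dots> = lift \<Gamma> H (V.V \<boxtimes> H) (rcoA \<omega>) (\<lambda>\<omega>0 h. tens K V.V H (pi_v K H \<Omega>\<^sub>H A \<Omega>\<^sub>A \<omega>0) h)"
    by (intro lift_cong refl) (simp add: pi_v_eq)
  also have "\<dots> = lift M H (N \<boxtimes> H) (bcoact M \<omega>) (\<lambda>\<omega>0 h. tens K N H (pi_v K H \<Omega>\<^sub>H A \<Omega>\<^sub>A \<omega>0) h)"
    unfolding tensor_space_same[OF same_N r] lift_same[OF same_M r r] M_sel ..
  finally show ?thesis .
qed

lemma N_VS: "VS N"
  by (rule VS_same[OF same_N]) simp

lemma N_covariant: "covariant_bimodule K H A N"
  by (rule covariant_bimodule_quotient[OF comod_alg_A M_covariant N_VS pi_v_Lin pi_v_surj pi_v_lact pi_v_ract])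
    (simp_all only: pi_v_coact)

section \<open>Horizontal forms and the exact sequence\<close>

abbreviation "S \<equiv> {\<omega> \<in> carrier M. D01 \<omega> = \<zero>\<^bsub>A \<boxtimes> \<Gamma>'\<^esub>}"

lemma hor1_forms_eq: "hor1_forms K H \<Omega>\<^sub>H \<Omega>\<^sub>A D = S"
proof -
  have "hor1_forms K H \<Omega>\<^sub>H \<Omega>\<^sub>A D \<subseteq> carrier M" by (auto simp: hor1_forms_def)
  then show ?thesis using hor_iff by auto
qed

abbreviation "hc \<equiv> restrict_coaction K H (M\<lparr>carrier := S\<rparr>) M rcoA"

lemma hor1_eq: "hor1 K H \<Omega>\<^sub>H A \<Omega>\<^sub>A D = M\<lparr>carrier := S, bcoact := hc\<rparr>"
  unfolding hor1_def Let_def hor1_forms_eq M_sel ..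

lemma M_VS [simp]: "VS M"
  by (rule VS_same[OF same_M]) simp

lemma D01_Lin_M: "D01 \<in> Lin M (A \<boxtimes> \<Gamma>')"
  using D01_Lin unfolding lin_maps_same[OF same_M same_space_refl] .

lemma hor_submodule: "submodule S K M"
  by (rule Lin_equalizer_submodule[OF D01_Lin_M Lin_zero_map]) simp_all

text \<open>\<open>restrict_coaction\<close> selects some preimage of the coaction of \<omega>. That
  there is one is \<open>kernel_tensor\<close>, whose hypothesis is \<open>F_colinear\<close> at a
  form killed by \<open>D01\<close>.\<close>

lemma hor_coact:
  assumes \<omega>: "\<omega> \<in> S"
  shows "hc \<omega> \<in> carrier (M\<lparr>carrier := S\<rparr> \<boxtimes> H)"
    and "lift (M\<lparr>carrier := S\<rparr>) H (M \<boxtimes> H) (hc \<omega>) (tens K M H) = rcoA \<omega>"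
    and "tensor_map K M H id id (hc \<omega>) = rcoA \<omega>"
proof -
  note [simp del] = first_order_sel
  let ?S = "M\<lparr>carrier := S\<rparr>" and ?W = "A \<boxtimes> \<Gamma>'"
  note r = same_space_refl
  have VSS: "VS ?S" by (rule VS_carrier_update[OF M_VS hor_submodule])
  have t: "tensor_map K M H id id s = lift ?S H (M \<boxtimes> H) s (tens K M H)" if s: "s \<in> carrier (?S \<boxtimes> H)" for s
    by (subst tensor_map_lift[where X = ?S and Y = H]) (use s VSS in simp_all)
  have w [simp]: "\<omega> \<in> carrier \<Gamma>" "D01 \<omega> = \<zero>\<^bsub>?W\<^esub>" using \<omega> by auto
  have "lift M H (?W \<boxtimes> H) (rcoA \<omega>) (\<lambda>v h. tens K ?W H (D01 v) h) = lift \<Gamma> H (?W \<boxtimes> H) (rcoA \<omega>) (\<lambda>v h. tens K ?W H (D01 v) h)"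
    unfolding lift_same[OF same_M r r] ..
  also have "\<dots> = \<zero>\<^bsub>?W \<boxtimes> H\<^esub>"
  proof -
    have B: "bilin A \<Gamma>' (?W \<boxtimes> H) (\<lambda>a \<gamma>. lift \<Gamma>' H (?W \<boxtimes> H) (rcoH \<gamma>) (\<lambda>\<gamma>0 g. tens K ?W H (tens K A \<Gamma>' a \<gamma>0) g))"
      by (intro lin_intro) simp_all
    show ?thesis using Lin_zero[OF lift_Lin[OF _ _ _ B]] by (simp add: V.F_colinear)
  qed
  finally have z: "lift M H (?W \<boxtimes> H) (rcoA \<omega>) (\<lambda>v h. tens K ?W H (D01 v) h) = \<zero>\<^bsub>?W \<boxtimes> H\<^esub>" .
  have VW: "VS ?W" by simp
  have co: "rcoA \<omega> \<in> carrier (M \<boxtimes> H)" unfolding tensor_space_same[OF same_M r, symmetric] by simp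
  obtain s where s: "s \<in> carrier (?S \<boxtimes> H)" "lift ?S H (M \<boxtimes> H) s (tens K M H) = rcoA \<omega>"
    by (rule bexE[OF kernel_tensor[OF M_VS VW H_simps(1) D01_Lin_M co z]])
  have im: "rcoA \<omega> \<in> tensor_map K M H id id ` carrier (?S \<boxtimes> H)"
    by (rule image_eqI[OF _ s(1)]) (simp only: t[OF s(1)] s(2))
  show hc: "hc \<omega> \<in> carrier (?S \<boxtimes> H)" "tensor_map K M H id id (hc \<omega>) = rcoA \<omega>"
    unfolding restrict_coaction_def by (rule inv_into_into[OF im], rule f_inv_into_f[OF im])
  show "lift ?S H (M \<boxtimes> H) (hc \<omega>) (tens K M H) = rcoA \<omega>"
    unfolding t[OF hc(1), symmetric] by (rule hc(2))
qed

lemma hor_covariant: "covariant_bimodule K H A (M\<lparr>carrier := S, bcoact := hc\<rparr>)"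
proof (rule covariant_bimodule_sub[OF comod_alg_A M_covariant hor_submodule])
  note [simp del] = first_order_sel
  note r = same_space_refl
  have sS: "same_space (M\<lparr>carrier := S\<rparr>) (M\<lparr>carrier := S, bcoact := hc\<rparr>)" by (simp add: same_space_def)
  fix a \<omega> assume a: "a \<in> carrier A" and \<omega>: "\<omega> \<in> S"
  note bl = biactionD(2,3)[OF V.biaction_W]
  note z = Lin_zero[OF bilinD(1)[OF bl(1)] _ _ , of a] Lin_zero[OF bilinD(1)[OF bl(2)] _ _ , of a]
  show "lact M a \<omega> \<in> S" "ract M \<omega> a \<in> S"
    using a \<omega> z by (simp_all add: V.F_bilinear)
next
  note r = same_space_refl
  have sS: "same_space (M\<lparr>carrier := S\<rparr>) (M\<lparr>carrier := S, bcoact := hc\<rparr>)" by (simp add: same_space_def)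
  fix \<omega> assume \<omega>: "\<omega> \<in> S"
  show "hc \<omega> \<in> carrier (M\<lparr>carrier := S, bcoact := hc\<rparr> \<boxtimes> H)"
    using hor_coact(1)[OF \<omega>] unfolding tensor_space_same[OF sS r] .
  show "lift (M\<lparr>carrier := S, bcoact := hc\<rparr>) H (M \<boxtimes> H) (hc \<omega>) (tens K M H) = bcoact M \<omega>"
    using hor_coact(2)[OF \<omega>] unfolding lift_same[OF sS r r] by (simp only: M_sel)
qed simp

lemma atiyah_sequence:
  "short_exact_covariant K H A (hor1 K H \<Omega>\<^sub>H A \<Omega>\<^sub>A D) (\<lambda>\<omega>. \<omega>) M (pi_v K H \<Omega>\<^sub>H A \<Omega>\<^sub>A) N"
  unfolding hor1_eq short_exact_covariant_def
proof (intro conjI hor_covariant M_covariant N_covariant)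
  note [simp del] = first_order_sel
  note r = same_space_refl
  let ?S = "M\<lparr>carrier := S, bcoact := hc\<rparr>"
  show "(\<lambda>\<omega>. \<omega>) \<in> covariant_homs K H A ?S M"
    using hor_coact(3) by (auto simp: covariant_homs_def lin_maps_def id_def)
  have "tensor_map K N H (pi_v K H \<Omega>\<^sub>H A \<Omega>\<^sub>A) id (bcoact M \<omega>) =
      lift M H (N \<boxtimes> H) (bcoact M \<omega>) (\<lambda>\<omega>0 h. tens K N H (pi_v K H \<Omega>\<^sub>H A \<Omega>\<^sub>A \<omega>0) h)"
    if "\<omega> \<in> carrier M" for \<omega>
  proof -
    have "rcoA \<omega> \<in> carrier (M \<boxtimes> H)"
      using that unfolding tensor_space_same[OF same_M r, symmetric] by simp
    then show ?thesis
      by (subst tensor_map_lift[where X = M and Y = H]) (simp_all add: N_VS pi_v_eq)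
  qed
  then show "pi_v K H \<Omega>\<^sub>H A \<Omega>\<^sub>A \<in> covariant_homs K H A M N"
    using pi_v_lact pi_v_ract pi_v_coact by (simp add: covariant_homs_def pi_v_Lin del: M_sel N_carrier)
  have "zero N = \<zero>\<^bsub>V.V\<^esub>" using same_N by (simp add: same_space_def)
  then show "exact_at ?S (\<lambda>\<omega>. \<omega>) M (pi_v K H \<Omega>\<^sub>H A \<Omega>\<^sub>A) N"
    by (simp add: exact_at_def pi_v_eq V.vpi_zero_iff cong: conj_cong)
qed (simp_all only: pi_v_surj inj_on_id2)

end

theorem theorem3p27:
  fixes K :: "'k ring"
    and H :: "('k, 'h) hopf" and \<Omega>\<^sub>H :: "('k, 'h) dga"
    and A :: "('k, 'a, 'h) comodule_alg" and \<Omega>\<^sub>A :: "('k, 'a) dga"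
    and D :: "'a \<Rightarrow> ('a \<times> 'h \<Rightarrow> 'k) set"
  assumes "field K"
    and "hopf_algebra K H" and "bij_betw (antipode H) (carrier H) (carrier H)"
    and "quantum_principal_bundle K H A"
    and "bicovariant_calculus K H (first_order \<Omega>\<^sub>H)" and "maximal_prolongation K H \<Omega>\<^sub>H"
    and "complete_calculus K H \<Omega>\<^sub>H A \<Omega>\<^sub>A D"
  shows "short_exact_covariant K H A (hor1 K H \<Omega>\<^sub>H A \<Omega>\<^sub>A D) (\<lambda>\<omega>. \<omega>)
    (Omega1 K H A \<Omega>\<^sub>A) (pi_v K H \<Omega>\<^sub>H A \<Omega>\<^sub>A) (ver1 K H \<Omega>\<^sub>H A)"
proof -
  have "differential_calculus K H \<Omega>\<^sub>H" using assms(6) unfolding maximal_prolongation_def by blast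
  then interpret complete_bundle K H \<Omega>\<^sub>H A \<Omega>\<^sub>A D
    using assms by (intro complete_bundle.intro)
  show ?thesis by (rule atiyah_sequence)
qed

end
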